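(* Let $\eta$ be a Poisson process on a measurable space $(\mathbb{X},\mathcal{X})$ with $\sigma$-finite intensity measure $\mu$. Let $m\in\mathbb{N}$, let $\widetilde m\in\mathbb{N}$ with $\widetilde m\ge m$ be even, and let $f^{(\ell)}\in L^2_s(\mu^{q_\ell})$ with $q_\ell\in\mathbb{N}$, $\ell\in\{1,\dots,m\}$, be such that $$\int_{\mathbb{X}^{|\sigma|}}|(\otimes_{\ell=1}^{\widetilde m}f^{(i)})_\sigma|\,\mathrm{d}\mu^{|\sigma|}<\infty,\qquad\sigma\in\Pi_{\ge2}^{\widetilde m}(q_i),\ i\in\{1,\dots,m\},$$ $$\int_{\mathbb{X}^{|\sigma|}}|(\otimes_{\ell=1}^{m}f^{(\ell)})_\sigma|\,\mathrm{d}\mu^{|\sigma|}<\infty,\qquad\sigma\in\Pi_{\ge2}(q_1,\dots,q_m).$$ Then $$\mathbb{E}\Big[\prod_{\ell=1}^mI_{q_\ell}(f^{(\ell)})\Big]=\sum_{\sigma\in\Pi_{\ge2}(q_1,\dots,q_m)}\int_{\mathbb{X}^{|\sigma|}}(\otimes_{\ell=1}^mf^{(\ell)})_\sigma\,\mathrm{d}\mu^{|\sigma|},$$ $$\operatorname{cum}(I_{q_1}(f^{(1)}),\dots,I_{q_m}(f^{(m)}))=\sum_{\sigma\in\widetilde\Pi_{\ge2}(q_1,\dots,q_m)}\int_{\mathbb{X}^{|\sigma|}}(\otimes_{\ell=1}^mf^{(\ell)})_\sigma\,\mathrm{d}\mu^{|\sigma|}.$$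
   Context: **Poisson processes and integrals.** A Poisson process $\eta$ on $(\mathbb{X},\mathcal{X})$ with $\sigma$-finite intensity measure $\mu$ is a random counting measure such that $\eta(B)$ is Poisson distributed with mean $\mu(B)$ for every $B\in\mathcal{X}$ (possibly degenerate), and $\eta(B_1),\dots,\eta(B_n)$ are independent for pairwise disjoint $B_1,\dots,B_n\in\mathcal{X}$. $\mu^q$ is the $q$-fold product measure; $L^r_s(\mu^q)$ is the set of measurable symmetric $f:\mathbb{X}^q\to\mathbb{R}$ with $\int|f|^r\,\mathrm{d}\mu^q<\infty$. For $m\in\mathbb{N}$, $\eta^{(m)}$ is the $m$-th factorial measure, $\eta^{(m)}(\cdot)=\int\cdots\int \mathbf{1}((x_1,\dots,x_m)\in\cdot)\,(\eta-\sum_{i=1}^{m-1}\delta_{x_i})(\mathrm{d}x_m)\cdots(\eta-\delta_{x_1})(\mathrm{d}x_2)\,\eta(\mathrm{d}x_1)$. For $f\in L^1_s(\mu^q)$ put $I_q(f):=\sum_{J\subset\{1,\dots,q\}}(-1)^{q-|J|}\int_{\mathbb{X}^{|J|}}\int_{\mathbb{X}^{q-|J|}}f(x_1,\dots,x_q)\,\mu^{q-|J|}(\mathrm{d}x_{J^c})\,\eta^{(|J|)}(\mathrm{d}x_J)$. For $f\in L^2_s(\mu^q)$ the $q$-fold Wiener-Itô integral $I_q(f)$ is the $L^2(\mathbb{P})$-limit of $I_q(f_j)$, where $f_j$ are simple symmetric functions converging to $f$ in $L^2(\mu^q)$. **Cumulants.** $\operatorname{cum}(X_1,\dots,X_m):=(-\mathbf{i})^m\frac{\partial^m}{\partial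 t_1\cdots\partial t_m}\log\mathbb{E}\exp(\mathbf{i}\sum_{j=1}^mt_jX_j)\big|_{t_1=\dots=t_m=0}$, with $\mathbf{i}$ the imaginary unit. **Partitions.** For $q_1,\dots,q_m\in\mathbb{N}$ put $N_0:=0$, $N_\ell:=\sum_{i=1}^\ell q_i$, $N:=N_m$ and $J_\ell:=\{N_{\ell-1}+1,\dots,N_\ell\}$. $\Pi(q_1,\dots,q_m)$ is the set of all partitions $\sigma$ of $\{1,\dots,N\}$ into non-empty blocks such that $|B\cap J_\ell|\le 1$ for all $\ell$ and all $B\in\sigma$; $|\sigma|$ is the number of blocks. Each $\sigma\in\Pi(q_1,\dots,q_m)$ induces the partition $\sigma^*$ of $\{1,\dots,m\}$ generated by requiring that $i,j$ lie in the same block whenever some $B\in\sigma$ meets both $J_i$ and $J_j$ (take the transitive closure). $\widetilde{\Pi}(q_1,\dots,q_m)$ is the set of $\sigma\in\Pi(q_1,\dots,q_m)$ with $|\sigma^*|=1$. $\Pi_{\ge2}(q_1,\dots,q_m)$ and $\widetilde\Pi_{\ge2}(q_1,\dots,q_m)$ are the sets of $\sigma\in\Pi(q_1,\dots,q_m)$, respectively $\sigma\in\widetilde\Pi(q_1,\dots,q_m)$, with $|B|\ge2$ for all $B\in\sigma$. $\Pi_{\ge2}^{m}(q)$ stands for $\Pi_{\ge2}(q,\dots,q)$ with $m$ entries. For functions $f^{(\ell)}:\mathbb{X}^{q_\ell}\to\mathbb{R}$, $(\otimes_{\ell=1}^m f^{(\ell)})(x_1,\dots,x_N):=\prod_{\ell=1}^m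 f^{(\ell)}(x_{N_{\ell-1}+1},\dots,x_{N_\ell})$, and for $\sigma\in\Pi(q_1,\dots,q_m)$ the function $(\otimes_{\ell=1}^m f^{(\ell)})_\sigma:\mathbb{X}^{|\sigma|}\to\mathbb{R}$ arises by replacing all variables whose indices belong to the same block of $\sigma$ by a common new variable (the order of the new variables is irrelevant). In $\otimes_{\ell=1}^{\widetilde m}f^{(i)}$ the same function $f^{(i)}$ is used $\widetilde m$ times. Empty sums are $0$. *)

theory Defs
  imports "HOL-Probability.Probability"
begin

section \<open>Poisson processes\<close>

definition counting_measure :: "'x measure \<Rightarrow> bool" where
  "counting_measure N \<longleftrightarrow> (\<forall>B\<in>sets N. emeasure N B = \<infinity> \<or> (\<exists>k::nat. emeasure N B = of_nat k))"

definition random_counting_measure :: "'w measure \<Rightarrow> 'x measure \<Rightarrow> ('w \<Rightarrow> 'x measure) \<Rightarrow> bool" where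
  "random_counting_measure M \<mu> \<eta> \<longleftrightarrow>
     (\<forall>\<omega>\<in>space M. sets (\<eta> \<omega>) = sets \<mu> \<and> counting_measure (\<eta> \<omega>)) \<and>
     (\<forall>B\<in>sets \<mu>. (\<lambda>\<omega>. emeasure (\<eta> \<omega>) B) \<in> borel_measurable M)"

text \<open>The two degenerate Poisson laws are included: mean \<open>0\<close> is the point mass at \<open>0\<close>
  (as \<open>0 ^ 0 = 1\<close>), and mean \<open>\<infinity>\<close> is the point mass at \<open>\<infinity>\<close>.\<close>

definition poisson_distributed :: "'w measure \<Rightarrow> ('w \<Rightarrow> ennreal) \<Rightarrow> ennreal \<Rightarrow> bool" where
  "poisson_distributed M Z c \<longleftrightarrow>
     (if c = \<infinity> then (AE \<omega> in M. Z \<omega> = \<infinity>)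
      else (\<forall>k::nat. measure M {\<omega>\<in>space M. Z \<omega> = of_nat k} =
              enn2real c ^ k / fact k * exp (- enn2real c)))"

definition poisson_process :: "'w measure \<Rightarrow> 'x measure \<Rightarrow> ('w \<Rightarrow> 'x measure) \<Rightarrow> bool" where
  "poisson_process M \<mu> \<eta> \<longleftrightarrow>
     random_counting_measure M \<mu> \<eta> \<and>
     (\<forall>B\<in>sets \<mu>. poisson_distributed M (\<lambda>\<omega>. emeasure (\<eta> \<omega>) B) (emeasure \<mu> B)) \<and>
     (\<forall>(n::nat) B. (\<forall>i\<in>{1..n}. B i \<in> sets \<mu>) \<and> disjoint_family_on B {1..n} \<longrightarrow>
        prob_space.indep_vars M (\<lambda>_. borel) (\<lambda>i \<omega>. emeasure (\<eta> \<omega>) (B i)) {1..n})"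


section \<open>Product spaces and symmetric functions\<close>

text \<open>Points of the \<open>q\<close>-fold product are extensional functions on \<open>{1..q}\<close>.\<close>

abbreviation pow_measure :: "'x measure \<Rightarrow> nat \<Rightarrow> (nat \<Rightarrow> 'x) measure" where
  "pow_measure \<mu> q \<equiv> PiM {1..q} (\<lambda>_. \<mu>)"

definition symmetric_on :: "'x measure \<Rightarrow> nat \<Rightarrow> ((nat \<Rightarrow> 'x) \<Rightarrow> real) \<Rightarrow> bool" where
  "symmetric_on \<mu> q f \<longleftrightarrow>
     (\<forall>\<pi>. \<pi> permutes {1..q} \<longrightarrow> (\<forall>x\<in>space (pow_measure \<mu> q). f (x \<circ> \<pi>) = f x))"

definition Lsym :: "nat \<Rightarrow> 'x measure \<Rightarrow> nat \<Rightarrow> ((nat \<Rightarrow> 'x) \<Rightarrow> real) set" where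
  "Lsym r \<mu> q = {f \<in> borel_measurable (pow_measure \<mu> q).
     symmetric_on \<mu> q f \<and> (\<integral>\<^sup>+ x. ennreal (\<bar>f x\<bar> ^ r) \<partial>pow_measure \<mu> q) < \<infinity>}"


section \<open>Factorial measures\<close>

text \<open>The outer \<open>k\<close> of the \<open>k + 1\<close> iterated integrals form the integral with respect to the
  \<open>k\<close>-th factorial measure, and the innermost one is
  \<open>\<integral> \<phi> d(N - \<Sum>j\<le>k. \<delta>\<^bsub>x j\<^esub>) = \<integral> \<phi> dN - \<Sum>j\<le>k. \<phi> (x j)\<close> for an indicator function \<open>\<phi>\<close>.
  The subtrahend is finite, so no \<open>\<infinity> - \<infinity>\<close> arises, and for a \<open>\<sigma>\<close>-finite counting measure \<open>N\<close> the
  truncation of subtraction on \<^typ>\<open>ennreal\<close> affects only a null set of points \<open>x\<close>.\<close>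

primrec factorial_measure :: "'x measure \<Rightarrow> nat \<Rightarrow> (nat \<Rightarrow> 'x) measure" where
  "factorial_measure N 0 = return (pow_measure N 0) (\<lambda>_. undefined)"
| "factorial_measure N (Suc k) =
     measure_of (space (pow_measure N (Suc k))) (sets (pow_measure N (Suc k)))
       (\<lambda>C. \<integral>\<^sup>+ x. ((\<integral>\<^sup>+ y. indicator C (x(Suc k := y)) \<partial>N)
                     - (\<Sum>j\<in>{1..k}. indicator C (x(Suc k := x j)))) \<partial>factorial_measure N k)"


section \<open>Multiple Wiener-Ito integrals\<close>

text \<open>The point of the product whose coordinates in \<open>J\<close> are, in increasing order of the index,
  \<open>y 1, \<dots>, y (card J)\<close>, and whose coordinates outside \<open>J\<close> are those of \<open>z\<close>.\<close>

definition insert_coords :: "nat set \<Rightarrow> (nat \<Rightarrow> 'x) \<Rightarrow> (nat \<Rightarrow> 'x) \<Rightarrow> nat \<Rightarrow> 'x" where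
  "insert_coords J y z = (\<lambda>i. if i \<in> J then y (card (J \<inter> {1..i})) else z i)"

definition wiener_ito_L1 ::
  "'x measure \<Rightarrow> ('w \<Rightarrow> 'x measure) \<Rightarrow> nat \<Rightarrow> ((nat \<Rightarrow> 'x) \<Rightarrow> real) \<Rightarrow> 'w \<Rightarrow> real" where
  "wiener_ito_L1 \<mu> \<eta> q f \<omega> =
     (\<Sum>J\<in>Pow {1..q}. (-1) ^ (q - card J) *
        (\<integral>y. (\<integral>z. f (insert_coords J y z) \<partial>PiM ({1..q} - J) (\<lambda>_. \<mu>))
           \<partial>factorial_measure (\<eta> \<omega>) (card J)))"

definition is_wiener_ito ::
  "'w measure \<Rightarrow> 'x measure \<Rightarrow> ('w \<Rightarrow> 'x measure) \<Rightarrow> nat \<Rightarrow> ((nat \<Rightarrow> 'x) \<Rightarrow> real) \<Rightarrow> ('w \<Rightarrow> real) \<Rightarrow> bool"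
where
  "is_wiener_ito M \<mu> \<eta> q f Y \<longleftrightarrow>
     Y \<in> borel_measurable M \<and> (\<integral>\<^sup>+ \<omega>. ennreal ((Y \<omega>)\<^sup>2) \<partial>M) < \<infinity> \<and>
     (\<exists>g :: nat \<Rightarrow> (nat \<Rightarrow> 'x) \<Rightarrow> real.
        (\<forall>j. simple_function (pow_measure \<mu> q) (g j) \<and> g j \<in> Lsym 1 \<mu> q) \<and>
        (\<lambda>j. \<integral>\<^sup>+ x. ennreal ((g j x - f x)\<^sup>2) \<partial>pow_measure \<mu> q) \<longlonglongrightarrow> 0 \<and>
        (\<lambda>j. \<integral>\<^sup>+ \<omega>. ennreal ((wiener_ito_L1 \<mu> \<eta> q (g j) \<omega> - Y \<omega>)\<^sup>2) \<partial>M) \<longlonglongrightarrow> 0)"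

text \<open>The limit is determined only almost surely; a version is chosen.\<close>

definition wiener_ito ::
  "'w measure \<Rightarrow> 'x measure \<Rightarrow> ('w \<Rightarrow> 'x measure) \<Rightarrow> nat \<Rightarrow> ((nat \<Rightarrow> 'x) \<Rightarrow> real) \<Rightarrow> 'w \<Rightarrow> real" where
  "wiener_ito M \<mu> \<eta> q f = (SOME Y. is_wiener_ito M \<mu> \<eta> q f Y)"


section \<open>Joint cumulants\<close>

definition partial_deriv :: "nat \<Rightarrow> ((nat \<Rightarrow> real) \<Rightarrow> complex) \<Rightarrow> (nat \<Rightarrow> real) \<Rightarrow> complex" where
  "partial_deriv i F t = vector_derivative (\<lambda>s. F (t(i := s))) (at (t i))"

fun mixed_deriv :: "nat \<Rightarrow> ((nat \<Rightarrow> real) \<Rightarrow> complex) \<Rightarrow> (nat \<Rightarrow> real) \<Rightarrow> complex" where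
  "mixed_deriv 0 F = F"
| "mixed_deriv (Suc m) F = mixed_deriv m (partial_deriv (Suc m) F)"

text \<open>The cumulant of \<open>X 1, \<dots>, X m\<close>; the logarithm is the principal branch, the characteristic
  function being close to \<open>1\<close> near the origin.\<close>

definition cum :: "'w measure \<Rightarrow> nat \<Rightarrow> (nat \<Rightarrow> 'w \<Rightarrow> real) \<Rightarrow> complex" where
  "cum M m X = (- \<i>) ^ m *
     mixed_deriv m
       (\<lambda>t. Ln (\<integral>\<omega>. exp (\<i> * complex_of_real (\<Sum>j\<in>{1..m}. t j * X j \<omega>)) \<partial>M)) (\<lambda>_. 0)"


section \<open>Partitions\<close>

definition cum_sizes :: "(nat \<Rightarrow> nat) \<Rightarrow> nat \<Rightarrow> nat" where
  "cum_sizes q l = (\<Sum>i\<in>{1..l}. q i)"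

definition row :: "(nat \<Rightarrow> nat) \<Rightarrow> nat \<Rightarrow> nat set" where
  "row q l = {cum_sizes q (l - 1) + 1 .. cum_sizes q l}"

definition Parts :: "nat \<Rightarrow> (nat \<Rightarrow> nat) \<Rightarrow> nat set set set" where
  "Parts m q = {\<sigma>. partition_on {1..cum_sizes q m} \<sigma> \<and>
     (\<forall>B\<in>\<sigma>. \<forall>l\<in>{1..m}. card (B \<inter> row q l) \<le> 1)}"

definition row_partition :: "nat \<Rightarrow> (nat \<Rightarrow> nat) \<Rightarrow> nat set set \<Rightarrow> nat set set" where
  "row_partition m q \<sigma> =
     {1..m} // {(i, j). i \<in> {1..m} \<and> j \<in> {1..m} \<and>
                        (\<exists>B\<in>\<sigma>. B \<inter> row q i \<noteq> {} \<and> B \<inter> row q j \<noteq> {})}\<^sup>*"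

definition conn_Parts :: "nat \<Rightarrow> (nat \<Rightarrow> nat) \<Rightarrow> nat set set set" where
  "conn_Parts m q = {\<sigma> \<in> Parts m q. card (row_partition m q \<sigma>) = 1}"

definition Parts_ge2 :: "nat \<Rightarrow> (nat \<Rightarrow> nat) \<Rightarrow> nat set set set" where
  "Parts_ge2 m q = {\<sigma> \<in> Parts m q. \<forall>B\<in>\<sigma>. card B \<ge> 2}"

definition conn_Parts_ge2 :: "nat \<Rightarrow> (nat \<Rightarrow> nat) \<Rightarrow> nat set set set" where
  "conn_Parts_ge2 m q = {\<sigma> \<in> conn_Parts m q. \<forall>B\<in>\<sigma>. card B \<ge> 2}"

definition tensor ::
  "nat \<Rightarrow> (nat \<Rightarrow> nat) \<Rightarrow> (nat \<Rightarrow> (nat \<Rightarrow> 'x) \<Rightarrow> real) \<Rightarrow> (nat \<Rightarrow> 'x) \<Rightarrow> real" where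
  "tensor m q f x = (\<Prod>l\<in>{1..m}. f l (\<lambda>k\<in>{1..q l}. x (cum_sizes q (l - 1) + k)))"

text \<open>The new variables are indexed by the blocks of \<open>\<sigma>\<close> themselves, so the function lives on the
  power of the space indexed by \<open>\<sigma>\<close>.\<close>

definition block_of :: "nat set set \<Rightarrow> nat \<Rightarrow> nat set" where
  "block_of \<sigma> i = (THE B. B \<in> \<sigma> \<and> i \<in> B)"

definition tensor_contr ::
  "nat \<Rightarrow> (nat \<Rightarrow> nat) \<Rightarrow> (nat \<Rightarrow> (nat \<Rightarrow> 'x) \<Rightarrow> real) \<Rightarrow> nat set set \<Rightarrow> (nat set \<Rightarrow> 'x) \<Rightarrow> real" where
  "tensor_contr m q f \<sigma> y = tensor m q f (\<lambda>i\<in>{1..cum_sizes q m}. y (block_of \<sigma> i))"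

end

theory Submission imports Defs begin

text \<open>Up to a null set, \<open>\<eta>\<close> is finite on the sets of an exhausting sequence \<open>B n\<close>, and on every countably
  generated sub-\<open>\<sigma>\<close>-algebra it is a sum of Dirac measures. For indicators of boxes the integrals \<open>I\<^sub>q\<close> are
  therefore finite sums over the points of \<open>\<eta>\<close>. Multiplying out and grouping by coincidences turns a
  product of such integrals into a sum over partitions \<open>\<sigma>\<close> of integrals with respect to factorial
  measures, whose expectations are the powers of \<open>\<mu>\<close>; inclusion-exclusion over the compensated variables
  cancels all \<open>\<sigma>\<close> with singleton blocks. Linearity and bounded convergence give the moment formula for
  simple functions supported in a box. Applied to \<open>mt\<close> copies of a difference of truncations of \<open>f l\<close>, it
  shows that their integrals form a Cauchy sequence in \<open>L\<^bsup>mt\<^esup>\<close>, so the formula passes to the limit.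

  The cumulant formula follows from the moment formulas for all subsets of the factors: the recursion
  between mixed derivatives of the characteristic function and of its logarithm corresponds to splitting
  off the connected component of the last row of a partition.\<close>

section \<open>Injective maps and partitions\<close>

text \<open>The space carries no topology, so \<open>\<eta> \<omega>\<close> need not be a sum of
  Dirac measures, and countable additivity of the set function behind a factorial measure is not
  evident. Both matters involve only countably many sets at a time, and on a countably generated
  sub-\<sigma>-algebra labelled points exist. They are chosen anew for each \<omega> and each family
  of sets and never enter a statement about moments. Since \<open>mt\<close> is even, the
  \<open>mt\<close>-th absolute power of an integral is a product of \<open>mt\<close> integrals of
  one function, so an L^mt distance is itself a moment and is controlled by contractions of
  \<open>mt\<close> copies. With two factors the same argument yields an L^2 bound, and from it
  existence and almost sure uniqueness of the integral, which is defined only through a choice.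
  Cumulants involve the products over all subsets of the factors. Finiteness of their contractions
  comes from the condition on \<open>mt\<close> copies: for absolute values of truncations every
  summand of the moment formula is nonnegative, hence bounded by the moment, and the moment of a
  product is bounded by \<open>mt\<close>-th moments of its factors.\<close>

lemma block_of_eq:
  assumes "partition_on P \<sigma>" "b \<in> \<sigma>" "p \<in> b"
  shows "block_of \<sigma> p = b"
  unfolding block_of_def using assms
  by (intro the_equality) (auto simp: partition_on_def disjoint_def)

lemma block_of_in:
  assumes "partition_on P \<sigma>" "p \<in> P"
  shows "block_of \<sigma> p \<in> \<sigma>" "p \<in> block_of \<sigma> p"
proof -
  obtain b where "b \<in> \<sigma>" "p \<in> b" using assms by (auto simp: partition_on_def)
  then show "block_of \<sigma> p \<in> \<sigma>" "p \<in> block_of \<sigma> p" using block_of_eq[OF assms(1)] by auto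
qed

lemma partition_on_finite_block:
  assumes "partition_on P \<sigma>" "finite P" "b \<in> \<sigma>"
  shows "finite b"
  using assms by (metis Union_upper finite_subset partition_on_def)

lemma prod_partition_on:
  fixes g :: "'p \<Rightarrow> 'a::comm_monoid_mult"
  assumes "partition_on P \<sigma>" "finite P"
  shows "(\<Prod>p\<in>P. g p) = (\<Prod>b\<in>\<sigma>. \<Prod>p\<in>b. g p)"
proof -
  have "P = \<Union>\<sigma>" using assms by (auto simp: partition_on_def)
  moreover have "prod g (\<Union>\<sigma>) = (prod \<circ> prod) g \<sigma>"
  proof (rule prod.Union_disjoint)
    show "\<forall>A\<in>\<sigma>. finite A" using assms partition_on_finite_block by blast
    show "\<forall>A\<in>\<sigma>. \<forall>B\<in>\<sigma>. A \<noteq> B \<longrightarrow> A \<inter> B = {}"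
      using assms by (auto simp: partition_on_def disjoint_def)
  qed
  ultimately show ?thesis by simp
qed

definition inj_maps :: "'k set \<Rightarrow> 'i set \<Rightarrow> ('k \<Rightarrow> 'i) set" where
  "inj_maps K I = {\<psi> \<in> K \<rightarrow>\<^sub>E I. inj_on \<psi> K}"

text \<open>Read \<open>r\<close> as the row of a position and \<open>I\<close> as labels of points.
  Labels must differ within a row, because a factorial measure counts only tuples of distinct
  labels; across rows they may coincide.\<close>

definition row_inj_maps :: "('p \<Rightarrow> 'r) \<Rightarrow> 'p set \<Rightarrow> 'i set \<Rightarrow> ('p \<Rightarrow> 'i) set" where
  "row_inj_maps r J I = {\<phi> \<in> J \<rightarrow>\<^sub>E I. \<forall>p\<in>J. \<forall>p'\<in>J. r p = r p' \<longrightarrow> \<phi> p = \<phi> p' \<longrightarrow> p = p'}"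

definition row_parts :: "('p \<Rightarrow> 'r) \<Rightarrow> 'p set \<Rightarrow> 'p set set set" where
  "row_parts r J = {\<sigma>. partition_on J \<sigma> \<and> (\<forall>b\<in>\<sigma>. inj_on r b)}"

lemma finite_row_parts: "finite J \<Longrightarrow> finite (row_parts r J)"
  by (rule finite_subset[OF _ finitely_many_partition_on]) (auto simp: row_parts_def)

lemma finite_inj_maps: "finite K \<Longrightarrow> finite I \<Longrightarrow> finite (inj_maps K I)"
  unfolding inj_maps_def by (rule finite_subset[OF _ finite_PiE[of K "\<lambda>_. I"]]) auto

lemma finite_row_inj_maps: "finite K \<Longrightarrow> finite I \<Longrightarrow> finite (row_inj_maps r K I)"
  unfolding row_inj_maps_def by (rule finite_subset[OF _ finite_PiE[of K "\<lambda>_. I"]]) auto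

text \<open>A map that is injective on every row factors uniquely as its kernel partition followed by an
  injective map on the blocks.\<close>

lemma sum_row_inj_maps:
  fixes a :: "nat \<Rightarrow> 'i \<Rightarrow> real"
  assumes J: "finite J" and I: "finite I"
  shows "(\<Sum>\<phi>\<in>row_inj_maps r J I. \<Prod>p\<in>J. a p (\<phi> p)) =
     (\<Sum>\<sigma>\<in>row_parts r J. \<Sum>\<psi>\<in>inj_maps \<sigma> I. \<Prod>b\<in>\<sigma>. \<Prod>p\<in>b. a p (\<psi> b))"
proof -
  \<comment> \<open>The partition into fibres. Injectivity of \<phi> on every row says exactly that
    no fibre contains two elements of one row.\<close>
  define K where "K = (\<lambda>\<phi>::nat\<Rightarrow>'i. (\<lambda>v. {p\<in>J. \<phi> p = v}) ` (\<phi> ` J))"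
  define fwd where "fwd = (\<lambda>\<phi>. (K \<phi>, \<lambda>b\<in>K \<phi>. the_elem (\<phi> ` b)))"
  define bwd where "bwd = (\<lambda>(\<sigma>, \<psi>::nat set \<Rightarrow> 'i). \<lambda>p\<in>J. \<psi> (block_of \<sigma> p))"
  have fs: "finite \<sigma>" if "\<sigma> \<in> row_parts r J" for \<sigma>
    using that J finite_elements by (auto simp: row_parts_def)
  have part: "partition_on J (K \<phi>)" for \<phi>
    by (rule partition_onI) (auto simp: K_def disjnt_def)
  have elem: "the_elem ((\<lambda>y. \<phi> x) ` {p\<in>J. \<phi> p = \<phi> x}) = \<phi> x" if "x \<in> J" for \<phi> :: "nat \<Rightarrow> 'i" and x
  proof -
    have "(\<lambda>y. \<phi> x) ` {p\<in>J. \<phi> p = \<phi> x} = {\<phi> x}" using that by auto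
    then show ?thesis by simp
  qed
  have fwd_in: "fwd \<phi> \<in> Sigma (row_parts r J) (\<lambda>\<sigma>. inj_maps \<sigma> I)" if "\<phi> \<in> row_inj_maps r J I" for \<phi>
  proof -
    have "K \<phi> \<in> row_parts r J"
      using that part unfolding row_parts_def row_inj_maps_def
      by (auto simp: K_def inj_on_def)
    moreover have "(\<lambda>b\<in>K \<phi>. the_elem (\<phi> ` b)) \<in> inj_maps (K \<phi>) I"
      using that unfolding inj_maps_def K_def row_inj_maps_def
      by (auto simp: elem inj_on_def)
    ultimately show ?thesis by (simp add: fwd_def)
  qed
  have bwd_fwd: "bwd (fwd \<phi>) = \<phi>" if "\<phi> \<in> row_inj_maps r J I" for \<phi>
  proof
    fix p
    show "bwd (fwd \<phi>) p = \<phi> p"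
    proof (cases "p \<in> J")
      case True
      have "{x\<in>J. \<phi> x = \<phi> p} \<in> K \<phi>" using True by (auto simp: K_def)
      moreover from this have "block_of (K \<phi>) p = {x\<in>J. \<phi> x = \<phi> p}"
        using block_of_eq[OF part] True by auto
      ultimately show ?thesis using True by (simp add: bwd_def fwd_def elem)
    qed (use that in \<open>auto simp: bwd_def fwd_def row_inj_maps_def\<close>)
  qed
  have blk: "block_of \<sigma> p = b" if "\<sigma> \<in> row_parts r J" "b \<in> \<sigma>" "p \<in> b" for \<sigma> b p
    using block_of_eq that by (auto simp: row_parts_def)
  have blk': "block_of \<sigma> p \<in> \<sigma>" "p \<in> block_of \<sigma> p" if "\<sigma> \<in> row_parts r J" "p \<in> J" for \<sigma> p
    using block_of_in that by (auto simp: row_parts_def)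
  have bwd_in: "bwd (\<sigma>, \<psi>) \<in> row_inj_maps r J I"
    if "\<sigma> \<in> row_parts r J" "\<psi> \<in> inj_maps \<sigma> I" for \<sigma> \<psi>
  proof -
    have "p = p'" if h: "p \<in> J" "p' \<in> J" "r p = r p'" "\<psi> (block_of \<sigma> p) = \<psi> (block_of \<sigma> p')" for p p'
    proof -
      have eq: "block_of \<sigma> p = block_of \<sigma> p'"
        using h blk'[OF \<open>\<sigma> \<in> _\<close>] \<open>\<psi> \<in> _\<close> by (auto simp: inj_maps_def inj_on_def)
      have "inj_on r (block_of \<sigma> p)" using blk' h \<open>\<sigma> \<in> _\<close> by (auto simp: row_parts_def)
      then show ?thesis using h eq blk'[OF \<open>\<sigma> \<in> _\<close>] by (metis inj_onD)
    qed
    then show ?thesis using that blk' by (auto simp: bwd_def row_inj_maps_def inj_maps_def)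
  qed
  have fwd_bwd: "fwd (bwd (\<sigma>, \<psi>)) = (\<sigma>, \<psi>)"
    if "\<sigma> \<in> row_parts r J" "\<psi> \<in> inj_maps \<sigma> I" for \<sigma> \<psi>
  proof -
    let ?\<phi> = "bwd (\<sigma>, \<psi>)"
    have p: "partition_on J \<sigma>" using that by (auto simp: row_parts_def)
    have fib: "{x\<in>J. ?\<phi> x = ?\<phi> p} = block_of \<sigma> p" if "p \<in> J" for p
    proof -
      have "x \<in> block_of \<sigma> p \<longleftrightarrow> x \<in> J \<and> \<psi> (block_of \<sigma> x) = \<psi> (block_of \<sigma> p)" for x
        using blk'[OF \<open>\<sigma> \<in> _\<close>] blk[OF \<open>\<sigma> \<in> _\<close>] that \<open>\<psi> \<in> _\<close> p
        by (smt (verit, ccfv_SIG) Union_iff inj_maps_def inj_onD mem_Collect_eq partition_onD1)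
      then show ?thesis using that by (auto simp: bwd_def)
    qed
    have K: "K ?\<phi> = \<sigma>"
    proof
      show "K ?\<phi> \<subseteq> \<sigma>" unfolding K_def using fib blk'[OF \<open>\<sigma> \<in> _\<close>] by auto
      show "\<sigma> \<subseteq> K ?\<phi>"
      proof
        fix b assume b: "b \<in> \<sigma>"
        then obtain x where x: "x \<in> b" "x \<in> J" using p by (metis Union_iff equals0I partition_on_def)
        then have "b = {y\<in>J. ?\<phi> y = ?\<phi> x}" using fib blk[OF \<open>\<sigma> \<in> _\<close> b] by auto
        then show "b \<in> K ?\<phi>" using x by (auto simp: K_def)
      qed
    qed
    have "(\<lambda>b\<in>\<sigma>. the_elem (?\<phi> ` b)) = \<psi>"
    proof
      fix b show "(\<lambda>b\<in>\<sigma>. the_elem (?\<phi> ` b)) b = \<psi> b"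
      proof (cases "b \<in> \<sigma>")
        case True
        then obtain x where x: "x \<in> b" "x \<in> J" using p by (metis Union_iff equals0I partition_on_def)
        have "b \<subseteq> J" using True p by (auto simp: partition_on_def)
        then have "?\<phi> ` b = {\<psi> b}" using x True blk[OF \<open>\<sigma> \<in> _\<close> True] by (auto simp: bwd_def image_iff subset_eq)
        then show ?thesis using True by simp
      qed (use that in \<open>auto simp: inj_maps_def PiE_def extensional_def\<close>)
    qed
    then show ?thesis using K by (simp add: fwd_def)
  qed
  have val: "(\<Prod>b\<in>\<sigma>. \<Prod>p\<in>b. a p (\<psi> b)) = (\<Prod>p\<in>J. a p (bwd (\<sigma>, \<psi>) p))"
    if "\<sigma> \<in> row_parts r J" for \<sigma> \<psi>
  proof -
    have p: "partition_on J \<sigma>" using that by (auto simp: row_parts_def)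
    have "b \<subseteq> J" if "b \<in> \<sigma>" for b using that p by (auto simp: partition_on_def)
    then show ?thesis unfolding prod_partition_on[OF p J]
      by (intro prod.cong refl) (auto simp: bwd_def blk[OF that] subset_eq)
  qed
  have "(\<Sum>\<sigma>\<in>row_parts r J. \<Sum>\<psi>\<in>inj_maps \<sigma> I. \<Prod>b\<in>\<sigma>. \<Prod>p\<in>b. a p (\<psi> b)) =
     (\<Sum>(\<sigma>, \<psi>)\<in>Sigma (row_parts r J) (\<lambda>\<sigma>. inj_maps \<sigma> I). \<Prod>b\<in>\<sigma>. \<Prod>p\<in>b. a p (\<psi> b))"
    by (rule sum.Sigma) (auto simp: finite_row_parts J I fs intro!: finite_inj_maps)
  also have "\<dots> = (\<Sum>\<phi>\<in>row_inj_maps r J I. \<Prod>p\<in>J. a p (\<phi> p))"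
    by (rule sum.reindex_bij_witness[of _ fwd bwd])
       (use fwd_in bwd_in fwd_bwd bwd_fwd val in auto)
  finally show ?thesis ..
qed

text \<open>Expand the product of (-1) + 1 over the elements of \<open>A\<close>.\<close>

lemma sum_Pow_alternating:
  assumes "finite A"
  shows "(\<Sum>U\<in>Pow A. (- 1::real) ^ card U) = (if A = {} then 1 else 0)"
proof -
  have "(\<Prod>x\<in>A. (-1) + (1::real)) = (\<Sum>U\<in>Pow A. (- 1) ^ card U)"
    using assms by (subst prod_add) auto
  moreover have "(\<Prod>x\<in>A. (-1) + (1::real)) = (if A = {} then 1 else 0)"
    using assms by (auto simp: prod_zero_iff)
  ultimately show ?thesis by simp
qed

text \<open>The points removed from \<open>P\<close> return as singleton blocks; the alternating sum over the set of
  marked singletons vanishes unless there are none.\<close>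

lemma row_parts_inclusion_exclusion:
  fixes w :: "nat set \<Rightarrow> real"
  assumes P: "finite P"
  shows "(\<Sum>J\<in>Pow P. (-1) ^ card (P - J) * (\<Prod>p\<in>P - J. w {p}) * (\<Sum>\<sigma>\<in>row_parts r J. \<Prod>b\<in>\<sigma>. w b))
    = (\<Sum>\<tau>\<in>{\<tau>\<in>row_parts r P. \<forall>b\<in>\<tau>. 2 \<le> card b}. \<Prod>b\<in>\<tau>. w b)"
proof -
  define sg where "sg \<tau> = {p\<in>P. {p} \<in> \<tau>}" for \<tau> :: "nat set set"
  define S where "S = Sigma (Pow P) (row_parts r)"
  define T where "T = Sigma (row_parts r P) (\<lambda>\<tau>. Pow (sg \<tau>))"
  have fP: "finite J" if "J \<subseteq> P" for J using that P finite_subset by auto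
  have fw: "\<sigma> \<union> (\<lambda>p. {p}) ` (P - J) \<in> row_parts r P"
    if "J \<subseteq> P" "\<sigma> \<in> row_parts r J" for J \<sigma>
    unfolding row_parts_def
  proof (intro CollectI conjI ballI)
    show "partition_on P (\<sigma> \<union> (\<lambda>p. {p}) ` (P - J))"
      using that unfolding row_parts_def partition_on_def disjoint_def by auto
  qed (use that in \<open>auto simp: row_parts_def\<close>)
  have ndj: "{p} \<notin> \<sigma>" if "\<sigma> \<in> row_parts r J" "p \<notin> J" for p J \<sigma>
    using that by (auto simp: row_parts_def partition_on_def)
  have bw: "\<tau> - (\<lambda>p. {p}) ` U \<in> row_parts r (P - U)"
    if "\<tau> \<in> row_parts r P" "U \<subseteq> sg \<tau>" for \<tau> U
    unfolding row_parts_def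
  proof (intro CollectI conjI ballI)
    have *: "disjoint \<tau>" "{} \<notin> \<tau>" "\<Union>\<tau> = P" using that by (auto simp: row_parts_def partition_on_def)
    have "\<Union> (\<tau> - (\<lambda>p. {p}) ` U) = P - U"
    proof safe
      fix x b assume "b \<in> \<tau>" "x \<in> b" "b \<notin> (\<lambda>p. {p}) ` U" "x \<in> U"
      moreover have "{x} \<in> \<tau>" using that \<open>x \<in> U\<close> by (auto simp: sg_def)
      ultimately have "b = {x}" using *(1) unfolding disjoint_def by (metis Int_iff empty_iff insertI1)
      then show False using \<open>b \<notin> _\<close> \<open>x \<in> U\<close> by auto
    next
      fix x assume "x \<in> P" "x \<notin> U"
      then show "x \<in> \<Union> (\<tau> - (\<lambda>p. {p}) ` U)" using * by auto
    qed (use * in auto)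
    then show "partition_on (P - U) (\<tau> - (\<lambda>p. {p}) ` U)"
      using * by (auto simp: partition_on_def disjoint_def)
  qed (use that in \<open>auto simp: row_parts_def\<close>)
  have "(\<Sum>J\<in>Pow P. (-1) ^ card (P - J) * (\<Prod>p\<in>P - J. w {p}) * (\<Sum>\<sigma>\<in>row_parts r J. \<Prod>b\<in>\<sigma>. w b))
    = (\<Sum>J\<in>Pow P. \<Sum>\<sigma>\<in>row_parts r J. (-1) ^ card (P - J) * (\<Prod>p\<in>P - J. w {p}) * (\<Prod>b\<in>\<sigma>. w b))"
    by (simp add: sum_distrib_left)
  also have "\<dots> = (\<Sum>(J,\<sigma>)\<in>S. (-1) ^ card (P - J) * (\<Prod>p\<in>P - J. w {p}) * (\<Prod>b\<in>\<sigma>. w b))"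
    unfolding S_def by (rule sum.Sigma) (auto simp: P fP intro!: finite_row_parts)
  also have "\<dots> = (\<Sum>(\<tau>,U)\<in>T. (-1) ^ card U * (\<Prod>b\<in>\<tau>. w b))"
  proof (rule sum.reindex_bij_witness[of _ "\<lambda>(\<tau>,U). (P - U, \<tau> - (\<lambda>p. {p}) ` U)"
        "\<lambda>(J,\<sigma>). (\<sigma> \<union> (\<lambda>p. {p}) ` (P - J), P - J)"], goal_cases)
    case (1 a)
    then obtain J \<sigma> where a: "a = (J,\<sigma>)" "J \<subseteq> P" "\<sigma> \<in> row_parts r J" by (auto simp: S_def)
    then have "P - (P - J) = J" by auto
    then show ?case using ndj[OF a(3)] by (auto simp: a)
  next
    case (2 a)
    then show ?case using fw by (auto simp: S_def T_def sg_def)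
  next
    case (3 b)
    then obtain \<tau> U where b: "b = (\<tau>,U)" "\<tau> \<in> row_parts r P" "U \<subseteq> sg \<tau>" by (auto simp: T_def)
    then have "U \<subseteq> P" by (auto simp: sg_def)
    then have "P - (P - U) = U" by auto
    then show ?case using b(3) by (auto simp: b sg_def)
  next
    case (4 b)
    then show ?case using bw by (auto simp: S_def T_def sg_def)
  next
    case (5 a)
    then obtain J \<sigma> where a: "a = (J,\<sigma>)" "J \<subseteq> P" "\<sigma> \<in> row_parts r J" by (auto simp: S_def)
    have "finite \<sigma>" using a fP finite_elements by (auto simp: row_parts_def)
    moreover have "\<sigma> \<inter> (\<lambda>p. {p}) ` (P - J) = {}" using ndj[OF a(3)] by auto
    ultimately have "(\<Prod>b\<in>\<sigma> \<union> (\<lambda>p. {p}) ` (P - J). w b) = (\<Prod>b\<in>\<sigma>. w b) * (\<Prod>p\<in>P - J. w {p})"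
      using P by (subst prod.union_disjoint) (auto simp: prod.reindex)
    then show ?case by (simp add: a)
  qed
  also have "\<dots> = (\<Sum>\<tau>\<in>row_parts r P. \<Sum>U\<in>Pow (sg \<tau>). (-1) ^ card U * (\<Prod>b\<in>\<tau>. w b))"
    unfolding T_def by (subst sum.Sigma) (auto simp: P sg_def finite_row_parts)
  also have "\<dots> = (\<Sum>\<tau>\<in>row_parts r P. if sg \<tau> = {} then (\<Prod>b\<in>\<tau>. w b) else 0)"
    by (intro sum.cong refl) (auto simp: sum_distrib_right[symmetric] sum_Pow_alternating sg_def P)
  also have "\<dots> = (\<Sum>\<tau>\<in>{\<tau>\<in>row_parts r P. \<forall>b\<in>\<tau>. 2 \<le> card b}. \<Prod>b\<in>\<tau>. w b)"
  proof -
    have "sg \<tau> = {} \<longleftrightarrow> (\<forall>b\<in>\<tau>. 2 \<le> card b)" if t: "\<tau> \<in> row_parts r P" for \<tau>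
    proof
      assume e: "sg \<tau> = {}"
      show "\<forall>b\<in>\<tau>. 2 \<le> card b"
      proof
        fix b assume b: "b \<in> \<tau>"
        then have "finite b" "b \<noteq> {}" "b \<subseteq> P"
          using t P partition_on_finite_block by (auto simp: row_parts_def partition_on_def)
        then have "card b \<noteq> 0" by auto
        moreover have "card b \<noteq> 1"
          using e b \<open>b \<subseteq> P\<close> by (auto simp: sg_def card_1_singleton_iff)
        ultimately show "2 \<le> card b" by auto
      qed
    qed (auto simp: sg_def)
    then show ?thesis using P
      by (simp add: sum.inter_filter finite_row_parts cong: sum.cong)
  qed
  finally show ?thesis .
qed

section \<open>Counting measures as sums of Dirac measures\<close>

text \<open>The sets that contain or miss \<open>D\<close> are closed under complements and
  countable unions.\<close>

lemma sigma_sets_atom: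
  assumes "S \<in> sigma_sets \<Omega> \<A>" "D \<subseteq> \<Omega>" "\<And>A. A \<in> \<A> \<Longrightarrow> D \<subseteq> A \<or> D \<inter> A = {}"
  shows "D \<subseteq> S \<or> D \<inter> S = {}"
  using assms(1)
proof induction
  case (Compl a)
  then show ?case using assms(2) by blast
next
  case (Union a)
  then show ?case by blast
qed (use assms in auto)

text \<open>Restriction to \<open>D\<close> is expressed by a density so that space and
  \<sigma>-algebra stay the same; the induction below can then keep its generator.\<close>

lemma counting_measure_density:
  assumes "counting_measure N" "D \<in> sets N"
  shows "counting_measure (density N (indicator D))"
    and "S \<in> sets N \<Longrightarrow> emeasure (density N (indicator D)) S = emeasure N (S \<inter> D)"
proof -
  have *: "emeasure (density N (indicator D)) S = emeasure N (S \<inter> D)" if "S \<in> sets N" for S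
  proof -
    have "emeasure (density N (indicator D)) S = (\<integral>\<^sup>+x. indicator D x * indicator S x \<partial>N)"
      using that assms by (subst emeasure_density) auto
    also have "\<dots> = (\<integral>\<^sup>+x. indicator (S \<inter> D) x \<partial>N)"
      by (intro nn_integral_cong) (auto split: split_indicator)
    finally show ?thesis using that assms by simp
  qed
  then show "S \<in> sets N \<Longrightarrow> emeasure (density N (indicator D)) S = emeasure N (S \<inter> D)" .
  show "counting_measure (density N (indicator D))"
    using assms by (auto simp: counting_measure_def *)
qed

text \<open>Halving along a countable generator keeps a piece of mass at least one; in the limit this
  yields an atom of the generated \<open>\<sigma>\<close>-algebra with positive mass, which is split off.\<close>

lemma finite_counting_measure_dirac:
  fixes N :: "'a measure"
  assumes "counting_measure N" "sets N = sigma_sets (space N) \<A>" "countable \<A>"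
    and "emeasure N (space N) = of_nat n"
  shows "\<exists>k (x :: nat \<Rightarrow> 'a). (\<forall>i<k. x i \<in> space N) \<and>
    (\<forall>S\<in>sets N. emeasure N S = of_nat (card {i. i < k \<and> x i \<in> S}))"
  using assms
proof (induction n arbitrary: N rule: less_induct)
  case (less n N)
  show ?case
  proof (cases "n = 0")
    case True
    then have "emeasure N S = 0" if "S \<in> sets N" for S
      using less.prems(4) emeasure_space[of N S] by auto
    then show ?thesis by (intro exI[of _ "0::nat"] exI) auto
  next
    case False
    \<comment> \<open>Adding the whole space makes the enumerated family nonempty without changing
      what it generates.\<close>
    define A where "A = from_nat_into (insert (space N) \<A>)"
    have A_range: "range A = insert (space N) \<A>"
      unfolding A_def using less.prems(3) by (intro range_from_nat_into) auto
    have "\<A> \<subseteq> sets N" unfolding less.prems(2) by (rule sigma_sets_superset_generator)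
    then have A_sets[measurable]: "A k \<in> sets N" for k
      using A_range sets.top[of N] by (metis insertE rangeI subsetD)
    \<comment> \<open>If the intersection with \<open>A k\<close> has mass below one, its mass is
      zero, so passing to the difference loses nothing and the mass stays at least one.\<close>
    define D where "D = rec_nat (space N) (\<lambda>k D. if 1 \<le> emeasure N (D \<inter> A k) then D \<inter> A k else D - A k)"
    have D0: "D 0 = space N" by (simp add: D_def)
    have DS: "D (Suc k) = (if 1 \<le> emeasure N (D k \<inter> A k) then D k \<inter> A k else D k - A k)" for k
      by (simp add: D_def)
    have D_sets[measurable]: "D k \<in> sets N" for k
      by (induction k) (auto simp: D0 DS)
    have nat_val: "emeasure N S = 0" if S: "S \<in> sets N" "\<not> 1 \<le> emeasure N S" for S
    proof -
      have "emeasure N S \<noteq> \<infinity>" using S(2) by auto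
      then obtain k :: nat where "emeasure N S = of_nat k"
        using less.prems(1) S(1) unfolding counting_measure_def by blast
      moreover from this S(2) have "k = 0" by (cases k) auto
      ultimately show ?thesis by simp
    qed
    have D1: "1 \<le> emeasure N (D k)" for k
    proof (induction k)
      case 0
      then show ?case using False less.prems(4) by (cases n) (auto simp: D0)
    next
      case (Suc k)
      show ?case
      proof (cases "1 \<le> emeasure N (D k \<inter> A k)")
        case False
        then have "emeasure N (D k \<inter> A k) = 0" using nat_val by auto
        then have "emeasure N (D k - A k) = emeasure N (D k)"
          using plus_emeasure[of "D k \<inter> A k" N "D k - A k"] by (simp add: Int_Diff_Un Int_Diff_disjoint)
        then show ?thesis using False Suc by (simp add: DS)
      qed (simp add: DS)
    qed
    have dec: "decseq D" by (rule decseq_SucI) (auto simp: DS)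
    define E where "E = (\<Inter>k. D k)"
    have E[measurable]: "E \<in> sets N" unfolding E_def by auto
    have fin: "emeasure N S < \<infinity>" if "S \<in> sets N" for S
      using emeasure_space[of N S] less.prems(4) by (simp add: le_less_trans of_nat_less_top)
    have "emeasure N E = (INF k. emeasure N (D k))"
      unfolding E_def using dec fin[OF D_sets] by (intro INF_emeasure_decseq[symmetric]) (auto simp: less_le)
    then have "1 \<le> emeasure N E" using D1 by (simp add: le_INF_iff)
    moreover obtain c :: nat where c: "emeasure N E = of_nat c"
      using fin[OF E] E less.prems(1) unfolding counting_measure_def by fastforce
    ultimately have c1: "c \<noteq> 0" by (cases c) auto
    have "E \<noteq> {}" using c c1 by auto
    then obtain z where z: "z \<in> E" by auto
    have E_sub: "E \<subseteq> space N" using sets.sets_into_space[OF E] .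
    \<comment> \<open>Stage \<open>k\<close> decides for or against \<open>A k\<close>, so the limit
      \<open>E\<close> splits no generator and hence no generated set.\<close>
    have atom: "E \<subseteq> S \<or> E \<inter> S = {}" if "S \<in> sets N" for S
    proof (rule sigma_sets_atom[of S "space N" \<A>])
      fix X assume "X \<in> \<A>"
      then obtain k where "X = A k" using A_range by (metis insertCI rangeE)
      moreover have "E \<subseteq> D (Suc k)" by (auto simp: E_def)
      ultimately show "E \<subseteq> X \<or> E \<inter> X = {}" by (auto simp: DS split: if_splits)
    qed (use that less.prems(2) E_sub in auto)
    define N' where "N' = density N (indicator (space N - E))"
    have N': "emeasure N' S = emeasure N (S - E)" if "S \<in> sets N" for S
    proof -
      have "S \<inter> (space N - E) = S - E" using sets.sets_into_space[OF that] by auto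
      then show ?thesis using that less.prems(1) by (simp add: N'_def counting_measure_density(2))
    qed
    have split: "emeasure N S = emeasure N' S + (if z \<in> S then of_nat c else 0)" if S: "S \<in> sets N" for S
    proof -
      have "emeasure N S = emeasure N (S \<inter> E) + emeasure N (S - E)"
        using S by (subst plus_emeasure) (auto intro!: arg_cong[where f="emeasure N"])
      moreover have "S \<inter> E = (if z \<in> S then E else {})" using atom[OF S] z by auto
      ultimately show ?thesis using N'[OF S] c by (auto simp: add.commute)
    qed
    have "c \<le> n" using c emeasure_space[of N E] less.prems(4) by simp
    have n': "emeasure N' (space N') = of_nat (n - c)"
    proof -
      have "emeasure N (space N - E) = of_nat n - of_nat c"
        using emeasure_compl[OF E] c less.prems(4) by (simp add: of_nat_less_top)
      also have "\<dots> = of_nat (n - c)"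
        using \<open>c \<le> n\<close> by (simp add: ennreal_of_nat_eq_real_of_nat ennreal_minus of_nat_diff)
      finally show ?thesis using N'[of "space N"] by (simp add: N'_def)
    qed
    have cm: "counting_measure N'" unfolding N'_def
      using less.prems(1) by (intro counting_measure_density) auto
    have "\<exists>k (x :: nat \<Rightarrow> 'a). (\<forall>i<k. x i \<in> space N') \<and>
       (\<forall>S\<in>sets N'. emeasure N' S = of_nat (card {i. i < k \<and> x i \<in> S}))"
    proof (rule less.IH[OF _ cm _ _ n'])
      show "n - c < n" using c1 \<open>c \<le> n\<close> by auto
      show "sets N' = sigma_sets (space N') \<A>" using less.prems(2) by (simp add: N'_def)
    qed (use less.prems in auto)
    then obtain k and x :: "nat \<Rightarrow> 'a" where kx: "\<And>i. i < k \<Longrightarrow> x i \<in> space N"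
      "\<And>S. S \<in> sets N \<Longrightarrow> emeasure N' S = of_nat (card {i. i < k \<and> x i \<in> S})"
      by (auto simp: N'_def)
    \<comment> \<open>The atom of mass \<open>c\<close> contributes \<open>c\<close> labels, all
      placed at the point \<open>z\<close>.\<close>
    define y where "y = (\<lambda>i. if i < k then x i else z)"
    have "emeasure N S = of_nat (card {i. i < k + c \<and> y i \<in> S})" if S: "S \<in> sets N" for S
    proof -
      have "{i. i < k + c \<and> y i \<in> S} = {i. i < k \<and> x i \<in> S} \<union> (if z \<in> S then {k..<k+c} else {})"
        by (auto simp: y_def)
      also have "card \<dots> = card {i. i < k \<and> x i \<in> S} + card (if z \<in> S then {k..<k+c} else {})"
        by (intro card_Un_disjoint) auto
      finally show ?thesis using split[OF S] kx(2)[OF S] by simp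
    qed
    moreover have "y i \<in> space N" if "i < k + c" for i using kx(1) z E_sub by (auto simp: y_def)
    ultimately show ?thesis by blast
  qed
qed

text \<open>A counting measure on a general space need not be a sum of Dirac measures on its whole
  \<open>\<sigma>\<close>-algebra, but it is one on the \<open>\<sigma>\<close>-algebra generated by a countable family \<open>\<A>\<close>.\<close>

definition dirac_rep :: "'x measure \<Rightarrow> 'x set set \<Rightarrow> 'i set \<Rightarrow> ('i \<Rightarrow> 'x) \<Rightarrow> bool" where
  "dirac_rep N \<A> I x \<longleftrightarrow> \<A> \<subseteq> sets N \<and> countable I \<and> x \<in> I \<rightarrow> space N \<and>
     (\<forall>S\<in>sigma_sets (space N) \<A>. emeasure N S = emeasure (count_space UNIV) {i\<in>I. x i \<in> S})"

text \<open>Local finiteness cuts the space into disjoint pieces of finite mass, to which the finite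
  case applies. The labels (n, i) form the disjoint union of the labels of the pieces.\<close>

lemma dirac_rep_ex:
  fixes N :: "'x measure"
  assumes N: "counting_measure N" and A: "countable \<A>" "\<A> \<subseteq> sets N"
    and B: "\<And>n::nat. B n \<in> sets N" "(\<Union>n. B n) = space N" "\<And>n. emeasure N (B n) < \<infinity>"
  shows "\<exists>(I :: (nat \<times> nat) set) x. dirac_rep N \<A> I x"
proof -
  define F where "F = sigma (space N) \<A>"
  have A_Pow: "\<A> \<subseteq> Pow (space N)" using A sets.sets_into_space by blast
  have F: "space F = space N" "sets F = sigma_sets (space N) \<A>"
    unfolding F_def using A_Pow by (auto simp: space_measure_of_conv sets_measure_of_conv)
  have F_sub: "sets F \<subseteq> sets N" unfolding F using A(2) by (rule sets.sigma_sets_subset)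
  define d where "d = disjointed B"
  have d[measurable]: "d n \<in> sets N" for n
    unfolding d_def using sets.range_disjointed_sets[of B N] B(1) by blast
  have d_disj: "disjoint_family d" unfolding d_def by (rule disjoint_family_disjointed)
  have d_un: "(\<Union>n. d n) = space N" unfolding d_def using B(2) UN_disjointed_eq[of B] by simp
  \<comment> \<open>The finite case requires the \<sigma>-algebra to be exactly the generated one.
    The pieces \<open>d n\<close> need not belong to it, so each is cut out first and the measure is
    restricted to the sub-\<sigma>-algebra afterwards.\<close>
  define Nn where "Nn n = restr_to_subalg (density N (indicator (d n))) F" for n
  have sa: "subalgebra (density N (indicator (d n))) F" for n
    using F F_sub by (auto simp: subalgebra_def)
  have Nn: "space (Nn n) = space N" "sets (Nn n) = sets F" for n
    unfolding Nn_def using sa[of n] by (auto simp: space_restr_to_subalg sets_restr_to_subalg)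
  have Nn_em: "emeasure (Nn n) S = emeasure N (S \<inter> d n)" if "S \<in> sets F" for n S
    unfolding Nn_def using that F_sub N
    by (subst emeasure_restr_to_subalg[OF sa]) (auto intro!: counting_measure_density)
  have "\<exists>k (x :: nat \<Rightarrow> 'x). (\<forall>i<k. x i \<in> space (Nn n)) \<and>
    (\<forall>S\<in>sets (Nn n). emeasure (Nn n) S = of_nat (card {i. i < k \<and> x i \<in> S}))" for n
  proof -
    have "emeasure N (space N \<inter> d n) \<le> emeasure N (B n)"
      using B(1) by (intro emeasure_mono) (auto simp: d_def disjointed_def)
    also have "\<dots> < \<infinity>" by (rule B)
    finally obtain m :: nat where "emeasure N (space N \<inter> d n) = of_nat m"
      using N d[of n] unfolding counting_measure_def by fastforce
    then have m: "emeasure (Nn n) (space (Nn n)) = of_nat m"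
      using Nn_em[of "space N" n] Nn F by (metis sets.top)
    show ?thesis
    proof (rule finite_counting_measure_dirac[OF _ _ A(1) m])
      show "counting_measure (Nn n)"
        unfolding counting_measure_def Nn
      proof
        fix S assume S: "S \<in> sets F"
        then have "S \<inter> d n \<in> sets N" using F_sub by auto
        then show "emeasure (Nn n) S = \<infinity> \<or> (\<exists>k::nat. emeasure (Nn n) S = of_nat k)"
          using N unfolding Nn_em[OF S] counting_measure_def by blast
      qed
      show "sets (Nn n) = sigma_sets (space (Nn n)) \<A>" using Nn F by simp
    qed
  qed
  then have "\<forall>n. \<exists>k (x :: nat \<Rightarrow> 'x). (\<forall>i<k. x i \<in> space N) \<and>
    (\<forall>S\<in>sets F. emeasure (Nn n) S = of_nat (card {i. i < k \<and> x i \<in> S}))" unfolding Nn by (rule allI)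
  from choice[OF this] obtain k where "\<forall>n. \<exists>x :: nat \<Rightarrow> 'x. (\<forall>i<k n. x i \<in> space N) \<and>
    (\<forall>S\<in>sets F. emeasure (Nn n) S = of_nat (card {i. i < k n \<and> x i \<in> S}))" by (elim exE)
  from choice[OF this] obtain x where "\<forall>n. (\<forall>i<k n. x n i \<in> space N) \<and>
    (\<forall>S\<in>sets F. emeasure (Nn n) S = of_nat (card {i. i < k n \<and> x n i \<in> S}))" by (elim exE)
  then have kx: "\<And>n i. i < k n \<Longrightarrow> x n i \<in> space N"
    "\<And>n S. S \<in> sets F \<Longrightarrow> emeasure (Nn n) S = of_nat (card {i. i < k n \<and> x n i \<in> S})" by auto
  define I where "I = {(n, i). i < k n}"
  have "emeasure N S = emeasure (count_space UNIV) {i\<in>I. (\<lambda>(n,i). x n i) i \<in> S}" if S: "S \<in> sets F" for S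
  proof -
    have SN: "S \<in> sets N" using S F_sub by auto
    have "emeasure N S = emeasure N (\<Union>n. S \<inter> d n)"
      using d_un sets.sets_into_space[OF SN] by (intro arg_cong[where f="emeasure N"]) auto
    also have "\<dots> = (\<Sum>n. emeasure N (S \<inter> d n))"
      using SN d_disj by (intro suminf_emeasure[symmetric]) (auto simp: disjoint_family_on_def)
    also have "\<dots> = (\<Sum>n. emeasure (count_space UNIV) {(n', i). n' = n \<and> i < k n \<and> x n i \<in> S})"
    proof (rule suminf_cong)
      fix n
      have e: "{(n', i). n' = n \<and> i < k n \<and> x n i \<in> S} = Pair n ` {i. i < k n \<and> x n i \<in> S}" by auto
      show "emeasure N (S \<inter> d n) = emeasure (count_space UNIV) {(n', i). n' = n \<and> i < k n \<and> x n i \<in> S}"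
        unfolding e using kx(2)[OF S, of n] Nn_em[OF S, of n]
        by (subst emeasure_count_space) (auto simp: card_image inj_on_def)
    qed
    also have "\<dots> = emeasure (count_space UNIV) (\<Union>n. {(n', i). n' = n \<and> i < k n \<and> x n i \<in> S})"
      by (intro suminf_emeasure) (auto simp: disjoint_family_on_def)
    also have "(\<Union>n. {(n', i). n' = n \<and> i < k n \<and> x n i \<in> S}) = {i\<in>I. (\<lambda>(n,i). x n i) i \<in> S}"
      by (auto simp: I_def)
    finally show ?thesis .
  qed
  then have "dirac_rep N \<A> I (\<lambda>(n,i). x n i)"
    unfolding dirac_rep_def F(2)[symmetric]
    using A(2) kx(1) by (intro conjI ballI countableI_type) (auto simp: I_def)
  then show ?thesis by blast
qed

text \<open>On \<open>F\<close> the measure \<open>N\<close> is the image of counting measure on the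
  labels, and the integral of an \<open>F\<close>-measurable function depends only on this
  restriction. It is stated for abstract \<open>T\<close>, since it is applied both to points and to
  tuples of points.\<close>

lemma nn_integral_dirac_rep:
  assumes F: "space F = space N" "sets F \<subseteq> sets N" and T: "T \<in> I \<rightarrow> space N"
    and eq: "\<And>S. S \<in> sets F \<Longrightarrow> emeasure N S = emeasure (count_space UNIV) {i\<in>I. T i \<in> S}"
    and h: "h \<in> borel_measurable F"
  shows "(\<integral>\<^sup>+y. h y \<partial>N) = (\<integral>\<^sup>+i. h (T i) \<partial>count_space I)"
proof -
  have sa: "subalgebra N F" using F by (auto simp: subalgebra_def)
  have T': "T \<in> measurable (count_space I) F" using T F by auto
  have "restr_to_subalg N F = distr (count_space I) F T"
  proof (rule measure_eqI)
    show "sets (restr_to_subalg N F) = sets (distr (count_space I) F T)"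
      using sa by (simp add: sets_restr_to_subalg)
    fix S assume "S \<in> sets (restr_to_subalg N F)"
    then have S: "S \<in> sets F" using sa by (simp add: sets_restr_to_subalg)
    have e: "T -` S \<inter> I = {i\<in>I. T i \<in> S}" by auto
    show "emeasure (restr_to_subalg N F) S = emeasure (distr (count_space I) F T) S"
      using S eq[OF S] T' sa
      by (subst emeasure_restr_to_subalg) (auto simp: emeasure_distr e emeasure_count_space)
  qed
  then have "(\<integral>\<^sup>+y. h y \<partial>N) = (\<integral>\<^sup>+y. h y \<partial>distr (count_space I) F T)"
    using nn_integral_subalgebra2[OF sa h] by simp
  also have "\<dots> = (\<integral>\<^sup>+i. h (T i) \<partial>count_space I)"
    by (rule nn_integral_distr) (use T' h in auto)
  finally show ?thesis .
qed

section \<open>Countable generators in product \<sigma>-algebras\<close>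

lemma sets_PiM_sigma_mono:
  assumes "\<A> \<subseteq> \<B>" "\<B> \<subseteq> Pow \<Omega>"
  shows "sets (PiM J (\<lambda>_. sigma \<Omega> \<A>)) \<subseteq> sets (PiM J (\<lambda>_. sigma \<Omega> \<B>))"
proof -
  have "sigma_sets \<Omega> \<A> \<subseteq> sigma_sets \<Omega> \<B>" using assms by (intro sigma_sets_mono') auto
  moreover have "sets (sigma \<Omega> \<A>) = sigma_sets \<Omega> \<A>" "sets (sigma \<Omega> \<B>) = sigma_sets \<Omega> \<B>"
    using assms by (auto simp: sets_measure_of_conv)
  ultimately have sub: "sets (sigma \<Omega> \<A>) \<subseteq> sets (sigma \<Omega> \<B>)" by simp
  show ?thesis
    unfolding sets_PiM_finite space_measure_of_conv
  proof (rule sigma_sets_mono', rule subsetI, elim CollectE exE conjE)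
    fix a X assume X: "a = Pi\<^sub>E J X" "\<forall>i. X i \<in> sets (sigma \<Omega> \<A>)" "finite {i. X i \<noteq> \<Omega>}"
    have "\<forall>i. X i \<in> sets (sigma \<Omega> \<B>)" using X(2) sub by blast
    with X(1,3) show "a \<in> {Pi\<^sub>E J X |X. (\<forall>i. X i \<in> sets (sigma \<Omega> \<B>)) \<and> finite {i. X i \<noteq> \<Omega>}}"
      by blast
  qed
qed

text \<open>The sets that can be described with countably many sets of the factor form a
  \<sigma>-algebra, as a countable union of countable families is countable, and they include the
  boxes. A question about a single measurable set of the product thus moves to a \<sigma>-algebra on
  which points exist.\<close>

lemma sets_PiM_countable_generator:
  assumes "C \<in> sets (PiM J (\<lambda>_. N))"
  shows "\<exists>\<A>. countable \<A> \<and> \<A> \<subseteq> sets N \<and> C \<in> sets (PiM J (\<lambda>_. sigma (space N) \<A>))"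
proof -
  define G where "G \<A> = sets (PiM J (\<lambda>_. sigma (space N) \<A>))" for \<A>
  have Pow: "sets N \<subseteq> Pow (space N)" using sets.sets_into_space by blast
  have G_mono: "G \<A> \<subseteq> G \<B>" if "\<A> \<subseteq> \<B>" "\<B> \<subseteq> sets N" for \<A> \<B>
    unfolding G_def using that Pow by (intro sets_PiM_sigma_mono) auto
  have G_empty: "{} \<in> G \<A>" for \<A> by (simp add: G_def)
  have G_compl: "(\<Pi>\<^sub>E i\<in>J. space N) - a \<in> G \<A>" if "a \<in> G \<A>" for \<A> a
    using sets.compl_sets[OF that[unfolded G_def]] by (simp add: G_def space_PiM space_measure_of_conv)
  have G_UN: "\<Union> (range a) \<in> G \<A>" if "\<And>i::nat. a i \<in> G \<A>" for \<A> a
    using that unfolding G_def by (intro sets.countable_UN image_subsetI)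
  have G_basic: "(\<Pi>\<^sub>E i\<in>J. X i) \<in> G (X ` {i. X i \<noteq> space N})"
    if X: "\<forall>i. X i \<in> sets N" "finite {i. X i \<noteq> space N}" for X
  proof -
    let ?A = "X ` {i. X i \<noteq> space N}"
    have P: "?A \<subseteq> Pow (space N)" using X Pow by auto
    have "X i \<in> sigma_sets (space N) ?A" for i
      by (cases "X i = space N") (simp_all add: sigma_sets_top sigma_sets.Basic)
    then have "X i \<in> sets (sigma (space N) ?A)" for i
      using P by (simp add: sets_measure_of_conv)
    then show ?thesis
      unfolding G_def sets_PiM_finite space_measure_of_conv using X(2)
      by - (rule sigma_sets.Basic, rule CollectI, rule exI[of _ X], rule conjI, rule refl, rule conjI, rule allI, assumption+)
  qed
  have "C \<in> sigma_sets (\<Pi>\<^sub>E i\<in>J. space N)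
        {(\<Pi>\<^sub>E i\<in>J. X i) |X. (\<forall>i. X i \<in> sets N) \<and> finite {i. X i \<noteq> space N}}"
    using assms unfolding sets_PiM_finite .
  then have "\<exists>\<A>. countable \<A> \<and> \<A> \<subseteq> sets N \<and> C \<in> G \<A>"
  proof induction
    case (Basic a)
    then obtain X where X: "a = (\<Pi>\<^sub>E i\<in>J. X i)" "\<forall>i. X i \<in> sets N" "finite {i. X i \<noteq> space N}" by blast
    have "countable (X ` {i. X i \<noteq> space N})" "X ` {i. X i \<noteq> space N} \<subseteq> sets N"
      using X by (auto intro: countable_finite)
    then show ?case using G_basic[OF X(2,3)] X(1) by blast
  next
    case Empty
    then show ?case using G_empty by blast
  next
    case (Compl a)
    then show ?case using G_compl by blast
  next
    case (Union a)
    have "\<forall>i. \<exists>\<A>. countable \<A> \<and> \<A> \<subseteq> sets N \<and> a i \<in> G \<A>" using Union.IH by (rule allI)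
    from choice[OF this] obtain \<A> where "\<forall>i. countable (\<A> i) \<and> \<A> i \<subseteq> sets N \<and> a i \<in> G (\<A> i)"
      by (elim exE)
    then have A: "\<And>i. countable (\<A> i)" "\<And>i. \<A> i \<subseteq> sets N" "\<And>i. a i \<in> G (\<A> i)" by simp_all
    have sub: "(\<Union>i. \<A> i) \<subseteq> sets N" using A(2) by blast
    have "a i \<in> G (\<Union>i. \<A> i)" for i
      using A(3)[of i] G_mono[OF _ sub, of "\<A> i"] by blast
    then have "\<Union> (range a) \<in> G (\<Union>i. \<A> i)" by (rule G_UN)
    moreover have "countable (\<Union>i. \<A> i)" using A(1) by simp
    ultimately show ?case using sub by (intro exI[of _ "\<Union>i. \<A> i"] conjI)
  qed
  then show ?thesis unfolding G_def .
qed

lemma emeasure_count_space_bij: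
  assumes "bij_betw f A B"
  shows "emeasure (count_space UNIV) A = emeasure (count_space UNIV) B"
  using bij_betw_finite[OF assms] bij_betw_same_card[OF assms] by (simp add: emeasure_count_space)

section \<open>Factorial measures as counts of tuples of distinct labels\<close>

lemma sets_factorial_measure: "sets (factorial_measure N k) = sets (pow_measure N k)"
  by (cases k) (auto simp: sets.space_closed)

lemma space_factorial_measure: "space (factorial_measure N k) = space (pow_measure N k)"
  using sets_factorial_measure by (rule sets_eq_imp_space_eq)

text \<open>The combinatorial counterpart of the recursion for factorial measures: the new label is
  any label not yet used.\<close>

lemma inj_maps_Suc_bij:
  "bij_betw (\<lambda>(\<iota>, i). \<iota>(Suc k := i)) {(\<iota>, i). \<iota> \<in> inj_maps {1..k} I \<and> i \<in> I - \<iota> ` {1..k}} (inj_maps {1..Suc k} I)"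
proof (rule bij_betw_byWitness[where f'="\<lambda>\<kappa>. (restrict \<kappa> {1..k}, \<kappa> (Suc k))"])
  show "\<forall>a\<in>{(\<iota>, i). \<iota> \<in> inj_maps {1..k} I \<and> i \<in> I - \<iota> ` {1..k}}.
    (restrict ((\<lambda>(\<iota>, i). \<iota>(Suc k := i)) a) {1..k}, (\<lambda>(\<iota>, i). \<iota>(Suc k := i)) a (Suc k)) = a"
    by (auto simp: inj_maps_def fun_eq_iff PiE_def extensional_def restrict_def)
  show "\<forall>a'\<in>inj_maps {1..Suc k} I. (\<lambda>(\<iota>, i). \<iota>(Suc k := i)) (restrict a' {1..k}, a' (Suc k)) = a'"
    by (auto simp: inj_maps_def fun_eq_iff PiE_def extensional_def restrict_def)
  show "(\<lambda>(\<iota>, i). \<iota>(Suc k := i)) ` {(\<iota>, i). \<iota> \<in> inj_maps {1..k} I \<and> i \<in> I - \<iota> ` {1..k}} \<subseteq> inj_maps {1..Suc k} I"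
  proof safe
    fix \<iota> i assume h: "\<iota> \<in> inj_maps {1..k} I" "i \<in> I" "i \<notin> \<iota> ` {1..k}"
    have e: "{1..Suc k} = insert (Suc k) {1..k}" by auto
    have "\<iota>(Suc k := i) \<in> {1..Suc k} \<rightarrow>\<^sub>E I" using h unfolding inj_maps_def e
      by (intro PiE_fun_upd) auto
    moreover have "inj_on (\<iota>(Suc k := i)) {1..Suc k}"
    proof -
      have "inj_on (\<iota>(Suc k := i)) {1..k} = inj_on \<iota> {1..k}" by (rule inj_on_cong) auto
      moreover have "(\<iota>(Suc k := i)) ` {1..k} = \<iota> ` {1..k}" by (intro image_cong) auto
      ultimately show ?thesis using h unfolding e inj_on_insert by (simp add: inj_maps_def)
    qed
    ultimately show "\<iota>(Suc k := i) \<in> inj_maps {1..Suc k} I" by (simp add: inj_maps_def)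
  qed
  show "(\<lambda>\<kappa>. (restrict \<kappa> {1..k}, \<kappa> (Suc k))) ` inj_maps {1..Suc k} I
    \<subseteq> {(\<iota>, i). \<iota> \<in> inj_maps {1..k} I \<and> i \<in> I - \<iota> ` {1..k}}"
  proof safe
    fix \<kappa> assume h: "\<kappa> \<in> inj_maps {1..Suc k} I"
    show "restrict \<kappa> {1..k} \<in> inj_maps {1..k} I" "\<kappa> (Suc k) \<in> I"
      using h by (auto simp: inj_maps_def inj_on_def)
    fix j assume "\<kappa> (Suc k) = restrict \<kappa> {1..k} j" "j \<in> {1..k}"
    then show False using h by (force simp: inj_maps_def inj_on_def)
  qed
qed

locale sf_counting =
  fixes N :: "'x measure" and B :: "nat \<Rightarrow> 'x set"
  assumes counting: "counting_measure N"
    and B_sets: "\<And>n. B n \<in> sets N" and B_UN: "(\<Union>n. B n) = space N" and B_fin: "\<And>n. emeasure N (B n) < \<infinity>"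
begin

lemma rep_ex:
  assumes "countable \<A>" "\<A> \<subseteq> sets N"
  obtains I :: "(nat \<times> nat) set" and x where "dirac_rep N \<A> I x"
  using dirac_rep_ex[of N \<A> B] counting assms B_sets B_UN B_fin by metis

text \<open>The set function that \<open>factorial_measure\<close> passes to
  \<open>measure_of\<close>. It is studied separately because \<open>measure_of\<close> returns the
  zero measure unless its argument is countably additive, which has to be proved first.\<close>

definition factorial_step :: "nat \<Rightarrow> (nat \<Rightarrow> 'x) set \<Rightarrow> ennreal" where
  "factorial_step k C = (\<integral>\<^sup>+ x. ((\<integral>\<^sup>+ y. indicator C (x(Suc k := y)) \<partial>N)
                     - (\<Sum>j\<in>{1..k}. indicator C (x(Suc k := x j)))) \<partial>factorial_measure N k)"

text \<open>At a tuple of distinct labels the subtracted sum removes from the sum over all labels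
  exactly those already used. Two labels at the same point remain two labels, which accounts for
  multiplicities.\<close>

lemma factorial_step_rep:
  fixes x :: "nat \<times> nat \<Rightarrow> 'x"
  defines "tup \<equiv> \<lambda>k \<iota>. \<lambda>j\<in>{1..k}. x (\<iota> j)"
  assumes rep: "dirac_rep N \<A> I x"
    and IH: "\<And>C. C \<in> sets (PiM {1..k} (\<lambda>_. sigma (space N) \<A>)) \<Longrightarrow>
      emeasure (factorial_measure N k) C = emeasure (count_space UNIV) {\<iota>\<in>inj_maps {1..k} I. tup k \<iota> \<in> C}"
    and C: "C \<in> sets (PiM {1..Suc k} (\<lambda>_. sigma (space N) \<A>))"
  shows "factorial_step k C = emeasure (count_space UNIV) {\<iota>\<in>inj_maps {1..Suc k} I. tup (Suc k) \<iota> \<in> C}"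
proof -
  define F where "F = sigma (space N) \<A>"
  have AN: "\<A> \<subseteq> sets N" and cI: "countable I" and xI: "x \<in> I \<rightarrow> space N"
    and rep': "\<And>S. S \<in> sigma_sets (space N) \<A> \<Longrightarrow> emeasure N S = emeasure (count_space UNIV) {i\<in>I. x i \<in> S}"
    using rep by (auto simp: dirac_rep_def)
  have A_Pow: "\<A> \<subseteq> Pow (space N)" using AN sets.sets_into_space by blast
  have F: "space F = space N" "sets F = sigma_sets (space N) \<A>"
    unfolding F_def using A_Pow by (auto simp: space_measure_of_conv sets_measure_of_conv)
  have F_sub: "sets F \<subseteq> sets N" unfolding F using AN by (rule sets.sigma_sets_subset)
  let ?P = "\<lambda>k. PiM {1..k} (\<lambda>_. F)"
  have C': "C \<in> sets (?P (Suc k))" using C by (simp add: F_def)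
  have e: "{1..Suc k} = {1..k} \<union> {Suc k}" by auto
  have m1: "(\<lambda>y. f(Suc k := y)) \<in> measurable F (?P (Suc k))" if "f \<in> space (?P k)" for f
    unfolding e by (rule measurable_fun_upd[where J="{1..k}"]) (use that in auto)
  have m2: "(\<lambda>f. f(Suc k := c)) \<in> measurable (?P k) (?P (Suc k))" if "c \<in> space F" for c
    unfolding e by (rule measurable_fun_upd[where J="{1..k}"]) (use that in auto)
  have m3: "(\<lambda>f. f(Suc k := f j)) \<in> measurable (?P k) (?P (Suc k))" if "j \<in> {1..k}" for j
    unfolding e by (rule measurable_fun_upd[where J="{1..k}"])
      (use that in \<open>auto intro: measurable_component_singleton\<close>)
  \<comment> \<open>With the inner integral written as a sum over countably many labels,
    measurability in \<open>f\<close> can be shown for the small product \<sigma>-algebra, which is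
    what \<open>nn_integral_dirac_rep\<close> asks for.\<close>
  define u where "u f = (\<integral>\<^sup>+ i. indicator C (f(Suc k := x i)) \<partial>count_space I)
                     - (\<Sum>j\<in>{1..k}. indicator C (f(Suc k := f j)) :: ennreal)" for f
  have sp: "space (?P k) = space (pow_measure N k)" by (simp add: space_PiM F)
  have u_eq: "(\<integral>\<^sup>+ y. indicator C (f(Suc k := y)) \<partial>N)
                     - (\<Sum>j\<in>{1..k}. indicator C (f(Suc k := f j))) = u f"
    if f: "f \<in> space (factorial_measure N k)" for f
  proof -
    have "(\<integral>\<^sup>+ y. indicator C (f(Suc k := y)) \<partial>N) = (\<integral>\<^sup>+ i. indicator C (f(Suc k := x i)) \<partial>count_space I)"
    proof (rule nn_integral_dirac_rep[OF F(1) F_sub xI])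
      show "emeasure N S = emeasure (count_space UNIV) {i \<in> I. x i \<in> S}" if "S \<in> sets F" for S
        using rep' that F by auto
      have "f \<in> space (?P k)" using f sp by (simp add: space_factorial_measure)
      from measurable_compose[OF m1[OF this] borel_measurable_indicator[OF C']]
      show "(\<lambda>y. indicator C (f(Suc k := y))) \<in> borel_measurable F" .
    qed
    then show ?thesis by (simp add: u_def)
  qed
  have u_meas: "u \<in> borel_measurable (?P k)"
  proof -
    interpret I: sigma_finite_measure "count_space I" by (rule sigma_finite_measure_count_space_countable[OF cI])
    have "(\<lambda>(i, f). indicator C (f(Suc k := x i)) :: ennreal) \<in> borel_measurable (count_space I \<Otimes>\<^sub>M ?P k)"
    proof (rule measurable_pair_measure_countable1[OF cI])
      fix i assume "i \<in> I"
      then have "x i \<in> space F" using xI F by auto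
      from measurable_compose[OF m2[OF this] borel_measurable_indicator[OF C']]
      show "(\<lambda>f. (\<lambda>(i, f). indicator C (f(Suc k := x i)) :: ennreal) (i, f)) \<in> borel_measurable (?P k)"
        by simp
    qed
    from I.borel_measurable_nn_integral[OF measurable_pair_swap[OF this], simplified]
    have 1: "(\<lambda>f. \<integral>\<^sup>+ i. indicator C (f(Suc k := x i)) \<partial>count_space I) \<in> borel_measurable (?P k)"
      by simp
    have 2: "(\<lambda>f. \<Sum>j\<in>{1..k}. indicator C (f(Suc k := f j)) :: ennreal) \<in> borel_measurable (?P k)"
      using measurable_compose[OF m3 borel_measurable_indicator[OF C']] by (intro borel_measurable_sum) auto
    show ?thesis unfolding u_def using 1 2 by measurable
  qed
  have tup_sp: "tup k \<iota> \<in> space (factorial_measure N k)" if "\<iota> \<in> inj_maps {1..k} I" for \<iota>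
    using that xI by (auto simp: space_factorial_measure space_PiM tup_def inj_maps_def PiE_iff Pi_iff)
  have P_sub: "sets (?P k) \<subseteq> sets (factorial_measure N k)"
  proof -
    have "sets (?P k) \<subseteq> sets (PiM {1..k} (\<lambda>_. sigma (space N) (sets N)))"
      unfolding F_def using AN by (rule sets_PiM_sigma_mono) (rule sets.space_closed)
    also have "\<dots> = sets (pow_measure N k)" by (intro sets_PiM_cong) (auto simp: sets.space_closed)
    finally show ?thesis by (simp add: sets_factorial_measure)
  qed
  have "factorial_step k C = (\<integral>\<^sup>+ f. u f \<partial>factorial_measure N k)"
    unfolding factorial_step_def by (intro nn_integral_cong u_eq)
  also have "\<dots> = (\<integral>\<^sup>+ \<iota>. u (tup k \<iota>) \<partial>count_space (inj_maps {1..k} I))"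
  proof (rule nn_integral_dirac_rep[of "?P k"])
    show "space (?P k) = space (factorial_measure N k)" by (simp only: space_factorial_measure sp)
    show "tup k \<in> inj_maps {1..k} I \<rightarrow> space (factorial_measure N k)" using tup_sp by (rule Pi_I)
    show "emeasure (factorial_measure N k) S = emeasure (count_space UNIV) {\<iota> \<in> inj_maps {1..k} I. tup k \<iota> \<in> S}"
      if "S \<in> sets (?P k)" for S
      using IH that unfolding F_def .
  qed (fact P_sub u_meas)+
  also have "\<dots> = (\<integral>\<^sup>+ \<iota>. (\<integral>\<^sup>+ i. indicator (I - \<iota> ` {1..k}) i * indicator C ((tup k \<iota>)(Suc k := x i)) \<partial>count_space UNIV)
      \<partial>count_space (inj_maps {1..k} I))"
  proof (intro nn_integral_cong)
    fix \<iota> assume "\<iota> \<in> space (count_space (inj_maps {1..k} I))"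
    then have \<iota>: "\<iota> ` {1..k} \<subseteq> I" "inj_on \<iota> {1..k}" by (auto simp: inj_maps_def)
    define g where "g i = (indicator C ((tup k \<iota>)(Suc k := x i)) :: ennreal)" for i
    have "(\<integral>\<^sup>+ i. g i \<partial>count_space I) = (\<integral>\<^sup>+ i. g i * indicator I i \<partial>count_space UNIV)"
      by (simp add: nn_integral_count_space_indicator)
    also have "\<dots> = (\<integral>\<^sup>+ i. indicator (I - \<iota> ` {1..k}) i * g i + g i * indicator (\<iota> ` {1..k}) i \<partial>count_space UNIV)"
      using \<iota> by (intro nn_integral_cong) (auto split: split_indicator)
    also have "\<dots> = (\<integral>\<^sup>+ i. indicator (I - \<iota> ` {1..k}) i * g i \<partial>count_space UNIV)
        + (\<integral>\<^sup>+ i. g i * indicator (\<iota> ` {1..k}) i \<partial>count_space UNIV)"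
      by (rule nn_integral_add) auto
    also have "(\<integral>\<^sup>+ i. g i * indicator (\<iota> ` {1..k}) i \<partial>count_space UNIV) = (\<Sum>i\<in>\<iota> ` {1..k}. g i)"
      by (simp add: nn_integral_count_space_indicator[symmetric] nn_integral_count_space_finite)
    also have "\<dots> = (\<Sum>j\<in>{1..k}. g (\<iota> j))" using \<iota> by (simp add: sum.reindex)
    finally have s: "(\<integral>\<^sup>+ i. g i \<partial>count_space I)
      = (\<integral>\<^sup>+ i. indicator (I - \<iota> ` {1..k}) i * g i \<partial>count_space UNIV) + (\<Sum>j\<in>{1..k}. g (\<iota> j))" .
    \<comment> \<open>The subtrahend is at most \<open>k\<close>; being finite, it cancels exactly
      in \<open>ennreal\<close> even if the whole sum is infinite.\<close>
    have "(\<Sum>j\<in>{1..k}. g (\<iota> j)) \<le> (\<Sum>j\<in>{1..k}. 1)" unfolding g_def by (intro sum_mono) (auto split: split_indicator)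
    also have "\<dots> < \<infinity>" by (simp add: of_nat_less_top)
    finally have fin: "(\<Sum>j\<in>{1..k}. g (\<iota> j)) \<noteq> \<infinity>" by (rule less_imp_neq)
    have "u (tup k \<iota>) = (\<integral>\<^sup>+ i. g i \<partial>count_space I) - (\<Sum>j\<in>{1..k}. g (\<iota> j))"
      unfolding u_def g_def by (intro arg_cong2[where f="(-)"] sum.cong refl) (auto simp: tup_def)
    also have "\<dots> = (\<integral>\<^sup>+ i. indicator (I - \<iota> ` {1..k}) i * g i \<partial>count_space UNIV)"
      unfolding s using fin by simp
    finally show "u (tup k \<iota>) = (\<integral>\<^sup>+ i. indicator (I - \<iota> ` {1..k}) i * indicator C ((tup k \<iota>)(Suc k := x i)) \<partial>count_space UNIV)"
      by (simp add: g_def)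
  qed
  also have "\<dots> = (\<integral>\<^sup>+ \<iota>. (\<integral>\<^sup>+ i. indicator {(\<iota>, i). (\<iota> \<in> inj_maps {1..k} I \<and> i \<in> I - \<iota> ` {1..k}) \<and> (tup k \<iota>)(Suc k := x i) \<in> C} (\<iota>, i) \<partial>count_space UNIV)
      \<partial>count_space UNIV)"
  proof -
    have "(\<integral>\<^sup>+ i. indicator (I - \<iota> ` {1..k}) i * indicator C ((tup k \<iota>)(Suc k := x i)) \<partial>count_space UNIV) * indicator (inj_maps {1..k} I) \<iota>
      = (\<integral>\<^sup>+ i. indicator {(\<iota>, i). (\<iota> \<in> inj_maps {1..k} I \<and> i \<in> I - \<iota> ` {1..k}) \<and> (tup k \<iota>)(Suc k := x i) \<in> C} (\<iota>, i) \<partial>count_space UNIV)" for \<iota>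
      by (cases "\<iota> \<in> inj_maps {1..k} I") (simp_all add: indicator_def of_bool_conj mult.assoc)
    then show ?thesis by (subst nn_integral_count_space_indicator) (simp_all add: NO_MATCH_def)
  qed
  also have "\<dots> = emeasure (count_space UNIV)
     {(\<iota>, i). (\<iota> \<in> inj_maps {1..k} I \<and> i \<in> I - \<iota> ` {1..k}) \<and> (tup k \<iota>)(Suc k := x i) \<in> C}"
    by (subst nn_integral_fst_count_space) simp
  also have "\<dots> = emeasure (count_space UNIV) {\<iota>\<in>inj_maps {1..Suc k} I. tup (Suc k) \<iota> \<in> C}"
  proof (rule emeasure_count_space_bij)
    have "tup (Suc k) (\<iota>(Suc k := i)) = (tup k \<iota>)(Suc k := x i)" for \<iota> i
      by (auto simp: tup_def fun_eq_iff)
    then have "{(\<iota>, i). (\<iota> \<in> inj_maps {1..k} I \<and> i \<in> I - \<iota> ` {1..k}) \<and> (tup k \<iota>)(Suc k := x i) \<in> C}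
      = {a\<in>{(\<iota>, i). \<iota> \<in> inj_maps {1..k} I \<and> i \<in> I - \<iota> ` {1..k}}. tup (Suc k) ((\<lambda>(\<iota>, i). \<iota>(Suc k := i)) a) \<in> C}"
      by auto
    moreover have "bij_betw (\<lambda>(\<iota>, i). \<iota>(Suc k := i))
       {a\<in>{(\<iota>, i). \<iota> \<in> inj_maps {1..k} I \<and> i \<in> I - \<iota> ` {1..k}}. tup (Suc k) ((\<lambda>(\<iota>, i). \<iota>(Suc k := i)) a) \<in> C}
       {\<iota>\<in>inj_maps {1..Suc k} I. tup (Suc k) \<iota> \<in> C}"
      using inj_maps_Suc_bij[of k I] by (rule bij_betw_Collect) auto
    ultimately show "bij_betw (\<lambda>(\<iota>, i). \<iota>(Suc k := i))
      {(\<iota>, i). (\<iota> \<in> inj_maps {1..k} I \<and> i \<in> I - \<iota> ` {1..k}) \<and> (tup k \<iota>)(Suc k := x i) \<in> C}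
      {\<iota>\<in>inj_maps {1..Suc k} I. tup (Suc k) \<iota> \<in> C}"
      by simp
  qed
  finally show ?thesis .
qed

text \<open>The induction hypothesis quantifies over all families and all their representations,
  since the additivity proof of the next stage chooses its own, larger family.\<close>

definition factorial_rep :: "nat \<Rightarrow> bool" where
  "factorial_rep k \<longleftrightarrow> (\<forall>\<A> (I :: (nat \<times> nat) set) x C. dirac_rep N \<A> I x \<longrightarrow>
     C \<in> sets (PiM {1..k} (\<lambda>_. sigma (space N) \<A>)) \<longrightarrow>
     emeasure (factorial_measure N k) C =
       emeasure (count_space UNIV) {\<iota>\<in>inj_maps {1..k} I. (\<lambda>j\<in>{1..k}. x (\<iota> j)) \<in> C})"

text \<open>For countable additivity the countably many sets of a disjoint sequence are placed in
  the product of one countably generated \<sigma>-algebra. There \<open>factorial_step\<close>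
  counts tuples of labels, and counting is additive.\<close>

lemma emeasure_factorial_Suc':
  assumes fr: "factorial_rep k" and C: "C \<in> sets (pow_measure N (Suc k))"
  shows "emeasure (factorial_measure N (Suc k)) C = factorial_step k C"
proof (rule emeasure_measure_of)
  show "factorial_measure N (Suc k) = measure_of (space (pow_measure N (Suc k)))
     (sets (pow_measure N (Suc k))) (factorial_step k)"
    by (simp add: factorial_step_def[abs_def])
  show "positive (sets (factorial_measure N (Suc k))) (factorial_step k)"
    by (simp add: positive_def factorial_step_def)
  show "countably_additive (sets (factorial_measure N (Suc k))) (factorial_step k)"
  proof (rule countably_additiveI)
    fix S :: "nat \<Rightarrow> (nat \<Rightarrow> 'x) set"
    assume S: "range S \<subseteq> sets (factorial_measure N (Suc k))" "disjoint_family S"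
      "\<Union> (range S) \<in> sets (factorial_measure N (Suc k))"
    let ?G = "\<lambda>\<A>. sets (PiM {1..Suc k} (\<lambda>_. sigma (space N) \<A>))"
    have "\<forall>n. \<exists>\<A>. countable \<A> \<and> \<A> \<subseteq> sets N \<and> S n \<in> ?G \<A>"
    proof
      fix n
      have "S n \<in> sets (pow_measure N (Suc k))"
        using S(1) by (metis range_subsetD sets_factorial_measure)
      then show "\<exists>\<A>. countable \<A> \<and> \<A> \<subseteq> sets N \<and> S n \<in> ?G \<A>"
        by (rule sets_PiM_countable_generator)
    qed
    from choice[OF this] obtain \<A> where "\<forall>n. countable (\<A> n) \<and> \<A> n \<subseteq> sets N \<and> S n \<in> ?G (\<A> n)"
      by (elim exE)
    then have A: "\<And>n. countable (\<A> n)" "\<And>n. \<A> n \<subseteq> sets N" "\<And>n. S n \<in> ?G (\<A> n)" by simp_all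
    define U where "U = (\<Union>n. \<A> n)"
    have U: "countable U" "U \<subseteq> sets N" using A(1,2) by (auto simp: U_def)
    have SU: "S n \<in> ?G U" for n
    proof -
      have "?G (\<A> n) \<subseteq> ?G U"
      proof (rule sets_PiM_sigma_mono)
        show "\<A> n \<subseteq> U" by (auto simp: U_def)
        show "U \<subseteq> Pow (space N)" using U(2) sets.space_closed by blast
      qed
      then show ?thesis using A(3)[of n] by (rule subsetD)
    qed
    obtain I :: "(nat \<times> nat) set" and x where rep: "dirac_rep N U I x" using rep_ex[OF U] .
    let ?R = "\<lambda>C. {\<iota>\<in>inj_maps {1..Suc k} I. (\<lambda>j\<in>{1..Suc k}. x (\<iota> j)) \<in> C}"
    have step: "factorial_step k C = emeasure (count_space UNIV) (?R C)" if C: "C \<in> ?G U" for C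
    proof (rule factorial_step_rep[OF rep _ C])
      fix C' assume "C' \<in> sets (PiM {1..k} (\<lambda>_. sigma (space N) U))"
      then show "emeasure (factorial_measure N k) C' =
         emeasure (count_space UNIV) {\<iota> \<in> inj_maps {1..k} I. (\<lambda>j\<in>{1..k}. x (\<iota> j)) \<in> C'}"
        using fr rep unfolding factorial_rep_def by simp
    qed
    have UN: "\<Union> (range S) \<in> ?G U" using SU by (intro sets.countable_UN image_subsetI)
    have "(\<Sum>n. factorial_step k (S n)) = (\<Sum>n. emeasure (count_space UNIV) (?R (S n)))"
      by (intro suminf_cong step SU)
    also have "\<dots> = emeasure (count_space UNIV) (\<Union>n. ?R (S n))"
      using S(2) by (intro suminf_emeasure) (auto simp: disjoint_family_on_def)
    also have "(\<Union>n. ?R (S n)) = ?R (\<Union> (range S))" by auto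
    also have "emeasure (count_space UNIV) \<dots> = factorial_step k (\<Union> (range S))"
      by (rule step[OF UN, symmetric])
    finally show "(\<Sum>n. factorial_step k (S n)) = factorial_step k (\<Union> (range S))" .
  qed
  show "sets (pow_measure N (Suc k)) \<subseteq> Pow (space (pow_measure N (Suc k)))" by (rule sets.space_closed)
  show "C \<in> sets (factorial_measure N (Suc k))" using C by (simp only: sets_factorial_measure)
qed

lemma factorial_rep: "factorial_rep k"
proof (induction k)
  case 0
  show ?case unfolding factorial_rep_def
  proof (intro allI impI)
    fix \<A> and I :: "(nat \<times> nat) set" and x :: "nat \<times> nat \<Rightarrow> 'x" and C
    assume "C \<in> sets (PiM {1..0::nat} (\<lambda>_. sigma (space N) \<A>))"
    then have "C = {} \<or> C = {\<lambda>_. undefined}" by (simp add: sets_PiM_empty)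
    moreover have "inj_maps {1..0::nat} I = {\<lambda>_. undefined}" by (auto simp: inj_maps_def)
    moreover have "(\<lambda>j\<in>{1..0::nat}. x (\<iota> j)) = (\<lambda>_. undefined)" for \<iota> :: "nat \<Rightarrow> nat \<times> nat" by auto
    ultimately show "emeasure (factorial_measure N 0) C = emeasure (count_space UNIV)
      {\<iota>\<in>inj_maps {1..0} I. (\<lambda>j\<in>{1..0}. x (\<iota> j)) \<in> C}"
      by (auto simp: sets_PiM_empty)
  qed
next
  case (Suc k)
  show ?case unfolding factorial_rep_def
  proof (intro allI impI)
    fix \<A> and I :: "(nat \<times> nat) set" and x :: "nat \<times> nat \<Rightarrow> 'x" and C
    assume rep: "dirac_rep N \<A> I x" and C: "C \<in> sets (PiM {1..Suc k} (\<lambda>_. sigma (space N) \<A>))"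
    have AN: "\<A> \<subseteq> sets N" using rep by (simp add: dirac_rep_def)
    have "sets (PiM {1..Suc k} (\<lambda>_. sigma (space N) \<A>)) \<subseteq> sets (PiM {1..Suc k} (\<lambda>_. sigma (space N) (sets N)))"
      using AN by (rule sets_PiM_sigma_mono) (rule sets.space_closed)
    also have "\<dots> = sets (pow_measure N (Suc k))" by (intro sets_PiM_cong) (auto simp: sets.space_closed)
    finally have C': "C \<in> sets (pow_measure N (Suc k))" using C by (rule subsetD)
    have "factorial_step k C = emeasure (count_space UNIV) {\<iota>\<in>inj_maps {1..Suc k} I. (\<lambda>j\<in>{1..Suc k}. x (\<iota> j)) \<in> C}"
    proof (rule factorial_step_rep[OF rep _ C])
      fix C' assume "C' \<in> sets (PiM {1..k} (\<lambda>_. sigma (space N) \<A>))"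
      then show "emeasure (factorial_measure N k) C' =
         emeasure (count_space UNIV) {\<iota> \<in> inj_maps {1..k} I. (\<lambda>j\<in>{1..k}. x (\<iota> j)) \<in> C'}"
        using Suc rep unfolding factorial_rep_def by simp
    qed
    then show "emeasure (factorial_measure N (Suc k)) C =
      emeasure (count_space UNIV) {\<iota>\<in>inj_maps {1..Suc k} I. (\<lambda>j\<in>{1..Suc k}. x (\<iota> j)) \<in> C}"
      using emeasure_factorial_Suc'[OF Suc C'] by simp
  qed
qed

lemmas emeasure_factorial_Suc = emeasure_factorial_Suc'[OF factorial_rep]

end

section \<open>Moments of factorial measures of a Poisson process\<close>

declare One_nat_def [simp del]

text \<open>The falling factorial z (z - 1) ... (z - k + 1), with truncated subtraction. It is the
  mass that the \<open>k\<close>-th factorial measure gives to the \<open>k\<close>-th power of a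
  set of mass \<open>z\<close>.\<close>

definition ffact :: "ennreal \<Rightarrow> nat \<Rightarrow> ennreal" where
  "ffact z k = (\<Prod>r<k. z - of_nat r)"

lemma ffact_measurable[measurable]: "(\<lambda>z. ffact z k) \<in> borel_measurable borel"
  unfolding ffact_def by measurable

lemma ennreal_of_nat_diff: "of_nat n - of_nat k = (of_nat (n - k) :: ennreal)"
proof (cases "k \<le> n")
  case True
  then show ?thesis by (simp add: ennreal_of_nat_eq_real_of_nat ennreal_minus of_nat_diff)
next
  case False
  then show ?thesis by (simp add: diff_eq_0_ennreal of_nat_less_top)
qed

lemma ffact_of_nat: "ffact (of_nat n) k = ennreal (real (\<Prod>r<k. n - r))"
  unfolding ennreal_of_nat_eq_real_of_nat[symmetric] ffact_def
  by (induction k) (auto simp: ennreal_of_nat_diff simp del: of_nat_prod)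

lemma prod_fact_shift: "(\<Prod>r<k. n + k - r) * fact n = (fact (n + k) :: nat)"
  by (induction k) (auto simp: prod.lessThan_Suc_shift algebra_simps simp del: prod.lessThan_Suc)

text \<open>The last coordinate ranges over its cell minus the points already placed there. Since
  the cells are disjoint, the number of these is constant on the box, namely the number of earlier
  coordinates assigned to the same cell. Each coordinate thus contributes one factor to the falling
  factorial of its cell.\<close>

lemma (in sf_counting) emeasure_factorial_cells:
  assumes E: "finite E" and D: "\<And>i. i \<in> E \<Longrightarrow> D i \<in> sets N" "disjoint_family_on D E"
    and e: "e \<in> {1..s} \<rightarrow> E"
  shows "emeasure (factorial_measure N s) (\<Pi>\<^sub>E j\<in>{1..s}. D (e j)) =
    (\<Prod>i\<in>E. ffact (emeasure N (D i)) (card {j\<in>{1..s}. e j = i}))"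
  using e
proof (induction s)
  case 0
  then show ?case by (simp add: ffact_def emeasure_return sets_PiM_empty)
next
  case (Suc s)
  define i0 where "i0 = e (Suc s)"
  have i0: "i0 \<in> E" using Suc.prems by (auto simp: i0_def)
  have eE: "e j \<in> E" if "j \<in> {1..s}" for j using Suc.prems that by auto
  define c where "c = card {j\<in>{1..s}. e j = i0}"
  let ?bx = "\<Pi>\<^sub>E j\<in>{1..s}. D (e j)"
  let ?bx' = "\<Pi>\<^sub>E j\<in>{1..Suc s}. D (e j)"
  have ins_pair: "{1..Suc s} = insert (Suc s) {1..s}" by auto
  have bx: "?bx \<in> sets (pow_measure N s)" using D eE by (intro sets_PiM_I_finite) auto
  have bx': "?bx' \<in> sets (pow_measure N (Suc s))"
    using D(1)[OF funcset_mem[OF Suc.prems]] by (intro sets_PiM_I_finite) simp_all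
  have mem: "x(Suc s := y) \<in> ?bx' \<longleftrightarrow> x \<in> ?bx \<and> y \<in> D i0"
    if "x \<in> space (factorial_measure N s)" for x y
  proof -
    have "x \<in> extensional {1..s}" using that by (auto simp: space_factorial_measure space_PiM PiE_def)
    then show ?thesis unfolding ins_pair
      by (auto simp: PiE_iff i0_def extensional_def)
  qed
  have "emeasure (factorial_measure N (Suc s)) ?bx' = factorial_step s ?bx'"
    by (rule emeasure_factorial_Suc[OF bx'])
  also have "\<dots> = (\<integral>\<^sup>+x. (emeasure N (D i0) - of_nat c) * indicator ?bx x \<partial>factorial_measure N s)"
    unfolding factorial_step_def
  proof (intro nn_integral_cong)
    fix x assume x: "x \<in> space (factorial_measure N s)"
    have *: "indicator ?bx' (x(Suc s := y)) = (indicator ?bx x * indicator (D i0) y :: ennreal)" for y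
      using mem[OF x] by (auto split: split_indicator)
    have "(\<Sum>j\<in>{1..s}. indicator (D i0) (x j)) = (of_nat c :: ennreal)" if "x \<in> ?bx"
    proof -
      have "indicator (D i0) (x j) = (if e j = i0 then 1 else 0 :: ennreal)" if "j \<in> {1..s}" for j
      proof -
        have "x j \<in> D (e j)" using \<open>x \<in> ?bx\<close> that by auto
        then show ?thesis using D(2) i0 eE[OF that] by (auto simp: disjoint_family_on_def split: split_indicator)
      qed
      then have "(\<Sum>j\<in>{1..s}. indicator (D i0) (x j)) = (\<Sum>j\<in>{1..s}. if e j = i0 then 1 else 0 :: ennreal)"
        by (intro sum.cong) auto
      also have "\<dots> = of_nat c" by (simp add: c_def sum.If_cases Int_def)
      finally show ?thesis .
    qed
    then show "(\<integral>\<^sup>+ y. indicator ?bx' (x(Suc s := y)) \<partial>N) - (\<Sum>j\<in>{1..s}. indicator ?bx' (x(Suc s := x j)))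
       = (emeasure N (D i0) - of_nat c) * indicator ?bx x"
      unfolding * using D i0 by (cases "x \<in> ?bx") (auto simp: nn_integral_cmult)
  qed
  also have "\<dots> = (emeasure N (D i0) - of_nat c) * emeasure (factorial_measure N s) ?bx"
    using bx by (simp add: nn_integral_cmult_indicator sets_factorial_measure)
  also have "emeasure (factorial_measure N s) ?bx
      = (\<Prod>i\<in>E. ffact (emeasure N (D i)) (card {j\<in>{1..s}. e j = i}))"
    using Suc.IH eE by auto
  also have "\<dots> = ffact (emeasure N (D i0)) c * (\<Prod>i\<in>E - {i0}. ffact (emeasure N (D i)) (card {j\<in>{1..s}. e j = i}))"
    unfolding c_def by (rule prod.remove[OF E i0])
  also have "(emeasure N (D i0) - of_nat c) * \<dots> =
     ffact (emeasure N (D i0)) (Suc c) * (\<Prod>i\<in>E - {i0}. ffact (emeasure N (D i)) (card {j\<in>{1..s}. e j = i}))"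
    by (simp add: ffact_def mult_ac)
  also have "Suc c = card {j\<in>{1..Suc s}. e j = i0}"
  proof -
    have "{j\<in>{1..Suc s}. e j = i0} = insert (Suc s) {j\<in>{1..s}. e j = i0}" unfolding ins_pair by (auto simp: i0_def)
    then show ?thesis by (simp add: c_def)
  qed
  also have "(\<Prod>i\<in>E - {i0}. ffact (emeasure N (D i)) (card {j\<in>{1..s}. e j = i}))
     = (\<Prod>i\<in>E - {i0}. ffact (emeasure N (D i)) (card {j\<in>{1..Suc s}. e j = i}))"
    unfolding ins_pair by (intro prod.cong refl arg_cong2[where f=ffact] arg_cong[where f=card]) (auto simp: i0_def)
  also have "ffact (emeasure N (D i0)) (card {j\<in>{1..Suc s}. e j = i0}) * \<dots> =
     (\<Prod>i\<in>E. ffact (emeasure N (D i)) (card {j\<in>{1..Suc s}. e j = i}))"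
    by (rule prod.remove[OF E i0, symmetric])
  finally show ?case .
qed

text \<open>The terms with n < k vanish. After the shift by \<open>k\<close> the falling factorial
  cancels against the factorial, leaving c^k times the Poisson weights, which sum to one.\<close>

lemma poisson_ffact_sums:
  "(\<lambda>n. real (\<Prod>r<k. n - r) * (c ^ n / fact n * exp (- c))) sums (c ^ k)"
proof -
  have "(\<lambda>n. c ^ n / fact n) sums exp c" using exp_converges[of c] by (simp add: field_simps)
  from sums_mult[OF this, of "c ^ k * exp (- c)"]
  have "(\<lambda>n. c ^ k * exp (- c) * (c ^ n / fact n)) sums (c ^ k)"
    by (simp add: exp_minus field_simps)
  moreover have "real (\<Prod>r<k. n + k - r) * (c ^ (n + k) / fact (n + k) * exp (- c)) =
      c ^ k * exp (- c) * (c ^ n / fact n)" for n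
  proof -
    have "real (fact (n + k)) = real (\<Prod>r<k. n + k - r) * real (fact n)"
      unfolding prod_fact_shift[symmetric] by simp
    then have *: "(fact (n + k) :: real) = real (\<Prod>r<k. n + k - r) * fact n" by simp
    have "real (\<Prod>r<k. n + k - r) \<noteq> 0" using * fact_nonzero[of "n + k"] by (metis mult_zero_left)
    then show ?thesis unfolding * by (simp add: power_add field_simps)
  qed
  ultimately have "(\<lambda>n. real (\<Prod>r<k. n + k - r) * (c ^ (n + k) / fact (n + k) * exp (- c))) sums (c ^ k)"
    by simp
  moreover have "(\<Sum>n<k. real (\<Prod>r<k. n - r) * (c ^ n / fact n * exp (- c))) = 0"
  proof (intro sum.neutral ballI)
    fix n assume n: "n \<in> {..<k}"
    have "(\<Prod>r<k. n - r) = 0" by (rule prod_zero) (use n in \<open>auto intro!: bexI[of _ n]\<close>)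
    then show "real (\<Prod>r<k. n - r) * (c ^ n / fact n * exp (- c)) = 0" by simp
  qed
  ultimately show ?thesis
    using sums_iff_shift[of "\<lambda>n. real (\<Prod>r<k. n - r) * (c ^ n / fact n * exp (- c))" k "c ^ k"] by simp
qed

text \<open>Finiteness of \<open>\<eta> \<omega>\<close> on the sets \<open>B n\<close> is demanded
  for every \<omega> of the space, not just almost surely, so that the counts are natural numbers
  and the point representations exist pathwise.\<close>

locale poisson_sf = prob_space M for M :: "'w measure" +
  fixes \<mu> :: "'x measure" and \<eta> :: "'w \<Rightarrow> 'x measure" and B :: "nat \<Rightarrow> 'x set"
  assumes sfm: "sigma_finite_measure \<mu>"
    and B_sets: "\<And>n. B n \<in> sets \<mu>" and B_inc: "incseq B" and B_UN: "(\<Union>n. B n) = space \<mu>"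
    and B_fin: "\<And>n. emeasure \<mu> (B n) < \<infinity>"
    and eta_sets: "\<And>\<omega>. \<omega> \<in> space M \<Longrightarrow> sets (\<eta> \<omega>) = sets \<mu>"
    and eta_counting: "\<And>\<omega>. \<omega> \<in> space M \<Longrightarrow> counting_measure (\<eta> \<omega>)"
    and eta_fin: "\<And>\<omega> n. \<omega> \<in> space M \<Longrightarrow> emeasure (\<eta> \<omega>) (B n) < \<infinity>"
    and eta_meas: "\<And>A. A \<in> sets \<mu> \<Longrightarrow> (\<lambda>\<omega>. emeasure (\<eta> \<omega>) A) \<in> borel_measurable M"
    and eta_poisson: "\<And>A. A \<in> sets \<mu> \<Longrightarrow> poisson_distributed M (\<lambda>\<omega>. emeasure (\<eta> \<omega>) A) (emeasure \<mu> A)"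
    and eta_indep: "\<And>(n::nat) D. (\<And>i. i \<in> {1..n} \<Longrightarrow> D i \<in> sets \<mu>) \<Longrightarrow> disjoint_family_on D {1..n} \<Longrightarrow>
        indep_vars (\<lambda>_. borel) (\<lambda>i \<omega>. emeasure (\<eta> \<omega>) (D i)) {1..n}"
begin

sublocale mu: sigma_finite_measure \<mu> by (rule sfm)
sublocale P: product_sigma_finite "\<lambda>_::nat. \<mu>" by standard

lemma eta_space: "\<omega> \<in> space M \<Longrightarrow> space (\<eta> \<omega>) = space \<mu>"
  using eta_sets by (rule sets_eq_imp_space_eq)

lemma sf_counting_eta: "\<omega> \<in> space M \<Longrightarrow> sf_counting (\<eta> \<omega>) B"
  using eta_counting eta_sets B_sets B_UN eta_fin eta_space by unfold_locales auto

lemma sets_fm: "\<omega> \<in> space M \<Longrightarrow> sets (factorial_measure (\<eta> \<omega>) s) = sets (pow_measure \<mu> s)"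
  unfolding sets_factorial_measure using eta_sets by (intro sets_PiM_cong) auto

lemma space_fm: "\<omega> \<in> space M \<Longrightarrow> space (factorial_measure (\<eta> \<omega>) s) = space (pow_measure \<mu> s)"
  using sets_fm by (rule sets_eq_imp_space_eq)

lemma B_mono: "n \<le> m \<Longrightarrow> B n \<subseteq> B m" using B_inc by (simp add: incseq_def)

section \<open>Boxes of finite mass and the intensity of factorial measures\<close>

definition Box :: "nat \<Rightarrow> nat \<Rightarrow> (nat \<Rightarrow> 'x) set" where
  "Box s n = (\<Pi>\<^sub>E j\<in>{1..s}. B n)"

lemma Box_sets[measurable]: "Box s n \<in> sets (pow_measure \<mu> s)"
  unfolding Box_def using B_sets by (intro sets_PiM_I_finite) auto

lemma Box_inc: "incseq (Box s)"
  unfolding Box_def incseq_def using B_mono by (auto intro!: PiE_mono)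

lemma Box_UN: "(\<Union>n. Box s n) = space (pow_measure \<mu> s)"
proof
  show "(\<Union>n. Box s n) \<subseteq> space (pow_measure \<mu> s)" using sets.sets_into_space[OF Box_sets] by blast
  show "space (pow_measure \<mu> s) \<subseteq> (\<Union>n. Box s n)"
  proof
    fix x assume x: "x \<in> space (pow_measure \<mu> s)"
    have "\<forall>j. \<exists>n. j \<in> {1..s} \<longrightarrow> x j \<in> B n" using x unfolding space_PiM B_UN[symmetric] by (auto simp: PiE_iff)
    from choice[OF this] obtain n where n: "\<forall>j. j \<in> {1..s} \<longrightarrow> x j \<in> B (n j)" by (elim exE)
    define m where "m = (\<Sum>j\<in>{1..s}. n j)"
    have "x j \<in> B m" if "j \<in> {1..s}" for j
    proof -
      have "n j \<le> m" unfolding m_def using that by (intro member_le_sum) auto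
      then show ?thesis using n that B_mono by blast
    qed
    then have "x \<in> Box s m" using x by (auto simp: Box_def space_PiM PiE_iff)
    then show "x \<in> (\<Union>n. Box s n)" by blast
  qed
qed

lemma Box_fin: "emeasure (pow_measure \<mu> s) (Box s n) < \<infinity>"
  unfolding Box_def using B_sets B_fin by (subst P.emeasure_PiM) (auto simp: ennreal_prod_eq_top less_top[symmetric] power_eq_top_ennreal less_imp_neq)

text \<open>A single cell receives all \<open>s\<close> coordinates.\<close>

lemma fm_Box: "\<omega> \<in> space M \<Longrightarrow> emeasure (factorial_measure (\<eta> \<omega>) s) (Box s n) = ffact (emeasure (\<eta> \<omega>) (B n)) s"
proof -
  assume \<omega>: "\<omega> \<in> space M"
  interpret sf_counting "\<eta> \<omega>" B by (rule sf_counting_eta[OF \<omega>])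
  have "{j. 1 \<le> j \<and> j \<le> s} = {1..s}" by auto
  then show ?thesis
    using emeasure_factorial_cells[of "{0::nat}" "\<lambda>_. B n" "\<lambda>_. 0" s] eta_sets[OF \<omega>] B_sets
    by (simp add: Box_def disjoint_family_on_def)
qed

lemma fm_Box_le: "\<omega> \<in> space M \<Longrightarrow> emeasure (factorial_measure (\<eta> \<omega>) s) (Box s n) \<le> emeasure (\<eta> \<omega>) (B n) ^ s"
  unfolding fm_Box ffact_def
  by (induction s) (auto intro!: mult_mono simp: diff_le_self_ennreal mult.commute)

lemma fm_Box_fin: "\<omega> \<in> space M \<Longrightarrow> emeasure (factorial_measure (\<eta> \<omega>) s) (Box s n) < \<infinity>"
  using fm_Box_le[of \<omega> s n] eta_fin[of \<omega> n] by (auto simp: power_less_top_ennreal intro: le_less_trans)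

text \<open>The factorial moments of a Poisson law, found by splitting the probability space
  according to the value of the count.\<close>

lemma nn_integral_ffact_eta:
  assumes D: "D \<in> sets \<mu>" "emeasure \<mu> D < \<infinity>" and fin: "\<And>\<omega>. \<omega> \<in> space M \<Longrightarrow> emeasure (\<eta> \<omega>) D < \<infinity>"
  shows "(\<integral>\<^sup>+\<omega>. ffact (emeasure (\<eta> \<omega>) D) k \<partial>M) = emeasure \<mu> D ^ k"
proof -
  define Z where "Z \<omega> = emeasure (\<eta> \<omega>) D" for \<omega>
  define c where "c = enn2real (emeasure \<mu> D)"
  have c: "emeasure \<mu> D = ennreal c" "0 \<le> c" using D(2) by (auto simp: c_def less_top)
  have Zm[measurable]: "Z \<in> borel_measurable M" unfolding Z_def using eta_meas D by simp
  have Zn: "\<exists>n::nat. Z \<omega> = of_nat n" if "\<omega> \<in> space M" for \<omega>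
    using eta_counting[OF that] fin[OF that] D eta_sets[OF that] unfolding counting_measure_def Z_def
    by (metis less_irrefl)
  have p: "measure M {\<omega>\<in>space M. Z \<omega> = of_nat n} = c ^ n / fact n * exp (- c)" for n
    using eta_poisson[OF D(1)] D(2) unfolding poisson_distributed_def Z_def c_def by auto
  have "(\<integral>\<^sup>+\<omega>. ffact (Z \<omega>) k \<partial>M) = (\<integral>\<^sup>+\<omega>. (\<Sum>n. ffact (of_nat n) k * indicator {\<omega>\<in>space M. Z \<omega> = of_nat n} \<omega>) \<partial>M)"
  proof (rule nn_integral_cong)
    fix \<omega> assume \<omega>: "\<omega> \<in> space M"
    then obtain n0 :: nat where n0: "Z \<omega> = of_nat n0" using Zn by blast
    have "(\<Sum>n. ffact (of_nat n) k * indicator {\<omega>\<in>space M. Z \<omega> = of_nat n} \<omega>)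
       = (\<Sum>n\<in>{n0}. ffact (of_nat n) k * indicator {\<omega>\<in>space M. Z \<omega> = of_nat n} \<omega>)"
      by (rule suminf_finite) (auto simp: n0)
    then show "ffact (Z \<omega>) k = (\<Sum>n. ffact (of_nat n) k * indicator {\<omega>\<in>space M. Z \<omega> = of_nat n} \<omega>)"
      using \<omega> n0 by simp
  qed
  also have "\<dots> = (\<Sum>n. \<integral>\<^sup>+\<omega>. ffact (of_nat n) k * indicator {\<omega>\<in>space M. Z \<omega> = of_nat n} \<omega> \<partial>M)"
    by (rule nn_integral_suminf) measurable
  also have "\<dots> = (\<Sum>n. ennreal (real (\<Prod>r<k. n - r) * (c ^ n / fact n * exp (- c))))"
  proof (rule suminf_cong)
    fix n
    have "{\<omega>\<in>space M. Z \<omega> = of_nat n} \<in> sets M" by measurable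
    then show "(\<integral>\<^sup>+\<omega>. ffact (of_nat n) k * indicator {\<omega>\<in>space M. Z \<omega> = of_nat n} \<omega> \<partial>M) =
       ennreal (real (\<Prod>r<k. n - r) * (c ^ n / fact n * exp (- c)))"
      by (subst nn_integral_cmult_indicator) (auto simp: emeasure_eq_measure p ffact_of_nat ennreal_mult''[symmetric] c(2) simp del: of_nat_prod)
  qed
  also have "\<dots> = ennreal (c ^ k)"
    using c(2) by (intro suminf_ennreal_eq poisson_ffact_sums) (auto intro!: divide_nonneg_nonneg mult_nonneg_nonneg prod_nonneg)
  finally show ?thesis using c by (simp add: Z_def ennreal_power)
qed

text \<open>The sets \<open>A j\<close> may overlap, while independence is available only for
  disjoint sets. So points are sorted into cells according to which \<open>A j\<close> contain them,
  and the box becomes a disjoint union of boxes of cells. For these the counts are independent and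
  their factorial moments are powers of cell masses; the distributive law reassembles the
  product.\<close>

lemma first_moment_box:
  assumes A: "\<And>j. j \<in> {1..s} \<Longrightarrow> A j \<in> sets \<mu>" "\<And>j. j \<in> {1..s} \<Longrightarrow> A j \<subseteq> B n"
  shows "(\<lambda>\<omega>. emeasure (factorial_measure (\<eta> \<omega>) s) (\<Pi>\<^sub>E j\<in>{1..s}. A j)) \<in> borel_measurable M" (is ?th1)
    and "(\<integral>\<^sup>+\<omega>. emeasure (factorial_measure (\<eta> \<omega>) s) (\<Pi>\<^sub>E j\<in>{1..s}. A j) \<partial>M) = (\<Prod>j\<in>{1..s}. emeasure \<mu> (A j))" (is ?th2)
proof -
  \<comment> \<open>The empty set is left out: its cell is the complement of all \<open>A j\<close>,
    which need not lie in \<open>B n\<close>.\<close>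
  define T where "T = Pow {1..s} - {{}}"
  have "finite T" by (simp add: T_def)
  then obtain g where g: "bij_betw g {1..card T} T" using ex_bij_betw_nat_finite_1 by blast
  define E where "E = {1..card T}"
  have fE: "finite E" by (simp add: E_def)
  define D where "D i = {y\<in>space \<mu>. \<forall>j\<in>{1..s}. y \<in> A j \<longleftrightarrow> j \<in> g i}" for i
  have gT: "g i \<in> T" if "i \<in> E" for i using g that by (auto simp: bij_betw_def E_def)
  have D_sets[measurable]: "D i \<in> sets \<mu>" for i
  proof -
    have "{y\<in>space \<mu>. y \<in> A j \<longleftrightarrow> j \<in> g i} \<in> sets \<mu>" if "j \<in> {1..s}" for j
    proof -
      have [measurable]: "A j \<in> sets \<mu>" using A that by auto
      show ?thesis by measurable
    qed
    then show ?thesis unfolding D_def by (intro sets.sets_Collect_finite_All) auto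
  qed
  have D_disj: "disjoint_family_on D E"
    unfolding disjoint_family_on_def
  proof (intro ballI impI)
    fix i i' assume h: "i \<in> E" "i' \<in> E" "i \<noteq> i'"
    have "inj_on g E" using g by (simp add: bij_betw_def E_def)
    then have "g i \<noteq> g i'" using h inj_onD[of g E i i'] by blast
    moreover have "g i \<subseteq> {1..s}" "g i' \<subseteq> {1..s}" using gT h by (auto simp: T_def)
    ultimately obtain j where "j \<in> {1..s}" "(j \<in> g i) \<noteq> (j \<in> g i')"
      by (meson subsetD subsetI subset_antisym)
    then show "D i \<inter> D i' = {}" by (auto simp: D_def)
  qed
  have D_sub: "D i \<subseteq> B n" if i: "i \<in> E" for i
  proof -
    have "g i \<noteq> {}" and gs: "g i \<subseteq> {1..s}" using gT[OF i] by (auto simp: T_def)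
    then obtain j where "j \<in> g i" by blast
    with gs have "j \<in> {1..s}" by blast
    then have "D i \<subseteq> A j" using \<open>j \<in> g i\<close> by (auto simp: D_def)
    then show ?thesis using A(2)[OF \<open>j \<in> {1..s}\<close>] by blast
  qed
  define V where "V j = {i\<in>E. j \<in> g i}" for j
  have V: "finite (V j)" "V j \<subseteq> E" for j by (auto simp: V_def fE)
  have A_un: "A j = (\<Union>i\<in>V j. D i)" if j: "j \<in> {1..s}" for j
  proof (intro equalityI subsetI)
    fix y assume y: "y \<in> A j"
    then have ys: "y \<in> space \<mu>" using A(1)[OF j] sets.sets_into_space by blast
    have "{j'\<in>{1..s}. y \<in> A j'} \<in> T" using y j by (auto simp: T_def)
    then obtain i where i: "i \<in> E" "g i = {j'\<in>{1..s}. y \<in> A j'}" using g by (metis (lifting) E_def bij_betw_iff_bijections)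
    then have "y \<in> D i" "i \<in> V j" using ys y j by (auto simp: D_def V_def)
    then show "y \<in> (\<Union>i\<in>V j. D i)" by blast
  next
    fix y assume "y \<in> (\<Union>i\<in>V j. D i)"
    then show "y \<in> A j" using j by (auto simp: D_def V_def)
  qed
  define W where "W = Pi\<^sub>E {1..s} V"
  have fW: "finite W" unfolding W_def using V by (intro finite_PiE) auto
  have WE: "e \<in> {1..s} \<rightarrow> E" if "e \<in> W" for e using that V(2) unfolding W_def PiE_def Pi_def by blast
  have box_un: "(\<Pi>\<^sub>E j\<in>{1..s}. A j) = (\<Union>e\<in>W. \<Pi>\<^sub>E j\<in>{1..s}. D (e j))"
  proof (intro equalityI subsetI)
    fix x assume x: "x \<in> (\<Pi>\<^sub>E j\<in>{1..s}. A j)"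
    have "\<forall>j. \<exists>i. j \<in> {1..s} \<longrightarrow> i \<in> V j \<and> x j \<in> D i" using x A_un unfolding PiE_def Pi_def by blast
    from choice[OF this] obtain e where e: "\<forall>j. j \<in> {1..s} \<longrightarrow> e j \<in> V j \<and> x j \<in> D (e j)" by (elim exE)
    then have "restrict e {1..s} \<in> W" by (auto simp: W_def)
    moreover have "x \<in> (\<Pi>\<^sub>E j\<in>{1..s}. D (restrict e {1..s} j))" using x e by (auto simp: PiE_iff)
    ultimately show "x \<in> (\<Union>e\<in>W. \<Pi>\<^sub>E j\<in>{1..s}. D (e j))" by blast
  next
    fix x assume "x \<in> (\<Union>e\<in>W. \<Pi>\<^sub>E j\<in>{1..s}. D (e j))"
    then obtain e where e: "e \<in> W" "x \<in> (\<Pi>\<^sub>E j\<in>{1..s}. D (e j))" by blast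
    then have "x j \<in> A j" if "j \<in> {1..s}" for j using A_un[OF that] that unfolding W_def PiE_def Pi_def by blast
    then show "x \<in> (\<Pi>\<^sub>E j\<in>{1..s}. A j)" using e by (auto simp: PiE_iff)
  qed
  have box_disj: "disjoint_family_on (\<lambda>e. \<Pi>\<^sub>E j\<in>{1..s}. D (e j)) W"
    unfolding disjoint_family_on_def
  proof (intro ballI impI equals0I)
    fix e e' x assume h: "e \<in> W" "e' \<in> W" "e \<noteq> e'" "x \<in> (\<Pi>\<^sub>E j\<in>{1..s}. D (e j)) \<inter> (\<Pi>\<^sub>E j\<in>{1..s}. D (e' j))"
    have "e j = e' j" if "j \<in> {1..s}" for j
    proof (rule ccontr)
      assume "e j \<noteq> e' j"
      then have "D (e j) \<inter> D (e' j) = {}" using D_disj WE[OF h(1)] WE[OF h(2)] that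
        unfolding disjoint_family_on_def Pi_def by blast
      moreover have "x j \<in> D (e j)" "x j \<in> D (e' j)" using h(4) that by auto
      ultimately show False by blast
    qed
    then have "e = e'" using h(1,2) unfolding W_def by (intro PiE_ext) auto
    then show False using h(3) by simp
  qed
  define K where "K e i = card {j\<in>{1..s}. e j = i}" for e :: "nat \<Rightarrow> nat" and i
  have em: "emeasure (factorial_measure (\<eta> \<omega>) s) (\<Pi>\<^sub>E j\<in>{1..s}. A j) =
      (\<Sum>e\<in>W. \<Prod>i\<in>E. ffact (emeasure (\<eta> \<omega>) (D i)) (K e i))" if \<omega>: "\<omega> \<in> space M" for \<omega>
  proof -
    interpret sf_counting "\<eta> \<omega>" B by (rule sf_counting_eta[OF \<omega>])
    have "emeasure (factorial_measure (\<eta> \<omega>) s) (\<Pi>\<^sub>E j\<in>{1..s}. A j) =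
      (\<Sum>e\<in>W. emeasure (factorial_measure (\<eta> \<omega>) s) (\<Pi>\<^sub>E j\<in>{1..s}. D (e j)))"
      unfolding box_un using fW box_disj D_sets
      by (intro sum_emeasure[symmetric]) (auto simp: sets_fm[OF \<omega>] intro!: sets_PiM_I_finite)
    also have "\<dots> = (\<Sum>e\<in>W. \<Prod>i\<in>E. ffact (emeasure (\<eta> \<omega>) (D i)) (K e i))"
      unfolding K_def using D_disj fE WE
      by (intro sum.cong refl emeasure_factorial_cells) (auto simp: eta_sets[OF \<omega>])
    finally show ?thesis .
  qed
  have meas: "(\<lambda>\<omega>. ffact (emeasure (\<eta> \<omega>) (D i)) k) \<in> borel_measurable M" for i k
    using eta_meas[OF D_sets, of i] by measurable
  have "(\<lambda>\<omega>. \<Sum>e\<in>W. \<Prod>i\<in>E. ffact (emeasure (\<eta> \<omega>) (D i)) (K e i)) \<in> borel_measurable M"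
    using meas by measurable
  then show ?th1 by (subst measurable_cong[OF em])
  have fin: "emeasure \<mu> (D i) < \<infinity>" "\<And>\<omega>. \<omega> \<in> space M \<Longrightarrow> emeasure (\<eta> \<omega>) (D i) < \<infinity>" if "i \<in> E" for i
    using D_sub[OF that] B_fin[of n] eta_fin[of _ n] B_sets[of n] eta_sets
    by (auto intro: le_less_trans[OF emeasure_mono])
  have "(\<integral>\<^sup>+\<omega>. emeasure (factorial_measure (\<eta> \<omega>) s) (\<Pi>\<^sub>E j\<in>{1..s}. A j) \<partial>M)
      = (\<integral>\<^sup>+\<omega>. (\<Sum>e\<in>W. \<Prod>i\<in>E. ffact (emeasure (\<eta> \<omega>) (D i)) (K e i)) \<partial>M)"
    by (intro nn_integral_cong em)
  also have "\<dots> = (\<Sum>e\<in>W. \<integral>\<^sup>+\<omega>. (\<Prod>i\<in>E. ffact (emeasure (\<eta> \<omega>) (D i)) (K e i)) \<partial>M)"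
    using meas by (intro nn_integral_sum borel_measurable_prod_ennreal)
  also have "\<dots> = (\<Sum>e\<in>W. \<Prod>i\<in>E. \<integral>\<^sup>+\<omega>. ffact (emeasure (\<eta> \<omega>) (D i)) (K e i) \<partial>M)"
  proof (intro sum.cong refl indep_vars_nn_integral fE)
    fix e
    have "indep_vars (\<lambda>_. borel) (\<lambda>i \<omega>. emeasure (\<eta> \<omega>) (D i)) E"
      unfolding E_def using D_disj by (intro eta_indep) (auto simp: E_def)
    then show "indep_vars (\<lambda>_. borel) (\<lambda>i \<omega>. ffact (emeasure (\<eta> \<omega>) (D i)) (K e i)) E"
      by (rule indep_vars_compose2) measurable
  qed auto
  also have "\<dots> = (\<Sum>e\<in>W. \<Prod>i\<in>E. emeasure \<mu> (D i) ^ K e i)"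
    using fin by (intro sum.cong prod.cong refl nn_integral_ffact_eta) auto
  also have "\<dots> = (\<Sum>e\<in>W. \<Prod>j\<in>{1..s}. emeasure \<mu> (D (e j)))"
  proof (intro sum.cong refl)
    fix e assume "e \<in> W"
    then have "e ` {1..s} \<subseteq> E" using WE by blast
    from prod.group[OF _ fE this, of "\<lambda>j. emeasure \<mu> (D (e j))"]
    have "(\<Prod>j\<in>{1..s}. emeasure \<mu> (D (e j))) = (\<Prod>i\<in>E. \<Prod>j\<in>{j\<in>{1..s}. e j = i}. emeasure \<mu> (D (e j)))" by simp
    also have "\<dots> = (\<Prod>i\<in>E. emeasure \<mu> (D i) ^ K e i)" unfolding K_def by (intro prod.cong refl) simp
    finally show "(\<Prod>i\<in>E. emeasure \<mu> (D i) ^ K e i) = (\<Prod>j\<in>{1..s}. emeasure \<mu> (D (e j)))" ..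
  qed
  also have "\<dots> = (\<Prod>j\<in>{1..s}. \<Sum>i\<in>V j. emeasure \<mu> (D i))"
    unfolding W_def using V by (intro prod_sum_PiE[symmetric]) auto
  also have "\<dots> = (\<Prod>j\<in>{1..s}. emeasure \<mu> (A j))"
  proof (intro prod.cong refl)
    fix j assume "j \<in> {1..s}"
    show "(\<Sum>i\<in>V j. emeasure \<mu> (D i)) = emeasure \<mu> (A j)"
      unfolding A_un[OF \<open>j \<in> {1..s}\<close>] using V D_disj
      by (intro sum_emeasure) (auto intro: disjoint_family_on_mono)
  qed
  finally show ?th2 .
qed

text \<open>A Dynkin class argument starting from boxes. Intersecting with \<open>Box s n\<close>
  keeps all masses finite, so that the step to complements can subtract.\<close>

lemma first_moment_set_Box:
  assumes C: "C \<in> sets (pow_measure \<mu> s)"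
  shows "(\<lambda>\<omega>. emeasure (factorial_measure (\<eta> \<omega>) s) (C \<inter> Box s n)) \<in> borel_measurable M \<and>
     (\<integral>\<^sup>+\<omega>. emeasure (factorial_measure (\<eta> \<omega>) s) (C \<inter> Box s n) \<partial>M) = emeasure (pow_measure \<mu> s) (C \<inter> Box s n)"
    (is "?P C")
proof -
  let ?\<Omega> = "\<Pi>\<^sub>E j\<in>{1..s}. space \<mu>"
  let ?G = "{\<Pi>\<^sub>E j\<in>{1..s}. X j |X. X \<in> {1..s} \<rightarrow> sets \<mu>}"
  have G: "?G = prod_algebra {1..s} (\<lambda>_. \<mu>)" by (subst prod_algebra_eq_finite) auto
  have sets_eq: "sets (pow_measure \<mu> s) = sigma_sets ?\<Omega> ?G" unfolding sets_PiM G ..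
  have stable: "Int_stable ?G" unfolding G by (rule Int_stable_prod_algebra)
  have sub: "?G \<subseteq> Pow ?\<Omega>" unfolding G by (rule prod_algebra_sets_into_space)
  from stable sub C[unfolded sets_eq] show ?thesis
  proof (induction rule: sigma_sets_induct_disjoint)
    case (basic A)
    then obtain X where X: "A = (\<Pi>\<^sub>E j\<in>{1..s}. X j)" "X \<in> {1..s} \<rightarrow> sets \<mu>" by blast
    have e: "A \<inter> Box s n = (\<Pi>\<^sub>E j\<in>{1..s}. X j \<inter> B n)" unfolding X Box_def by (rule PiE_Int)
    have Xs: "X j \<inter> B n \<in> sets \<mu>" "X j \<inter> B n \<subseteq> B n" if "j \<in> {1..s}" for j
      using funcset_mem[OF X(2) that] B_sets by auto
    have "emeasure (pow_measure \<mu> s) (\<Pi>\<^sub>E j\<in>{1..s}. X j \<inter> B n) = (\<Prod>j\<in>{1..s}. emeasure \<mu> (X j \<inter> B n))"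
      using Xs(1) by (intro P.emeasure_PiM) auto
    then show ?case unfolding e using first_moment_box[of s "\<lambda>j. X j \<inter> B n" n, OF Xs] by simp
  next
    case empty
    show ?case by simp
  next
    case (compl A)
    have A: "A \<in> sets (pow_measure \<mu> s)" using compl(1) by (simp add: sets_eq)
    have AB: "A \<inter> Box s n \<in> sets (pow_measure \<mu> s)" using A by auto
    have B: "Box s n \<in> sets (pow_measure \<mu> s)" by simp
    have e: "(?\<Omega> - A) \<inter> Box s n = Box s n - A \<inter> Box s n"
      using sets.sets_into_space[OF B] by (auto simp: space_PiM)
    have fin: "emeasure (factorial_measure (\<eta> \<omega>) s) (A \<inter> Box s n) \<noteq> \<infinity>" if "\<omega> \<in> space M" for \<omega>
    proof -
      have "emeasure (factorial_measure (\<eta> \<omega>) s) (A \<inter> Box s n) \<le> emeasure (factorial_measure (\<eta> \<omega>) s) (Box s n)"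
        using B by (intro emeasure_mono) (auto simp: sets_fm[OF that])
      then show ?thesis using fm_Box_fin[OF that, of s n] by (auto dest: le_less_trans)
    qed
    have d: "emeasure (factorial_measure (\<eta> \<omega>) s) ((?\<Omega> - A) \<inter> Box s n) =
        emeasure (factorial_measure (\<eta> \<omega>) s) (Box s n) - emeasure (factorial_measure (\<eta> \<omega>) s) (A \<inter> Box s n)"
      if "\<omega> \<in> space M" for \<omega>
      unfolding e using AB B fin[OF that] by (intro emeasure_Diff) (auto simp: sets_fm[OF that])
    have BB: "(\<lambda>\<omega>. emeasure (factorial_measure (\<eta> \<omega>) s) (Box s n)) \<in> borel_measurable M"
      "(\<integral>\<^sup>+\<omega>. emeasure (factorial_measure (\<eta> \<omega>) s) (Box s n) \<partial>M) = emeasure (pow_measure \<mu> s) (Box s n)"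
      unfolding Box_def using first_moment_box[of s "\<lambda>_. B n" n] B_sets by (simp_all add: P.emeasure_PiM)
    have le: "emeasure (pow_measure \<mu> s) (A \<inter> Box s n) \<noteq> \<infinity>"
      using emeasure_mono[of "A \<inter> Box s n" "Box s n" "pow_measure \<mu> s"] Box_fin[of s n] B by (auto dest: le_less_trans)
    show ?case
    proof
      show "(\<lambda>\<omega>. emeasure (factorial_measure (\<eta> \<omega>) s) ((?\<Omega> - A) \<inter> Box s n)) \<in> borel_measurable M"
        using BB(1) compl(2) by (subst measurable_cong[OF d]) auto
      have "(\<integral>\<^sup>+\<omega>. emeasure (factorial_measure (\<eta> \<omega>) s) ((?\<Omega> - A) \<inter> Box s n) \<partial>M) =
         (\<integral>\<^sup>+\<omega>. emeasure (factorial_measure (\<eta> \<omega>) s) (Box s n) - emeasure (factorial_measure (\<eta> \<omega>) s) (A \<inter> Box s n) \<partial>M)"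
        by (intro nn_integral_cong d)
      also have "\<dots> = (\<integral>\<^sup>+\<omega>. emeasure (factorial_measure (\<eta> \<omega>) s) (Box s n) \<partial>M) -
          (\<integral>\<^sup>+\<omega>. emeasure (factorial_measure (\<eta> \<omega>) s) (A \<inter> Box s n) \<partial>M)"
      proof (rule nn_integral_diff)
        show "AE \<omega> in M. emeasure (factorial_measure (\<eta> \<omega>) s) (A \<inter> Box s n) \<le> emeasure (factorial_measure (\<eta> \<omega>) s) (Box s n)"
          using B by (intro AE_I2 emeasure_mono) (auto simp: sets_fm)
      qed (use BB compl le in auto)
      also have "\<dots> = emeasure (pow_measure \<mu> s) (Box s n) - emeasure (pow_measure \<mu> s) (A \<inter> Box s n)"
        using BB compl by simp
      also have "\<dots> = emeasure (pow_measure \<mu> s) ((?\<Omega> - A) \<inter> Box s n)"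
        unfolding e using AB B le by (intro emeasure_Diff[symmetric]) auto
      finally show "(\<integral>\<^sup>+\<omega>. emeasure (factorial_measure (\<eta> \<omega>) s) ((?\<Omega> - A) \<inter> Box s n) \<partial>M) =
         emeasure (pow_measure \<mu> s) ((?\<Omega> - A) \<inter> Box s n)" .
    qed
  next
    case (union A)
    have A: "A i \<in> sets (pow_measure \<mu> s)" for i using union(2) by (auto simp: sets_eq)
    have AB: "A i \<inter> Box s n \<in> sets (pow_measure \<mu> s)" for i using A by auto
    have dj: "disjoint_family (\<lambda>i. A i \<inter> Box s n)" using union(1) by (auto simp: disjoint_family_on_def)
    have e: "\<Union> (range A) \<inter> Box s n = (\<Union>i. A i \<inter> Box s n)" by auto
    have d: "emeasure (factorial_measure (\<eta> \<omega>) s) (\<Union> (range A) \<inter> Box s n) =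
       (\<Sum>i. emeasure (factorial_measure (\<eta> \<omega>) s) (A i \<inter> Box s n))" if "\<omega> \<in> space M" for \<omega>
      unfolding e using AB dj by (intro suminf_emeasure[symmetric]) (auto simp: sets_fm[OF that])
    have m: "\<And>i. (\<lambda>\<omega>. emeasure (factorial_measure (\<eta> \<omega>) s) (A i \<inter> Box s n)) \<in> borel_measurable M"
      using union(3) by blast
    show ?case
    proof
      show "(\<lambda>\<omega>. emeasure (factorial_measure (\<eta> \<omega>) s) (\<Union> (range A) \<inter> Box s n)) \<in> borel_measurable M"
        using m by (subst measurable_cong[OF d]) auto
      have "(\<integral>\<^sup>+\<omega>. emeasure (factorial_measure (\<eta> \<omega>) s) (\<Union> (range A) \<inter> Box s n) \<partial>M) =
        (\<integral>\<^sup>+\<omega>. (\<Sum>i. emeasure (factorial_measure (\<eta> \<omega>) s) (A i \<inter> Box s n)) \<partial>M)"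
        by (intro nn_integral_cong d)
      also have "\<dots> = (\<Sum>i. emeasure (pow_measure \<mu> s) (A i \<inter> Box s n))"
        using m union(3) by (subst nn_integral_suminf) auto
      also have "\<dots> = emeasure (pow_measure \<mu> s) (\<Union> (range A) \<inter> Box s n)"
        unfolding e using AB dj by (intro suminf_emeasure) auto
      finally show "(\<integral>\<^sup>+\<omega>. emeasure (factorial_measure (\<eta> \<omega>) s) (\<Union> (range A) \<inter> Box s n) \<partial>M) =
        emeasure (pow_measure \<mu> s) (\<Union> (range A) \<inter> Box s n)" .
    qed
  qed
qed

text \<open>Monotone convergence along the boxes.\<close>

lemma first_moment_set:
  assumes C: "C \<in> sets (pow_measure \<mu> s)"
  shows "(\<lambda>\<omega>. emeasure (factorial_measure (\<eta> \<omega>) s) C) \<in> borel_measurable M"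
     "(\<integral>\<^sup>+\<omega>. emeasure (factorial_measure (\<eta> \<omega>) s) C \<partial>M) = emeasure (pow_measure \<mu> s) C"
proof -
  have inc: "incseq (\<lambda>n. C \<inter> Box s n)" using Box_inc by (auto simp: incseq_def)
  have un: "(\<Union>n. C \<inter> Box s n) = C"
    using Box_UN[of s] sets.sets_into_space[OF C] by auto
  have CB: "C \<inter> Box s n \<in> sets (pow_measure \<mu> s)" for n using C by auto
  have d: "emeasure (factorial_measure (\<eta> \<omega>) s) C = (SUP n. emeasure (factorial_measure (\<eta> \<omega>) s) (C \<inter> Box s n))"
    if "\<omega> \<in> space M" for \<omega>
    using inc CB by (subst SUP_emeasure_incseq) (auto simp only: sets_fm[OF that] un image_subset_iff)
  show "(\<lambda>\<omega>. emeasure (factorial_measure (\<eta> \<omega>) s) C) \<in> borel_measurable M"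
    using first_moment_set_Box[OF C] by (subst measurable_cong[OF d]) (auto intro!: borel_measurable_SUP)
  have "(\<integral>\<^sup>+\<omega>. emeasure (factorial_measure (\<eta> \<omega>) s) C \<partial>M) =
    (\<integral>\<^sup>+\<omega>. (SUP n. emeasure (factorial_measure (\<eta> \<omega>) s) (C \<inter> Box s n)) \<partial>M)"
    by (intro nn_integral_cong d)
  also have "\<dots> = (SUP n. \<integral>\<^sup>+\<omega>. emeasure (factorial_measure (\<eta> \<omega>) s) (C \<inter> Box s n) \<partial>M)"
  proof (rule nn_integral_monotone_convergence_SUP_AE)
    show "AE \<omega> in M. emeasure (factorial_measure (\<eta> \<omega>) s) (C \<inter> Box s n) \<le>
        emeasure (factorial_measure (\<eta> \<omega>) s) (C \<inter> Box s (Suc n))" for n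
      using CB inc by (intro AE_I2 emeasure_mono) (auto simp: sets_fm incseq_Suc_iff)
  qed (use first_moment_set_Box[OF C] in auto)
  also have "\<dots> = (SUP n. emeasure (pow_measure \<mu> s) (C \<inter> Box s n))"
    using first_moment_set_Box[OF C] by simp
  also have "\<dots> = emeasure (pow_measure \<mu> s) C"
    using inc CB by (subst SUP_emeasure_incseq) (auto simp only: un image_subset_iff)
  finally show "(\<integral>\<^sup>+\<omega>. emeasure (factorial_measure (\<eta> \<omega>) s) C \<partial>M) = emeasure (pow_measure \<mu> s) C" .
qed

text \<open>Campbell's formula for factorial measures: their intensity is the product measure. The
  extension from sets to functions is the usual one.\<close>

lemma first_moment_nn:
  assumes h: "h \<in> borel_measurable (pow_measure \<mu> s)"
  shows "(\<lambda>\<omega>. \<integral>\<^sup>+y. h y \<partial>factorial_measure (\<eta> \<omega>) s) \<in> borel_measurable M \<and>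
     (\<integral>\<^sup>+\<omega>. (\<integral>\<^sup>+y. h y \<partial>factorial_measure (\<eta> \<omega>) s) \<partial>M) = (\<integral>\<^sup>+y. h y \<partial>pow_measure \<mu> s)"
  using h
proof (induction rule: borel_measurable_induct)
  case (cong f g)
  have "(\<integral>\<^sup>+y. f y \<partial>factorial_measure (\<eta> \<omega>) s) = (\<integral>\<^sup>+y. g y \<partial>factorial_measure (\<eta> \<omega>) s)" if "\<omega> \<in> space M" for \<omega>
    using cong(3) by (intro nn_integral_cong) (simp add: space_fm[OF that])
  moreover have "(\<integral>\<^sup>+y. f y \<partial>pow_measure \<mu> s) = (\<integral>\<^sup>+y. g y \<partial>pow_measure \<mu> s)"
    using cong(3) by (intro nn_integral_cong) simp
  ultimately show ?case using cong(4) by (simp cong: measurable_cong nn_integral_cong)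
next
  case (set A)
  have "(\<integral>\<^sup>+y. indicator A y \<partial>factorial_measure (\<eta> \<omega>) s) = emeasure (factorial_measure (\<eta> \<omega>) s) A"
    if "\<omega> \<in> space M" for \<omega> using set by (intro nn_integral_indicator) (simp add: sets_fm[OF that])
  then show ?case using first_moment_set[OF set] set by (simp cong: measurable_cong nn_integral_cong)
next
  case (mult u c)
  have "(\<integral>\<^sup>+y. c * u y \<partial>factorial_measure (\<eta> \<omega>) s) = c * (\<integral>\<^sup>+y. u y \<partial>factorial_measure (\<eta> \<omega>) s)"
    if "\<omega> \<in> space M" for \<omega>
    using mult(2) by (intro nn_integral_cmult) (simp add: measurable_cong_sets[OF sets_fm[OF that] refl])
  moreover have "(\<lambda>\<omega>. c * (\<integral>\<^sup>+y. u y \<partial>factorial_measure (\<eta> \<omega>) s)) \<in> borel_measurable M"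
    using conjunct1[OF mult(4)] by (intro borel_measurable_times_ennreal borel_measurable_const)
  ultimately show ?case using mult by (simp add: nn_integral_cmult cong: measurable_cong nn_integral_cong)
next
  case (add u v)
  have "(\<integral>\<^sup>+y. v y + u y \<partial>factorial_measure (\<eta> \<omega>) s) =
     (\<integral>\<^sup>+y. v y \<partial>factorial_measure (\<eta> \<omega>) s) + (\<integral>\<^sup>+y. u y \<partial>factorial_measure (\<eta> \<omega>) s)"
    if "\<omega> \<in> space M" for \<omega>
    using add(1,3) by (intro nn_integral_add) (simp_all add: measurable_cong_sets[OF sets_fm[OF that] refl])
  moreover have "(\<lambda>\<omega>. (\<integral>\<^sup>+y. v y \<partial>factorial_measure (\<eta> \<omega>) s) + (\<integral>\<^sup>+y. u y \<partial>factorial_measure (\<eta> \<omega>) s)) \<in> borel_measurable M"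
  proof (rule borel_measurable_add)
    show "(\<lambda>\<omega>. \<integral>\<^sup>+y. v y \<partial>factorial_measure (\<eta> \<omega>) s) \<in> borel_measurable M" using add by simp
    show "(\<lambda>\<omega>. \<integral>\<^sup>+y. u y \<partial>factorial_measure (\<eta> \<omega>) s) \<in> borel_measurable M" using add by simp
  qed
  ultimately show ?case using add by (simp add: nn_integral_add cong: measurable_cong nn_integral_cong)
next
  case (seq U)
  have *: "(\<integral>\<^sup>+y. (SUP i. U i y) \<partial>K) = (SUP i. \<integral>\<^sup>+y. U i y \<partial>K)" if "sets K = sets (pow_measure \<mu> s)" for K
    using seq(1,3) that nn_integral_monotone_convergence_SUP[of U K]
    by (simp add: image_comp measurable_cong_sets[OF that refl])
  have mono: "(\<integral>\<^sup>+y. U i y \<partial>K) \<le> (\<integral>\<^sup>+y. U (Suc i) y \<partial>K)" for i and K :: "(nat \<Rightarrow> 'x) measure"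
    using seq(3) by (intro nn_integral_mono) (auto simp: incseq_Suc_iff le_fun_def)
  have "(\<integral>\<^sup>+\<omega>. (SUP i. \<integral>\<^sup>+y. U i y \<partial>factorial_measure (\<eta> \<omega>) s) \<partial>M) =
      (SUP i. \<integral>\<^sup>+\<omega>. (\<integral>\<^sup>+y. U i y \<partial>factorial_measure (\<eta> \<omega>) s) \<partial>M)"
    using seq mono by (intro nn_integral_monotone_convergence_SUP_AE) auto
  moreover have "(\<lambda>\<omega>. SUP i. \<integral>\<^sup>+y. U i y \<partial>factorial_measure (\<eta> \<omega>) s) \<in> borel_measurable M"
    using seq by (intro borel_measurable_SUP) auto
  moreover have "(\<integral>\<^sup>+\<omega>. (\<integral>\<^sup>+y. U i y \<partial>factorial_measure (\<eta> \<omega>) s) \<partial>M) = (\<integral>\<^sup>+y. U i y \<partial>pow_measure \<mu> s)" for i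
    using seq by simp
  ultimately show ?case
    by (simp add: * sets_fm image_comp cong: measurable_cong nn_integral_cong)
qed

end

section \<open>Wiener-Ito integrals of integrable functions\<close>

text \<open>The rank of \<open>i\<close> in \<open>J\<close> is the index at which
  \<open>insert_coords\<close> reads its second argument, so this bijection translates between
  \<open>J\<close> and \<open>{1..card J}\<close>.\<close>

lemma bij_betw_rank:
  fixes J :: "nat set"
  assumes "finite J" "0 \<notin> J"
  shows "bij_betw (\<lambda>i. card (J \<inter> {1..i})) J {1..card J}"
proof -
  have less: "card (J \<inter> {1..i}) < card (J \<inter> {1..j})" if "i \<in> J" "j \<in> J" "i < j" for i j
  proof (rule psubset_card_mono)
    have "1 \<le> j" using that by linarith
    then have "j \<in> J \<inter> {1..j} - J \<inter> {1..i}" using that by auto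
    moreover have "J \<inter> {1..i} \<subseteq> J \<inter> {1..j}" using that(3) by auto
    ultimately show "J \<inter> {1..i} \<subset> J \<inter> {1..j}" by blast
  qed (use assms in auto)
  have inj: "inj_on (\<lambda>i. card (J \<inter> {1..i})) J"
    by (rule linorder_inj_onI) (use less in \<open>auto simp: less_le\<close>)
  have sub: "(\<lambda>i. card (J \<inter> {1..i})) ` J \<subseteq> {1..card J}"
  proof safe
    fix i assume i: "i \<in> J"
    then have "i \<in> J \<inter> {1..i}" using assms by (cases i) auto
    then have "card (J \<inter> {1..i}) \<noteq> 0" using assms by auto
    then have "1 \<le> card (J \<inter> {1..i})" by linarith
    moreover have "card (J \<inter> {1..i}) \<le> card J" using assms by (intro card_mono) auto
    ultimately show "card (J \<inter> {1..i}) \<in> {1..card J}" by simp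
  qed
  have "(\<lambda>i. card (J \<inter> {1..i})) ` J = {1..card J}"
    using sub by (rule card_subset_eq[rotated]) (auto simp: card_image[OF inj])
  then show ?thesis using inj by (simp add: bij_betw_def)
qed

context poisson_sf begin

section \<open>One measure on the full product for each set of uncompensated coordinates\<close>

abbreviation ins_pair :: "nat set \<Rightarrow> (nat \<Rightarrow> 'x) \<times> (nat \<Rightarrow> 'x) \<Rightarrow> nat \<Rightarrow> 'x" where
  "ins_pair J \<equiv> \<lambda>(y, z). insert_coords J y z"

abbreviation compl_pow :: "nat \<Rightarrow> nat set \<Rightarrow> (nat \<Rightarrow> 'x) measure" where
  "compl_pow q J \<equiv> PiM ({1..q} - J) (\<lambda>_. \<mu>)"

lemma rank_in: "(J :: nat set) \<subseteq> {1..q} \<Longrightarrow> i \<in> J \<Longrightarrow> card (J \<inter> {1..i}) \<in> {1..card J}"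
  using bij_betw_rank[of J] by (metis atLeastAtMost_iff bij_betwE finite_atLeastAtMost finite_subset not_one_le_zero subsetD)

lemma ins_pair_meas:
  assumes J: "J \<subseteq> {1..q}"
  shows "ins_pair J \<in> measurable (pow_measure \<mu> (card J) \<Otimes>\<^sub>M compl_pow q J) (pow_measure \<mu> q)"
proof -
  have *: "(\<lambda>w i. if i \<in> J then fst w (card (J \<inter> {1..i})) else snd w i)
    \<in> measurable (pow_measure \<mu> (card J) \<Otimes>\<^sub>M compl_pow q J) (pow_measure \<mu> q)"
  proof (rule measurable_PiM_single')
    fix i assume i: "i \<in> {1..q}"
    show "(\<lambda>w. if i \<in> J then fst w (card (J \<inter> {1..i})) else snd w i)
      \<in> measurable (pow_measure \<mu> (card J) \<Otimes>\<^sub>M compl_pow q J) \<mu>"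
    proof (cases "i \<in> J")
      case True
      have "(\<lambda>y. y (card (J \<inter> {1..i}))) \<in> measurable (pow_measure \<mu> (card J)) \<mu>"
        using rank_in[OF J True] by (rule measurable_component_singleton)
      then show ?thesis using True measurable_compose[OF measurable_fst] by simp
    next
      case False
      have "(\<lambda>z. z i) \<in> measurable (compl_pow q J) \<mu>"
        using False i by (intro measurable_component_singleton) auto
      then show ?thesis using False measurable_compose[OF measurable_snd] by simp
    qed
  next
    show "(\<lambda>w i. if i \<in> J then fst w (card (J \<inter> {1..i})) else snd w i)
       \<in> space (pow_measure \<mu> (card J) \<Otimes>\<^sub>M compl_pow q J) \<rightarrow> (\<Pi>\<^sub>E i\<in>{1..q}. space \<mu>)"
    proof (rule Pi_I)
      fix w assume "w \<in> space (pow_measure \<mu> (card J) \<Otimes>\<^sub>M compl_pow q J)"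
      then have w: "fst w \<in> (\<Pi>\<^sub>E i\<in>{1..card J}. space \<mu>)" "snd w \<in> (\<Pi>\<^sub>E i\<in>{1..q}-J. space \<mu>)"
        by (auto simp: space_pair_measure space_PiM)
      have a: "fst w (card (J \<inter> {1..i})) \<in> space \<mu>" if "i \<in> J" for i
        using w(1) rank_in[OF J that] by (rule PiE_mem)
      have b: "snd w i \<in> space \<mu>" if "i \<notin> J" "i \<in> {1..q}" for i using PiE_mem[OF w(2)] that by auto
      have c: "snd w i = undefined" if "i \<notin> {1..q}" for i using PiE_arb[OF w(2)] that by auto
      show "(\<lambda>i. if i \<in> J then fst w (card (J \<inter> {1..i})) else snd w i) \<in> (\<Pi>\<^sub>E i\<in>{1..q}. space \<mu>)"
        using a b c J by (intro PiE_I) (auto dest: subsetD)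
    qed
  qed
  have "ins_pair J = (\<lambda>w i. if i \<in> J then fst w (card (J \<inter> {1..i})) else snd w i)"
    by (auto simp: insert_coords_def fun_eq_iff)
  with * show ?thesis by simp
qed

definition unrank :: "nat set \<Rightarrow> nat \<Rightarrow> nat" where
  "unrank J = the_inv_into J (\<lambda>i. card (J \<inter> {1..i}))"

lemma unrank:
  assumes "J \<subseteq> {1..q}"
  shows "bij_betw (unrank J) {1..card J} J" "i \<in> J \<Longrightarrow> unrank J (card (J \<inter> {1..i})) = i"
    "r \<in> {1..card J} \<Longrightarrow> card (J \<inter> {1..unrank J r}) = r"
proof -
  have b: "bij_betw (\<lambda>i. card (J \<inter> {1..i})) J {1..card J}"
    using assms by (intro bij_betw_rank) (auto intro: finite_subset)
  show "bij_betw (unrank J) {1..card J} J" unfolding unrank_def using b by (rule bij_betw_the_inv_into)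
  show "i \<in> J \<Longrightarrow> unrank J (card (J \<inter> {1..i})) = i"
    unfolding unrank_def using b by (intro the_inv_into_f_f) (auto simp: bij_betw_def)
  show "r \<in> {1..card J} \<Longrightarrow> card (J \<inter> {1..unrank J r}) = r"
    unfolding unrank_def using b by (intro f_the_inv_into_f[of "\<lambda>i. card (J \<inter> {1..i})"]) (auto simp: bij_betw_def)
qed

text \<open>\<open>F\<close> is left abstract since the computation is needed twice: for a power of
  \<mu> and for a factorial measure of \<open>\<eta> \<omega>\<close>.\<close>

lemma emeasure_distr_ins_pair_box:
  assumes J: "J \<subseteq> {1..q}" and F: "sets F = sets (pow_measure \<mu> (card J))"
    and A: "\<And>i. i \<in> {1..q} \<Longrightarrow> A i \<in> sets \<mu>"
  shows "emeasure (distr (F \<Otimes>\<^sub>M compl_pow q J) (pow_measure \<mu> q) (ins_pair J)) (\<Pi>\<^sub>E i\<in>{1..q}. A i)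
    = emeasure F (\<Pi>\<^sub>E r\<in>{1..card J}. A (unrank J r)) * (\<Prod>i\<in>{1..q} - J. emeasure \<mu> (A i))"
proof -
  interpret K: sigma_finite_measure "compl_pow q J" by (rule P.sigma_finite) simp
  have m: "ins_pair J \<in> measurable (F \<Otimes>\<^sub>M compl_pow q J) (pow_measure \<mu> q)"
    using ins_pair_meas[OF J] F by (simp cong: measurable_cong_sets sets_pair_measure_cong)
  have box: "(\<Pi>\<^sub>E i\<in>{1..q}. A i) \<in> sets (pow_measure \<mu> q)" using A by (intro sets_PiM_I_finite) auto
  have un: "unrank J r \<in> J" if "r \<in> {1..card J}" for r using unrank(1)[OF J] that by (auto simp: bij_betw_def)
  have sp: "space F = (\<Pi>\<^sub>E i\<in>{1..card J}. space \<mu>)" using sets_eq_imp_space_eq[OF F] by (simp add: space_PiM)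
  have Asub: "A i \<subseteq> space \<mu>" if "i \<in> {1..q}" for i using sets.sets_into_space[OF A[OF that]] .
  have e: "ins_pair J -` (\<Pi>\<^sub>E i\<in>{1..q}. A i) \<inter> space (F \<Otimes>\<^sub>M compl_pow q J) =
    (\<Pi>\<^sub>E r\<in>{1..card J}. A (unrank J r)) \<times> (\<Pi>\<^sub>E i\<in>{1..q} - J. A i)"
  proof (intro equalityI subsetI)
    fix w assume "w \<in> ins_pair J -` (\<Pi>\<^sub>E i\<in>{1..q}. A i) \<inter> space (F \<Otimes>\<^sub>M compl_pow q J)"
    then obtain y z where w: "w = (y, z)" "insert_coords J y z \<in> (\<Pi>\<^sub>E i\<in>{1..q}. A i)"
      "y \<in> (\<Pi>\<^sub>E i\<in>{1..card J}. space \<mu>)" "z \<in> (\<Pi>\<^sub>E i\<in>{1..q}-J. space \<mu>)"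
      by (auto simp: space_pair_measure sp space_PiM)
    have "y r \<in> A (unrank J r)" if r: "r \<in> {1..card J}" for r
    proof -
      have "unrank J r \<in> {1..q}" using un[OF r] J by blast
      from PiE_mem[OF w(2) this] show ?thesis using un[OF r] unrank(3)[OF J r] by (simp add: insert_coords_def)
    qed
    moreover have "z i \<in> A i" if "i \<in> {1..q} - J" for i
      using PiE_mem[OF w(2), of i] that by (simp add: insert_coords_def)
    ultimately show "w \<in> (\<Pi>\<^sub>E r\<in>{1..card J}. A (unrank J r)) \<times> (\<Pi>\<^sub>E i\<in>{1..q} - J. A i)"
      using w(1,3,4) by (auto simp: PiE_iff)
  next
    fix w assume "w \<in> (\<Pi>\<^sub>E r\<in>{1..card J}. A (unrank J r)) \<times> (\<Pi>\<^sub>E i\<in>{1..q} - J. A i)"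
    then obtain y z where w: "w = (y, z)" "y \<in> (\<Pi>\<^sub>E r\<in>{1..card J}. A (unrank J r))" "z \<in> (\<Pi>\<^sub>E i\<in>{1..q} - J. A i)"
      by auto
    have "y \<in> (\<Pi>\<^sub>E i\<in>{1..card J}. space \<mu>)"
      using w(2) subsetD[OF Asub[OF subsetD[OF J un]]] by (auto simp: PiE_iff)
    moreover have "z \<in> (\<Pi>\<^sub>E i\<in>{1..q}-J. space \<mu>)" using w(3) subsetD[OF Asub] by (auto simp: PiE_iff)
    moreover have "insert_coords J y z i \<in> A i" if i: "i \<in> {1..q}" for i
    proof (cases "i \<in> J")
      case True
      from PiE_mem[OF w(2) rank_in[OF J True]] show ?thesis using True unrank(2)[OF J True] by (simp add: insert_coords_def)
    next
      case False
      then show ?thesis using PiE_mem[OF w(3), of i] i by (simp add: insert_coords_def)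
    qed
    moreover have "insert_coords J y z i = undefined" if "i \<notin> {1..q}" for i
      using PiE_arb[OF w(3), of i] that J by (auto simp: insert_coords_def)
    ultimately show "w \<in> ins_pair J -` (\<Pi>\<^sub>E i\<in>{1..q}. A i) \<inter> space (F \<Otimes>\<^sub>M compl_pow q J)"
      by (auto simp: w(1) space_pair_measure sp space_PiM intro!: PiE_I)
  qed
  have "emeasure (distr (F \<Otimes>\<^sub>M compl_pow q J) (pow_measure \<mu> q) (ins_pair J)) (\<Pi>\<^sub>E i\<in>{1..q}. A i) =
     emeasure (F \<Otimes>\<^sub>M compl_pow q J) ((\<Pi>\<^sub>E r\<in>{1..card J}. A (unrank J r)) \<times> (\<Pi>\<^sub>E i\<in>{1..q} - J. A i))"
    using m box by (subst emeasure_distr) (auto simp: e)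
  also have "\<dots> = emeasure F (\<Pi>\<^sub>E r\<in>{1..card J}. A (unrank J r)) * emeasure (compl_pow q J) (\<Pi>\<^sub>E i\<in>{1..q} - J. A i)"
  proof (rule K.emeasure_pair_measure_Times)
    show "(\<Pi>\<^sub>E r\<in>{1..card J}. A (unrank J r)) \<in> sets F"
      unfolding F using A subsetD[OF J un] by (intro sets_PiM_I_finite) auto
    show "(\<Pi>\<^sub>E i\<in>{1..q} - J. A i) \<in> sets (compl_pow q J)" using A by (intro sets_PiM_I_finite) auto
  qed
  also have "emeasure (compl_pow q J) (\<Pi>\<^sub>E i\<in>{1..q} - J. A i) = (\<Prod>i\<in>{1..q} - J. emeasure \<mu> (A i))"
    using A by (intro P.emeasure_PiM) auto
  finally show ?thesis .
qed

lemma distr_ins_pair_pow: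
  assumes J: "J \<subseteq> {1..q}"
  shows "distr (pow_measure \<mu> (card J) \<Otimes>\<^sub>M compl_pow q J) (pow_measure \<mu> q) (ins_pair J) = pow_measure \<mu> q"
proof (rule P.PiM_eqI)
  fix A assume A: "\<And>i. i \<in> {1..q} \<Longrightarrow> A i \<in> sets \<mu>"
  have un: "unrank J r \<in> J" if "r \<in> {1..card J}" for r using unrank(1)[OF J] that by (auto simp: bij_betw_def)
  have "emeasure (pow_measure \<mu> (card J)) (\<Pi>\<^sub>E r\<in>{1..card J}. A (unrank J r)) = (\<Prod>r\<in>{1..card J}. emeasure \<mu> (A (unrank J r)))"
    using A subsetD[OF J un] by (intro P.emeasure_PiM) auto
  also have "\<dots> = (\<Prod>i\<in>J. emeasure \<mu> (A i))" by (rule prod.reindex_bij_betw[OF unrank(1)[OF J]])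
  finally have "emeasure (distr (pow_measure \<mu> (card J) \<Otimes>\<^sub>M compl_pow q J) (pow_measure \<mu> q) (ins_pair J)) (Pi\<^sub>E {1..q} A)
     = (\<Prod>i\<in>J. emeasure \<mu> (A i)) * (\<Prod>i\<in>{1..q} - J. emeasure \<mu> (A i))"
    using emeasure_distr_ins_pair_box[OF J refl A] by simp
  also have "\<dots> = (\<Prod>i\<in>{1..q}. emeasure \<mu> (A i))"
    using prod.subset_diff[OF J, of "\<lambda>i. emeasure \<mu> (A i)"] by (simp add: mult.commute)
  finally show "emeasure (distr (pow_measure \<mu> (card J) \<Otimes>\<^sub>M compl_pow q J) (pow_measure \<mu> q) (ins_pair J)) (Pi\<^sub>E {1..q} A)
     = (\<Prod>i\<in>{1..q}. emeasure \<mu> (A i))" .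
qed simp_all

text \<open>Turns each summand of \<open>wiener_ito_L1\<close> into a single integral over the full
  product, where linearity, bounds and dominated convergence apply directly to the
  integrand.\<close>

definition nu :: "nat set \<Rightarrow> nat \<Rightarrow> 'w \<Rightarrow> (nat \<Rightarrow> 'x) measure" where
  "nu J q \<omega> = distr (factorial_measure (\<eta> \<omega>) (card J) \<Otimes>\<^sub>M compl_pow q J) (pow_measure \<mu> q) (ins_pair J)"

lemma sets_nu[simp, measurable_cong]: "sets (nu J q \<omega>) = sets (pow_measure \<mu> q)"
  by (simp add: nu_def)

lemma space_nu[simp]: "space (nu J q \<omega>) = space (pow_measure \<mu> q)"
  by (simp add: nu_def)

lemma ins_pair_meas':
  assumes "J \<subseteq> {1..q}" "\<omega> \<in> space M"
  shows "ins_pair J \<in> measurable (factorial_measure (\<eta> \<omega>) (card J) \<Otimes>\<^sub>M compl_pow q J) (pow_measure \<mu> q)"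
  using ins_pair_meas[OF assms(1)] sets_fm[OF assms(2)] by (simp cong: measurable_cong_sets sets_pair_measure_cong)

lemma nn_integral_nu:
  assumes J: "J \<subseteq> {1..q}" and \<omega>: "\<omega> \<in> space M" and h: "h \<in> borel_measurable (pow_measure \<mu> q)"
  shows "(\<integral>\<^sup>+x. h x \<partial>nu J q \<omega>) = (\<integral>\<^sup>+y. (\<integral>\<^sup>+z. h (insert_coords J y z) \<partial>compl_pow q J) \<partial>factorial_measure (\<eta> \<omega>) (card J))"
proof -
  interpret K: sigma_finite_measure "compl_pow q J" by (rule P.sigma_finite) simp
  have m: "(\<lambda>w. h (ins_pair J w)) \<in> borel_measurable (factorial_measure (\<eta> \<omega>) (card J) \<Otimes>\<^sub>M compl_pow q J)"
    by (rule measurable_compose[OF ins_pair_meas'[OF J \<omega>] h])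
  have "(\<integral>\<^sup>+x. h x \<partial>nu J q \<omega>) = (\<integral>\<^sup>+w. h (ins_pair J w) \<partial>(factorial_measure (\<eta> \<omega>) (card J) \<Otimes>\<^sub>M compl_pow q J))"
    unfolding nu_def by (rule nn_integral_distr[OF ins_pair_meas'[OF J \<omega>]]) (use h in simp)
  also have "\<dots> = (\<integral>\<^sup>+y. (\<integral>\<^sup>+z. h (insert_coords J y z) \<partial>compl_pow q J) \<partial>factorial_measure (\<eta> \<omega>) (card J))"
    using K.nn_integral_fst[OF m] by simp
  finally show ?thesis .
qed

text \<open>By Campbell's formula for the coordinates in \<open>J\<close>, all the random measures
  \<open>nu J q\<close> have the same expectation, whatever \<open>J\<close> is. Integrability with
  respect to the product measure therefore passes to each of them almost surely.\<close>

lemma nu_moment: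
  assumes J: "J \<subseteq> {1..q}" and h: "h \<in> borel_measurable (pow_measure \<mu> q)"
  shows "(\<lambda>\<omega>. \<integral>\<^sup>+x. h x \<partial>nu J q \<omega>) \<in> borel_measurable M"
    "(\<integral>\<^sup>+\<omega>. (\<integral>\<^sup>+x. h x \<partial>nu J q \<omega>) \<partial>M) = (\<integral>\<^sup>+x. h x \<partial>pow_measure \<mu> q)"
proof -
  interpret K: sigma_finite_measure "compl_pow q J" by (rule P.sigma_finite) simp
  define H where "H y = (\<integral>\<^sup>+z. h (insert_coords J y z) \<partial>compl_pow q J)" for y
  have m: "(\<lambda>w. h (ins_pair J w)) \<in> borel_measurable (pow_measure \<mu> (card J) \<Otimes>\<^sub>M compl_pow q J)"
    by (rule measurable_compose[OF ins_pair_meas[OF J] h])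
  have H: "H \<in> borel_measurable (pow_measure \<mu> (card J))"
    unfolding H_def using K.borel_measurable_nn_integral_fst[OF m] by simp
  have e: "(\<integral>\<^sup>+x. h x \<partial>nu J q \<omega>) = (\<integral>\<^sup>+y. H y \<partial>factorial_measure (\<eta> \<omega>) (card J))" if "\<omega> \<in> space M" for \<omega>
    unfolding H_def by (rule nn_integral_nu[OF J that h])
  show "(\<lambda>\<omega>. \<integral>\<^sup>+x. h x \<partial>nu J q \<omega>) \<in> borel_measurable M"
    using first_moment_nn[OF H] by (subst measurable_cong[OF e]) auto
  have "(\<integral>\<^sup>+\<omega>. (\<integral>\<^sup>+x. h x \<partial>nu J q \<omega>) \<partial>M) = (\<integral>\<^sup>+\<omega>. (\<integral>\<^sup>+y. H y \<partial>factorial_measure (\<eta> \<omega>) (card J)) \<partial>M)"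
    by (intro nn_integral_cong e)
  also have "\<dots> = (\<integral>\<^sup>+y. H y \<partial>pow_measure \<mu> (card J))" using first_moment_nn[OF H] by simp
  also have "\<dots> = (\<integral>\<^sup>+w. h (ins_pair J w) \<partial>(pow_measure \<mu> (card J) \<Otimes>\<^sub>M compl_pow q J))"
    unfolding H_def using K.nn_integral_fst[OF m] by simp
  also have "\<dots> = (\<integral>\<^sup>+x. h x \<partial>distr (pow_measure \<mu> (card J) \<Otimes>\<^sub>M compl_pow q J) (pow_measure \<mu> q) (ins_pair J))"
    by (rule nn_integral_distr[OF ins_pair_meas[OF J], symmetric]) (use h in simp)
  also have "\<dots> = (\<integral>\<^sup>+x. h x \<partial>pow_measure \<mu> q)" unfolding distr_ins_pair_pow[OF J] ..
  finally show "(\<integral>\<^sup>+\<omega>. (\<integral>\<^sup>+x. h x \<partial>nu J q \<omega>) \<partial>M) = (\<integral>\<^sup>+x. h x \<partial>pow_measure \<mu> q)" .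
qed

lemma sigma_finite_fm: "\<omega> \<in> space M \<Longrightarrow> sigma_finite_measure (factorial_measure (\<eta> \<omega>) s)"
proof
  assume \<omega>: "\<omega> \<in> space M"
  show "\<exists>A. countable A \<and> A \<subseteq> sets (factorial_measure (\<eta> \<omega>) s) \<and> \<Union> A = space (factorial_measure (\<eta> \<omega>) s)
     \<and> (\<forall>a\<in>A. emeasure (factorial_measure (\<eta> \<omega>) s) a \<noteq> \<infinity>)"
    using Box_UN[of s] fm_Box_fin[OF \<omega>, of s] Box_sets[of s]
    by (intro exI[of _ "range (Box s)"]) (auto simp: sets_fm[OF \<omega>] space_fm[OF \<omega>] less_le)
qed

lemma integral_nu:
  assumes J: "J \<subseteq> {1..q}" and \<omega>: "\<omega> \<in> space M" and g: "integrable (nu J q \<omega>) (g :: _ \<Rightarrow> real)"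
  shows "(\<integral>x. g x \<partial>nu J q \<omega>) = (\<integral>y. (\<integral>z. g (insert_coords J y z) \<partial>compl_pow q J) \<partial>factorial_measure (\<eta> \<omega>) (card J))"
proof -
  interpret K: sigma_finite_measure "compl_pow q J" by (rule P.sigma_finite) simp
  interpret F: sigma_finite_measure "factorial_measure (\<eta> \<omega>) (card J)" by (rule sigma_finite_fm[OF \<omega>])
  interpret FK: pair_sigma_finite "factorial_measure (\<eta> \<omega>) (card J)" "compl_pow q J" by unfold_locales
  have gm: "g \<in> borel_measurable (pow_measure \<mu> q)" using borel_measurable_integrable[OF g] by simp
  have i: "integrable (factorial_measure (\<eta> \<omega>) (card J) \<Otimes>\<^sub>M compl_pow q J) (\<lambda>w. g (ins_pair J w))"
    using g ins_pair_meas'[OF J \<omega>] gm unfolding nu_def by (simp add: integrable_distr_eq)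
  have "(\<integral>x. g x \<partial>nu J q \<omega>) = (\<integral>w. g (ins_pair J w) \<partial>(factorial_measure (\<eta> \<omega>) (card J) \<Otimes>\<^sub>M compl_pow q J))"
    unfolding nu_def by (rule integral_distr[OF ins_pair_meas'[OF J \<omega>] gm])
  also have "\<dots> = (\<integral>y. (\<integral>z. g (insert_coords J y z) \<partial>compl_pow q J) \<partial>factorial_measure (\<eta> \<omega>) (card J))"
    using FK.integral_fst'[OF i] by simp
  finally show ?thesis .
qed

text \<open>Agrees with \<^const>\<open>wiener_ito_L1\<close> if \<open>g\<close> is integrable with respect to all \<open>nu J q \<omega>\<close>; otherwise the
  iterated and the joint Bochner integral may have different junk values.\<close>

definition WI :: "nat \<Rightarrow> ((nat \<Rightarrow> 'x) \<Rightarrow> real) \<Rightarrow> 'w \<Rightarrow> real" where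
  "WI q g \<omega> = (\<Sum>J\<in>Pow {1..q}. (-1) ^ (q - card J) * (\<integral>x. g x \<partial>nu J q \<omega>))"

lemma WI_eq:
  assumes "\<omega> \<in> space M" "\<And>J. J \<subseteq> {1..q} \<Longrightarrow> integrable (nu J q \<omega>) g"
  shows "wiener_ito_L1 \<mu> \<eta> q g \<omega> = WI q g \<omega>"
  unfolding wiener_ito_L1_def WI_def using assms by (intro sum.cong refl) (auto simp: integral_nu)

lemma WI_meas:
  assumes g: "g \<in> borel_measurable (pow_measure \<mu> q)"
  shows "WI q g \<in> borel_measurable M"
proof -
  have "(\<lambda>\<omega>. \<integral>x. g x \<partial>nu J q \<omega>) \<in> borel_measurable M" if J: "J \<subseteq> {1..q}" for J
  proof -
    \<comment> \<open>The Bochner integral is expressed by nonnegative integrals, whose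
      measurability in \<omega> is known; the value 0 is its default when \<open>g\<close> is not
      integrable.\<close>
    have e: "(\<integral>x. g x \<partial>nu J q \<omega>) = (if (\<integral>\<^sup>+x. ennreal \<bar>g x\<bar> \<partial>nu J q \<omega>) < \<infinity>
      then enn2real (\<integral>\<^sup>+x. ennreal (g x) \<partial>nu J q \<omega>) - enn2real (\<integral>\<^sup>+x. ennreal (- g x) \<partial>nu J q \<omega>) else 0)" for \<omega>
    proof -
      have "integrable (nu J q \<omega>) g \<longleftrightarrow> (\<integral>\<^sup>+x. ennreal \<bar>g x\<bar> \<partial>nu J q \<omega>) < \<infinity>"
        using g by (simp add: integrable_iff_bounded)
      then show ?thesis by (auto simp: real_lebesgue_integral_def not_integrable_integral_eq)
    qed
    have [measurable]: "(\<lambda>\<omega>. \<integral>\<^sup>+x. ennreal \<bar>g x\<bar> \<partial>nu J q \<omega>) \<in> borel_measurable M"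
      "(\<lambda>\<omega>. \<integral>\<^sup>+x. ennreal (g x) \<partial>nu J q \<omega>) \<in> borel_measurable M"
      "(\<lambda>\<omega>. \<integral>\<^sup>+x. ennreal (- g x) \<partial>nu J q \<omega>) \<in> borel_measurable M"
      using g by (auto intro!: nu_moment(1)[OF J])
    show ?thesis unfolding e by measurable
  qed
  then show ?thesis unfolding WI_def[abs_def] by (intro borel_measurable_sum borel_measurable_times borel_measurable_const) auto
qed

text \<open>The integral of |g| has finite expectation, so it is almost surely finite; only finitely
  many sets \<open>J\<close> contribute null sets.\<close>

lemma AE_integrable_nu:
  assumes g: "g \<in> borel_measurable (pow_measure \<mu> q)" "(\<integral>\<^sup>+x. ennreal \<bar>g x\<bar> \<partial>pow_measure \<mu> q) < \<infinity>"
  shows "AE \<omega> in M. \<forall>J\<in>Pow {1..q}. integrable (nu J q \<omega>) g"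
proof (rule AE_finite_allI)
  fix J assume "J \<in> Pow {1..q}"
  then have J: "J \<subseteq> {1..q}" by simp
  have "(\<lambda>x. ennreal \<bar>g x\<bar>) \<in> borel_measurable (pow_measure \<mu> q)" using g by measurable
  from nu_moment[OF J this] have "AE \<omega> in M. (\<integral>\<^sup>+x. ennreal \<bar>g x\<bar> \<partial>nu J q \<omega>) \<noteq> \<infinity>"
    using g(2) by (intro nn_integral_PInf_AE) auto
  then show "AE \<omega> in M. integrable (nu J q \<omega>) g"
    by eventually_elim (use g in \<open>auto simp: integrable_iff_bounded less_top\<close>)
qed simp

lemma AE_WI_eq:
  assumes "g \<in> borel_measurable (pow_measure \<mu> q)" "(\<integral>\<^sup>+x. ennreal \<bar>g x\<bar> \<partial>pow_measure \<mu> q) < \<infinity>"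
  shows "AE \<omega> in M. wiener_ito_L1 \<mu> \<eta> q g \<omega> = WI q g \<omega>"
  using AE_integrable_nu[OF assms] AE_space by eventually_elim (auto intro: WI_eq)

lemma WI_lin:
  assumes "\<And>J. J \<subseteq> {1..q} \<Longrightarrow> integrable (nu J q \<omega>) g" "\<And>J. J \<subseteq> {1..q} \<Longrightarrow> integrable (nu J q \<omega>) h"
  shows "WI q (\<lambda>x. a * g x + b * h x) \<omega> = a * WI q g \<omega> + b * WI q h \<omega>"
proof -
  have "WI q (\<lambda>x. a * g x + b * h x) \<omega> =
    (\<Sum>J\<in>Pow {1..q}. a * ((-1) ^ (q - card J) * (\<integral>x. g x \<partial>nu J q \<omega>)) + b * ((-1) ^ (q - card J) * (\<integral>x. h x \<partial>nu J q \<omega>)))"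
    unfolding WI_def using assms by (intro sum.cong refl) (auto simp: algebra_simps)
  then show ?thesis by (simp add: WI_def sum.distrib sum_distrib_left)
qed

text \<open>For this class the integrals exist for every \<omega>, so that identities hold pathwise,
  and \<open>WI\<close> has moments of every order. The class is closed under linear combinations
  and contains the truncations used later.\<close>

definition box_supp :: "nat \<Rightarrow> nat \<Rightarrow> ((nat \<Rightarrow> 'x) \<Rightarrow> real) \<Rightarrow> bool" where
  "box_supp n q g \<longleftrightarrow> g \<in> borel_measurable (pow_measure \<mu> q) \<and>
     (\<exists>c. \<forall>x\<in>space (pow_measure \<mu> q). \<bar>g x\<bar> \<le> c * indicator (Box q n) x)"

text \<open>Replacing each of the two masses by their sum gives a bound that is the same for all
  \<open>J\<close>.\<close>

lemma emeasure_nu_Box: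
  assumes J: "J \<subseteq> {1..q}" and \<omega>: "\<omega> \<in> space M"
  shows "emeasure (nu J q \<omega>) (Box q n) \<le> (emeasure (\<eta> \<omega>) (B n) + emeasure \<mu> (B n)) ^ q"
proof -
  have "emeasure (nu J q \<omega>) (Box q n) = emeasure (factorial_measure (\<eta> \<omega>) (card J)) (Box (card J) n) * emeasure \<mu> (B n) ^ card ({1..q} - J)"
    unfolding nu_def Box_def using emeasure_distr_ins_pair_box[OF J sets_fm[OF \<omega>], of "\<lambda>_. B n"] B_sets by simp
  also have "\<dots> \<le> emeasure (\<eta> \<omega>) (B n) ^ card J * emeasure \<mu> (B n) ^ card ({1..q} - J)"
    by (intro mult_right_mono fm_Box_le[OF \<omega>]) auto
  also have "\<dots> \<le> (emeasure (\<eta> \<omega>) (B n) + emeasure \<mu> (B n)) ^ card J * (emeasure (\<eta> \<omega>) (B n) + emeasure \<mu> (B n)) ^ card ({1..q} - J)"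
    by (intro mult_mono power_mono) auto
  also have "\<dots> = (emeasure (\<eta> \<omega>) (B n) + emeasure \<mu> (B n)) ^ q"
  proof -
    have "card J + card ({1..q} - J) = q"
      using card_mono[OF _ J] finite_subset[OF J] J by (subst card_Diff_subset) simp_all
    then show ?thesis by (simp add: power_add[symmetric])
  qed
  finally show ?thesis .
qed

text \<open>The one random variable that dominates all integrals over boxes: a bounded function
  supported in \<open>Box q n\<close> has integrals of size at most a constant times its
  \<open>q\<close>-th power.\<close>

definition box_mass :: "nat \<Rightarrow> 'w \<Rightarrow> real" where
  "box_mass n \<omega> = enn2real (emeasure (\<eta> \<omega>) (B n)) + enn2real (emeasure \<mu> (B n))"

lemma box_mass_nonneg: "0 \<le> box_mass n \<omega>" by (simp add: box_mass_def)

lemma box_mass_eq: "\<omega> \<in> space M \<Longrightarrow> emeasure (\<eta> \<omega>) (B n) + emeasure \<mu> (B n) = ennreal (box_mass n \<omega>)"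
  using eta_fin[of \<omega> n] B_fin[of n] by (simp add: box_mass_def less_top)

text \<open>Falling factorials are the quantities with known moments, so powers are reduced to them.
  For k > 2p every factor k - r with r < p is at least k/2, which gives the constant 2^p; the
  remaining k are covered by (2p)^p.\<close>

lemma power_le_ffact: "(of_nat k :: ennreal) ^ p \<le> of_nat ((2 * p) ^ p) + of_nat (2 ^ p) * ffact (of_nat k) p"
proof -
  have "k ^ p \<le> (2 * p) ^ p + 2 ^ p * (\<Prod>r<p. k - r)"
  proof (cases "k \<le> 2 * p")
    case True
    then have "k ^ p \<le> (2 * p) ^ p" by (rule power_mono) simp
    then show ?thesis by simp
  next
    case False
    have "k ^ p = (\<Prod>r<p. k)" by simp
    also have "\<dots> \<le> (\<Prod>r<p. 2 * (k - r))" using False by (intro prod_mono) auto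
    also have "\<dots> = 2 ^ p * (\<Prod>r<p. k - r)" by (simp add: prod.distrib)
    finally show ?thesis by simp
  qed
  then have "of_nat (k ^ p) \<le> (of_nat ((2 * p) ^ p + 2 ^ p * (\<Prod>r<p. k - r)) :: ennreal)"
    by (simp only: of_nat_le_iff)
  then show ?thesis
    by (simp add: ffact_of_nat ennreal_of_nat_eq_real_of_nat[symmetric] del: of_nat_prod)
qed

lemma box_mass_meas[measurable]: "box_mass n \<in> borel_measurable M"
  unfolding box_mass_def[abs_def] using eta_meas[OF B_sets] by measurable

lemma box_mass_integrable: "integrable M (\<lambda>\<omega>. box_mass n \<omega> ^ p)"
proof -
  let ?Z = "\<lambda>\<omega>. emeasure (\<eta> \<omega>) (B n)" and ?b = "emeasure \<mu> (B n)"
  have [measurable]: "?Z \<in> borel_measurable M" using eta_meas B_sets by simp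
  have ff: "(\<lambda>\<omega>. ffact (?Z \<omega>) p) \<in> borel_measurable M" by measurable
  have bd: "ennreal (box_mass n \<omega> ^ p) \<le> of_nat (2 ^ p) * ((of_nat ((2 * p) ^ p) + of_nat (2 ^ p) * ffact (?Z \<omega>) p) + ?b ^ p)"
    if \<omega>: "\<omega> \<in> space M" for \<omega>
  proof -
    obtain k :: nat where k: "?Z \<omega> = of_nat k"
      using eta_counting[OF \<omega>] eta_fin[OF \<omega>, of n] B_sets[of n] eta_sets[OF \<omega>] unfolding counting_measure_def
      by (metis less_irrefl)
    have "ennreal (box_mass n \<omega> ^ p) = (?Z \<omega> + ?b) ^ p" using box_mass_eq[OF \<omega>] box_mass_nonneg by (simp add: ennreal_power)
    also have "\<dots> \<le> (2 * max (?Z \<omega>) ?b) ^ p"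
      by (intro power_mono) (auto simp: mult_2 intro!: add_mono)
    also have "\<dots> = 2 ^ p * (max (?Z \<omega>) ?b) ^ p" by (rule power_mult_distrib)
    also have "\<dots> \<le> 2 ^ p * (?Z \<omega> ^ p + ?b ^ p)" by (intro mult_left_mono) (auto simp: max_def)
    also have "\<dots> \<le> of_nat (2 ^ p) * ((of_nat ((2 * p) ^ p) + of_nat (2 ^ p) * ffact (?Z \<omega>) p) + ?b ^ p)"
      unfolding k using power_le_ffact[of k p] by (auto intro!: mult_mono add_mono)
    finally show ?thesis .
  qed
  have "(\<integral>\<^sup>+\<omega>. ennreal (box_mass n \<omega> ^ p) \<partial>M) \<le>
     (\<integral>\<^sup>+\<omega>. of_nat (2 ^ p) * ((of_nat ((2 * p) ^ p) + of_nat (2 ^ p) * ffact (?Z \<omega>) p) + ?b ^ p) \<partial>M)"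
    by (intro nn_integral_mono bd)
  also have "\<dots> = of_nat (2 ^ p) * ((of_nat ((2 * p) ^ p) + of_nat (2 ^ p) * (\<integral>\<^sup>+\<omega>. ffact (?Z \<omega>) p \<partial>M)) + ?b ^ p)"
    using ff by (simp add: nn_integral_cmult nn_integral_add emeasure_space_1 del: of_nat_power of_nat_mult)
  also have "\<dots> = of_nat (2 ^ p) * ((of_nat ((2 * p) ^ p) + of_nat (2 ^ p) * ?b ^ p) + ?b ^ p)"
    using nn_integral_ffact_eta[OF B_sets B_fin eta_fin] by simp
  also have "\<dots> < \<infinity>" using B_fin[of n]
    by (simp add: ennreal_mult_less_top power_less_top_ennreal of_nat_less_top del: of_nat_power of_nat_mult)
  finally show ?thesis using box_mass_nonneg by (intro integrableI_bounded) auto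
qed

lemma box_supp_integrable:
  assumes g: "box_supp n q g" and J: "J \<subseteq> {1..q}" and \<omega>: "\<omega> \<in> space M"
  shows "integrable (nu J q \<omega>) g"
proof -
  from g obtain c where gm: "g \<in> borel_measurable (pow_measure \<mu> q)"
    and c: "\<And>x. x \<in> space (pow_measure \<mu> q) \<Longrightarrow> \<bar>g x\<bar> \<le> c * indicator (Box q n) x" by (auto simp: box_supp_def)
  have "emeasure (nu J q \<omega>) (Box q n) < \<infinity>"
    using emeasure_nu_Box[OF J \<omega>, of n] unfolding box_mass_eq[OF \<omega>]
    by (auto simp: box_mass_nonneg ennreal_power intro: le_less_trans)
  then have "integrable (nu J q \<omega>) (\<lambda>x. c * indicator (Box q n) x)" by (intro integrable_mult_right integrable_real_indicator) auto
  then show ?thesis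
  proof (rule Bochner_Integration.integrable_bound)
    show "AE x in nu J q \<omega>. norm (g x) \<le> norm (c * indicator (Box q n) x)"
      using c by (intro AE_I2) (fastforce intro: order_trans[OF _ abs_ge_self])
  qed (use gm in simp)
qed

text \<open>The factor \<open>2 ^ q\<close> counts the sets \<open>J\<close>; each of their
  integrals is at most \<open>c\<close> times the mass of the box.\<close>

lemma WI_bound:
  assumes gm: "g \<in> borel_measurable (pow_measure \<mu> q)"
    and c: "\<And>x. x \<in> space (pow_measure \<mu> q) \<Longrightarrow> \<bar>g x\<bar> \<le> c * indicator (Box q n) x" and c0: "0 \<le> c"
    and \<omega>: "\<omega> \<in> space M"
  shows "\<bar>WI q g \<omega>\<bar> \<le> 2 ^ q * (c * box_mass n \<omega> ^ q)"
proof -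
  have b: "box_supp n q g" using gm c by (auto simp: box_supp_def)
  have "\<bar>WI q g \<omega>\<bar> \<le> (\<Sum>J\<in>Pow {1..q}. \<bar>(-1) ^ (q - card J) * (\<integral>x. g x \<partial>nu J q \<omega>)\<bar>)"
    unfolding WI_def by (rule sum_abs)
  also have "\<dots> \<le> (\<Sum>J\<in>Pow {1..q}. c * box_mass n \<omega> ^ q)"
  proof (rule sum_mono)
    fix J assume "J \<in> Pow {1..q}"
    then have J: "J \<subseteq> {1..q}" by simp
    have fin: "emeasure (nu J q \<omega>) (Box q n) \<le> ennreal (box_mass n \<omega> ^ q)"
      using emeasure_nu_Box[OF J \<omega>, of n] unfolding box_mass_eq[OF \<omega>] by (simp add: box_mass_nonneg ennreal_power)
    then have "measure (nu J q \<omega>) (Box q n) \<le> box_mass n \<omega> ^ q"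
      unfolding measure_def using box_mass_nonneg by (intro enn2real_leI) auto
    have "\<bar>(-1) ^ (q - card J) * (\<integral>x. g x \<partial>nu J q \<omega>)\<bar> = \<bar>\<integral>x. g x \<partial>nu J q \<omega>\<bar>" by (simp add: abs_mult)
    also have "\<dots> \<le> (\<integral>x. \<bar>g x\<bar> \<partial>nu J q \<omega>)" by (rule integral_abs_bound)
    also have "\<dots> \<le> (\<integral>x. c * indicator (Box q n) x \<partial>nu J q \<omega>)"
    proof (rule integral_mono)
      show "integrable (nu J q \<omega>) (\<lambda>x. c * indicator (Box q n) x)"
        using fin by (intro integrable_mult_right integrable_real_indicator) (auto intro: le_less_trans)
    qed (use box_supp_integrable[OF b J \<omega>] c in auto)
    also have "\<dots> = c * measure (nu J q \<omega>) (Box q n)" by simp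
    also have "\<dots> \<le> c * box_mass n \<omega> ^ q" using \<open>measure _ _ \<le> _\<close> c0 by (rule mult_left_mono)
    finally show "\<bar>(-1) ^ (q - card J) * (\<integral>x. g x \<partial>nu J q \<omega>)\<bar> \<le> c * box_mass n \<omega> ^ q" .
  qed
  also have "\<dots> = 2 ^ q * (c * box_mass n \<omega> ^ q)" by (simp add: card_Pow)
  finally show ?thesis .
qed

lemma WI_limit:
  assumes \<omega>: "\<omega> \<in> space M" and gm: "\<And>j. g j \<in> borel_measurable (pow_measure \<mu> q)"
    and h: "\<And>J. J \<subseteq> {1..q} \<Longrightarrow> integrable (nu J q \<omega>) h"
    and bd: "\<And>j x. x \<in> space (pow_measure \<mu> q) \<Longrightarrow> \<bar>g j x\<bar> \<le> \<bar>h x\<bar>"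
    and fm: "f \<in> borel_measurable (pow_measure \<mu> q)"
    and lim: "\<And>x. x \<in> space (pow_measure \<mu> q) \<Longrightarrow> (\<lambda>j. g j x) \<longlonglongrightarrow> f x"
  shows "(\<lambda>j. WI q (g j) \<omega>) \<longlonglongrightarrow> WI q f \<omega>"
  unfolding WI_def
proof (intro tendsto_sum tendsto_mult tendsto_const)
  fix J assume "J \<in> Pow {1..q}"
  then have J: "J \<subseteq> {1..q}" by simp
  show "(\<lambda>j. \<integral>x. g j x \<partial>nu J q \<omega>) \<longlonglongrightarrow> (\<integral>x. f x \<partial>nu J q \<omega>)"
    by (rule integral_dominated_convergence[where w="\<lambda>x. \<bar>h x\<bar>"])
       (use h[OF J] gm fm lim bd in \<open>auto intro!: AE_I2\<close>)
qed

end

section \<open>The moment formula for indicators of boxes\<close>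

text \<open>\<open>None\<close> marks a coordinate that is integrated against \<mu>,
  \<open>Some i\<close> one that sits at the point labelled \<open>i\<close>. A choice of
  \<open>J\<close> together with labels on \<open>J\<close> thus becomes one function, and such
  functions on disjoint sets of rows can simply be glued.\<close>

definition partial_inj_maps :: "('p \<Rightarrow> 'r) \<Rightarrow> 'p set \<Rightarrow> 'i set \<Rightarrow> ('p \<Rightarrow> 'i option) set" where
  "partial_inj_maps r K I = {u \<in> K \<rightarrow>\<^sub>E insert None (Some ` I).
     \<forall>p\<in>K. \<forall>p'\<in>K. r p = r p' \<longrightarrow> u p \<noteq> None \<longrightarrow> u p = u p' \<longrightarrow> p = p'}"

text \<open>\<open>J\<close> is recovered from \<open>u\<close> as the set on which it differs from
  \<open>None\<close>.\<close>

lemma sum_partial_inj_maps: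
  fixes m :: "'p \<Rightarrow> real" and a :: "'p \<Rightarrow> 'i \<Rightarrow> real"
  assumes K: "finite K" and I: "finite I"
  shows "(\<Sum>J\<in>Pow K. (\<Prod>p\<in>K - J. m p) * (\<Sum>\<phi>\<in>row_inj_maps r J I. \<Prod>p\<in>J. a p (\<phi> p)))
    = (\<Sum>u\<in>partial_inj_maps r K I. \<Prod>p\<in>K. case u p of None \<Rightarrow> m p | Some i \<Rightarrow> a p i)"
proof -
  define S where "S = Sigma (Pow K) (\<lambda>J. row_inj_maps r J I)"
  define fw where "fw = (\<lambda>(J, \<phi>::'p \<Rightarrow> 'i). \<lambda>p\<in>K. if p \<in> J then Some (\<phi> p) else None)"
  define bw where "bw = (\<lambda>u::'p \<Rightarrow> 'i option. ({p\<in>K. u p \<noteq> None}, \<lambda>p\<in>{p\<in>K. u p \<noteq> None}. the (u p)))"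
  have fJ: "finite J" if "J \<subseteq> K" for J using that K finite_subset by auto
  have "(\<Sum>J\<in>Pow K. (\<Prod>p\<in>K - J. m p) * (\<Sum>\<phi>\<in>row_inj_maps r J I. \<Prod>p\<in>J. a p (\<phi> p)))
    = (\<Sum>J\<in>Pow K. \<Sum>\<phi>\<in>row_inj_maps r J I. (\<Prod>p\<in>K - J. m p) * (\<Prod>p\<in>J. a p (\<phi> p)))"
    by (simp add: sum_distrib_left)
  also have "\<dots> = (\<Sum>(J,\<phi>)\<in>S. (\<Prod>p\<in>K - J. m p) * (\<Prod>p\<in>J. a p (\<phi> p)))"
    unfolding S_def by (rule sum.Sigma) (use K I fJ finite_row_inj_maps in auto)
  also have "\<dots> = (\<Sum>u\<in>partial_inj_maps r K I. \<Prod>p\<in>K. case u p of None \<Rightarrow> m p | Some i \<Rightarrow> a p i)"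
  proof (rule sum.reindex_bij_witness[of _ bw fw], goal_cases)
    case (1 w)
    then obtain J \<phi> where w: "w = (J, \<phi>)" "J \<subseteq> K" "\<phi> \<in> row_inj_maps r J I" by (auto simp: S_def)
    have J: "{p\<in>K. fw w p \<noteq> None} = J" using w by (auto simp: fw_def)
    have "\<phi> \<in> extensional J" using w by (auto simp: row_inj_maps_def PiE_def)
    then have "(\<lambda>p\<in>J. the (fw w p)) = \<phi>" using w(2) by (auto simp: fw_def w(1) fun_eq_iff extensional_def)
    then show ?case unfolding bw_def J w(1)[symmetric] by (simp add: w(1))
  next
    case (2 w)
    then obtain J \<phi> where w: "w = (J, \<phi>)" "J \<subseteq> K" "\<phi> \<in> row_inj_maps r J I" by (auto simp: S_def)
    then show ?case by (auto simp: fw_def partial_inj_maps_def row_inj_maps_def PiE_iff split: if_splits)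
  next
    case (3 u)
    then have u: "u \<in> extensional K" by (auto simp: partial_inj_maps_def PiE_def)
    show ?case using u by (auto simp: fw_def bw_def fun_eq_iff extensional_def)
  next
    case (4 u)
    have ex: "\<exists>i\<in>I. u p = Some i" if "p \<in> K" "u p \<noteq> None" for p
      using 4 that by (auto simp: partial_inj_maps_def PiE_iff)
    have "the (u p) \<in> I" if "p \<in> K" "u p \<noteq> None" for p using ex[OF that] by auto
    moreover have "p = p'" if "p \<in> K" "p' \<in> K" "r p = r p'" "u p \<noteq> None" "u p' \<noteq> None" "the (u p) = the (u p')" for p p'
    proof -
      have "u p = u p'" using that by auto
      then show ?thesis using 4 that unfolding partial_inj_maps_def by blast
    qed
    ultimately show ?case by (auto simp: S_def bw_def row_inj_maps_def simp del: not_None_eq)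
  next
    case (5 w)
    then obtain J \<phi> where w: "w = (J, \<phi>)" "J \<subseteq> K" by (auto simp: S_def)
    have "(\<Prod>p\<in>K. case fw w p of None \<Rightarrow> m p | Some i \<Rightarrow> a p i) =
      (\<Prod>p\<in>K - J. case fw w p of None \<Rightarrow> m p | Some i \<Rightarrow> a p i) * (\<Prod>p\<in>J. case fw w p of None \<Rightarrow> m p | Some i \<Rightarrow> a p i)"
      by (rule prod.subset_diff[OF w(2) K])
    also have "(\<Prod>p\<in>K - J. case fw w p of None \<Rightarrow> m p | Some i \<Rightarrow> a p i) = (\<Prod>p\<in>K - J. m p)"
      by (intro prod.cong refl) (auto simp: fw_def w)
    also have "(\<Prod>p\<in>J. case fw w p of None \<Rightarrow> m p | Some i \<Rightarrow> a p i) = (\<Prod>p\<in>J. a p (\<phi> p))"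
      using w(2) by (intro prod.cong refl) (auto simp: fw_def w(1))
    finally show ?case by (simp add: w(1))
  qed
  finally show ?thesis .
qed

text \<open>The injectivity condition relates only positions of the same row. When the two sets
  share no row, a map on the union is an arbitrary pair of maps.\<close>

lemma prod_partial_inj_maps_Un:
  fixes c :: "'p \<Rightarrow> 'i option \<Rightarrow> real"
  assumes K: "finite K1" "finite K2" and I: "finite I" and r: "r ` K1 \<inter> r ` K2 = {}"
  shows "(\<Sum>u\<in>partial_inj_maps r K1 I. \<Prod>p\<in>K1. c p (u p)) * (\<Sum>u\<in>partial_inj_maps r K2 I. \<Prod>p\<in>K2. c p (u p))
    = (\<Sum>u\<in>partial_inj_maps r (K1 \<union> K2) I. \<Prod>p\<in>K1 \<union> K2. c p (u p))"
proof -
  have dj: "K1 \<inter> K2 = {}" using r by auto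
  have rr: "r p \<noteq> r p'" "r p' \<noteq> r p" if "p \<in> K1" "p' \<in> K2" for p p' using r that by (metis IntI empty_iff imageI)+
  have "(\<Sum>u\<in>partial_inj_maps r K1 I. \<Prod>p\<in>K1. c p (u p)) * (\<Sum>u\<in>partial_inj_maps r K2 I. \<Prod>p\<in>K2. c p (u p))
    = (\<Sum>(u,v)\<in>partial_inj_maps r K1 I \<times> partial_inj_maps r K2 I. (\<Prod>p\<in>K1. c p (u p)) * (\<Prod>p\<in>K2. c p (v p)))"
    by (simp add: sum_product sum.cartesian_product)
  also have "\<dots> = (\<Sum>u\<in>partial_inj_maps r (K1 \<union> K2) I. \<Prod>p\<in>K1 \<union> K2. c p (u p))"
  proof (rule sum.reindex_bij_witness[of _ "\<lambda>w. (restrict w K1, restrict w K2)"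
       "\<lambda>(u,v) p. if p \<in> K1 then u p else v p"], goal_cases)
    case (1 w)
    then show ?case using dj by (auto simp: partial_inj_maps_def fun_eq_iff PiE_def extensional_def restrict_def)
  next
    case (2 w)
    then obtain u v where w: "w = (u, v)" "u \<in> partial_inj_maps r K1 I" "v \<in> partial_inj_maps r K2 I" by auto
    have "(\<lambda>p. if p \<in> K1 then u p else v p) \<in> K1 \<union> K2 \<rightarrow>\<^sub>E insert None (Some ` I)"
      using w by (auto simp: partial_inj_maps_def PiE_iff extensional_def)
    moreover have "p = p'" if "p \<in> K1 \<union> K2" "p' \<in> K1 \<union> K2" "r p = r p'"
      "(if p \<in> K1 then u p else v p) \<noteq> None" "(if p \<in> K1 then u p else v p) = (if p' \<in> K1 then u p' else v p')" for p p'
    proof (cases "p \<in> K1")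
      case True
      then have "p' \<in> K1" using rr that by blast
      then show ?thesis using True that w(2) by (simp add: partial_inj_maps_def)
    next
      case False
      then have "p \<in> K2" "p' \<notin> K1" "p' \<in> K2" using rr that by blast+
      then show ?thesis using False that w(3) by (simp add: partial_inj_maps_def)
    qed
    ultimately have "(\<lambda>p. if p \<in> K1 then u p else v p) \<in> partial_inj_maps r (K1 \<union> K2) I"
      unfolding partial_inj_maps_def by blast
    then show ?case by (simp add: w(1))
  next
    case (3 w)
    then show ?case by (auto simp: partial_inj_maps_def fun_eq_iff PiE_def extensional_def restrict_def)
  next
    case (4 w)
    then show ?case by (auto simp: partial_inj_maps_def simp del: not_None_eq)
  next
    case (5 w)
    then obtain u v where w: "w = (u, v)" by (cases w)
    have "(\<Prod>p\<in>K2. c p (if p \<in> K1 then u p else v p)) = (\<Prod>p\<in>K2. c p (v p))"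
      using dj by (intro prod.cong) auto
    then show ?case using K dj by (simp add: w prod.union_disjoint)
  qed
  finally show ?thesis .
qed

lemma prod_partial_inj_maps_UN:
  fixes c :: "'p \<Rightarrow> 'i option \<Rightarrow> real"
  assumes "finite S" "\<And>l. l \<in> S \<Longrightarrow> finite (R l)" "finite I" and "\<And>l p. l \<in> S \<Longrightarrow> p \<in> R l \<Longrightarrow> r p = l"
  shows "(\<Prod>l\<in>S. \<Sum>u\<in>partial_inj_maps r (R l) I. \<Prod>p\<in>R l. c p (u p))
    = (\<Sum>u\<in>partial_inj_maps r (\<Union>l\<in>S. R l) I. \<Prod>p\<in>(\<Union>l\<in>S. R l). c p (u p))"
  using assms
proof (induction S rule: finite_induct)
  case empty
  have "partial_inj_maps r {} I = {\<lambda>_. undefined}" by (auto simp: partial_inj_maps_def)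
  then show ?case by simp
next
  case (insert l S)
  have "r ` R l \<inter> r ` (\<Union>l\<in>S. R l) = {}" using insert.prems(3) insert.hyps(2) by fastforce
  then show ?case
    using insert prod_partial_inj_maps_Un[of "R l" "\<Union>l\<in>S. R l" I r c] by simp
qed

text \<open>Partial maps serve as an intermediate form in which the product over rows is immediate.
  Afterwards \<open>J\<close> is extracted again, now as a set of positions in all rows, and the
  label maps are grouped by their coincidences across rows.\<close>

lemma prod_rows_expand:
  fixes m :: "nat \<Rightarrow> real" and a :: "nat \<Rightarrow> 'i \<Rightarrow> real"
  assumes "finite S" "\<And>l. l \<in> S \<Longrightarrow> finite (R l)" "finite I" and r: "\<And>l p. l \<in> S \<Longrightarrow> p \<in> R l \<Longrightarrow> r p = l"
  defines "P \<equiv> (\<Union>l\<in>S. R l)"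
  shows "(\<Prod>l\<in>S. \<Sum>J\<in>Pow (R l). (\<Prod>p\<in>R l - J. m p) * (\<Sum>\<iota>\<in>inj_maps J I. \<Prod>p\<in>J. a p (\<iota> p)))
    = (\<Sum>J\<in>Pow P. (\<Prod>p\<in>P - J. m p) * (\<Sum>\<sigma>\<in>row_parts r J. \<Sum>\<psi>\<in>inj_maps \<sigma> I. \<Prod>b\<in>\<sigma>. \<Prod>p\<in>b. a p (\<psi> b)))"
proof -
  have fP: "finite P" using assms by auto
  have e: "row_inj_maps r J I = inj_maps J I" if "l \<in> S" "J \<subseteq> R l" for l J
  proof -
    have "r p = l" if "p \<in> J" for p using r[OF \<open>l \<in> S\<close>] that \<open>J \<subseteq> R l\<close> by blast
    then show ?thesis unfolding row_inj_maps_def inj_maps_def inj_on_def by auto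
  qed
  have "(\<Prod>l\<in>S. \<Sum>J\<in>Pow (R l). (\<Prod>p\<in>R l - J. m p) * (\<Sum>\<iota>\<in>inj_maps J I. \<Prod>p\<in>J. a p (\<iota> p)))
     = (\<Prod>l\<in>S. \<Sum>J\<in>Pow (R l). (\<Prod>p\<in>R l - J. m p) * (\<Sum>\<iota>\<in>row_inj_maps r J I. \<Prod>p\<in>J. a p (\<iota> p)))"
    by (intro prod.cong sum.cong refl arg_cong2[where f="(*)"]) (use e in auto)
  also have "\<dots> = (\<Prod>l\<in>S. \<Sum>u\<in>partial_inj_maps r (R l) I. \<Prod>p\<in>R l. case u p of None \<Rightarrow> m p | Some i \<Rightarrow> a p i)"
    using assms by (intro prod.cong refl sum_partial_inj_maps) auto
  also have "\<dots> = (\<Sum>u\<in>partial_inj_maps r P I. \<Prod>p\<in>P. case u p of None \<Rightarrow> m p | Some i \<Rightarrow> a p i)"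
    unfolding P_def using assms(1-4) by (intro prod_partial_inj_maps_UN[where c="\<lambda>p u. case u of None \<Rightarrow> m p | Some i \<Rightarrow> a p i"]) auto
  also have "\<dots> = (\<Sum>J\<in>Pow P. (\<Prod>p\<in>P - J. m p) * (\<Sum>\<phi>\<in>row_inj_maps r J I. \<Prod>p\<in>J. a p (\<phi> p)))"
    using fP assms(3) by (rule sum_partial_inj_maps[symmetric])
  also have "\<dots> = (\<Sum>J\<in>Pow P. (\<Prod>p\<in>P - J. m p) * (\<Sum>\<sigma>\<in>row_parts r J. \<Sum>\<psi>\<in>inj_maps \<sigma> I. \<Prod>b\<in>\<sigma>. \<Prod>p\<in>b. a p (\<psi> b)))"
    using fP assms(3) by (intro sum.cong refl arg_cong2[where f="(*)"] sum_row_inj_maps) (auto intro: finite_subset)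
  finally show ?thesis .
qed

lemma sum_inj_maps_reindex:
  fixes a :: "'k \<Rightarrow> 'i \<Rightarrow> real"
  assumes h: "bij_betw h K' K"
  shows "(\<Sum>\<iota>\<in>inj_maps K I. \<Prod>k\<in>K. a k (\<iota> k)) = (\<Sum>\<iota>\<in>inj_maps K' I. \<Prod>k\<in>K'. a (h k) (\<iota> k))"
proof (rule sum.reindex_bij_witness[of _ "\<lambda>\<kappa>. \<lambda>k\<in>K. \<kappa> (the_inv_into K' h k)" "\<lambda>\<iota>. \<lambda>k\<in>K'. \<iota> (h k)"])
  let ?g = "the_inv_into K' h"
  have hin: "h k \<in> K" if "k \<in> K'" for k using h that by (auto simp: bij_betw_def)
  have g: "bij_betw ?g K K'" using h by (rule bij_betw_the_inv_into)
  have gin: "?g k \<in> K'" if "k \<in> K" for k using g that by (auto simp: bij_betw_def)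
  have hg: "h (?g k) = k" if "k \<in> K" for k using h that by (auto simp: bij_betw_def intro!: f_the_inv_into_f)
  have gh: "?g (h k) = k" if "k \<in> K'" for k using h that by (auto simp: bij_betw_def intro!: the_inv_into_f_f)
  show "(\<lambda>k\<in>K. (\<lambda>k\<in>K'. \<iota> (h k)) (?g k)) = \<iota>" if "\<iota> \<in> inj_maps K I" for \<iota>
    using that hg gin by (auto simp: fun_eq_iff inj_maps_def PiE_def extensional_def)
  show "(\<lambda>k\<in>K'. (\<lambda>k\<in>K. \<kappa> (?g k)) (h k)) = \<kappa>" if "\<kappa> \<in> inj_maps K' I" for \<kappa>
    using that gh hin by (auto simp: fun_eq_iff inj_maps_def PiE_def extensional_def)
  show "(\<lambda>k\<in>K'. \<iota> (h k)) \<in> inj_maps K' I" if "\<iota> \<in> inj_maps K I" for \<iota>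
  proof -
    have "inj_on (\<iota> \<circ> h) K'" using that h by (intro comp_inj_on) (auto simp: inj_maps_def bij_betw_def)
    then show ?thesis using that hin by (auto simp: inj_maps_def inj_on_def)
  qed
  show "(\<lambda>k\<in>K. \<kappa> (?g k)) \<in> inj_maps K I" if "\<kappa> \<in> inj_maps K' I" for \<kappa>
  proof -
    have "inj_on (\<kappa> \<circ> ?g) K" using that g by (intro comp_inj_on) (auto simp: inj_maps_def bij_betw_def)
    then show ?thesis using that gin by (auto simp: inj_maps_def inj_on_def)
  qed
  show "(\<Prod>k\<in>K'. a (h k) ((\<lambda>k\<in>K'. \<iota> (h k)) k)) = (\<Prod>k\<in>K. a k (\<iota> k))" if "\<iota> \<in> inj_maps K I" for \<iota>
    using prod.reindex_bij_betw[OF h, of "\<lambda>k. a k (\<iota> k)"] by simp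
qed

section \<open>Rows, positions and partitions for arbitrary sets of rows\<close>

definition pos :: "(nat \<Rightarrow> nat) \<Rightarrow> nat \<Rightarrow> nat \<Rightarrow> nat" where
  "pos q l k = cum_sizes q (l - 1) + k"

text \<open>Taking the least \<open>l\<close> yields the row that contains \<open>p\<close> even
  when some rows are empty.\<close>

definition row_index :: "(nat \<Rightarrow> nat) \<Rightarrow> nat \<Rightarrow> nat" where
  "row_index q p = (LEAST l. p \<le> cum_sizes q l)"

definition rows :: "(nat \<Rightarrow> nat) \<Rightarrow> nat set \<Rightarrow> nat set" where
  "rows q S = (\<Union>l\<in>S. row q l)"

lemma cum_sizes_step: "1 \<le> l \<Longrightarrow> cum_sizes q l = cum_sizes q (l - 1) + q l"
  unfolding cum_sizes_def by (cases l) (auto simp: One_nat_def)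

lemma cum_sizes_mono: "l \<le> l' \<Longrightarrow> cum_sizes q l \<le> cum_sizes q l'"
  unfolding cum_sizes_def by (intro sum_mono2) auto

lemma row_eq: "1 \<le> l \<Longrightarrow> row q l = pos q l ` {1..q l}"
  unfolding row_def pos_def[abs_def] using cum_sizes_step[of l q] by (simp add: image_add_atLeastAtMost add.commute)

lemma inj_pos: "inj_on (pos q l) A" by (auto simp: inj_on_def pos_def)

lemma bij_pos: "1 \<le> l \<Longrightarrow> bij_betw (pos q l) {1..q l} (row q l)"
  using row_eq[of l q] inj_pos by (auto simp: bij_betw_def)

lemma pos_in_row: "1 \<le> l \<Longrightarrow> k \<in> {1..q l} \<Longrightarrow> pos q l k \<in> row q l" by (simp add: row_eq)

lemma row_index_row:
  assumes "1 \<le> l" "p \<in> row q l" shows "row_index q p = l"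
  unfolding row_index_def
proof (rule Least_equality)
  show "p \<le> cum_sizes q l" using assms by (auto simp: row_def)
  fix l' assume "p \<le> cum_sizes q l'"
  show "l \<le> l'"
  proof (rule ccontr)
    assume "\<not> l \<le> l'"
    then have "cum_sizes q l' \<le> cum_sizes q (l - 1)" by (intro cum_sizes_mono) auto
    then show False using assms \<open>p \<le> cum_sizes q l'\<close> by (auto simp: row_def)
  qed
qed

lemma finite_row[simp]: "finite (row q l)" by (simp add: row_def)

lemma finite_rows: "finite S \<Longrightarrow> finite (rows q S)" by (simp add: rows_def)

lemma rows_atLeastAtMost: "rows q {1..m} = {1..cum_sizes q m}"
proof (induction m)
  case 0
  then show ?case by (simp add: rows_def cum_sizes_def)
next
  case (Suc m)
  have "rows q {1..Suc m} = rows q {1..m} \<union> row q (Suc m)"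
    by (simp add: rows_def atLeastAtMostSuc_conv Un_commute)
  also have "row q (Suc m) = {cum_sizes q m + 1..cum_sizes q (Suc m)}" by (simp add: row_def)
  also have "rows q {1..m} \<union> {cum_sizes q m + 1..cum_sizes q (Suc m)} = {1..cum_sizes q (Suc m)}"
    unfolding Suc using cum_sizes_mono[of m "Suc m" q] by auto
  finally show ?case .
qed

text \<open>The counterpart of \<open>Parts\<close> for an arbitrary set of rows, as the cumulant
  recursion runs through the subsets of the factors. Rows keep their absolute positions, so no
  renumbering is involved.\<close>

definition gparts :: "(nat \<Rightarrow> nat) \<Rightarrow> nat set \<Rightarrow> nat set set set" where
  "gparts q S = row_parts (row_index q) (rows q S)"

definition gparts2 :: "(nat \<Rightarrow> nat) \<Rightarrow> nat set \<Rightarrow> nat set set set" where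
  "gparts2 q S = {\<sigma> \<in> gparts q S. \<forall>b\<in>\<sigma>. 2 \<le> card b}"

text \<open>The counterpart of \<^const>\<open>tensor_contr\<close> for the rows in \<open>S\<close> only.\<close>

definition contr :: "(nat \<Rightarrow> nat) \<Rightarrow> (nat \<Rightarrow> (nat \<Rightarrow> 'x) \<Rightarrow> real) \<Rightarrow> nat set \<Rightarrow> nat set set \<Rightarrow> (nat set \<Rightarrow> 'x) \<Rightarrow> real" where
  "contr q f S \<sigma> y = (\<Prod>l\<in>S. f l (\<lambda>k\<in>{1..q l}. y (block_of \<sigma> (pos q l k))))"

lemma gparts_partition: "\<sigma> \<in> gparts q S \<Longrightarrow> partition_on (rows q S) \<sigma>"
  by (simp add: gparts_def row_parts_def)

text \<open>A block meets no row twice if and only if the row index is injective on it.\<close>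

lemma Parts_eq_gparts: "Parts m q = gparts q {1..m}"
proof -
  have "inj_on (row_index q) b \<longleftrightarrow> (\<forall>l\<in>{1..m}. card (b \<inter> row q l) \<le> 1)" if b: "b \<subseteq> rows q {1..m}" for b
  proof
    assume inj: "inj_on (row_index q) b"
    show "\<forall>l\<in>{1..m}. card (b \<inter> row q l) \<le> 1"
    proof
      fix l assume l: "l \<in> {1..m}"
      have "x = y" if "x \<in> b \<inter> row q l" "y \<in> b \<inter> row q l" for x y
        using that row_index_row[of l _ q] l inj by (metis IntD1 IntD2 atLeastAtMost_iff inj_onD)
      then have "card (b \<inter> row q l) \<le> Suc 0" by (auto simp: card_le_Suc0_iff_eq)
      then show "card (b \<inter> row q l) \<le> 1" by simp
    qed
  next
    assume c: "\<forall>l\<in>{1..m}. card (b \<inter> row q l) \<le> 1"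
    show "inj_on (row_index q) b"
    proof (rule inj_onI)
      fix x y assume h: "x \<in> b" "y \<in> b" "row_index q x = row_index q y"
      obtain l where l: "l \<in> {1..m}" "x \<in> row q l" using b h by (auto simp: rows_def)
      obtain l' where l': "l' \<in> {1..m}" "y \<in> row q l'" using b h by (auto simp: rows_def)
      have "l = l'" using row_index_row[of l x q] row_index_row[of l' y q] l l' h(3) by auto
      then have "x \<in> b \<inter> row q l" "y \<in> b \<inter> row q l" using h l l' by auto
      moreover have "card (b \<inter> row q l) \<le> Suc 0" using bspec[OF c l(1)] by simp
      ultimately show "x = y" by (auto simp: card_le_Suc0_iff_eq)
    qed
  qed
  then have "(\<forall>b\<in>\<sigma>. \<forall>l\<in>{1..m}. card (b \<inter> row q l) \<le> 1) \<longleftrightarrow> (\<forall>b\<in>\<sigma>. inj_on (row_index q) b)"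
    if "partition_on (rows q {1..m}) \<sigma>" for \<sigma>
    using partition_onD1[OF that] by (intro ball_cong refl) (simp add: Union_upper)
  then show ?thesis
    unfolding Parts_def gparts_def row_parts_def rows_atLeastAtMost[symmetric]
    by (intro Collect_cong conj_cong refl)
qed

lemma Parts_ge2_eq_gparts2: "Parts_ge2 m q = gparts2 q {1..m}"
  by (simp add: Parts_ge2_def gparts2_def Parts_eq_gparts)

lemma tensor_contr_eq: "tensor_contr m q f \<sigma> y = contr q f {1..m} \<sigma> y"
proof -
  have "pos q l k \<in> {1..cum_sizes q m}" if "l \<in> {1..m}" "k \<in> {1..q l}" for l k
  proof -
    have "pos q l k \<in> rows q {1..m}" using pos_in_row[of l k q] that by (auto simp: rows_def)
    then show ?thesis by (simp only: rows_atLeastAtMost)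
  qed
  then show ?thesis
    unfolding tensor_contr_def tensor_def contr_def pos_def
    by (intro prod.cong refl arg_cong[where f="f _"] restrict_ext) auto
qed

lemma finite_gparts: "finite S \<Longrightarrow> finite (gparts q S)"
  unfolding gparts_def by (intro finite_row_parts finite_rows)

lemma finite_gparts2: "finite S \<Longrightarrow> finite (gparts2 q S)"
  unfolding gparts2_def using finite_gparts by auto

lemma finite_gpart: "finite S \<Longrightarrow> \<sigma> \<in> gparts q S \<Longrightarrow> finite \<sigma>"
  using gparts_partition finite_elements finite_rows by blast

context poisson_sf begin

sublocale PS: product_sigma_finite "\<lambda>_::nat set. \<mu>" by standard

text \<open>Only labels whose point lies in \<open>B n\<close> matter for boxes inside
  \<open>B n\<close>; adding \<open>B n\<close> to the family makes their number equal to its mass,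
  which is finite. A single label set serves all orders \<open>s\<close>, which allows products of
  different factorial measures to be expanded together.\<close>

lemma fm_box_rep:
  assumes \<omega>: "\<omega> \<in> space M" and \<A>: "countable \<A>" "\<A> \<subseteq> sets \<mu>"
  obtains I :: "(nat \<times> nat) set" and x where "finite I"
    "\<And>s A. (\<And>j. j \<in> {1..s} \<Longrightarrow> A j \<in> \<A> \<and> A j \<subseteq> B n) \<Longrightarrow>
       measure (factorial_measure (\<eta> \<omega>) s) (\<Pi>\<^sub>E j\<in>{1..s}. A j)
       = (\<Sum>\<iota>\<in>inj_maps {1..s} I. \<Prod>j\<in>{1..s}. indicator (A j) (x (\<iota> j)))"
proof -
  interpret N: sf_counting "\<eta> \<omega>" B by (rule sf_counting_eta[OF \<omega>])
  define \<A>' where "\<A>' = insert (B n) \<A>"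
  have A': "countable \<A>'" "\<A>' \<subseteq> sets (\<eta> \<omega>)" using \<A> B_sets by (auto simp: \<A>'_def eta_sets[OF \<omega>])
  obtain I0 :: "(nat \<times> nat) set" and x where rep: "dirac_rep (\<eta> \<omega>) \<A>' I0 x" using N.rep_ex[OF A'] .
  define I where "I = {i\<in>I0. x i \<in> B n}"
  have "emeasure (\<eta> \<omega>) (B n) = emeasure (count_space UNIV) I"
    using rep by (auto simp: dirac_rep_def I_def \<A>'_def intro: sigma_sets.Basic)
  then have fI: "finite I" using eta_fin[OF \<omega>, of n] by (auto simp: emeasure_count_space split: if_splits)
  have "measure (factorial_measure (\<eta> \<omega>) s) (\<Pi>\<^sub>E j\<in>{1..s}. A j)
       = (\<Sum>\<iota>\<in>inj_maps {1..s} I. \<Prod>j\<in>{1..s}. indicator (A j) (x (\<iota> j)))"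
    if A: "\<And>j. j \<in> {1..s} \<Longrightarrow> A j \<in> \<A> \<and> A j \<subseteq> B n" for s A
  proof -
    let ?F = "sigma (space (\<eta> \<omega>)) \<A>'"
    have "\<A>' \<subseteq> Pow (space (\<eta> \<omega>))" using A'(2) sets.space_closed by blast
    then have "A j \<in> sets ?F" if "j \<in> {1..s}" for j using A[OF that] by (auto simp: \<A>'_def)
    then have box: "(\<Pi>\<^sub>E j\<in>{1..s}. A j) \<in> sets (PiM {1..s} (\<lambda>_. ?F))" by (intro sets_PiM_I_finite) auto
    have "emeasure (factorial_measure (\<eta> \<omega>) s) (\<Pi>\<^sub>E j\<in>{1..s}. A j) =
       emeasure (count_space UNIV) {\<iota>\<in>inj_maps {1..s} I0. (\<lambda>j\<in>{1..s}. x (\<iota> j)) \<in> (\<Pi>\<^sub>E j\<in>{1..s}. A j)}"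
      using N.factorial_rep[of s] rep box unfolding N.factorial_rep_def by simp
    also have "{\<iota>\<in>inj_maps {1..s} I0. (\<lambda>j\<in>{1..s}. x (\<iota> j)) \<in> (\<Pi>\<^sub>E j\<in>{1..s}. A j)} =
      {\<iota>\<in>inj_maps {1..s} I. \<forall>j\<in>{1..s}. x (\<iota> j) \<in> A j}" (is "_ = ?T")
    proof (intro equalityI subsetI)
      fix \<iota> assume "\<iota> \<in> {\<iota>\<in>inj_maps {1..s} I0. (\<lambda>j\<in>{1..s}. x (\<iota> j)) \<in> (\<Pi>\<^sub>E j\<in>{1..s}. A j)}"
      then have h: "\<iota> \<in> inj_maps {1..s} I0" "\<And>j. j \<in> {1..s} \<Longrightarrow> x (\<iota> j) \<in> A j" by auto
      then have "\<iota> j \<in> I" if "j \<in> {1..s}" for j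
        using A[OF that] that by (auto simp: I_def inj_maps_def)
      then show "\<iota> \<in> ?T" using h by (auto simp: inj_maps_def PiE_iff)
    next
      fix \<iota> assume "\<iota> \<in> ?T"
      then show "\<iota> \<in> {\<iota>\<in>inj_maps {1..s} I0. (\<lambda>j\<in>{1..s}. x (\<iota> j)) \<in> (\<Pi>\<^sub>E j\<in>{1..s}. A j)}"
        by (auto simp: inj_maps_def PiE_iff I_def)
    qed
    finally have e: "emeasure (factorial_measure (\<eta> \<omega>) s) (\<Pi>\<^sub>E j\<in>{1..s}. A j) = of_nat (card ?T)"
      using fI finite_inj_maps[of "{1..s}" I] by (simp add: emeasure_count_space)
    have "(\<Sum>\<iota>\<in>inj_maps {1..s} I. \<Prod>j\<in>{1..s}. indicator (A j) (x (\<iota> j))) =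
      (\<Sum>\<iota>\<in>inj_maps {1..s} I. if \<forall>j\<in>{1..s}. x (\<iota> j) \<in> A j then 1 else 0 :: real)"
      by (intro sum.cong refl) (auto simp: indicator_def prod_zero_iff)
    also have "\<dots> = card ?T" using fI finite_inj_maps[of "{1..s}" I] by (simp add: sum.If_cases Int_def)
    finally show ?thesis using e by (simp add: measure_def)
  qed
  with fI show ?thesis by (rule that)
qed

text \<open>The sign is distributed over the compensated coordinates, one minus for each. This gives
  the product form over coordinates in which the expansion over rows is stated.\<close>

lemma WI_box:
  assumes \<omega>: "\<omega> \<in> space M" and A: "\<And>i. i \<in> {1..q} \<Longrightarrow> A i \<in> sets \<mu>"
  shows "WI q (indicator (\<Pi>\<^sub>E i\<in>{1..q}. A i)) \<omega> =
    (\<Sum>J\<in>Pow {1..q}. (\<Prod>i\<in>{1..q} - J. - measure \<mu> (A i)) *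
       measure (factorial_measure (\<eta> \<omega>) (card J)) (\<Pi>\<^sub>E r\<in>{1..card J}. A (unrank J r)))"
  unfolding WI_def
proof (intro sum.cong refl)
  fix J assume "J \<in> Pow {1..q}"
  then have J: "J \<subseteq> {1..q}" by simp
  have box: "(\<Pi>\<^sub>E i\<in>{1..q}. A i) \<in> sets (pow_measure \<mu> q)" using A by (intro sets_PiM_I_finite) auto
  have "(\<integral>x. indicator (\<Pi>\<^sub>E i\<in>{1..q}. A i) x \<partial>nu J q \<omega>) = measure (nu J q \<omega>) (\<Pi>\<^sub>E i\<in>{1..q}. A i)"
    using sets.sets_into_space[OF box] by (simp add: Int_absorb2)
  also have "\<dots> = enn2real (emeasure (factorial_measure (\<eta> \<omega>) (card J)) (\<Pi>\<^sub>E r\<in>{1..card J}. A (unrank J r))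
      * (\<Prod>i\<in>{1..q} - J. emeasure \<mu> (A i)))"
    unfolding measure_def nu_def using emeasure_distr_ins_pair_box[OF J sets_fm[OF \<omega>] A] by simp
  also have "\<dots> = measure (factorial_measure (\<eta> \<omega>) (card J)) (\<Pi>\<^sub>E r\<in>{1..card J}. A (unrank J r)) *
      (\<Prod>i\<in>{1..q} - J. measure \<mu> (A i))"
  proof -
    have "enn2real (\<Prod>i\<in>K. emeasure \<mu> (A i)) = (\<Prod>i\<in>K. measure \<mu> (A i))" if "finite K" for K
      using that by (induction K) (auto simp: enn2real_mult measure_def)
    then show ?thesis by (simp add: enn2real_mult measure_def)
  qed
  finally have "(\<integral>x. indicator (\<Pi>\<^sub>E i\<in>{1..q}. A i) x \<partial>nu J q \<omega>) =
     measure (factorial_measure (\<eta> \<omega>) (card J)) (\<Pi>\<^sub>E r\<in>{1..card J}. A (unrank J r)) * (\<Prod>i\<in>{1..q} - J. measure \<mu> (A i))" .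
  moreover have "(\<Prod>i\<in>{1..q} - J. - measure \<mu> (A i)) = (-1) ^ (q - card J) * (\<Prod>i\<in>{1..q} - J. measure \<mu> (A i))"
    using J finite_subset[OF J] by (simp add: prod_uminus card_Diff_subset)
  ultimately show "(-1) ^ (q - card J) * (\<integral>x. indicator (\<Pi>\<^sub>E i\<in>{1..q}. A i) x \<partial>nu J q \<omega>) =
    (\<Prod>i\<in>{1..q} - J. - measure \<mu> (A i)) * measure (factorial_measure (\<eta> \<omega>) (card J)) (\<Pi>\<^sub>E r\<in>{1..card J}. A (unrank J r))"
    by simp
qed

text \<open>Pathwise the product is at most a constant times a power of \<open>box_mass\<close>, and
  these powers are integrable. The pathwise bound is exported as well, since it is the majorant for
  limits in one factor.\<close>

lemma box_supp_prod_integrable: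
  assumes S: "finite S" and g: "\<And>l. l \<in> S \<Longrightarrow> box_supp n (q l) (g l)"
  shows "integrable M (\<lambda>\<omega>. \<Prod>l\<in>S. WI (q l) (g l) \<omega>)"
    and "\<exists>C\<ge>0. \<forall>\<omega>\<in>space M. \<bar>\<Prod>l\<in>S. WI (q l) (g l) \<omega>\<bar> \<le> C * box_mass n \<omega> ^ (\<Sum>l\<in>S. q l)"
proof -
  have "\<forall>l. \<exists>c. l \<in> S \<longrightarrow> 0 \<le> c \<and> (\<forall>x\<in>space (pow_measure \<mu> (q l)). \<bar>g l x\<bar> \<le> c * indicator (Box (q l) n) x)"
  proof
    fix l
    show "\<exists>c. l \<in> S \<longrightarrow> 0 \<le> c \<and> (\<forall>x\<in>space (pow_measure \<mu> (q l)). \<bar>g l x\<bar> \<le> c * indicator (Box (q l) n) x)"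
    proof (cases "l \<in> S")
      case True
      then obtain c where c: "\<forall>x\<in>space (pow_measure \<mu> (q l)). \<bar>g l x\<bar> \<le> c * indicator (Box (q l) n) x"
        using g by (auto simp: box_supp_def)
      have "\<forall>x\<in>space (pow_measure \<mu> (q l)). \<bar>g l x\<bar> \<le> \<bar>c\<bar> * indicator (Box (q l) n) x"
        using c by (auto intro: order_trans[OF _ mult_right_mono[OF abs_ge_self]])
      then show ?thesis by (intro exI[of _ "\<bar>c\<bar>"]) auto
    qed auto
  qed
  from choice[OF this] obtain c where c: "\<And>l. l \<in> S \<Longrightarrow> 0 \<le> c l"
    "\<And>l x. l \<in> S \<Longrightarrow> x \<in> space (pow_measure \<mu> (q l)) \<Longrightarrow> \<bar>g l x\<bar> \<le> c l * indicator (Box (q l) n) x" by auto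
  have gm: "g l \<in> borel_measurable (pow_measure \<mu> (q l))" if "l \<in> S" for l using g that by (auto simp: box_supp_def)
  define C where "C = (\<Prod>l\<in>S. 2 ^ q l * c l)"
  have C0: "0 \<le> C" unfolding C_def using c(1) by (intro prod_nonneg) auto
  have bd: "\<bar>\<Prod>l\<in>S. WI (q l) (g l) \<omega>\<bar> \<le> C * box_mass n \<omega> ^ (\<Sum>l\<in>S. q l)" if \<omega>: "\<omega> \<in> space M" for \<omega>
  proof -
    have "\<bar>\<Prod>l\<in>S. WI (q l) (g l) \<omega>\<bar> = (\<Prod>l\<in>S. \<bar>WI (q l) (g l) \<omega>\<bar>)" by (rule abs_prod)
    also have "\<dots> \<le> (\<Prod>l\<in>S. 2 ^ q l * (c l * box_mass n \<omega> ^ q l))"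
      using WI_bound[OF gm c(2) c(1) \<omega>] by (intro prod_mono) auto
    also have "\<dots> = C * box_mass n \<omega> ^ (\<Sum>l\<in>S. q l)"
      unfolding C_def by (simp add: prod.distrib power_sum mult.assoc)
    finally show ?thesis .
  qed
  then show "\<exists>C\<ge>0. \<forall>\<omega>\<in>space M. \<bar>\<Prod>l\<in>S. WI (q l) (g l) \<omega>\<bar> \<le> C * box_mass n \<omega> ^ (\<Sum>l\<in>S. q l)" using C0 by blast
  show "integrable M (\<lambda>\<omega>. \<Prod>l\<in>S. WI (q l) (g l) \<omega>)"
  proof (rule Bochner_Integration.integrable_bound)
    show "integrable M (\<lambda>\<omega>. C * box_mass n \<omega> ^ (\<Sum>l\<in>S. q l))" using box_mass_integrable by simp
    show "(\<lambda>\<omega>. \<Prod>l\<in>S. WI (q l) (g l) \<omega>) \<in> borel_measurable M"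
      using WI_meas[OF gm] by (intro borel_measurable_prod) auto
    show "AE \<omega> in M. norm (\<Prod>l\<in>S. WI (q l) (g l) \<omega>) \<le> norm (C * box_mass n \<omega> ^ (\<Sum>l\<in>S. q l))"
      using bd by (intro AE_I2) (fastforce intro: order_trans[OF _ abs_ge_self])
  qed
qed

end

lemma disjoint_rows: "1 \<le> l \<Longrightarrow> 1 \<le> l' \<Longrightarrow> l \<noteq> l' \<Longrightarrow> row q l \<inter> row q l' = {}"
  using row_index_row[of l _ q] row_index_row[of l' _ q] by fastforce

lemma prod_rows:
  assumes "finite S" "\<And>l. l \<in> S \<Longrightarrow> 1 \<le> l"
  shows "(\<Prod>l\<in>S. \<Prod>p\<in>row q l. g p) = (\<Prod>p\<in>rows q S. g p)"
  unfolding rows_def using assms disjoint_rows by (subst prod.UNION_disjoint) auto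

lemma indicator_PiE_restrict:
  "indicator (\<Pi>\<^sub>E k\<in>K. A k) (\<lambda>k\<in>K. z k) = (if \<forall>k\<in>K. z k \<in> A k then 1 else 0 :: real)"
  by (auto simp: indicator_def)

lemma prod_indicator: "finite K \<Longrightarrow> (\<Prod>k\<in>K. indicator (A k) (z k)) = (if \<forall>k\<in>K. z k \<in> A k then 1 else 0 :: real)"
  by (auto simp: indicator_def prod_zero_iff)

lemma block_of_pos_in:
  fixes q :: "nat \<Rightarrow> nat"
  assumes "\<sigma> \<in> gparts q S" "l \<in> S" "1 \<le> l" "k \<in> {1..q l}"
  shows "block_of \<sigma> (pos q l k) \<in> \<sigma>"
proof -
  have "pos q l k \<in> rows q S" using pos_in_row[of l k q] assms by (auto simp: rows_def)
  then show ?thesis by (rule block_of_in(1)[OF gparts_partition[OF assms(1)]])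
qed

section \<open>The two sides of the moment formula for boxes\<close>

context poisson_sf begin

text \<open>Moves the coordinates \<open>{1..q l}\<close> to the positions of row \<open>l\<close>,
  so that all factors live on disjoint sets of positions but share the labels
  \<open>I\<close>.\<close>

lemma WI_row_expand:
  assumes \<omega>: "\<omega> \<in> space M" and l: "1 \<le> l"
    and a: "\<And>p. p \<in> row q l \<Longrightarrow> a p \<in> sets \<mu>"
    and rep: "\<And>s A. (\<And>j. j \<in> {1..s} \<Longrightarrow> A j \<in> a ` row q l) \<Longrightarrow>
       measure (factorial_measure (\<eta> \<omega>) s) (\<Pi>\<^sub>E j\<in>{1..s}. A j)
       = (\<Sum>\<iota>\<in>inj_maps {1..s} I. \<Prod>j\<in>{1..s}. indicator (A j) (x (\<iota> j)))"
  shows "WI (q l) (indicator (\<Pi>\<^sub>E k\<in>{1..q l}. a (pos q l k))) \<omega> =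
    (\<Sum>J\<in>Pow (row q l). (\<Prod>p\<in>row q l - J. - measure \<mu> (a p)) *
       (\<Sum>\<iota>\<in>inj_maps J I. \<Prod>p\<in>J. indicator (a p) (x (\<iota> p))))"
proof -
  let ?f = "pos q l"
  have re: "row q l = ?f ` {1..q l}" using row_eq[OF l] .
  have inj: "inj_on ?f A" for A by (rule inj_pos)
  have aA: "a (?f k) \<in> sets \<mu>" if "k \<in> {1..q l}" for k using a re that by auto
  have "WI (q l) (indicator (\<Pi>\<^sub>E k\<in>{1..q l}. a (?f k))) \<omega> =
    (\<Sum>J\<in>Pow {1..q l}. (\<Prod>i\<in>{1..q l} - J. - measure \<mu> (a (?f i))) *
       measure (factorial_measure (\<eta> \<omega>) (card J)) (\<Pi>\<^sub>E r\<in>{1..card J}. a (?f (unrank J r))))"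
    by (rule WI_box[OF \<omega> aA])
  also have "\<dots> = (\<Sum>J\<in>Pow {1..q l}. (\<Prod>p\<in>row q l - ?f ` J. - measure \<mu> (a p)) *
       (\<Sum>\<iota>\<in>inj_maps (?f ` J) I. \<Prod>p\<in>?f ` J. indicator (a p) (x (\<iota> p))))"
  proof (intro sum.cong refl arg_cong2[where f="(*)"])
    fix J assume "J \<in> Pow {1..q l}"
    then have J: "J \<subseteq> {1..q l}" by simp
    have "row q l - ?f ` J = ?f ` ({1..q l} - J)" unfolding re using inj by (rule image_set_diff[symmetric])
    then show "(\<Prod>i\<in>{1..q l} - J. - measure \<mu> (a (?f i))) = (\<Prod>p\<in>row q l - ?f ` J. - measure \<mu> (a p))"
      using inj by (simp add: prod.reindex)
    have b: "bij_betw (\<lambda>r. ?f (unrank J r)) {1..card J} (?f ` J)"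
      using bij_betw_trans[OF unrank(1)[OF J] bij_betw_imageI[OF inj refl]] by (simp add: comp_def)
    have "a (?f (unrank J r)) \<in> a ` row q l" if "r \<in> {1..card J}" for r
    proof -
      have "unrank J r \<in> J" using unrank(1)[OF J] that by (auto simp: bij_betw_def)
      then show ?thesis using J re by auto
    qed
    then have "measure (factorial_measure (\<eta> \<omega>) (card J)) (\<Pi>\<^sub>E r\<in>{1..card J}. a (?f (unrank J r))) =
      (\<Sum>\<iota>\<in>inj_maps {1..card J} I. \<Prod>r\<in>{1..card J}. indicator (a (?f (unrank J r))) (x (\<iota> r)))"
      by (rule rep)
    also have "\<dots> = (\<Sum>\<iota>\<in>inj_maps (?f ` J) I. \<Prod>p\<in>?f ` J. indicator (a p) (x (\<iota> p)))"
      by (rule sum_inj_maps_reindex[OF b, symmetric, where a="\<lambda>p i. indicator (a p) (x i)"])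
    finally show "measure (factorial_measure (\<eta> \<omega>) (card J)) (\<Pi>\<^sub>E r\<in>{1..card J}. a (?f (unrank J r))) =
      (\<Sum>\<iota>\<in>inj_maps (?f ` J) I. \<Prod>p\<in>?f ` J. indicator (a p) (x (\<iota> p)))" .
  qed
  also have "\<dots> = (\<Sum>J\<in>(`) ?f ` Pow {1..q l}. (\<Prod>p\<in>row q l - J. - measure \<mu> (a p)) *
       (\<Sum>\<iota>\<in>inj_maps J I. \<Prod>p\<in>J. indicator (a p) (x (\<iota> p))))"
    using inj_on_image_Pow[OF inj] by (subst sum.reindex) auto
  also have "(`) ?f ` Pow {1..q l} = Pow (row q l)" unfolding re by (rule image_Pow_surj[OF refl])
  finally show ?thesis .
qed

lemma box_moment:
  assumes S: "finite S" "\<And>l. l \<in> S \<Longrightarrow> 1 \<le> l"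
    and a: "\<And>p. p \<in> rows q S \<Longrightarrow> a p \<in> sets \<mu>" "\<And>p. p \<in> rows q S \<Longrightarrow> a p \<subseteq> B n"
  shows "(\<integral>\<omega>. (\<Prod>l\<in>S. WI (q l) (indicator (\<Pi>\<^sub>E k\<in>{1..q l}. a (pos q l k))) \<omega>) \<partial>M) =
    (\<Sum>\<sigma>\<in>gparts2 q S. \<Prod>b\<in>\<sigma>. measure \<mu> (\<Inter>p\<in>b. a p))"
proof -
  define P where "P = rows q S"
  have fP: "finite P" unfolding P_def using S by (intro finite_rows)
  have row_sub: "row q l \<subseteq> P" if "l \<in> S" for l using that by (auto simp: P_def rows_def)
  define D where "D b = (\<Inter>p\<in>b. a p)" for b
  define h where "h \<sigma> = (SOME h. bij_betw h {1..card \<sigma>} (\<sigma> :: nat set set))" for \<sigma>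
  have h: "bij_betw (h \<sigma>) {1..card \<sigma>} \<sigma>" if "finite \<sigma>" for \<sigma>
    unfolding h_def using ex_bij_betw_nat_finite_1[OF that] by (rule someI_ex)
  define F where "F \<sigma> \<omega> = measure (factorial_measure (\<eta> \<omega>) (card \<sigma>)) (\<Pi>\<^sub>E r\<in>{1..card \<sigma>}. D (h \<sigma> r))" for \<sigma> \<omega>
  \<comment> \<open>All intersections over nonempty sets of positions. The family is finite, and one
    choice of points for it serves every partition at once.\<close>
  let ?\<A> = "D ` (Pow P - {{}})"
  have D_sets: "D b \<in> sets \<mu>" "D b \<subseteq> B n" if b: "b \<subseteq> P" "b \<noteq> {}" for b
  proof -
    have "finite b" using b fP finite_subset by auto
    then show "D b \<in> sets \<mu>" unfolding D_def using b a(1) P_def by (intro sets.finite_INT) auto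
    obtain p where "p \<in> b" using b(2) by blast
    then show "D b \<subseteq> B n" unfolding D_def using a(2)[of p] b P_def by blast
  qed
  have blk: "b \<subseteq> P" "b \<noteq> {}" "finite \<sigma>" if "\<sigma> \<in> row_parts (row_index q) J" "J \<subseteq> P" "b \<in> \<sigma>" for b \<sigma> J
  proof -
    have p: "partition_on J \<sigma>" using that by (simp add: row_parts_def)
    show "b \<subseteq> P" "b \<noteq> {}" using p that by (auto simp: partition_on_def)
    show "finite \<sigma>" using p that(2) fP finite_elements finite_subset by metis
  qed
  have fin\<sigma>: "finite \<sigma>" if "\<sigma> \<in> row_parts (row_index q) J" "J \<subseteq> P" for \<sigma> J
    using that fP finite_elements finite_subset by (metis (lifting) mem_Collect_eq row_parts_def)
  have path: "(\<Prod>l\<in>S. WI (q l) (indicator (\<Pi>\<^sub>E k\<in>{1..q l}. a (pos q l k))) \<omega>) =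
     (\<Sum>J\<in>Pow P. (\<Prod>p\<in>P - J. - measure \<mu> (a p)) * (\<Sum>\<sigma>\<in>row_parts (row_index q) J. F \<sigma> \<omega>))"
    if \<omega>: "\<omega> \<in> space M" for \<omega>
  proof -
    have A: "countable ?\<A>" "?\<A> \<subseteq> sets \<mu>" using fP D_sets by (auto intro: countable_finite)
    obtain I :: "(nat \<times> nat) set" and x where fI: "finite I" and rep:
      "\<And>s A. (\<And>j. j \<in> {1..s} \<Longrightarrow> A j \<in> ?\<A> \<and> A j \<subseteq> B n) \<Longrightarrow>
       measure (factorial_measure (\<eta> \<omega>) s) (\<Pi>\<^sub>E j\<in>{1..s}. A j)
       = (\<Sum>\<iota>\<in>inj_maps {1..s} I. \<Prod>j\<in>{1..s}. indicator (A j) (x (\<iota> j)))"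
      using fm_box_rep[OF \<omega> A, of n] by blast
    have a_in: "a p \<in> ?\<A>" if "p \<in> P" for p
    proof -
      have "{p} \<in> Pow P - {{}}" using that by simp
      then have "D {p} \<in> ?\<A>" by (rule imageI)
      then show ?thesis by (simp add: D_def)
    qed
    have F: "F \<sigma> \<omega> = (\<Sum>\<psi>\<in>inj_maps \<sigma> I. \<Prod>b\<in>\<sigma>. \<Prod>p\<in>b. indicator (a p) (x (\<psi> b)))"
      if \<sigma>: "\<sigma> \<in> row_parts (row_index q) J" "J \<subseteq> P" for \<sigma> J
    proof -
      have hb: "h \<sigma> r \<in> \<sigma>" if "r \<in> {1..card \<sigma>}" for r
        using bij_betwE[OF h[OF fin\<sigma>[OF \<sigma>]]] that by (rule bspec)
      have "F \<sigma> \<omega> = (\<Sum>\<iota>\<in>inj_maps {1..card \<sigma>} I. \<Prod>r\<in>{1..card \<sigma>}. indicator (D (h \<sigma> r)) (x (\<iota> r)))"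
        unfolding F_def
      proof (rule rep[of "card \<sigma>" "\<lambda>r. D (h \<sigma> r)"])
        fix r assume "r \<in> {1..card \<sigma>}"
        then have "h \<sigma> r \<subseteq> P" "h \<sigma> r \<noteq> {}" using blk(1,2)[OF \<sigma> hb] by simp_all
        then show "D (h \<sigma> r) \<in> ?\<A> \<and> D (h \<sigma> r) \<subseteq> B n"
          using D_sets(2) by simp
      qed
      also have "\<dots> = (\<Sum>\<psi>\<in>inj_maps \<sigma> I. \<Prod>b\<in>\<sigma>. indicator (D b) (x (\<psi> b)))"
        by (rule sum_inj_maps_reindex[OF h[OF fin\<sigma>[OF \<sigma>]], symmetric, where a="\<lambda>b i. indicator (D b) (x i)"])
      also have "\<dots> = (\<Sum>\<psi>\<in>inj_maps \<sigma> I. \<Prod>b\<in>\<sigma>. \<Prod>p\<in>b. indicator (a p) (x (\<psi> b)))"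
      proof (intro sum.cong prod.cong refl)
        fix \<psi> b assume "b \<in> \<sigma>"
        then have "finite b" using blk[OF \<sigma>] fP finite_subset by blast
        then show "indicator (D b) (x (\<psi> b)) = (\<Prod>p\<in>b. indicator (a p) (x (\<psi> b)) :: real)"
          using prod_indicator[of b a "\<lambda>_. x (\<psi> b)"] by (simp add: D_def indicator_def)
      qed
      finally show ?thesis .
    qed
    have "(\<Prod>l\<in>S. WI (q l) (indicator (\<Pi>\<^sub>E k\<in>{1..q l}. a (pos q l k))) \<omega>) =
      (\<Prod>l\<in>S. \<Sum>J\<in>Pow (row q l). (\<Prod>p\<in>row q l - J. - measure \<mu> (a p)) *
       (\<Sum>\<iota>\<in>inj_maps J I. \<Prod>p\<in>J. indicator (a p) (x (\<iota> p))))"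
    proof (intro prod.cong refl WI_row_expand[OF \<omega>])
      fix l s and A :: "nat \<Rightarrow> 'x set"
      assume l: "l \<in> S" and A: "\<And>j. j \<in> {1..s} \<Longrightarrow> A j \<in> a ` row q l"
      show "measure (factorial_measure (\<eta> \<omega>) s) (\<Pi>\<^sub>E j\<in>{1..s}. A j)
       = (\<Sum>\<iota>\<in>inj_maps {1..s} I. \<Prod>j\<in>{1..s}. indicator (A j) (x (\<iota> j)))"
      proof (rule rep)
        fix j assume "j \<in> {1..s}"
        then obtain p where p: "p \<in> row q l" "A j = a p" using A by blast
        then have "p \<in> P" using row_sub[OF l] by blast
        then show "A j \<in> ?\<A> \<and> A j \<subseteq> B n" using a_in a(2) p P_def by simp
      qed
    next
      fix l p assume "l \<in> S" "p \<in> row q l"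
      then show "a p \<in> sets \<mu>" using a(1) row_sub P_def by blast
    qed (use S in auto)
    also have "\<dots> = (\<Sum>J\<in>Pow (\<Union>l\<in>S. row q l). (\<Prod>p\<in>(\<Union>l\<in>S. row q l) - J. - measure \<mu> (a p)) *
       (\<Sum>\<sigma>\<in>row_parts (row_index q) J. \<Sum>\<psi>\<in>inj_maps \<sigma> I. \<Prod>b\<in>\<sigma>. \<Prod>p\<in>b. indicator (a p) (x (\<psi> b))))"
      using S fI row_index_row
      by (intro prod_rows_expand[where a="\<lambda>p i. indicator (a p) (x i)" and r="row_index q"]) auto
    also have "\<dots> = (\<Sum>J\<in>Pow P. (\<Prod>p\<in>P - J. - measure \<mu> (a p)) * (\<Sum>\<sigma>\<in>row_parts (row_index q) J. F \<sigma> \<omega>))"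
      unfolding P_def[unfolded rows_def, symmetric]
      by (intro sum.cong refl arg_cong2[where f="(*)"]) (auto simp: F)
    finally show ?thesis .
  qed
  have FE: "integrable M (F \<sigma>) \<and> (\<integral>\<omega>. F \<sigma> \<omega> \<partial>M) = (\<Prod>b\<in>\<sigma>. measure \<mu> (D b))"
    if \<sigma>: "\<sigma> \<in> row_parts (row_index q) J" "J \<subseteq> P" for \<sigma> J
  proof -
    have hb: "h \<sigma> r \<in> \<sigma>" if "r \<in> {1..card \<sigma>}" for r
      using bij_betwE[OF h[OF fin\<sigma>[OF \<sigma>]]] that by (rule bspec)
    have Dh: "D (h \<sigma> r) \<in> sets \<mu>" "D (h \<sigma> r) \<subseteq> B n" if "r \<in> {1..card \<sigma>}" for r
      using D_sets[OF blk(1,2)[OF \<sigma> hb[OF that]]] by auto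
    let ?box = "\<Pi>\<^sub>E r\<in>{1..card \<sigma>}. D (h \<sigma> r)"
    have "?box \<in> sets (pow_measure \<mu> (card \<sigma>))" using Dh by (intro sets_PiM_I_finite) auto
    moreover have "?box \<subseteq> Box (card \<sigma>) n" unfolding Box_def using Dh(2) by (intro PiE_mono) auto
    ultimately have fin: "emeasure (factorial_measure (\<eta> \<omega>) (card \<sigma>)) ?box = ennreal (F \<sigma> \<omega>)" if "\<omega> \<in> space M" for \<omega>
      unfolding F_def using fm_Box_fin[OF that, of "card \<sigma>" n] emeasure_mono[of ?box "Box (card \<sigma>) n" "factorial_measure (\<eta> \<omega>) (card \<sigma>)"] Box_sets
      by (intro emeasure_eq_ennreal_measure) (auto simp: sets_fm[OF that] top_unique)
    have Dfin: "emeasure \<mu> (D b) = ennreal (measure \<mu> (D b))" if "b \<in> \<sigma>" for b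
      using emeasure_mono[OF D_sets(2)[OF blk(1,2)[OF \<sigma> that]] B_sets] B_fin[of n]
      by (intro emeasure_eq_ennreal_measure) (auto simp: top_unique)
    note fb = first_moment_box[of "card \<sigma>" "\<lambda>r. D (h \<sigma> r)" n, OF Dh]
    have "(\<integral>\<^sup>+\<omega>. ennreal (F \<sigma> \<omega>) \<partial>M) = (\<integral>\<^sup>+\<omega>. emeasure (factorial_measure (\<eta> \<omega>) (card \<sigma>)) ?box \<partial>M)"
      by (intro nn_integral_cong) (simp add: fin)
    also have "\<dots> = (\<Prod>r\<in>{1..card \<sigma>}. emeasure \<mu> (D (h \<sigma> r)))" by (rule fb(2))
    also have "\<dots> = (\<Prod>b\<in>\<sigma>. emeasure \<mu> (D b))" by (rule prod.reindex_bij_betw[OF h[OF fin\<sigma>[OF \<sigma>]]])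
    also have "\<dots> = (\<Prod>b\<in>\<sigma>. ennreal (measure \<mu> (D b)))" using Dfin by (intro prod.cong) auto
    also have "\<dots> = ennreal (\<Prod>b\<in>\<sigma>. measure \<mu> (D b))" by (intro prod_ennreal) simp
    finally have nn: "(\<integral>\<^sup>+\<omega>. ennreal (F \<sigma> \<omega>) \<partial>M) = ennreal (\<Prod>b\<in>\<sigma>. measure \<mu> (D b))" .
    have Fm: "F \<sigma> \<in> borel_measurable M"
      unfolding F_def[abs_def] measure_def using fb(1) by simp
    have F0: "0 \<le> F \<sigma> \<omega>" for \<omega> by (simp add: F_def)
    have "has_bochner_integral M (F \<sigma>) (\<Prod>b\<in>\<sigma>. measure \<mu> (D b))"
      using nn Fm F0 by (intro has_bochner_integral_nn_integral) (auto intro!: prod_nonneg)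
    then show ?thesis by (auto simp: has_bochner_integral_iff)
  qed
  have "(\<integral>\<omega>. (\<Prod>l\<in>S. WI (q l) (indicator (\<Pi>\<^sub>E k\<in>{1..q l}. a (pos q l k))) \<omega>) \<partial>M) =
     (\<integral>\<omega>. (\<Sum>J\<in>Pow P. (\<Prod>p\<in>P - J. - measure \<mu> (a p)) * (\<Sum>\<sigma>\<in>row_parts (row_index q) J. F \<sigma> \<omega>)) \<partial>M)"
    by (intro Bochner_Integration.integral_cong refl path)
  also have "\<dots> = (\<Sum>J\<in>Pow P. (\<Prod>p\<in>P - J. - measure \<mu> (a p)) * (\<Sum>\<sigma>\<in>row_parts (row_index q) J. \<Prod>b\<in>\<sigma>. measure \<mu> (D b)))"
    using FE by (simp add: Bochner_Integration.integral_sum)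
  \<comment> \<open>As \<open>a p\<close> is \<open>D {p}\<close>, the mass of a compensated
    coordinate is the weight of a singleton block, which is the shape required for
    inclusion-exclusion.\<close>
  also have "\<dots> = (\<Sum>J\<in>Pow P. (-1) ^ card (P - J) * (\<Prod>p\<in>P - J. measure \<mu> (D {p})) *
      (\<Sum>\<sigma>\<in>row_parts (row_index q) J. \<Prod>b\<in>\<sigma>. measure \<mu> (D b)))"
    by (simp add: prod_uminus D_def)
  also have "\<dots> = (\<Sum>\<tau>\<in>{\<tau>\<in>row_parts (row_index q) P. \<forall>b\<in>\<tau>. 2 \<le> card b}. \<Prod>b\<in>\<tau>. measure \<mu> (D b))"
    by (rule row_parts_inclusion_exclusion[OF fP])
  also have "{\<tau>\<in>row_parts (row_index q) P. \<forall>b\<in>\<tau>. 2 \<le> card b} = gparts2 q S"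
    by (simp add: gparts2_def gparts_def P_def)
  finally show ?thesis unfolding D_def .
qed

text \<open>Identifying variables turns the product of indicators into a product over blocks, each
  block requiring its variable to lie in the intersection of its sets. Fubini's theorem then gives
  the masses that appear in \<open>box_moment\<close>.\<close>

lemma contr_box:
  assumes S: "finite S" "\<And>l. l \<in> S \<Longrightarrow> 1 \<le> l" and \<sigma>: "\<sigma> \<in> gparts q S"
    and a: "\<And>p. p \<in> rows q S \<Longrightarrow> a p \<in> sets \<mu>" "\<And>p. p \<in> rows q S \<Longrightarrow> a p \<subseteq> B n"
  shows "(\<integral>y. contr q (\<lambda>l. indicator (\<Pi>\<^sub>E k\<in>{1..q l}. a (pos q l k))) S \<sigma> y \<partial>PiM \<sigma> (\<lambda>_. \<mu>)) =
    (\<Prod>b\<in>\<sigma>. measure \<mu> (\<Inter>p\<in>b. a p))"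
proof -
  have part: "partition_on (rows q S) \<sigma>" by (rule gparts_partition[OF \<sigma>])
  have fP: "finite (rows q S)" using S by (intro finite_rows)
  have f\<sigma>: "finite \<sigma>" using finite_gpart[OF S(1) \<sigma>] .
  have blk: "b \<subseteq> rows q S" "b \<noteq> {}" "finite b" if "b \<in> \<sigma>" for b
    using part that partition_on_finite_block[OF part fP] by (auto simp: partition_on_def)
  have "contr q (\<lambda>l. indicator (\<Pi>\<^sub>E k\<in>{1..q l}. a (pos q l k))) S \<sigma> y = (\<Prod>b\<in>\<sigma>. indicator (\<Inter>p\<in>b. a p) (y b))" for y
  proof -
    have "contr q (\<lambda>l. indicator (\<Pi>\<^sub>E k\<in>{1..q l}. a (pos q l k))) S \<sigma> y =
       (\<Prod>l\<in>S. \<Prod>k\<in>{1..q l}. indicator (a (pos q l k)) (y (block_of \<sigma> (pos q l k))))"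
      unfolding contr_def by (intro prod.cong refl) (simp add: indicator_PiE_restrict prod_indicator)
    also have "\<dots> = (\<Prod>l\<in>S. \<Prod>p\<in>row q l. indicator (a p) (y (block_of \<sigma> p)))"
      using S(2) by (intro prod.cong refl prod.reindex_bij_betw[OF bij_pos]) auto
    also have "\<dots> = (\<Prod>p\<in>rows q S. indicator (a p) (y (block_of \<sigma> p)))" by (rule prod_rows[OF S])
    also have "\<dots> = (\<Prod>b\<in>\<sigma>. \<Prod>p\<in>b. indicator (a p) (y (block_of \<sigma> p)))"
      by (rule prod_partition_on[OF part fP])
    also have "\<dots> = (\<Prod>b\<in>\<sigma>. \<Prod>p\<in>b. indicator (a p) (y b))"
      using block_of_eq[OF part] by (intro prod.cong refl) auto
    also have "\<dots> = (\<Prod>b\<in>\<sigma>. indicator (\<Inter>p\<in>b. a p) (y b))"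
      using blk(3) by (intro prod.cong refl) (auto simp: prod_indicator indicator_def)
    finally show ?thesis .
  qed
  then have "(\<integral>y. contr q (\<lambda>l. indicator (\<Pi>\<^sub>E k\<in>{1..q l}. a (pos q l k))) S \<sigma> y \<partial>PiM \<sigma> (\<lambda>_. \<mu>)) =
    (\<integral>y. (\<Prod>b\<in>\<sigma>. indicator (\<Inter>p\<in>b. a p) (y b)) \<partial>PiM \<sigma> (\<lambda>_. \<mu>))" by simp
  also have "\<dots> = (\<Prod>b\<in>\<sigma>. \<integral>x. indicator (\<Inter>p\<in>b. a p) x \<partial>\<mu>)"
  proof (rule PS.product_integral_prod[OF f\<sigma>])
    fix b assume b: "b \<in> \<sigma>"
    have m: "(\<Inter>p\<in>b. a p) \<in> sets \<mu>" using blk[OF b] a(1) by (intro sets.finite_INT) auto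
    obtain p where "p \<in> b" using blk(2)[OF b] by auto
    then have "(\<Inter>p\<in>b. a p) \<subseteq> B n" using a(2)[of p] blk(1)[OF b] by blast
    then have "emeasure \<mu> (\<Inter>p\<in>b. a p) < \<infinity>" using emeasure_mono[OF _ B_sets] B_fin[of n] by (auto intro: le_less_trans)
    then show "integrable \<mu> (indicator (\<Inter>p\<in>b. a p) :: _ \<Rightarrow> real)" using m by (intro integrable_real_indicator)
  qed
  also have "\<dots> = (\<Prod>b\<in>\<sigma>. measure \<mu> (\<Inter>p\<in>b. a p))"
  proof (intro prod.cong refl)
    fix b assume b: "b \<in> \<sigma>"
    have m: "(\<Inter>p\<in>b. a p) \<in> sets \<mu>" using blk[OF b] a(1) by (intro sets.finite_INT) auto
    then show "(\<integral>x. indicator (\<Inter>p\<in>b. a p) x \<partial>\<mu>) = measure \<mu> (\<Inter>p\<in>b. a p)"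
      using sets.sets_into_space[OF m] by (simp add: Int_absorb2)
  qed
  finally show ?thesis .
qed

section \<open>Measurability, bounds and integrability of contractions\<close>

lemma contr_arg_space:
  assumes S: "l \<in> S" "1 \<le> l" and \<sigma>: "\<sigma> \<in> gparts q S" and y: "y \<in> space (PiM \<sigma> (\<lambda>_. \<mu>))"
  shows "(\<lambda>k\<in>{1..q l}. y (block_of \<sigma> (pos q l k))) \<in> space (pow_measure \<mu> (q l))"
proof -
  have "block_of \<sigma> (pos q l k) \<in> \<sigma>" if "k \<in> {1..q l}" for k
    using block_of_pos_in[OF \<sigma> S that] .
  then show ?thesis using y by (auto simp: space_PiM)
qed

lemma contr_arg_meas:
  assumes S: "l \<in> S" "1 \<le> l" and \<sigma>: "\<sigma> \<in> gparts q S"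
  shows "(\<lambda>y. \<lambda>k\<in>{1..q l}. y (block_of \<sigma> (pos q l k))) \<in> measurable (PiM \<sigma> (\<lambda>_. \<mu>)) (pow_measure \<mu> (q l))"
proof (rule measurable_restrict)
  fix k assume k: "k \<in> {1..q l}"
  have "block_of \<sigma> (pos q l k) \<in> \<sigma>"
    using block_of_pos_in[OF \<sigma> S k] .
  then show "(\<lambda>y. y (block_of \<sigma> (pos q l k))) \<in> measurable (PiM \<sigma> (\<lambda>_. \<mu>)) \<mu>"
    by (rule measurable_component_singleton)
qed

lemma contr_meas:
  assumes S: "\<And>l. l \<in> S \<Longrightarrow> 1 \<le> l" and \<sigma>: "\<sigma> \<in> gparts q S"
    and g: "\<And>l. l \<in> S \<Longrightarrow> g l \<in> borel_measurable (pow_measure \<mu> (q l))"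
  shows "contr q g S \<sigma> \<in> borel_measurable (PiM \<sigma> (\<lambda>_. \<mu>))"
  unfolding contr_def[abs_def]
  using measurable_compose[OF contr_arg_meas[OF _ _ \<sigma>] g] S by (intro borel_measurable_prod) auto

text \<open>Every block meets some row, so all rows have their arguments in their boxes if and only
  if every block variable lies in \<open>B n\<close>.\<close>

lemma contr_bound:
  assumes S: "finite S" "\<And>l. l \<in> S \<Longrightarrow> 1 \<le> l" and \<sigma>: "\<sigma> \<in> gparts q S"
    and c: "\<And>l x. l \<in> S \<Longrightarrow> x \<in> space (pow_measure \<mu> (q l)) \<Longrightarrow> \<bar>g l x\<bar> \<le> c l * indicator (Box (q l) n) x"
    and y: "y \<in> space (PiM \<sigma> (\<lambda>_. \<mu>))"
  shows "\<bar>contr q g S \<sigma> y\<bar> \<le> (\<Prod>l\<in>S. c l) * indicator (\<Pi>\<^sub>E b\<in>\<sigma>. B n) y"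
proof -
  let ?x = "\<lambda>l. \<lambda>k\<in>{1..q l}. y (block_of \<sigma> (pos q l k))"
  have part: "partition_on (rows q S) \<sigma>" by (rule gparts_partition[OF \<sigma>])
  have xs: "?x l \<in> space (pow_measure \<mu> (q l))" if "l \<in> S" for l
    using contr_arg_space[OF that S(2)[OF that] \<sigma> y] .
  have "\<bar>contr q g S \<sigma> y\<bar> = (\<Prod>l\<in>S. \<bar>g l (?x l)\<bar>)" unfolding contr_def by (rule abs_prod)
  also have "\<dots> \<le> (\<Prod>l\<in>S. c l * indicator (Box (q l) n) (?x l))"
    using c xs by (intro prod_mono) auto
  also have "\<dots> = (\<Prod>l\<in>S. c l) * (\<Prod>l\<in>S. indicator (Box (q l) n) (?x l))" by (rule prod.distrib)
  also have "(\<Prod>l\<in>S. indicator (Box (q l) n) (?x l)) = (indicator (\<Pi>\<^sub>E b\<in>\<sigma>. B n) y :: real)"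
  proof -
    have "(\<forall>l\<in>S. ?x l \<in> Box (q l) n) \<longleftrightarrow> y \<in> (\<Pi>\<^sub>E b\<in>\<sigma>. B n)"
    proof
      assume h: "\<forall>l\<in>S. ?x l \<in> Box (q l) n"
      have "y b \<in> B n" if b: "b \<in> \<sigma>" for b
      proof -
        have "b \<noteq> {}" using part b by (auto simp: partition_on_def)
        then obtain p where p: "p \<in> b" by blast
        then have "p \<in> rows q S" using part b by (auto simp: partition_on_def)
        then obtain l where l: "l \<in> S" "p \<in> row q l" by (auto simp: rows_def)
        then obtain k where k: "k \<in> {1..q l}" "p = pos q l k" using row_eq[OF S(2)[OF l(1)]] by auto
        have "?x l k \<in> B n" using bspec[OF h l(1)] k(1) unfolding Box_def by (rule PiE_mem)
        then show ?thesis using k block_of_eq[OF part b p] by simp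
      qed
      then show "y \<in> (\<Pi>\<^sub>E b\<in>\<sigma>. B n)" using y by (auto simp: space_PiM PiE_iff)
    next
      assume h: "y \<in> (\<Pi>\<^sub>E b\<in>\<sigma>. B n)"
      show "\<forall>l\<in>S. ?x l \<in> Box (q l) n"
      proof
        fix l assume l: "l \<in> S"
        have "block_of \<sigma> (pos q l k) \<in> \<sigma>" if "k \<in> {1..q l}" for k
          using block_of_pos_in[OF \<sigma> l S(2)[OF l] that] .
        then show "?x l \<in> Box (q l) n" using h by (auto simp: Box_def)
      qed
    qed
    then show ?thesis unfolding prod_indicator[OF S(1)] by (auto simp: indicator_def)
  qed
  finally show ?thesis .
qed

lemma PiE_B_fin: "finite \<sigma> \<Longrightarrow> emeasure (PiM \<sigma> (\<lambda>_::nat set. \<mu>)) (\<Pi>\<^sub>E b\<in>\<sigma>. B n) < \<infinity>"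
  using B_sets B_fin by (subst PS.emeasure_PiM) (auto simp: power_less_top_ennreal)

lemma PiE_B_sets: "finite \<sigma> \<Longrightarrow> (\<Pi>\<^sub>E b\<in>\<sigma>. B n) \<in> sets (PiM \<sigma> (\<lambda>_::nat set. \<mu>))"
  using B_sets by (intro sets_PiM_I_finite) auto


lemma box_supp_bounds:
  assumes "\<And>l. l \<in> S \<Longrightarrow> box_supp n (q l) (g l)"
  obtains c where "\<And>l. l \<in> S \<Longrightarrow> 0 \<le> c l"
    "\<And>l x. l \<in> S \<Longrightarrow> x \<in> space (pow_measure \<mu> (q l)) \<Longrightarrow> \<bar>g l x\<bar> \<le> c l * indicator (Box (q l) n) x"
proof -
  have "\<forall>l. \<exists>c. l \<in> S \<longrightarrow> 0 \<le> c \<and> (\<forall>x\<in>space (pow_measure \<mu> (q l)). \<bar>g l x\<bar> \<le> c * indicator (Box (q l) n) x)"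
  proof
    fix l
    show "\<exists>c. l \<in> S \<longrightarrow> 0 \<le> c \<and> (\<forall>x\<in>space (pow_measure \<mu> (q l)). \<bar>g l x\<bar> \<le> c * indicator (Box (q l) n) x)"
    proof (cases "l \<in> S")
      case True
      then obtain c where c: "\<forall>x\<in>space (pow_measure \<mu> (q l)). \<bar>g l x\<bar> \<le> c * indicator (Box (q l) n) x"
        using assms by (auto simp: box_supp_def)
      have "\<forall>x\<in>space (pow_measure \<mu> (q l)). \<bar>g l x\<bar> \<le> \<bar>c\<bar> * indicator (Box (q l) n) x"
        using c by (auto intro: order_trans[OF _ mult_right_mono[OF abs_ge_self]])
      then show ?thesis by (intro exI[of _ "\<bar>c\<bar>"]) auto
    qed auto
  qed
  from choice[OF this] obtain c where
    "\<forall>l. l \<in> S \<longrightarrow> 0 \<le> c l \<and> (\<forall>x\<in>space (pow_measure \<mu> (q l)). \<bar>g l x\<bar> \<le> c l * indicator (Box (q l) n) x)"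
    by (elim exE)
  then show ?thesis by (intro that[of c]) auto
qed

lemma contr_integrable:
  assumes S: "finite S" "\<And>l. l \<in> S \<Longrightarrow> 1 \<le> l" and \<sigma>: "\<sigma> \<in> gparts q S"
    and g: "\<And>l. l \<in> S \<Longrightarrow> box_supp n (q l) (g l)"
  shows "integrable (PiM \<sigma> (\<lambda>_. \<mu>)) (contr q g S \<sigma>)"
proof -
  obtain c where c: "\<And>l. l \<in> S \<Longrightarrow> 0 \<le> c l"
    "\<And>l x. l \<in> S \<Longrightarrow> x \<in> space (pow_measure \<mu> (q l)) \<Longrightarrow> \<bar>g l x\<bar> \<le> c l * indicator (Box (q l) n) x"
    using box_supp_bounds[of S n q g] g by blast
  have f\<sigma>: "finite \<sigma>" using finite_gpart[OF S(1) \<sigma>] .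
  show ?thesis
  proof (rule Bochner_Integration.integrable_bound)
    show "integrable (PiM \<sigma> (\<lambda>_. \<mu>)) (\<lambda>y. (\<Prod>l\<in>S. c l) * indicator (\<Pi>\<^sub>E b\<in>\<sigma>. B n) y)"
      using PiE_B_fin[OF f\<sigma>] PiE_B_sets[OF f\<sigma>] by (intro integrable_mult_right integrable_real_indicator)
    show "contr q g S \<sigma> \<in> borel_measurable (PiM \<sigma> (\<lambda>_. \<mu>))"
      using g by (intro contr_meas S \<sigma>) (auto simp: box_supp_def)
    show "AE y in PiM \<sigma> (\<lambda>_. \<mu>). norm (contr q g S \<sigma> y) \<le> norm ((\<Prod>l\<in>S. c l) * indicator (\<Pi>\<^sub>E b\<in>\<sigma>. B n) y)"
      using contr_bound[OF S \<sigma> c(2)] by (intro AE_I2) (auto intro: order_trans[OF _ abs_ge_self])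
  qed
qed

section \<open>The moment formula for simple functions\<close>

text \<open>Kept as a predicate in \<open>g\<close> because it is extended one factor at a time:
  with the other factors fixed, both sides are linear in a factor and continuous under bounded
  pointwise limits within a box.\<close>

definition moment_formula :: "(nat \<Rightarrow> nat) \<Rightarrow> nat set \<Rightarrow> (nat \<Rightarrow> (nat \<Rightarrow> 'x) \<Rightarrow> real) \<Rightarrow> bool" where
  "moment_formula q S g \<longleftrightarrow> (\<integral>\<omega>. (\<Prod>l\<in>S. WI (q l) (g l) \<omega>) \<partial>M) =
     (\<Sum>\<sigma>\<in>gparts2 q S. \<integral>y. contr q g S \<sigma> y \<partial>PiM \<sigma> (\<lambda>_. \<mu>))"

lemma box_supp_lin: "box_supp n q h1 \<Longrightarrow> box_supp n q h2 \<Longrightarrow> box_supp n q (\<lambda>x. a * h1 x + b * h2 x)"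
proof -
  assume h: "box_supp n q h1" "box_supp n q h2"
  then obtain c1 c2 where c: "\<And>x. x \<in> space (pow_measure \<mu> q) \<Longrightarrow> \<bar>h1 x\<bar> \<le> c1 * indicator (Box q n) x"
    "\<And>x. x \<in> space (pow_measure \<mu> q) \<Longrightarrow> \<bar>h2 x\<bar> \<le> c2 * indicator (Box q n) x" by (auto simp: box_supp_def)
  have "\<bar>a * h1 x + b * h2 x\<bar> \<le> (\<bar>a\<bar> * c1 + \<bar>b\<bar> * c2) * indicator (Box q n) x"
    if "x \<in> space (pow_measure \<mu> q)" for x
  proof -
    have "\<bar>a * h1 x + b * h2 x\<bar> \<le> \<bar>a\<bar> * \<bar>h1 x\<bar> + \<bar>b\<bar> * \<bar>h2 x\<bar>"
      using abs_triangle_ineq[of "a * h1 x" "b * h2 x"] by (simp add: abs_mult)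
    also have "\<dots> \<le> \<bar>a\<bar> * (c1 * indicator (Box q n) x) + \<bar>b\<bar> * (c2 * indicator (Box q n) x)"
      using c that by (intro add_mono mult_left_mono) auto
    finally show ?thesis by (simp add: algebra_simps)
  qed
  then show ?thesis using h by (auto simp: box_supp_def)
qed

lemma box_supp_indicator: "C \<in> sets (pow_measure \<mu> q) \<Longrightarrow> C \<subseteq> Box q n \<Longrightarrow> box_supp n q (indicator C)"
  unfolding box_supp_def by (auto intro!: exI[of _ 1] split: split_indicator)

lemma contr_upd:
  assumes "finite S" "l0 \<in> S"
  shows "contr q (g(l0 := h)) S \<sigma> y = h (\<lambda>k\<in>{1..q l0}. y (block_of \<sigma> (pos q l0 k))) *
    (\<Prod>l\<in>S - {l0}. g l (\<lambda>k\<in>{1..q l}. y (block_of \<sigma> (pos q l k))))"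
  unfolding contr_def using assms by (subst prod.remove[of S l0]) (auto intro!: prod.cong)

lemma WI_upd:
  assumes "finite S" "l0 \<in> S"
  shows "(\<Prod>l\<in>S. WI (q l) ((g(l0 := h)) l) \<omega>) = WI (q l0) h \<omega> * (\<Prod>l\<in>S - {l0}. WI (q l) (g l) \<omega>)"
  using assms by (subst prod.remove[of S l0]) (auto intro!: prod.cong)

lemma gparts2D: "\<sigma> \<in> gparts2 q S \<Longrightarrow> \<sigma> \<in> gparts q S" by (simp add: gparts2_def)

lemma moment_formula_lin:
  assumes S: "finite S" "\<And>l. l \<in> S \<Longrightarrow> 1 \<le> l" "l0 \<in> S"
    and g: "\<And>l. l \<in> S - {l0} \<Longrightarrow> box_supp n (q l) (g l)"
    and h: "box_supp n (q l0) h1" "box_supp n (q l0) h2"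
    and T: "moment_formula q S (g(l0 := h1))" "moment_formula q S (g(l0 := h2))"
  shows "moment_formula q S (g(l0 := \<lambda>x. a * h1 x + b * h2 x))"
proof -
  have bu: "box_supp n (q l) ((g(l0 := h)) l)" if "l \<in> S" "box_supp n (q l0) h" for l h
    using that g by (cases "l = l0") auto
  have i1: "integrable M (\<lambda>\<omega>. \<Prod>l\<in>S. WI (q l) ((g(l0 := h1)) l) \<omega>)"
    by (rule box_supp_prod_integrable(1)[of S n q "g(l0 := h1)", OF S(1) bu[OF _ h(1)]])
  have i2: "integrable M (\<lambda>\<omega>. \<Prod>l\<in>S. WI (q l) ((g(l0 := h2)) l) \<omega>)"
    by (rule box_supp_prod_integrable(1)[of S n q "g(l0 := h2)", OF S(1) bu[OF _ h(2)]])
  have "(\<integral>\<omega>. (\<Prod>l\<in>S. WI (q l) ((g(l0 := \<lambda>x. a * h1 x + b * h2 x)) l) \<omega>) \<partial>M) =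
    (\<integral>\<omega>. a * (\<Prod>l\<in>S. WI (q l) ((g(l0 := h1)) l) \<omega>) + b * (\<Prod>l\<in>S. WI (q l) ((g(l0 := h2)) l) \<omega>) \<partial>M)"
  proof (intro Bochner_Integration.integral_cong refl)
    fix \<omega> assume \<omega>: "\<omega> \<in> space M"
    have "WI (q l0) (\<lambda>x. a * h1 x + b * h2 x) \<omega> = a * WI (q l0) h1 \<omega> + b * WI (q l0) h2 \<omega>"
      using box_supp_integrable[OF h(1) _ \<omega>] box_supp_integrable[OF h(2) _ \<omega>] by (intro WI_lin) auto
    then show "(\<Prod>l\<in>S. WI (q l) ((g(l0 := \<lambda>x. a * h1 x + b * h2 x)) l) \<omega>) =
      a * (\<Prod>l\<in>S. WI (q l) ((g(l0 := h1)) l) \<omega>) + b * (\<Prod>l\<in>S. WI (q l) ((g(l0 := h2)) l) \<omega>)"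
      unfolding WI_upd[OF S(1,3)] by (simp add: algebra_simps)
  qed
  also have "\<dots> = a * (\<integral>\<omega>. (\<Prod>l\<in>S. WI (q l) ((g(l0 := h1)) l) \<omega>) \<partial>M)
      + b * (\<integral>\<omega>. (\<Prod>l\<in>S. WI (q l) ((g(l0 := h2)) l) \<omega>) \<partial>M)"
    using i1 i2 by (subst Bochner_Integration.integral_add) auto
  also have "\<dots> = (\<Sum>\<sigma>\<in>gparts2 q S. a * (\<integral>y. contr q (g(l0 := h1)) S \<sigma> y \<partial>PiM \<sigma> (\<lambda>_. \<mu>))
      + b * (\<integral>y. contr q (g(l0 := h2)) S \<sigma> y \<partial>PiM \<sigma> (\<lambda>_. \<mu>)))"
    using T unfolding moment_formula_def by (simp add: sum.distrib sum_distrib_left)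
  also have "\<dots> = (\<Sum>\<sigma>\<in>gparts2 q S. \<integral>y. contr q (g(l0 := \<lambda>x. a * h1 x + b * h2 x)) S \<sigma> y \<partial>PiM \<sigma> (\<lambda>_. \<mu>))"
  proof (intro sum.cong refl)
    fix \<sigma> assume "\<sigma> \<in> gparts2 q S"
    then have \<sigma>: "\<sigma> \<in> gparts q S" by (rule gparts2D)
    have "(\<lambda>y. contr q (g(l0 := \<lambda>x. a * h1 x + b * h2 x)) S \<sigma> y) =
      (\<lambda>y. a * contr q (g(l0 := h1)) S \<sigma> y + b * contr q (g(l0 := h2)) S \<sigma> y)"
      unfolding contr_upd[OF S(1,3)] by (simp add: algebra_simps)
    moreover have "integrable (PiM \<sigma> (\<lambda>_. \<mu>)) (contr q (g(l0 := h1)) S \<sigma>)"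
      by (rule contr_integrable[OF S(1,2) \<sigma> bu[OF _ h(1)]])
    moreover have "integrable (PiM \<sigma> (\<lambda>_. \<mu>)) (contr q (g(l0 := h2)) S \<sigma>)"
      by (rule contr_integrable[OF S(1,2) \<sigma> bu[OF _ h(2)]])
    ultimately show "a * (\<integral>y. contr q (g(l0 := h1)) S \<sigma> y \<partial>PiM \<sigma> (\<lambda>_. \<mu>))
      + b * (\<integral>y. contr q (g(l0 := h2)) S \<sigma> y \<partial>PiM \<sigma> (\<lambda>_. \<mu>)) =
      (\<integral>y. contr q (g(l0 := \<lambda>x. a * h1 x + b * h2 x)) S \<sigma> y \<partial>PiM \<sigma> (\<lambda>_. \<mu>))"
      by simp
  qed
  finally show ?thesis unfolding moment_formula_def .
qed

text \<open>Dominated convergence on both sides. On the left the majorant is a power of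
  \<open>box_mass\<close>; on the right it is the contraction in which the varying factor is
  replaced by the indicator of the box.\<close>

lemma moment_formula_lim:
  assumes S: "finite S" "\<And>l. l \<in> S \<Longrightarrow> 1 \<le> l" "l0 \<in> S"
    and g: "\<And>l. l \<in> S - {l0} \<Longrightarrow> box_supp n (q l) (g l)"
    and hm: "\<And>j. h j \<in> borel_measurable (pow_measure \<mu> (q l0))" "h' \<in> borel_measurable (pow_measure \<mu> (q l0))"
    and hb: "\<And>j x. x \<in> space (pow_measure \<mu> (q l0)) \<Longrightarrow> \<bar>h j x\<bar> \<le> indicator (Box (q l0) n) x"
    and lim: "\<And>x. x \<in> space (pow_measure \<mu> (q l0)) \<Longrightarrow> (\<lambda>j. h j x) \<longlonglongrightarrow> h' x"
    and T: "\<And>j. moment_formula q S (g(l0 := h j))"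
  shows "moment_formula q S (g(l0 := h'))"
proof -
  let ?Z = "\<lambda>\<omega>. \<Prod>l\<in>S - {l0}. WI (q l) (g l) \<omega>"
  let ?H = "\<lambda>x. indicator (Box (q l0) n) x :: real"
  have H: "box_supp n (q l0) ?H" by (intro box_supp_indicator) auto
  have Zb: "\<exists>C\<ge>0. \<forall>\<omega>\<in>space M. \<bar>?Z \<omega>\<bar> \<le> C * box_mass n \<omega> ^ (\<Sum>l\<in>S - {l0}. q l)"
    using g S(1) by (intro box_supp_prod_integrable(2)) auto
  then obtain C where C: "0 \<le> C" "\<And>\<omega>. \<omega> \<in> space M \<Longrightarrow> \<bar>?Z \<omega>\<bar> \<le> C * box_mass n \<omega> ^ (\<Sum>l\<in>S - {l0}. q l)" by auto
  have Zm: "?Z \<in> borel_measurable M"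
    using g by (intro borel_measurable_prod WI_meas) (auto simp: box_supp_def)
  have 1: "(\<lambda>j. \<integral>\<omega>. (\<Prod>l\<in>S. WI (q l) ((g(l0 := h j)) l) \<omega>) \<partial>M) \<longlonglongrightarrow> (\<integral>\<omega>. (\<Prod>l\<in>S. WI (q l) ((g(l0 := h')) l) \<omega>) \<partial>M)"
    unfolding WI_upd[OF S(1,3)]
  proof (rule integral_dominated_convergence)
    show "(\<lambda>\<omega>. WI (q l0) h' \<omega> * ?Z \<omega>) \<in> borel_measurable M"
      "(\<lambda>\<omega>. WI (q l0) (h j) \<omega> * ?Z \<omega>) \<in> borel_measurable M" for j
      using hm Zm by (auto intro!: borel_measurable_times WI_meas)
    show "integrable M (\<lambda>\<omega>. (2 ^ q l0 * C) * box_mass n \<omega> ^ (q l0 + (\<Sum>l\<in>S - {l0}. q l)))"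
      using box_mass_integrable by simp
    show "AE \<omega> in M. (\<lambda>j. WI (q l0) (h j) \<omega> * ?Z \<omega>) \<longlonglongrightarrow> WI (q l0) h' \<omega> * ?Z \<omega>"
    proof (intro AE_I2 tendsto_mult tendsto_const)
      fix \<omega> assume \<omega>: "\<omega> \<in> space M"
      show "(\<lambda>j. WI (q l0) (h j) \<omega>) \<longlonglongrightarrow> WI (q l0) h' \<omega>"
        using hb by (intro WI_limit[OF \<omega>, where h="?H"] hm lim box_supp_integrable[OF H _ \<omega>]) auto
    qed
    show "AE \<omega> in M. norm (WI (q l0) (h j) \<omega> * ?Z \<omega>) \<le> (2 ^ q l0 * C) * box_mass n \<omega> ^ (q l0 + (\<Sum>l\<in>S - {l0}. q l))" for j
    proof (rule AE_I2)
      fix \<omega> assume \<omega>: "\<omega> \<in> space M"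
      have "\<bar>WI (q l0) (h j) \<omega>\<bar> \<le> 2 ^ q l0 * (1 * box_mass n \<omega> ^ q l0)"
        using hb by (intro WI_bound[OF hm(1) _ _ \<omega>]) auto
      then have "\<bar>WI (q l0) (h j) \<omega>\<bar> * \<bar>?Z \<omega>\<bar> \<le> (2 ^ q l0 * (1 * box_mass n \<omega> ^ q l0)) * (C * box_mass n \<omega> ^ (\<Sum>l\<in>S - {l0}. q l))"
        using C(2)[OF \<omega>] box_mass_nonneg by (intro mult_mono) auto
      then show "norm (WI (q l0) (h j) \<omega> * ?Z \<omega>) \<le> (2 ^ q l0 * C) * box_mass n \<omega> ^ (q l0 + (\<Sum>l\<in>S - {l0}. q l))"
        by (simp add: abs_mult power_add algebra_simps)
    qed
  qed
  have 2: "(\<lambda>j. \<Sum>\<sigma>\<in>gparts2 q S. \<integral>y. contr q (g(l0 := h j)) S \<sigma> y \<partial>PiM \<sigma> (\<lambda>_. \<mu>))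
     \<longlonglongrightarrow> (\<Sum>\<sigma>\<in>gparts2 q S. \<integral>y. contr q (g(l0 := h')) S \<sigma> y \<partial>PiM \<sigma> (\<lambda>_. \<mu>))"
  proof (intro tendsto_sum)
    fix \<sigma> assume "\<sigma> \<in> gparts2 q S"
    then have \<sigma>: "\<sigma> \<in> gparts q S" by (rule gparts2D)
    have gm: "(g(l0 := u)) l \<in> borel_measurable (pow_measure \<mu> (q l))"
      if "l \<in> S" "u \<in> borel_measurable (pow_measure \<mu> (q l0))" for u l
      using that g by (auto simp: box_supp_def)
    show "(\<lambda>j. \<integral>y. contr q (g(l0 := h j)) S \<sigma> y \<partial>PiM \<sigma> (\<lambda>_. \<mu>)) \<longlonglongrightarrow> (\<integral>y. contr q (g(l0 := h')) S \<sigma> y \<partial>PiM \<sigma> (\<lambda>_. \<mu>))"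
    proof (rule integral_dominated_convergence)
      show "contr q (g(l0 := h')) S \<sigma> \<in> borel_measurable (PiM \<sigma> (\<lambda>_. \<mu>))"
        by (rule contr_meas[OF S(2) \<sigma> gm[OF _ hm(2)]])
      show "contr q (g(l0 := h j)) S \<sigma> \<in> borel_measurable (PiM \<sigma> (\<lambda>_. \<mu>))" for j
        by (rule contr_meas[OF S(2) \<sigma> gm[OF _ hm(1)]])
      have "integrable (PiM \<sigma> (\<lambda>_. \<mu>)) (contr q (g(l0 := ?H)) S \<sigma>)"
      proof (rule contr_integrable[OF S(1,2) \<sigma>])
        show "box_supp n (q l) ((g(l0 := ?H)) l)" if "l \<in> S" for l using that g H by (cases "l = l0") auto
      qed
      then show "integrable (PiM \<sigma> (\<lambda>_. \<mu>)) (\<lambda>y. \<bar>contr q (g(l0 := ?H)) S \<sigma> y\<bar>)" by (rule integrable_abs)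
      show "AE y in PiM \<sigma> (\<lambda>_. \<mu>). (\<lambda>j. contr q (g(l0 := h j)) S \<sigma> y) \<longlonglongrightarrow> contr q (g(l0 := h')) S \<sigma> y"
        unfolding contr_upd[OF S(1,3)]
        by (intro AE_I2 tendsto_mult tendsto_const lim contr_arg_space[OF S(3) S(2)[OF S(3)] \<sigma>])
      show "AE y in PiM \<sigma> (\<lambda>_. \<mu>). norm (contr q (g(l0 := h j)) S \<sigma> y) \<le> \<bar>contr q (g(l0 := ?H)) S \<sigma> y\<bar>" for j
        unfolding contr_upd[OF S(1,3)] real_norm_def abs_mult
        using hb contr_arg_space[OF S(3) S(2)[OF S(3)] \<sigma>]
        by (intro AE_I2 mult_right_mono) auto
    qed
  qed
  show ?thesis unfolding moment_formula_def
    by (rule LIMSEQ_unique[OF 1]) (use 2 T in \<open>simp add: moment_formula_def\<close>)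
qed

lemma moment_formula_cong:
  assumes "\<And>l. l \<in> S \<Longrightarrow> 1 \<le> l" "\<And>l x. l \<in> S \<Longrightarrow> x \<in> space (pow_measure \<mu> (q l)) \<Longrightarrow> g l x = g' l x"
    "moment_formula q S g"
  shows "moment_formula q S g'"
proof -
  have 1: "WI (q l) (g l) \<omega> = WI (q l) (g' l) \<omega>" if "l \<in> S" for l \<omega>
    unfolding WI_def using assms(2)[OF that]
    by (intro sum.cong refl arg_cong2[where f="(*)"] Bochner_Integration.integral_cong) auto
  have 2: "(\<integral>y. contr q g S \<sigma> y \<partial>PiM \<sigma> (\<lambda>_. \<mu>)) = (\<integral>y. contr q g' S \<sigma> y \<partial>PiM \<sigma> (\<lambda>_. \<mu>))" if "\<sigma> \<in> gparts2 q S" for \<sigma>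
    unfolding contr_def using contr_arg_space[OF _ assms(1) gparts2D[OF that]] assms(2)
    by (intro Bochner_Integration.integral_cong prod.cong refl) auto
  show ?thesis using assms(3) unfolding moment_formula_def using 1 2 by (simp cong: prod.cong sum.cong)
qed

text \<open>A Dynkin class argument in the factor \<open>l0\<close>. Complements are taken within
  the box and follow by linearity; a disjoint union is the limit of its finite partial
  unions.\<close>

lemma moment_formula_set:
  assumes S: "finite S" "\<And>l. l \<in> S \<Longrightarrow> 1 \<le> l" "l0 \<in> S"
    and g: "\<And>l. l \<in> S - {l0} \<Longrightarrow> box_supp n (q l) (g l)"
    and box: "\<And>A. (\<And>k. k \<in> {1..q l0} \<Longrightarrow> A k \<in> sets \<mu> \<and> A k \<subseteq> B n) \<Longrightarrow>
      moment_formula q S (g(l0 := indicator (\<Pi>\<^sub>E k\<in>{1..q l0}. A k)))"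
    and C: "C \<in> sets (pow_measure \<mu> (q l0))"
  shows "moment_formula q S (g(l0 := indicator (C \<inter> Box (q l0) n)))"
proof -
  let ?s = "q l0"
  let ?\<Omega> = "\<Pi>\<^sub>E j\<in>{1..?s}. space \<mu>"
  let ?G = "{\<Pi>\<^sub>E j\<in>{1..?s}. X j |X. X \<in> {1..?s} \<rightarrow> sets \<mu>}"
  let ?T = "\<lambda>h. moment_formula q S (g(l0 := h))"
  have G: "?G = prod_algebra {1..?s} (\<lambda>_. \<mu>)" by (subst prod_algebra_eq_finite) auto
  have sets_eq: "sets (pow_measure \<mu> ?s) = sigma_sets ?\<Omega> ?G" unfolding sets_PiM G ..
  have stable: "Int_stable ?G" unfolding G by (rule Int_stable_prod_algebra)
  have sub: "?G \<subseteq> Pow ?\<Omega>" unfolding G by (rule prod_algebra_sets_into_space)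
  have bs: "box_supp n ?s (indicator (A \<inter> Box ?s n))" if "A \<in> sets (pow_measure \<mu> ?s)" for A
    using that by (intro box_supp_indicator) auto
  have full: "?T (indicator (Box ?s n))"
    unfolding Box_def using B_sets by (intro box) auto
  have bfull: "box_supp n ?s (indicator (Box ?s n))" by (intro box_supp_indicator) auto
  have zero: "?T (\<lambda>x. 0)"
    using moment_formula_lin[OF S g bfull bfull full full, of 0 0] by simp
  from stable sub C[unfolded sets_eq] show ?thesis
  proof (induction rule: sigma_sets_induct_disjoint)
    case (basic A)
    then obtain X where X: "A = (\<Pi>\<^sub>E j\<in>{1..?s}. X j)" "X \<in> {1..?s} \<rightarrow> sets \<mu>" by blast
    have e: "A \<inter> Box ?s n = (\<Pi>\<^sub>E j\<in>{1..?s}. X j \<inter> B n)" unfolding X Box_def by (rule PiE_Int)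
    show ?case unfolding e using B_sets funcset_mem[OF X(2)] by (intro box) auto
  next
    case empty
    have "indicator ({} \<inter> Box ?s n) = (\<lambda>x. 0 :: real)" by (auto simp: fun_eq_iff)
    then show ?case using zero by (simp only:)
  next
    case (compl A)
    have A: "A \<in> sets (pow_measure \<mu> ?s)" using compl(1) by (simp add: sets_eq)
    have "indicator ((?\<Omega> - A) \<inter> Box ?s n) = (\<lambda>x. 1 * indicator (Box ?s n) x + (-1) * indicator (A \<inter> Box ?s n) x :: real)"
      using sets.sets_into_space[OF Box_sets, of ?s n] by (auto simp: fun_eq_iff space_PiM split: split_indicator)
    then show ?case using moment_formula_lin[OF S g bfull bs[OF A] full compl(2), of 1 "-1"] by (simp only:)
  next
    case (union A)
    have A: "A i \<in> sets (pow_measure \<mu> ?s)" for i using union(2) by (auto simp: sets_eq)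
    define U where "U j = (\<Union>i<j. A i \<inter> Box ?s n)" for j :: nat
    have U: "U j \<in> sets (pow_measure \<mu> ?s)" "U j \<subseteq> Box ?s n" for j using A by (auto simp: U_def)
    have TU: "?T (indicator (U j))" for j
    proof (induction j)
      case 0
      have "indicator (U 0) = (\<lambda>x. 0 :: real)" by (auto simp: fun_eq_iff U_def)
      then show ?case using zero by (simp only:)
    next
      case (Suc j)
      have "A i \<inter> A j = {}" if "i < j" for i using union(1) that by (simp add: disjoint_family_on_def)
      then have dj: "U j \<inter> (A j \<inter> Box ?s n) = {}" unfolding U_def by blast
      have "U (Suc j) = U j \<union> (A j \<inter> Box ?s n)" by (simp add: U_def lessThan_Suc Un_commute)
      then have "indicator (U (Suc j)) = (\<lambda>x. 1 * indicator (U j) x + 1 * indicator (A j \<inter> Box ?s n) x :: real)"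
        using indicator_add[OF dj, where ?'b=real] by (simp only: mult_1)
      then show ?case
        using moment_formula_lin[OF S g box_supp_indicator[OF U] bs[OF A] Suc union(3), of 1 1 j] by (simp only:)
    qed
    have e: "\<Union> (range A) \<inter> Box ?s n = (\<Union>i. A i \<inter> Box ?s n)" by auto
    show ?case unfolding e
    proof (rule moment_formula_lim[OF S g, where h="\<lambda>j. indicator (U j)"])
      show "\<bar>indicator (U j) x :: real\<bar> \<le> indicator (Box ?s n) x" for j x using U(2)[of j] by (auto split: split_indicator)
      show "(\<lambda>j. indicator (U j) x :: real) \<longlonglongrightarrow> indicator (\<Union>i. A i \<inter> Box ?s n) x" for x
        unfolding U_def by (rule LIMSEQ_indicator_UN)
      show "indicator (U j) \<in> borel_measurable (pow_measure \<mu> ?s)" for j using U by simp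
      show "indicator (\<Union>i. A i \<inter> Box ?s n) \<in> borel_measurable (pow_measure \<mu> ?s)"
        using A by (intro borel_measurable_indicator sets.countable_UN) auto
    qed (use TU in auto)
  qed
qed

lemma moment_formula_simple1:
  assumes S: "finite S" "\<And>l. l \<in> S \<Longrightarrow> 1 \<le> l" "l0 \<in> S"
    and g: "\<And>l. l \<in> S - {l0} \<Longrightarrow> box_supp n (q l) (g l)"
    and box: "\<And>A. (\<And>k. k \<in> {1..q l0} \<Longrightarrow> A k \<in> sets \<mu> \<and> A k \<subseteq> B n) \<Longrightarrow>
      moment_formula q S (g(l0 := indicator (\<Pi>\<^sub>E k\<in>{1..q l0}. A k)))"
    and h: "simple_function (pow_measure \<mu> (q l0)) h" "box_supp n (q l0) h"
  shows "moment_formula q S (g(l0 := h))"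
proof -
  let ?P = "pow_measure \<mu> (q l0)" and ?X = "Box (q l0) n"
  define E where "E v = h -` {v} \<inter> space ?P" for v
  have E: "E v \<in> sets ?P" for v unfolding E_def by (rule simple_functionD(2)[OF h(1)])
  have fin: "finite (h ` space ?P)" using h(1) by (rule simple_functionD(1))
  have bs: "box_supp n (q l0) (indicator (E v \<inter> ?X))" for v using E by (intro box_supp_indicator) auto
  have TE: "moment_formula q S (g(l0 := indicator (E v \<inter> ?X)))" for v
    by (rule moment_formula_set[OF S g box E])
  have "moment_formula q S (g(l0 := \<lambda>x. \<Sum>v\<in>V. v * indicator (E v \<inter> ?X) x)) \<and> box_supp n (q l0) (\<lambda>x. \<Sum>v\<in>V. v * indicator (E v \<inter> ?X) x)"
    if "finite V" for V
    using that
  proof induction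
    case empty
    show ?case using moment_formula_lin[OF S g bs bs TE TE, of 0 _ 0] box_supp_lin[OF bs bs, of 0 _ 0] by (simp add: fun_upd_def)
  next
    case (insert v V)
    have "(\<lambda>x. \<Sum>v\<in>insert v V. v * indicator (E v \<inter> ?X) x) =
      (\<lambda>x. v * indicator (E v \<inter> ?X) x + 1 * (\<Sum>v\<in>V. v * indicator (E v \<inter> ?X) x))"
      using sum.insert[OF insert.hyps, of "\<lambda>v. v * indicator (E v \<inter> ?X) x" for x] by (simp only: mult_1)
    then show ?case
      using moment_formula_lin[OF S g bs conjunct2[OF insert.IH] TE conjunct1[OF insert.IH], of v v 1]
        box_supp_lin[OF bs conjunct2[OF insert.IH], of v v 1] by (simp only: simp_thms)
  qed
  from this[OF fin] have T: "moment_formula q S (g(l0 := \<lambda>x. \<Sum>v\<in>h ` space ?P. v * indicator (E v \<inter> ?X) x))" by simp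
  show ?thesis
  proof (rule moment_formula_cong[OF S(2) _ T])
    fix l x assume "l \<in> S" and x: "x \<in> space (pow_measure \<mu> (q l))"
    show "(g(l0 := \<lambda>x. \<Sum>v\<in>h ` space ?P. v * indicator (E v \<inter> ?X) x)) l x = (g(l0 := h)) l x"
    proof (cases "l = l0")
      case True
      then have x: "x \<in> space ?P" using x by simp
      have "(\<Sum>v\<in>h ` space ?P. v * indicator (E v \<inter> ?X) x) = (\<Sum>v\<in>{h x}. v * indicator (E v \<inter> ?X) x)"
        using x fin by (intro sum.mono_neutral_right) (auto simp: E_def)
      also have "\<dots> = h x"
      proof (cases "x \<in> ?X")
        case False
        then have "h x = 0" using h(2) x by (fastforce simp: box_supp_def)
        then show ?thesis by simp
      qed (use x in \<open>simp add: E_def\<close>)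
      finally show ?thesis using True by simp
    qed simp
  qed
qed

text \<open>Induction over the set \<open>U\<close> of factors that are allowed to be general simple
  functions while the others are still indicators of boxes. Each step releases one factor by
  \<open>moment_formula_simple1\<close>.\<close>

theorem moment_formula_simple:
  assumes S: "finite S" "\<And>l. l \<in> S \<Longrightarrow> 1 \<le> l"
    and g: "\<And>l. l \<in> S \<Longrightarrow> simple_function (pow_measure \<mu> (q l)) (g l)" "\<And>l. l \<in> S \<Longrightarrow> box_supp n (q l) (g l)"
  shows "moment_formula q S g"
proof -
  define isbox where "isbox l u \<longleftrightarrow> (\<exists>A. (\<forall>k\<in>{1..q l}. A k \<in> sets \<mu> \<and> A k \<subseteq> B n) \<and> u = indicator (\<Pi>\<^sub>E k\<in>{1..q l}. A k))"
    for l and u :: "(nat \<Rightarrow> 'x) \<Rightarrow> real"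
  have box_box_supp: "box_supp n (q l) u" if u: "isbox l u" for l u
  proof -
    from u obtain A where A: "\<forall>k\<in>{1..q l}. A k \<in> sets \<mu> \<and> A k \<subseteq> B n" "u = indicator (\<Pi>\<^sub>E k\<in>{1..q l}. A k)"
      unfolding isbox_def by (elim exE conjE)
    show ?thesis unfolding A(2) Box_def using A(1) by (intro box_supp_indicator sets_PiM_I_finite) (auto simp: Box_def intro!: PiE_mono)
  qed
  have "\<forall>g. (\<forall>l\<in>U. simple_function (pow_measure \<mu> (q l)) (g l) \<and> box_supp n (q l) (g l)) \<longrightarrow> (\<forall>l\<in>S - U. isbox l (g l)) \<longrightarrow> moment_formula q S g"
    if "finite U" "U \<subseteq> S" for U
    using that
  proof (induction U rule: finite_induct)
    case empty
    show ?case
    proof (intro allI impI)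
      fix g assume "\<forall>l\<in>S - {}. isbox l (g l)"
      then have "\<forall>l. \<exists>A. l \<in> S \<longrightarrow> (\<forall>k\<in>{1..q l}. A k \<in> sets \<mu> \<and> A k \<subseteq> B n) \<and> g l = indicator (\<Pi>\<^sub>E k\<in>{1..q l}. A k)"
        unfolding isbox_def by simp
      from choice[OF this] obtain A where A: "\<forall>l. l \<in> S \<longrightarrow> (\<forall>k\<in>{1..q l}. A l k \<in> sets \<mu> \<and> A l k \<subseteq> B n) \<and> g l = indicator (\<Pi>\<^sub>E k\<in>{1..q l}. A l k)"
        by (elim exE)
      \<comment> \<open>The sides of all boxes are collected in one family indexed by positions, the
        form in which \<open>box_moment\<close> takes them.\<close>
      define a where "a p = A (row_index q p) (p - cum_sizes q (row_index q p - 1))" for p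
      have a_pos: "a (pos q l k) = A l k" if "l \<in> S" "k \<in> {1..q l}" for l k
        using row_index_row[OF S(2)[OF that(1)] pos_in_row[of l k q, OF S(2)[OF that(1)] that(2)]] by (simp add: a_def pos_def)
      have a: "a p \<in> sets \<mu> \<and> a p \<subseteq> B n" if p: "p \<in> rows q S" for p
      proof -
        obtain l where l: "l \<in> S" "p \<in> row q l" using p by (auto simp: rows_def)
        then obtain k where "k \<in> {1..q l}" "p = pos q l k" using row_eq[OF S(2)[OF l(1)]] by auto
        then show ?thesis using a_pos l(1) A by simp
      qed
      have ge: "indicator (\<Pi>\<^sub>E k\<in>{1..q l}. a (pos q l k)) = g l" if "l \<in> S" for l
      proof -
        have "(\<Pi>\<^sub>E k\<in>{1..q l}. a (pos q l k)) = (\<Pi>\<^sub>E k\<in>{1..q l}. A l k)" using a_pos[OF that] by (intro PiE_cong) auto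
        then show ?thesis using A that by simp
      qed
      have "moment_formula q S (\<lambda>l. indicator (\<Pi>\<^sub>E k\<in>{1..q l}. a (pos q l k)))"
        unfolding moment_formula_def using box_moment[OF S, of q a n] a contr_box[OF S gparts2D, of _ q a n] by simp
      then show "moment_formula q S g" by (rule moment_formula_cong[OF S(2), rotated 2]) (simp_all add: ge)
    qed
  next
    case (insert l0 U)
    show ?case
    proof (intro allI impI)
      fix g assume g1: "\<forall>l\<in>insert l0 U. simple_function (pow_measure \<mu> (q l)) (g l) \<and> box_supp n (q l) (g l)"
        and g2: "\<forall>l\<in>S - insert l0 U. isbox l (g l)"
      have "moment_formula q S (g(l0 := g l0))"
      proof (rule moment_formula_simple1[OF S, of l0 n])
        show "l0 \<in> S" using insert.prems by simp
        show "box_supp n (q l) (g l)" if "l \<in> S - {l0}" for l using g1 g2 that box_box_supp by blast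
        show "simple_function (pow_measure \<mu> (q l0)) (g l0)" "box_supp n (q l0) (g l0)" using g1 by auto
        fix A assume A: "\<And>k. k \<in> {1..q l0} \<Longrightarrow> A k \<in> sets \<mu> \<and> A k \<subseteq> B n"
        have "isbox l0 (indicator (\<Pi>\<^sub>E k\<in>{1..q l0}. A k))" unfolding isbox_def using A by blast
        then show "moment_formula q S (g(l0 := indicator (\<Pi>\<^sub>E k\<in>{1..q l0}. A k)))"
          using insert g1 g2 by simp
      qed
      then show "moment_formula q S g" by simp
    qed
  qed
  from this[OF S(1) order_refl] g show ?thesis by simp
qed

end

section \<open>Completeness of \<open>L\<^sup>p\<close> and truncations\<close>

context prob_space begin

text \<open>Where |D| is at most \<epsilon> it is bounded by \<epsilon>; elsewhere |D| is at most
  |D|^p / \<epsilon>^(p - 1). This plays the part of Hoelder's inequality.\<close>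

lemma nn_integral_L1_le_Lp:
  assumes D: "D \<in> borel_measurable M" and p: "1 \<le> p" and \<epsilon>: "0 < \<epsilon>"
  shows "(\<integral>\<^sup>+\<omega>. ennreal \<bar>D \<omega>\<bar> \<partial>M) \<le> ennreal \<epsilon> + ennreal (1 / \<epsilon> ^ (p - 1)) * (\<integral>\<^sup>+\<omega>. ennreal (\<bar>D \<omega>\<bar> ^ p) \<partial>M)"
proof -
  have le: "\<bar>t\<bar> \<le> \<epsilon> + 1 / \<epsilon> ^ (p - 1) * \<bar>t\<bar> ^ p" for t :: real
  proof (cases "\<bar>t\<bar> \<le> \<epsilon>")
    case True
    have "0 \<le> 1 / \<epsilon> ^ (p - 1) * \<bar>t\<bar> ^ p" using \<epsilon> by (intro mult_nonneg_nonneg) auto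
    with True show ?thesis by linarith
  next
    case False
    have "\<epsilon> ^ (p - 1) \<le> \<bar>t\<bar> ^ (p - 1)" using False \<epsilon> by (intro power_mono) auto
    then have "\<bar>t\<bar> * \<epsilon> ^ (p - 1) \<le> \<bar>t\<bar> * \<bar>t\<bar> ^ (p - 1)" by (intro mult_left_mono) auto
    also have "\<dots> = \<bar>t\<bar> ^ p" using p by (cases p) (auto simp: One_nat_def)
    finally have "\<bar>t\<bar> \<le> 1 / \<epsilon> ^ (p - 1) * \<bar>t\<bar> ^ p" using \<epsilon> by (simp add: field_simps)
    then show ?thesis using \<epsilon> by linarith
  qed
  have "(\<integral>\<^sup>+\<omega>. ennreal \<bar>D \<omega>\<bar> \<partial>M) \<le> (\<integral>\<^sup>+\<omega>. ennreal \<epsilon> + ennreal (1 / \<epsilon> ^ (p - 1)) * ennreal (\<bar>D \<omega>\<bar> ^ p) \<partial>M)"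
    using le \<epsilon> by (intro nn_integral_mono) (simp add: ennreal_mult[symmetric] ennreal_plus[symmetric] del: ennreal_plus)
  also have "\<dots> = ennreal \<epsilon> + ennreal (1 / \<epsilon> ^ (p - 1)) * (\<integral>\<^sup>+\<omega>. ennreal (\<bar>D \<omega>\<bar> ^ p) \<partial>M)"
    using D by (simp add: nn_integral_add nn_integral_cmult emeasure_space_1)
  finally show ?thesis .
qed

text \<open>An \<open>L\<^sup>p\<close>-Cauchy sequence is \<open>L\<^sup>1\<close>-Cauchy, hence has an almost surely convergent
  subsequence; Fatou's lemma upgrades its limit to an \<open>L\<^sup>p\<close>-limit.\<close>

lemma Lp_complete:
  fixes X :: "nat \<Rightarrow> 'a \<Rightarrow> real"
  assumes X: "\<And>n. integrable M (X n)" and p: "1 \<le> p"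
    and cauchy: "\<And>\<epsilon>. 0 < \<epsilon> \<Longrightarrow> \<exists>N. \<forall>n\<ge>N. \<forall>k\<ge>N. (\<integral>\<^sup>+\<omega>. ennreal (\<bar>X n \<omega> - X k \<omega>\<bar> ^ p) \<partial>M) \<le> ennreal \<epsilon>"
  obtains Y where "Y \<in> borel_measurable M" "(\<lambda>n. \<integral>\<^sup>+\<omega>. ennreal (\<bar>X n \<omega> - Y \<omega>\<bar> ^ p) \<partial>M) \<longlonglongrightarrow> 0"
proof -
  have Xm[measurable]: "X n \<in> borel_measurable M" for n using X by auto
  have L1: "\<exists>N. \<forall>i\<ge>N. \<forall>j\<ge>N. (LINT \<omega>|M. norm (X i \<omega> - X j \<omega>)) < e" if e: "0 < e" for e
  proof -
    define \<epsilon> where "\<epsilon> = e / 3"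
    have \<epsilon>: "0 < \<epsilon>" using e by (simp add: \<epsilon>_def)
    \<comment> \<open>At this level of smallness the second term of the L^1 bound is at most
      \<epsilon>, and two thirds of \<open>e\<close> remain below \<open>e\<close>.\<close>
    have "0 < \<epsilon> * \<epsilon> ^ (p - 1)" using \<epsilon> by simp
    from cauchy[OF this] obtain N where N: "\<And>n k. n \<ge> N \<Longrightarrow> k \<ge> N \<Longrightarrow>
      (\<integral>\<^sup>+\<omega>. ennreal (\<bar>X n \<omega> - X k \<omega>\<bar> ^ p) \<partial>M) \<le> ennreal (\<epsilon> * \<epsilon> ^ (p - 1))" by blast
    have "(LINT \<omega>|M. norm (X i \<omega> - X j \<omega>)) < e" if ij: "i \<ge> N" "j \<ge> N" for i j
    proof -
      have "(\<integral>\<^sup>+\<omega>. ennreal \<bar>X i \<omega> - X j \<omega>\<bar> \<partial>M) \<le>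
         ennreal \<epsilon> + ennreal (1 / \<epsilon> ^ (p - 1)) * (\<integral>\<^sup>+\<omega>. ennreal (\<bar>X i \<omega> - X j \<omega>\<bar> ^ p) \<partial>M)"
        using p \<epsilon> by (intro nn_integral_L1_le_Lp) auto
      also have "\<dots> \<le> ennreal \<epsilon> + ennreal (1 / \<epsilon> ^ (p - 1)) * ennreal (\<epsilon> * \<epsilon> ^ (p - 1))"
        using N[OF ij] by (intro add_left_mono mult_left_mono) auto
      also have "\<dots> = ennreal (\<epsilon> + \<epsilon>)"
        using \<epsilon> by (simp add: ennreal_mult[symmetric] ennreal_plus[symmetric] del: ennreal_plus)
      finally have "(\<integral>\<^sup>+\<omega>. ennreal \<bar>X i \<omega> - X j \<omega>\<bar> \<partial>M) \<le> ennreal (\<epsilon> + \<epsilon>)" .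
      moreover have "(\<integral>\<^sup>+\<omega>. ennreal \<bar>X i \<omega> - X j \<omega>\<bar> \<partial>M) = ennreal (LINT \<omega>|M. \<bar>X i \<omega> - X j \<omega>\<bar>)"
        using X by (intro nn_integral_eq_integral) auto
      ultimately have "(LINT \<omega>|M. \<bar>X i \<omega> - X j \<omega>\<bar>) \<le> \<epsilon> + \<epsilon>" using \<epsilon> by (simp add: ennreal_le_iff)
      also have "\<dots> < e" using e by (simp add: \<epsilon>_def)
      finally show ?thesis by simp
    qed
    then show ?thesis by blast
  qed
  obtain r where r: "strict_mono r" "AE \<omega> in M. Cauchy (\<lambda>i. X (r i) \<omega>)"
    using cauchy_L1_AE_cauchy_subseq[OF X L1] by blast
  define Y where "Y \<omega> = lim (\<lambda>i. X (r i) \<omega>)" for \<omega>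
  have Ym[measurable]: "Y \<in> borel_measurable M" unfolding Y_def[abs_def] by (rule borel_measurable_lim_metric) measurable
  have lim: "AE \<omega> in M. (\<lambda>i. X (r i) \<omega>) \<longlonglongrightarrow> Y \<omega>"
    using r(2) by eventually_elim (simp add: Y_def Cauchy_convergent_iff convergent_LIMSEQ_iff)
  have "(\<lambda>n. \<integral>\<^sup>+\<omega>. ennreal (\<bar>X n \<omega> - Y \<omega>\<bar> ^ p) \<partial>M) \<longlonglongrightarrow> 0"
  proof (rule order_tendstoI)
    fix e :: ennreal assume e: "0 < e"
    obtain \<epsilon> where \<epsilon>: "0 < \<epsilon>" "ennreal \<epsilon> < e"
    proof -
      obtain z where z: "0 < z" "z < e" using dense[OF e] by auto
      then show ?thesis using that[of "enn2real z"] by (cases z) (auto simp: less_top[symmetric])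
    qed
    from cauchy[OF \<epsilon>(1)] obtain N where N: "\<And>n k. n \<ge> N \<Longrightarrow> k \<ge> N \<Longrightarrow>
      (\<integral>\<^sup>+\<omega>. ennreal (\<bar>X n \<omega> - X k \<omega>\<bar> ^ p) \<partial>M) \<le> ennreal \<epsilon>" by blast
    show "eventually (\<lambda>n. (\<integral>\<^sup>+\<omega>. ennreal (\<bar>X n \<omega> - Y \<omega>\<bar> ^ p) \<partial>M) < e) sequentially"
      unfolding eventually_sequentially
    proof (intro exI allI impI)
      fix n assume n: "N \<le> n"
      have "(\<integral>\<^sup>+\<omega>. ennreal (\<bar>X n \<omega> - Y \<omega>\<bar> ^ p) \<partial>M) = (\<integral>\<^sup>+\<omega>. liminf (\<lambda>i. ennreal (\<bar>X n \<omega> - X (r i) \<omega>\<bar> ^ p)) \<partial>M)"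
      proof (rule nn_integral_cong_AE)
        show "AE \<omega> in M. ennreal (\<bar>X n \<omega> - Y \<omega>\<bar> ^ p) = liminf (\<lambda>i. ennreal (\<bar>X n \<omega> - X (r i) \<omega>\<bar> ^ p))"
          using lim
        proof eventually_elim
          fix \<omega> assume "(\<lambda>i. X (r i) \<omega>) \<longlonglongrightarrow> Y \<omega>"
          then have "(\<lambda>i. ennreal (\<bar>X n \<omega> - X (r i) \<omega>\<bar> ^ p)) \<longlonglongrightarrow> ennreal (\<bar>X n \<omega> - Y \<omega>\<bar> ^ p)"
            by (intro tendsto_ennrealI tendsto_power tendsto_rabs tendsto_diff tendsto_const)
          then show "ennreal (\<bar>X n \<omega> - Y \<omega>\<bar> ^ p) = liminf (\<lambda>i. ennreal (\<bar>X n \<omega> - X (r i) \<omega>\<bar> ^ p))"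
            by (intro lim_imp_Liminf[symmetric]) auto
        qed
      qed
      also have "\<dots> \<le> liminf (\<lambda>i. \<integral>\<^sup>+\<omega>. ennreal (\<bar>X n \<omega> - X (r i) \<omega>\<bar> ^ p) \<partial>M)"
        by (rule nn_integral_liminf) measurable
      also have "\<dots> \<le> liminf (\<lambda>i. ennreal \<epsilon>)"
      proof (rule Liminf_mono)
        have "r i \<ge> N" if "i \<ge> N" for i using seq_suble[OF r(1), of i] that by linarith
        then show "eventually (\<lambda>i. (\<integral>\<^sup>+\<omega>. ennreal (\<bar>X n \<omega> - X (r i) \<omega>\<bar> ^ p) \<partial>M) \<le> ennreal \<epsilon>) sequentially"
          unfolding eventually_sequentially using N[OF n] by blast
      qed
      also have "\<dots> = ennreal \<epsilon>" by (simp add: Liminf_const)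
      also have "\<dots> < e" by (rule \<epsilon>)
      finally show "(\<integral>\<^sup>+\<omega>. ennreal (\<bar>X n \<omega> - Y \<omega>\<bar> ^ p) \<partial>M) < e" .
    qed
  qed simp
  with Ym show ?thesis by (rule that)
qed

lemma L1_limit_of_Lp:
  assumes X: "\<And>n. X n \<in> borel_measurable M" and Y: "Y \<in> borel_measurable M" and p: "1 \<le> p"
    and lim: "(\<lambda>n. \<integral>\<^sup>+\<omega>. ennreal (\<bar>X n \<omega> - Y \<omega> :: real\<bar> ^ p) \<partial>M) \<longlonglongrightarrow> 0" and \<epsilon>: "0 < (\<epsilon>::real)"
  shows "eventually (\<lambda>n. (\<integral>\<^sup>+\<omega>. ennreal \<bar>X n \<omega> - Y \<omega>\<bar> \<partial>M) \<le> ennreal \<epsilon>) sequentially"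
proof -
  define \<delta> where "\<delta> = \<epsilon> / 2"
  have \<delta>: "0 < \<delta>" using \<epsilon> by (simp add: \<delta>_def)
  have "0 < ennreal (\<delta> * \<delta> ^ (p - 1))" using \<delta> by simp
  from order_tendstoD(2)[OF lim this] show ?thesis
  proof eventually_elim
    case (elim n)
    have "(\<integral>\<^sup>+\<omega>. ennreal \<bar>X n \<omega> - Y \<omega>\<bar> \<partial>M) \<le>
       ennreal \<delta> + ennreal (1 / \<delta> ^ (p - 1)) * (\<integral>\<^sup>+\<omega>. ennreal (\<bar>X n \<omega> - Y \<omega>\<bar> ^ p) \<partial>M)"
      using p \<delta> X Y by (intro nn_integral_L1_le_Lp) auto
    also have "\<dots> \<le> ennreal \<delta> + ennreal (1 / \<delta> ^ (p - 1)) * ennreal (\<delta> * \<delta> ^ (p - 1))"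
      using elim by (intro add_left_mono mult_left_mono) auto
    also have "\<dots> = ennreal \<epsilon>"
      using \<delta> by (simp add: ennreal_mult[symmetric] ennreal_plus[symmetric] \<delta>_def del: ennreal_plus)
    finally show ?case .
  qed
qed

text \<open>Both modes of convergence imply convergence in L^1. The exponents may differ, because an
  L^p limit has to be identified with the L^2 limit that defines the integral.\<close>

lemma Lp_limits_AE_eq:
  assumes X: "\<And>n. X n \<in> borel_measurable M" and Y: "Y \<in> borel_measurable M" and W: "W \<in> borel_measurable M"
    and p: "1 \<le> p" "1 \<le> p'"
    and limY: "(\<lambda>n. \<integral>\<^sup>+\<omega>. ennreal (\<bar>X n \<omega> - Y \<omega> :: real\<bar> ^ p) \<partial>M) \<longlonglongrightarrow> 0"
    and limW: "(\<lambda>n. \<integral>\<^sup>+\<omega>. ennreal (\<bar>X n \<omega> - W \<omega> :: real\<bar> ^ p') \<partial>M) \<longlonglongrightarrow> 0"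
  shows "AE \<omega> in M. Y \<omega> = W \<omega>"
proof -
  have "(\<integral>\<^sup>+\<omega>. ennreal \<bar>Y \<omega> - W \<omega>\<bar> \<partial>M) \<le> 0"
  proof (rule ennreal_le_epsilon)
    fix e :: real assume e: "0 < e"
    have "eventually (\<lambda>n. (\<integral>\<^sup>+\<omega>. ennreal \<bar>X n \<omega> - Y \<omega>\<bar> \<partial>M) \<le> ennreal (e / 2) \<and>
        (\<integral>\<^sup>+\<omega>. ennreal \<bar>X n \<omega> - W \<omega>\<bar> \<partial>M) \<le> ennreal (e / 2)) sequentially"
      using L1_limit_of_Lp[OF X Y p(1) limY, of "e/2"] L1_limit_of_Lp[OF X W p(2) limW, of "e/2"] e
      by (intro eventually_conj) auto
    then obtain n where n: "(\<integral>\<^sup>+\<omega>. ennreal \<bar>X n \<omega> - Y \<omega>\<bar> \<partial>M) \<le> ennreal (e / 2)"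
        "(\<integral>\<^sup>+\<omega>. ennreal \<bar>X n \<omega> - W \<omega>\<bar> \<partial>M) \<le> ennreal (e / 2)"
      using eventually_happens'[of sequentially] by fastforce
    have "(\<integral>\<^sup>+\<omega>. ennreal \<bar>Y \<omega> - W \<omega>\<bar> \<partial>M) \<le> (\<integral>\<^sup>+\<omega>. ennreal \<bar>X n \<omega> - Y \<omega>\<bar> + ennreal \<bar>X n \<omega> - W \<omega>\<bar> \<partial>M)"
      by (intro nn_integral_mono) (simp add: ennreal_plus[symmetric] del: ennreal_plus)
    also have "\<dots> = (\<integral>\<^sup>+\<omega>. ennreal \<bar>X n \<omega> - Y \<omega>\<bar> \<partial>M) + (\<integral>\<^sup>+\<omega>. ennreal \<bar>X n \<omega> - W \<omega>\<bar> \<partial>M)"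
      using X Y W by (intro nn_integral_add) auto
    also have "\<dots> \<le> ennreal (e / 2) + ennreal (e / 2)" using n by (rule add_mono)
    also have "\<dots> = 0 + ennreal e" using e by (simp add: ennreal_plus[symmetric] del: ennreal_plus)
    finally show "(\<integral>\<^sup>+\<omega>. ennreal \<bar>Y \<omega> - W \<omega>\<bar> \<partial>M) \<le> 0 + ennreal e" .
  qed
  then have "AE \<omega> in M. ennreal \<bar>Y \<omega> - W \<omega>\<bar> = 0"
    using Y W by (subst nn_integral_0_iff_AE[symmetric]) auto
  then show ?thesis by eventually_elim (simp add: ennreal_eq_0_iff)
qed

end

text \<open>Values are rounded towards zero to multiples of 2^-n and replaced by 0 beyond
  \<open>n\<close>. Rounding towards zero never increases the absolute value, so contractions of the
  rounded function are dominated by those of the original one.\<close>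

definition dyadic_round :: "nat \<Rightarrow> real \<Rightarrow> real" where
  "dyadic_round n t = (if \<bar>t\<bar> \<le> real n then sgn t * (real_of_int \<lfloor>2 ^ n * \<bar>t\<bar>\<rfloor> / 2 ^ n) else 0)"

lemma floor_part: "0 \<le> u \<Longrightarrow> real_of_int \<lfloor>2 ^ n * u\<rfloor> / 2 ^ n \<le> u"
  "u - 1 / 2 ^ n \<le> real_of_int \<lfloor>2 ^ n * u\<rfloor> / 2 ^ n" "0 \<le> u \<Longrightarrow> 0 \<le> real_of_int \<lfloor>2 ^ n * u\<rfloor> / 2 ^ n" for u :: real
proof -
  show "0 \<le> u \<Longrightarrow> real_of_int \<lfloor>2 ^ n * u\<rfloor> / 2 ^ n \<le> u"
    using of_int_floor_le[of "2 ^ n * u"] by (simp add: field_simps)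
  have "2 ^ n * u - 1 \<le> real_of_int \<lfloor>2 ^ n * u\<rfloor>" by linarith
  then have "(2 ^ n * u - 1) / 2 ^ n \<le> real_of_int \<lfloor>2 ^ n * u\<rfloor> / 2 ^ n" by (intro divide_right_mono) auto
  then show "u - 1 / 2 ^ n \<le> real_of_int \<lfloor>2 ^ n * u\<rfloor> / 2 ^ n" by (simp add: diff_divide_distrib)
  show "0 \<le> u \<Longrightarrow> 0 \<le> real_of_int \<lfloor>2 ^ n * u\<rfloor> / 2 ^ n" by simp
qed

lemma dyadic_round_diff: "\<bar>dyadic_round n t - t\<bar> \<le> \<bar>t\<bar>" "\<bar>t\<bar> \<le> real n \<Longrightarrow> \<bar>dyadic_round n t - t\<bar> \<le> 1 / 2 ^ n"
proof -
  let ?u = "real_of_int \<lfloor>2 ^ n * \<bar>t\<bar>\<rfloor> / 2 ^ n"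
  have u: "?u \<le> \<bar>t\<bar>" "\<bar>t\<bar> - 1 / 2 ^ n \<le> ?u" "0 \<le> ?u" using floor_part[of "\<bar>t\<bar>" n] by auto
  have e: "\<bar>sgn t * ?u - t\<bar> = \<bar>t\<bar> - ?u"
  proof (cases "t = 0")
    case False
    have "sgn t * ?u - t = sgn t * (?u - \<bar>t\<bar>)" by (simp add: right_diff_distrib mult_sgn_abs)
    then show ?thesis using u False by (simp add: abs_mult abs_sgn_eq)
  qed (use u in auto)
  have r: "dyadic_round n t = sgn t * ?u" if "\<bar>t\<bar> \<le> real n" using that by (simp add: dyadic_round_def)
  show "\<bar>dyadic_round n t - t\<bar> \<le> \<bar>t\<bar>"
  proof (cases "\<bar>t\<bar> \<le> real n")
    case True
    then show ?thesis unfolding r[OF True] e using u(3) by linarith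
  qed (simp add: dyadic_round_def)
  show "\<bar>dyadic_round n t - t\<bar> \<le> 1 / 2 ^ n" if t: "\<bar>t\<bar> \<le> real n"
    unfolding r[OF t] e using u(2) by linarith
qed

lemma dyadic_round_abs: "\<bar>dyadic_round n t\<bar> \<le> \<bar>t\<bar>" "\<bar>dyadic_round n t\<bar> \<le> real n"
proof -
  have 1: "\<bar>dyadic_round n t\<bar> \<le> \<bar>t\<bar>"
    using floor_part[of "\<bar>t\<bar>" n] by (auto simp: dyadic_round_def abs_mult abs_sgn_eq)
  then show "\<bar>dyadic_round n t\<bar> \<le> \<bar>t\<bar>" .
  show "\<bar>dyadic_round n t\<bar> \<le> real n" using 1 by (cases "\<bar>t\<bar> \<le> real n") (auto simp: dyadic_round_def)
qed

lemma dyadic_round_measurable[measurable]: "dyadic_round n \<in> borel_measurable borel"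
  unfolding dyadic_round_def[abs_def] by measurable

lemma finite_range_dyadic_round: "finite (range (dyadic_round n))"
proof (rule finite_subset)
  show "range (dyadic_round n) \<subseteq> insert 0 ((\<lambda>(s, k). s * (real_of_int k / 2 ^ n)) ` ({-1, 0, 1} \<times> {0..\<lfloor>2 ^ n * real n\<rfloor>}))"
  proof safe
    fix t assume ne: "dyadic_round n t \<notin> (\<lambda>(s, k). s * (real_of_int k / 2 ^ n)) ` ({-1, 0, 1} \<times> {0..\<lfloor>2 ^ n * real n\<rfloor>})"
    show "dyadic_round n t = 0"
    proof (cases "\<bar>t\<bar> \<le> real n")
      case True
      have "(sgn t, \<lfloor>2 ^ n * \<bar>t\<bar>\<rfloor>) \<in> {-1, 0, 1} \<times> {0..\<lfloor>2 ^ n * real n\<rfloor>}"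
      proof -
        have "2 ^ n * \<bar>t\<bar> \<le> 2 ^ n * real n" using True by (intro mult_left_mono) auto
        then have "\<lfloor>2 ^ n * \<bar>t\<bar>\<rfloor> \<le> \<lfloor>2 ^ n * real n\<rfloor>" by (rule floor_mono)
        moreover have "0 \<le> \<lfloor>2 ^ n * \<bar>t\<bar>\<rfloor>" by simp
        ultimately have "\<lfloor>2 ^ n * \<bar>t\<bar>\<rfloor> \<in> {0..\<lfloor>2 ^ n * real n\<rfloor>}" by simp
        moreover have "sgn t \<in> {-1, 0, 1}" by (simp add: sgn_if)
        ultimately show ?thesis by (rule SigmaI[rotated])
      qed
      from imageI[OF this, of "\<lambda>(s, k). s * (real_of_int k / 2 ^ n)"] show ?thesis
        using ne True by (simp add: dyadic_round_def)
    qed (simp add: dyadic_round_def)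
  qed
qed simp

context poisson_sf begin

text \<open>The single parameter \<open>n\<close> governs the mesh of the rounding, the cutoff of
  the values and the supporting box, so one limit removes all three.\<close>

definition trunc :: "nat \<Rightarrow> nat \<Rightarrow> ((nat \<Rightarrow> 'x) \<Rightarrow> real) \<Rightarrow> (nat \<Rightarrow> 'x) \<Rightarrow> real" where
  "trunc q n f x = dyadic_round n (f x) * indicator (Box q n) x"

lemma trunc_simple:
  assumes "f \<in> borel_measurable (pow_measure \<mu> q)"
  shows "simple_function (pow_measure \<mu> q) (trunc q n f)"
proof -
  have "simple_function (pow_measure \<mu> q) (\<lambda>x. dyadic_round n (f x))"
    unfolding simple_function_borel_measurable
  proof (rule simple_function_borel_measurable)
    show "(\<lambda>x. dyadic_round n (f x)) \<in> borel_measurable (pow_measure \<mu> q)" using assms by measurable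
    show "finite ((\<lambda>x. dyadic_round n (f x)) ` space (pow_measure \<mu> q))"
      by (rule finite_subset[OF _ finite_range_dyadic_round[of n]]) auto
  qed
  then show ?thesis unfolding trunc_def[abs_def] by (intro simple_function_mult simple_function_indicator) auto
qed

lemma trunc_box_supp:
  assumes "f \<in> borel_measurable (pow_measure \<mu> q)"
  shows "box_supp n q (trunc q n f)"
  unfolding box_supp_def
proof (intro conjI exI ballI)
  show "trunc q n f \<in> borel_measurable (pow_measure \<mu> q)"
    using trunc_simple[OF assms] by (rule borel_measurable_simple_function)
  show "\<bar>trunc q n f x\<bar> \<le> real n * indicator (Box q n) x" for x
    using dyadic_round_abs(2) by (auto simp: trunc_def split: split_indicator)
qed

lemma trunc_abs: "\<bar>trunc q n f x\<bar> \<le> \<bar>f x\<bar>"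
  using dyadic_round_abs(1) by (auto simp: trunc_def split: split_indicator)

text \<open>A bound for the error of all truncations from stage \<open>N\<close> on.\<close>

definition tail :: "nat \<Rightarrow> nat \<Rightarrow> ((nat \<Rightarrow> 'x) \<Rightarrow> real) \<Rightarrow> (nat \<Rightarrow> 'x) \<Rightarrow> real" where
  "tail q N f x = (if x \<in> Box q N \<and> \<bar>f x\<bar> \<le> real N then min \<bar>f x\<bar> (1 / 2 ^ N) else \<bar>f x\<bar>)"

lemma tail_bounds: "0 \<le> tail q N f x" "tail q N f x \<le> \<bar>f x\<bar>" by (auto simp: tail_def)

text \<open>The bound is uniform in n \<ge> N; hence twice the tail bounds the difference of any two
  later truncations, as the Cauchy estimates require.\<close>

lemma trunc_tail: "N \<le> n \<Longrightarrow> \<bar>trunc q n f x - f x\<bar> \<le> tail q N f x"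
proof (cases "x \<in> Box q N \<and> \<bar>f x\<bar> \<le> real N")
  case True
  assume n: "N \<le> n"
  have "x \<in> Box q n" using True n Box_inc[of q] by (auto simp: incseq_def)
  then have "\<bar>trunc q n f x - f x\<bar> \<le> min \<bar>f x\<bar> (1 / 2 ^ n)"
    using dyadic_round_diff[where n=n and t="f x"] True n by (auto simp: trunc_def)
  also have "\<dots> \<le> min \<bar>f x\<bar> (1 / 2 ^ N)" using n by (intro min.mono) (auto intro!: divide_left_mono power_increasing)
  finally show ?thesis using True by (simp add: tail_def)
next
  case False
  then show ?thesis using dyadic_round_diff(1)[where n=n and t="f x"] by (auto simp: tail_def trunc_def split: split_indicator)
qed

lemma tail_lim: "x \<in> space (pow_measure \<mu> q) \<Longrightarrow> (\<lambda>N. tail q N f x) \<longlonglongrightarrow> 0"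
proof -
  assume x: "x \<in> space (pow_measure \<mu> q)"
  then obtain N0 where N0: "x \<in> Box q N0" using Box_UN[of q] by auto
  obtain N1 where N1: "\<bar>f x\<bar> \<le> real N1" using real_arch_simple by blast
  have "eventually (\<lambda>N. tail q N f x \<le> (1/2) ^ N) sequentially"
    unfolding eventually_sequentially
  proof (intro exI[of _ "max N0 N1"] allI impI)
    fix N assume N: "max N0 N1 \<le> N"
    have "x \<in> Box q N" using N0 N Box_inc[of q] by (auto simp: incseq_def)
    moreover have "\<bar>f x\<bar> \<le> real N" using N1 N by (meson max.boundedE of_nat_mono order_trans)
    ultimately show "tail q N f x \<le> (1/2) ^ N" by (simp add: tail_def power_divide)
  qed
  then show ?thesis
    by (rule tendsto_sandwich[rotated 1, where f="\<lambda>_. 0"]) (auto simp: tail_bounds intro: LIMSEQ_power_zero)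
qed

lemma tail_meas:
  assumes [measurable]: "f \<in> borel_measurable (pow_measure \<mu> q)"
  shows "tail q N f \<in> borel_measurable (pow_measure \<mu> q)"
  unfolding tail_def[abs_def] by measurable

lemma trunc_lim:
  assumes "x \<in> space (pow_measure \<mu> q)"
  shows "(\<lambda>n. trunc q n f x) \<longlonglongrightarrow> f x"
proof (rule LIM_zero_cancel, rule tendsto_rabs_zero_cancel)
  show "(\<lambda>n. \<bar>trunc q n f x - f x\<bar>) \<longlonglongrightarrow> 0"
  proof (rule tendsto_sandwich[where f="\<lambda>_. 0" and h="\<lambda>n. tail q n f x"])
    show "eventually (\<lambda>n. \<bar>trunc q n f x - f x\<bar> \<le> tail q n f x) sequentially"
      using trunc_tail[OF order_refl] by (intro always_eventually allI)
    show "(\<lambda>n. tail q n f x) \<longlonglongrightarrow> 0" using assms by (rule tail_lim)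
  qed (auto intro: tendsto_const always_eventually)
qed

end

section \<open>The Wiener-Ito integral\<close>

lemma sq_sum_le: "(a + b)\<^sup>2 \<le> 2 * a\<^sup>2 + 2 * (b::real)\<^sup>2"
  using sum_squares_bound[of a b] by (simp add: power2_sum)

section \<open>An L^2 bound and the identification of the integral\<close>

context poisson_sf begin

lemma PiM_reindex:
  fixes \<beta> :: "nat \<Rightarrow> nat set"
  assumes \<beta>: "bij_betw \<beta> K \<sigma>" and K: "finite K"
  shows "(\<lambda>y. \<lambda>k\<in>K. y (\<beta> k)) \<in> measurable (PiM \<sigma> (\<lambda>_. \<mu>)) (PiM K (\<lambda>_. \<mu>))"
    and "distr (PiM \<sigma> (\<lambda>_. \<mu>)) (PiM K (\<lambda>_. \<mu>)) (\<lambda>y. \<lambda>k\<in>K. y (\<beta> k)) = PiM K (\<lambda>_. \<mu>)"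
proof -
  have \<beta>in: "\<beta> k \<in> \<sigma>" if "k \<in> K" for k using \<beta> that by (rule bij_betwE[THEN bspec])
  have f\<sigma>: "finite \<sigma>" using \<beta> K bij_betw_finite by blast
  show m: "(\<lambda>y. \<lambda>k\<in>K. y (\<beta> k)) \<in> measurable (PiM \<sigma> (\<lambda>_. \<mu>)) (PiM K (\<lambda>_. \<mu>))"
    using \<beta>in by (intro measurable_restrict measurable_component_singleton)
  let ?g = "the_inv_into K \<beta>"
  have g: "?g b \<in> K" "\<beta> (?g b) = b" if "b \<in> \<sigma>" for b
    using \<beta> that by (auto simp: bij_betw_def the_inv_into_into f_the_inv_into_f)
  have g\<beta>: "?g (\<beta> k) = k" if "k \<in> K" for k using \<beta> that by (auto simp: bij_betw_def the_inv_into_f_f)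
  show "distr (PiM \<sigma> (\<lambda>_. \<mu>)) (PiM K (\<lambda>_. \<mu>)) (\<lambda>y. \<lambda>k\<in>K. y (\<beta> k)) = PiM K (\<lambda>_. \<mu>)"
  proof (rule P.PiM_eqI[OF K])
    fix A assume A: "\<And>k. k \<in> K \<Longrightarrow> A k \<in> sets \<mu>"
    have Asp: "A k \<subseteq> space \<mu>" if "k \<in> K" for k using sets.sets_into_space[OF A[OF that]] .
    have e: "(\<lambda>y. \<lambda>k\<in>K. y (\<beta> k)) -` Pi\<^sub>E K A \<inter> space (PiM \<sigma> (\<lambda>_. \<mu>)) = (\<Pi>\<^sub>E b\<in>\<sigma>. A (?g b))"
    proof (intro equalityI subsetI)
      fix y assume y: "y \<in> (\<lambda>y. \<lambda>k\<in>K. y (\<beta> k)) -` Pi\<^sub>E K A \<inter> space (PiM \<sigma> (\<lambda>_. \<mu>))"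
      have "y b \<in> A (?g b)" if b: "b \<in> \<sigma>" for b
      proof -
        have "(\<lambda>k\<in>K. y (\<beta> k)) \<in> Pi\<^sub>E K A" using y by simp
        from PiE_mem[OF this g(1)[OF b]] show ?thesis using g[OF b] by simp
      qed
      then show "y \<in> (\<Pi>\<^sub>E b\<in>\<sigma>. A (?g b))" using y by (auto simp: space_PiM PiE_iff)
    next
      fix y assume y: "y \<in> (\<Pi>\<^sub>E b\<in>\<sigma>. A (?g b))"
      have "y (\<beta> k) \<in> A k" if "k \<in> K" for k using PiE_mem[OF y \<beta>in[OF that]] g\<beta>[OF that] by simp
      moreover have "y \<in> space (PiM \<sigma> (\<lambda>_. \<mu>))" using y subsetD[OF Asp[OF g(1)]] by (auto simp: space_PiM PiE_iff)
      ultimately show "y \<in> (\<lambda>y. \<lambda>k\<in>K. y (\<beta> k)) -` Pi\<^sub>E K A \<inter> space (PiM \<sigma> (\<lambda>_. \<mu>))" by auto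
    qed
    have "emeasure (distr (PiM \<sigma> (\<lambda>_. \<mu>)) (PiM K (\<lambda>_. \<mu>)) (\<lambda>y. \<lambda>k\<in>K. y (\<beta> k))) (Pi\<^sub>E K A)
      = emeasure (PiM \<sigma> (\<lambda>_. \<mu>)) (\<Pi>\<^sub>E b\<in>\<sigma>. A (?g b))"
      using m A K by (subst emeasure_distr) (auto simp: e intro!: sets_PiM_I_finite)
    also have "\<dots> = (\<Prod>b\<in>\<sigma>. emeasure \<mu> (A (?g b)))"
      using f\<sigma> A g(1) by (intro PS.emeasure_PiM) auto
    also have "\<dots> = (\<Prod>k\<in>K. emeasure \<mu> (A (?g (\<beta> k))))"
      by (rule prod.reindex_bij_betw[OF \<beta>, symmetric])
    also have "\<dots> = (\<Prod>k\<in>K. emeasure \<mu> (A k))" using g\<beta> by (intro prod.cong) auto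
    finally show "emeasure (distr (PiM \<sigma> (\<lambda>_. \<mu>)) (PiM K (\<lambda>_. \<mu>)) (\<lambda>y. \<lambda>k\<in>K. y (\<beta> k))) (Pi\<^sub>E K A)
      = (\<Prod>k\<in>K. emeasure \<mu> (A k))" .
  qed simp
qed

text \<open>With two rows, a block that has at least two elements and meets each row at most once
  contains exactly one position of each row. The partition is a perfect matching of the rows, and
  its blocks are indexed by the positions of either one.\<close>

lemma pair_block_bij:
  assumes \<sigma>: "\<sigma> \<in> gparts2 (\<lambda>_. q) {1, 2}" and l: "l \<in> {1, 2}"
  shows "bij_betw (\<lambda>k. block_of \<sigma> (pos (\<lambda>_. q) l k)) {1..q} \<sigma>"
proof -
  let ?q = "\<lambda>_::nat. q"
  have \<sigma>': "\<sigma> \<in> gparts ?q {1, 2}" using \<sigma> by (rule gparts2D)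
  have l1: "1 \<le> l" using l by auto
  have part: "partition_on (rows ?q {1, 2}) \<sigma>" by (rule gparts_partition[OF \<sigma>'])
  have inj: "inj_on (row_index ?q) b" if "b \<in> \<sigma>" for b using \<sigma>' that by (auto simp: gparts_def row_parts_def)
  have row1: "pos ?q l k \<in> row ?q l" if "k \<in> {1..q}" for k using pos_in_row[of l k ?q] l1 that by simp
  have inr: "pos ?q l k \<in> rows ?q {1, 2}" if "k \<in> {1..q}" for k
    using row1[OF that] l by (auto simp: rows_def)
  note bi = block_of_in[OF part inr]
  show ?thesis
  proof (rule bij_betw_imageI)
    show "inj_on (\<lambda>k. block_of \<sigma> (pos ?q l k)) {1..q}"
    proof (rule inj_onI)
      fix k k' assume k: "k \<in> {1..q}" "k' \<in> {1..q}" and e: "block_of \<sigma> (pos ?q l k) = block_of \<sigma> (pos ?q l k')"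
      have "row_index ?q (pos ?q l k) = row_index ?q (pos ?q l k')"
        using row_index_row[OF l1 row1[OF k(1)]] row_index_row[OF l1 row1[OF k(2)]] by simp
      then have "pos ?q l k = pos ?q l k'"
        using inj_onD[OF inj[OF bi(1)[OF k(1)]] _ bi(2)[OF k(1)]] bi(2)[OF k(2)] e by simp
      then show "k = k'" by (simp add: pos_def)
    qed
    show "(\<lambda>k. block_of \<sigma> (pos ?q l k)) ` {1..q} = \<sigma>"
    proof (intro equalityI subsetI)
      fix b assume "b \<in> (\<lambda>k. block_of \<sigma> (pos ?q l k)) ` {1..q}"
      then show "b \<in> \<sigma>" using bi(1) by auto
    next
      fix b assume b: "b \<in> \<sigma>"
      have sub: "b \<subseteq> rows ?q {1, 2}" using part b by (auto simp: partition_on_def)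
      have ri: "row_index ?q p \<in> {1, 2} \<and> p \<in> row ?q (row_index ?q p)" if p: "p \<in> b" for p
      proof -
        obtain l' where l': "l' \<in> {1, 2}" "p \<in> row ?q l'" using subsetD[OF sub p] unfolding rows_def by blast
        then have "row_index ?q p = l'" by (intro row_index_row) auto
        then show ?thesis using l' by simp
      qed
      have "card (row_index ?q ` b) = card b" using inj[OF b] by (rule card_image)
      moreover have "2 \<le> card b" using \<sigma> b by (simp add: gparts2_def)
      moreover have "row_index ?q ` b \<subseteq> {1, 2}" using ri by auto
      ultimately have "row_index ?q ` b = {1, 2}" by (intro card_seteq) auto
      then obtain p where p: "p \<in> b" "row_index ?q p = l" using l by (metis imageE)
      then have "p \<in> row ?q l" using ri by auto
      then obtain k where k: "k \<in> {1..q}" "p = pos ?q l k" using row_eq[OF l1, of ?q] by auto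
      then have "block_of \<sigma> (pos ?q l k) = b" using block_of_eq[OF part b p(1)] by simp
      then show "b \<in> (\<lambda>k. block_of \<sigma> (pos ?q l k)) ` {1..q}" using k(1) by blast
    qed
  qed
qed

text \<open>By |ab| \<le> a^2/2 + b^2/2 the two copies separate. Each has an argument that is only a
  renaming of the block variables, so each integrates to half the squared L^2 norm.\<close>

lemma contr_pair_bound:
  assumes \<sigma>: "\<sigma> \<in> gparts2 (\<lambda>_. q) {1, 2}" and g[measurable]: "g \<in> borel_measurable (pow_measure \<mu> q)"
  shows "(\<integral>\<^sup>+y. ennreal \<bar>contr (\<lambda>_. q) (\<lambda>_. g) {1, 2} \<sigma> y\<bar> \<partial>PiM \<sigma> (\<lambda>_. \<mu>)) \<le> (\<integral>\<^sup>+x. ennreal ((g x)\<^sup>2) \<partial>pow_measure \<mu> q)"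
proof -
  let ?a = "\<lambda>l y. \<lambda>k\<in>{1..q}. y (block_of \<sigma> (pos (\<lambda>_. q) l k))"
  have m: "?a l \<in> measurable (PiM \<sigma> (\<lambda>_. \<mu>)) (pow_measure \<mu> q)" if "l \<in> {1, 2}" for l
    using PiM_reindex(1)[OF pair_block_bij[OF \<sigma> that]] by simp
  have half: "(\<integral>\<^sup>+y. ennreal ((g (?a l y))\<^sup>2 / 2) \<partial>PiM \<sigma> (\<lambda>_. \<mu>)) = (\<integral>\<^sup>+x. ennreal ((g x)\<^sup>2 / 2) \<partial>pow_measure \<mu> q)"
    if l: "l \<in> {1, 2}" for l
  proof -
    have "(\<integral>\<^sup>+x. ennreal ((g x)\<^sup>2 / 2) \<partial>pow_measure \<mu> q) =
      (\<integral>\<^sup>+x. ennreal ((g x)\<^sup>2 / 2) \<partial>distr (PiM \<sigma> (\<lambda>_. \<mu>)) (pow_measure \<mu> q) (?a l))"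
      using PiM_reindex(2)[OF pair_block_bij[OF \<sigma> l]] by simp
    also have "\<dots> = (\<integral>\<^sup>+y. ennreal ((g (?a l y))\<^sup>2 / 2) \<partial>PiM \<sigma> (\<lambda>_. \<mu>))"
      using m[OF l] by (subst nn_integral_distr) auto
    finally show ?thesis ..
  qed
  have mm: "(\<lambda>y. ennreal ((g (?a l y))\<^sup>2 / 2)) \<in> borel_measurable (PiM \<sigma> (\<lambda>_. \<mu>))" if "l \<in> {1, 2}" for l
    using measurable_compose[OF m[OF that] g] by measurable
  have "(\<integral>\<^sup>+y. ennreal \<bar>contr (\<lambda>_. q) (\<lambda>_. g) {1, 2} \<sigma> y\<bar> \<partial>PiM \<sigma> (\<lambda>_. \<mu>)) \<le>
    (\<integral>\<^sup>+y. ennreal ((g (?a 1 y))\<^sup>2 / 2) + ennreal ((g (?a 2 y))\<^sup>2 / 2) \<partial>PiM \<sigma> (\<lambda>_. \<mu>))"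
  proof (rule nn_integral_mono)
    fix y
    have "\<bar>g (?a 1 y) * g (?a 2 y)\<bar> \<le> (g (?a 1 y))\<^sup>2 / 2 + (g (?a 2 y))\<^sup>2 / 2"
      using sum_squares_bound[of "\<bar>g (?a 1 y)\<bar>" "\<bar>g (?a 2 y)\<bar>"] by (simp add: abs_mult)
    then show "ennreal \<bar>contr (\<lambda>_. q) (\<lambda>_. g) {1, 2} \<sigma> y\<bar> \<le> ennreal ((g (?a 1 y))\<^sup>2 / 2) + ennreal ((g (?a 2 y))\<^sup>2 / 2)"
      unfolding contr_def by (simp add: ennreal_plus[symmetric] ennreal_le_iff del: ennreal_plus)
  qed
  also have "\<dots> = (\<integral>\<^sup>+y. ennreal ((g (?a 1 y))\<^sup>2 / 2) \<partial>PiM \<sigma> (\<lambda>_. \<mu>)) + (\<integral>\<^sup>+y. ennreal ((g (?a 2 y))\<^sup>2 / 2) \<partial>PiM \<sigma> (\<lambda>_. \<mu>))"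
    using mm by (intro nn_integral_add) auto
  also have "\<dots> = (\<integral>\<^sup>+x. ennreal ((g x)\<^sup>2 / 2) \<partial>pow_measure \<mu> q) + (\<integral>\<^sup>+x. ennreal ((g x)\<^sup>2 / 2) \<partial>pow_measure \<mu> q)"
    using half by simp
  also have "\<dots> = (\<integral>\<^sup>+x. ennreal ((g x)\<^sup>2 / 2) + ennreal ((g x)\<^sup>2 / 2) \<partial>pow_measure \<mu> q)"
    by (intro nn_integral_add[symmetric]) measurable
  also have "\<dots> = (\<integral>\<^sup>+x. ennreal ((g x)\<^sup>2) \<partial>pow_measure \<mu> q)"
    by (intro nn_integral_cong) (simp add: ennreal_plus[symmetric] del: ennreal_plus)
  finally show ?thesis .
qed

text \<open>The number of perfect matchings of two rows of length \<open>q\<close>, that is q!; the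
  estimates below use it as a finite constant.\<close>

definition L2const :: "nat \<Rightarrow> nat" where "L2const q = card (gparts2 (\<lambda>_. q) {1, 2})"

lemma moment_abs_bound:
  assumes S: "finite S" "\<And>l. l \<in> S \<Longrightarrow> 1 \<le> l"
    and g: "\<And>l. l \<in> S \<Longrightarrow> simple_function (pow_measure \<mu> (q l)) (g l)" "\<And>l. l \<in> S \<Longrightarrow> box_supp n (q l) (g l)"
  shows "ennreal (\<integral>\<omega>. (\<Prod>l\<in>S. WI (q l) (g l) \<omega>) \<partial>M) \<le>
    (\<Sum>\<sigma>\<in>gparts2 q S. \<integral>\<^sup>+y. ennreal \<bar>contr q g S \<sigma> y\<bar> \<partial>PiM \<sigma> (\<lambda>_. \<mu>))"
proof -
  have "(\<integral>\<omega>. (\<Prod>l\<in>S. WI (q l) (g l) \<omega>) \<partial>M) = (\<Sum>\<sigma>\<in>gparts2 q S. \<integral>y. contr q g S \<sigma> y \<partial>PiM \<sigma> (\<lambda>_. \<mu>))"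
    using moment_formula_simple[OF S g] by (simp add: moment_formula_def)
  also have "\<dots> \<le> (\<Sum>\<sigma>\<in>gparts2 q S. \<bar>\<integral>y. contr q g S \<sigma> y \<partial>PiM \<sigma> (\<lambda>_. \<mu>)\<bar>)" by (intro sum_mono) simp
  finally have "ennreal (\<integral>\<omega>. (\<Prod>l\<in>S. WI (q l) (g l) \<omega>) \<partial>M) \<le>
      ennreal (\<Sum>\<sigma>\<in>gparts2 q S. \<bar>\<integral>y. contr q g S \<sigma> y \<partial>PiM \<sigma> (\<lambda>_. \<mu>)\<bar>)" by (rule ennreal_leI)
  also have "\<dots> = (\<Sum>\<sigma>\<in>gparts2 q S. ennreal \<bar>\<integral>y. contr q g S \<sigma> y \<partial>PiM \<sigma> (\<lambda>_. \<mu>)\<bar>)"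
    by (intro sum_ennreal[symmetric]) simp
  also have "\<dots> \<le> (\<Sum>\<sigma>\<in>gparts2 q S. \<integral>\<^sup>+y. ennreal \<bar>contr q g S \<sigma> y\<bar> \<partial>PiM \<sigma> (\<lambda>_. \<mu>))"
  proof (rule sum_mono)
    fix \<sigma> assume "\<sigma> \<in> gparts2 q S"
    then show "ennreal \<bar>\<integral>y. contr q g S \<sigma> y \<partial>PiM \<sigma> (\<lambda>_. \<mu>)\<bar> \<le> (\<integral>\<^sup>+y. ennreal \<bar>contr q g S \<sigma> y\<bar> \<partial>PiM \<sigma> (\<lambda>_. \<mu>))"
      using integral_norm_bound_ennreal[OF contr_integrable[OF S gparts2D g(2)]] by simp
  qed
  finally show ?thesis .
qed

lemma WI_L2_box_supp:
  assumes g: "simple_function (pow_measure \<mu> q) g" "box_supp n q g"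
  shows "(\<integral>\<^sup>+\<omega>. ennreal ((WI q g \<omega>)\<^sup>2) \<partial>M) \<le> of_nat (L2const q) * (\<integral>\<^sup>+x. ennreal ((g x)\<^sup>2) \<partial>pow_measure \<mu> q)"
proof -
  let ?S = "{1, 2 :: nat}"
  have pr: "(\<Prod>l\<in>?S. WI q g \<omega>) = (WI q g \<omega>)\<^sup>2" for \<omega> by (simp add: power2_eq_square)
  have "integrable M (\<lambda>\<omega>. \<Prod>l\<in>?S. WI q g \<omega>)"
    using g by (intro box_supp_prod_integrable(1)[of ?S n "\<lambda>_. q" "\<lambda>_. g"]) auto
  then have "(\<integral>\<^sup>+\<omega>. ennreal ((WI q g \<omega>)\<^sup>2) \<partial>M) = ennreal (\<integral>\<omega>. (\<Prod>l\<in>?S. WI q g \<omega>) \<partial>M)"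
    unfolding pr by (intro nn_integral_eq_integral) auto
  also have "\<dots> \<le> (\<Sum>\<sigma>\<in>gparts2 (\<lambda>_. q) ?S. \<integral>\<^sup>+y. ennreal \<bar>contr (\<lambda>_. q) (\<lambda>_. g) ?S \<sigma> y\<bar> \<partial>PiM \<sigma> (\<lambda>_. \<mu>))"
    using g by (intro moment_abs_bound[of ?S "\<lambda>_. q" "\<lambda>_. g" n]) auto
  also have "\<dots> \<le> (\<Sum>\<sigma>\<in>gparts2 (\<lambda>_. q) ?S. \<integral>\<^sup>+x. ennreal ((g x)\<^sup>2) \<partial>pow_measure \<mu> q)"
    using g by (intro sum_mono contr_pair_bound) (auto simp: box_supp_def)
  also have "\<dots> = of_nat (L2const q) * (\<integral>\<^sup>+x. ennreal ((g x)\<^sup>2) \<partial>pow_measure \<mu> q)"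
    by (simp add: L2const_def)
  finally show ?thesis .
qed

text \<open>The approximating functions in \<open>is_wiener_ito\<close> are simple and integrable
  but need not be supported in a box. Cutting them off by boxes gives pathwise convergence of
  \<open>WI\<close> almost surely, and Fatou's lemma keeps the bound.\<close>

lemma WI_L2:
  assumes g: "simple_function (pow_measure \<mu> q) g" "(\<integral>\<^sup>+x. ennreal \<bar>g x\<bar> \<partial>pow_measure \<mu> q) < \<infinity>"
  shows "(\<integral>\<^sup>+\<omega>. ennreal ((WI q g \<omega>)\<^sup>2) \<partial>M) \<le> of_nat (L2const q) * (\<integral>\<^sup>+x. ennreal ((g x)\<^sup>2) \<partial>pow_measure \<mu> q)"
proof -
  define h where "h n x = g x * indicator (Box q n) x" for n x
  have gm[measurable]: "g \<in> borel_measurable (pow_measure \<mu> q)" using g(1) by (rule borel_measurable_simple_function)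
  have hs: "simple_function (pow_measure \<mu> q) (h n)" for n
    unfolding h_def using g(1) by (intro simple_function_mult simple_function_indicator) auto
  have hm: "h n \<in> borel_measurable (pow_measure \<mu> q)" for n using hs by (rule borel_measurable_simple_function)
  have hb: "box_supp n q (h n)" for n
  proof -
    have fin: "finite (g ` space (pow_measure \<mu> q))" using g(1) by (rule simple_functionD(1))
    have "\<bar>g x\<bar> \<le> (\<Sum>v\<in>g ` space (pow_measure \<mu> q). \<bar>v\<bar>)" if "x \<in> space (pow_measure \<mu> q)" for x
      using that fin by (intro member_le_sum) auto
    then have "\<bar>h n x\<bar> \<le> (\<Sum>v\<in>g ` space (pow_measure \<mu> q). \<bar>v\<bar>) * indicator (Box q n) x" if "x \<in> space (pow_measure \<mu> q)" for x
      using that by (auto simp: h_def split: split_indicator)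
    then show ?thesis using hm unfolding box_supp_def by blast
  qed
  have lim: "(\<lambda>n. h n x) \<longlonglongrightarrow> g x" if x: "x \<in> space (pow_measure \<mu> q)" for x
  proof (rule tendsto_eventually)
    obtain N where N: "x \<in> Box q N" using x Box_UN[of q] by auto
    show "eventually (\<lambda>n. h n x = g x) sequentially"
      unfolding eventually_sequentially
    proof (intro exI allI impI)
      fix n assume "N \<le> n"
      then have "x \<in> Box q n" using N Box_inc[of q] by (auto simp: incseq_def)
      then show "h n x = g x" by (simp add: h_def)
    qed
  qed
  have "AE \<omega> in M. (\<lambda>n. WI q (h n) \<omega>) \<longlonglongrightarrow> WI q g \<omega>"
    using AE_integrable_nu[OF gm g(2)] AE_space
  proof eventually_elim
    case (elim \<omega>)
    show ?case
    proof (rule WI_limit[of \<omega> h q g g])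
      show "\<bar>h n x\<bar> \<le> \<bar>g x\<bar>" for n x by (auto simp: h_def split: split_indicator)
      show "integrable (nu J q \<omega>) g" if "J \<subseteq> {1..q}" for J using elim that by auto
    qed (use elim hm lim in auto)
  qed
  then have "AE \<omega> in M. ennreal ((WI q g \<omega>)\<^sup>2) = liminf (\<lambda>n. ennreal ((WI q (h n) \<omega>)\<^sup>2))"
  proof eventually_elim
    case (elim \<omega>)
    then have "(\<lambda>n. ennreal ((WI q (h n) \<omega>)\<^sup>2)) \<longlonglongrightarrow> ennreal ((WI q g \<omega>)\<^sup>2)"
      by (intro tendsto_ennrealI tendsto_power)
    then show ?case by (intro lim_imp_Liminf[symmetric]) auto
  qed
  then have "(\<integral>\<^sup>+\<omega>. ennreal ((WI q g \<omega>)\<^sup>2) \<partial>M) = (\<integral>\<^sup>+\<omega>. liminf (\<lambda>n. ennreal ((WI q (h n) \<omega>)\<^sup>2)) \<partial>M)"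
    by (rule nn_integral_cong_AE)
  also have "\<dots> \<le> liminf (\<lambda>n. \<integral>\<^sup>+\<omega>. ennreal ((WI q (h n) \<omega>)\<^sup>2) \<partial>M)"
    using WI_meas[OF hm] by (intro nn_integral_liminf) measurable
  also have "\<dots> \<le> liminf (\<lambda>n. of_nat (L2const q) * (\<integral>\<^sup>+x. ennreal ((g x)\<^sup>2) \<partial>pow_measure \<mu> q))"
  proof (intro Liminf_mono always_eventually allI)
    fix n
    have "(\<integral>\<^sup>+\<omega>. ennreal ((WI q (h n) \<omega>)\<^sup>2) \<partial>M) \<le> of_nat (L2const q) * (\<integral>\<^sup>+x. ennreal ((h n x)\<^sup>2) \<partial>pow_measure \<mu> q)"
      by (rule WI_L2_box_supp[OF hs hb])
    also have "\<dots> \<le> of_nat (L2const q) * (\<integral>\<^sup>+x. ennreal ((g x)\<^sup>2) \<partial>pow_measure \<mu> q)"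
      by (intro mult_left_mono nn_integral_mono) (auto simp: h_def split: split_indicator)
    finally show "(\<integral>\<^sup>+\<omega>. ennreal ((WI q (h n) \<omega>)\<^sup>2) \<partial>M) \<le> of_nat (L2const q) * (\<integral>\<^sup>+x. ennreal ((g x)\<^sup>2) \<partial>pow_measure \<mu> q)" .
  qed
  also have "\<dots> = of_nat (L2const q) * (\<integral>\<^sup>+x. ennreal ((g x)\<^sup>2) \<partial>pow_measure \<mu> q)" by (simp add: Liminf_const)
  finally show ?thesis .
qed

lemma WI_L2_diff:
  assumes g: "simple_function (pow_measure \<mu> q) g" "(\<integral>\<^sup>+x. ennreal \<bar>g x\<bar> \<partial>pow_measure \<mu> q) < \<infinity>"
    and h: "simple_function (pow_measure \<mu> q) h" "(\<integral>\<^sup>+x. ennreal \<bar>h x\<bar> \<partial>pow_measure \<mu> q) < \<infinity>"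
  shows "(\<integral>\<^sup>+\<omega>. ennreal ((WI q g \<omega> - WI q h \<omega>)\<^sup>2) \<partial>M) \<le> of_nat (L2const q) * (\<integral>\<^sup>+x. ennreal ((g x - h x)\<^sup>2) \<partial>pow_measure \<mu> q)"
proof -
  have gm[measurable]: "g \<in> borel_measurable (pow_measure \<mu> q)" using g(1) by (rule borel_measurable_simple_function)
  have hm[measurable]: "h \<in> borel_measurable (pow_measure \<mu> q)" using h(1) by (rule borel_measurable_simple_function)
  have d: "simple_function (pow_measure \<mu> q) (\<lambda>x. g x - h x)" using g(1) h(1) by (rule simple_function_diff)
  have "(\<integral>\<^sup>+x. ennreal \<bar>g x - h x\<bar> \<partial>pow_measure \<mu> q) \<le> (\<integral>\<^sup>+x. ennreal \<bar>g x\<bar> + ennreal \<bar>h x\<bar> \<partial>pow_measure \<mu> q)"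
    by (intro nn_integral_mono) (simp add: ennreal_plus[symmetric] del: ennreal_plus)
  also have "\<dots> < \<infinity>" using g(2) h(2) by (subst nn_integral_add) (auto simp: less_top[symmetric])
  finally have d1: "(\<integral>\<^sup>+x. ennreal \<bar>g x - h x\<bar> \<partial>pow_measure \<mu> q) < \<infinity>" .
  have "AE \<omega> in M. WI q g \<omega> - WI q h \<omega> = WI q (\<lambda>x. g x - h x) \<omega>"
    using AE_integrable_nu[OF gm g(2)] AE_integrable_nu[OF hm h(2)]
  proof eventually_elim
    case (elim \<omega>)
    then show ?case using WI_lin[of q \<omega> g h 1 "-1"] by simp
  qed
  then have "(\<integral>\<^sup>+\<omega>. ennreal ((WI q g \<omega> - WI q h \<omega>)\<^sup>2) \<partial>M) = (\<integral>\<^sup>+\<omega>. ennreal ((WI q (\<lambda>x. g x - h x) \<omega>)\<^sup>2) \<partial>M)"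
    by (intro nn_integral_cong_AE) auto
  also have "\<dots> \<le> of_nat (L2const q) * (\<integral>\<^sup>+x. ennreal ((g x - h x)\<^sup>2) \<partial>pow_measure \<mu> q)"
    by (rule WI_L2[OF d d1])
  finally show ?thesis .
qed

lemma box_supp_L1:
  assumes "box_supp n q g"
  shows "(\<integral>\<^sup>+x. ennreal \<bar>g x\<bar> \<partial>pow_measure \<mu> q) < \<infinity>"
proof -
  obtain c where c: "\<And>x. x \<in> space (pow_measure \<mu> q) \<Longrightarrow> \<bar>g x\<bar> \<le> c * indicator (Box q n) x" using assms by (auto simp: box_supp_def)
  have "(\<integral>\<^sup>+x. ennreal \<bar>g x\<bar> \<partial>pow_measure \<mu> q) \<le> (\<integral>\<^sup>+x. ennreal \<bar>c\<bar> * indicator (Box q n) x \<partial>pow_measure \<mu> q)"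
  proof (rule nn_integral_mono)
    fix x assume x: "x \<in> space (pow_measure \<mu> q)"
    show "ennreal \<bar>g x\<bar> \<le> ennreal \<bar>c\<bar> * indicator (Box q n) x"
      using c[OF x] by (auto split: split_indicator intro!: ennreal_leI)
  qed
  also have "\<dots> = ennreal \<bar>c\<bar> * emeasure (pow_measure \<mu> q) (Box q n)" by (simp add: nn_integral_cmult_indicator)
  also have "\<dots> < \<infinity>" using Box_fin[of q n] by (simp add: ennreal_mult_less_top)
  finally show ?thesis .
qed

lemma tail_L2:
  assumes f[measurable]: "f \<in> borel_measurable (pow_measure \<mu> q)" and f2: "(\<integral>\<^sup>+x. ennreal ((f x)\<^sup>2) \<partial>pow_measure \<mu> q) < \<infinity>"
  shows "(\<lambda>N. \<integral>\<^sup>+x. ennreal ((tail q N f x)\<^sup>2) \<partial>pow_measure \<mu> q) \<longlonglongrightarrow> 0"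
proof -
  have "(\<lambda>N. \<integral>\<^sup>+x. ennreal ((tail q N f x)\<^sup>2) \<partial>pow_measure \<mu> q) \<longlonglongrightarrow> (\<integral>\<^sup>+x. 0 \<partial>pow_measure \<mu> q)"
  proof (rule nn_integral_dominated_convergence[where w="\<lambda>x. ennreal ((f x)\<^sup>2)"])
    show "(\<lambda>x. ennreal ((tail q N f x)\<^sup>2)) \<in> borel_measurable (pow_measure \<mu> q)" for N
      using tail_meas[OF f, of N] by measurable
    show "AE x in pow_measure \<mu> q. ennreal ((tail q N f x)\<^sup>2) \<le> ennreal ((f x)\<^sup>2)" for N
    proof (intro AE_I2 ennreal_leI)
      fix x show "(tail q N f x)\<^sup>2 \<le> (f x)\<^sup>2" using tail_bounds[of q N f x] by (metis abs_of_nonneg abs_le_square_iff)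
    qed
    show "AE x in pow_measure \<mu> q. (\<lambda>N. ennreal ((tail q N f x)\<^sup>2)) \<longlonglongrightarrow> 0"
    proof (rule AE_I2)
      fix x assume "x \<in> space (pow_measure \<mu> q)"
      from tendsto_ennrealI[OF tendsto_power[OF tail_lim[OF this, of f], of 2]]
      show "(\<lambda>N. ennreal ((tail q N f x)\<^sup>2)) \<longlonglongrightarrow> 0" by simp
    qed
  qed (use f2 in auto)
  then show ?thesis by simp
qed

text \<open>\<open>is_wiener_ito\<close> asks for symmetric approximations. Rounding acts on values
  only, and the box is invariant under permutations of the coordinates.\<close>

lemma trunc_sym: "symmetric_on \<mu> q f \<Longrightarrow> symmetric_on \<mu> q (trunc q n f)"
  unfolding symmetric_on_def
proof (intro allI impI ballI)
  fix \<pi> x assume f: "\<forall>\<pi>. \<pi> permutes {1..q} \<longrightarrow> (\<forall>x\<in>space (pow_measure \<mu> q). f (x \<circ> \<pi>) = f x)"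
    and \<pi>: "\<pi> permutes {1..q}" and x: "x \<in> space (pow_measure \<mu> q)"
  have "x \<circ> \<pi> \<in> Box q n \<longleftrightarrow> x \<in> Box q n"
  proof -
    have xe: "x i = undefined" if "i \<notin> {1..q}" for i using x that by (auto simp: space_PiM)
    have "(x \<circ> \<pi>) i = undefined" if "i \<notin> {1..q}" for i using xe[OF that] permutes_not_in[OF \<pi> that] by simp
    then have "x \<circ> \<pi> \<in> Box q n \<longleftrightarrow> (\<forall>i\<in>{1..q}. x (\<pi> i) \<in> B n)" by (auto simp: Box_def PiE_iff extensional_def)
    also have "\<dots> \<longleftrightarrow> (\<forall>i\<in>\<pi> ` {1..q}. x i \<in> B n)" by auto
    also have "\<dots> \<longleftrightarrow> x \<in> Box q n" unfolding permutes_image[OF \<pi>] using xe by (auto simp: Box_def PiE_iff extensional_def)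
    finally show ?thesis .
  qed
  then show "trunc q n f (x \<circ> \<pi>) = trunc q n f x" using f \<pi> x by (simp add: trunc_def indicator_def)
qed

lemma trunc_diff_sq: "N \<le> n \<Longrightarrow> N \<le> k \<Longrightarrow> (trunc q n f x - trunc q k f x)\<^sup>2 \<le> 4 * (tail q N f x)\<^sup>2"
proof -
  assume "N \<le> n" "N \<le> k"
  then have "\<bar>trunc q n f x - trunc q k f x\<bar> \<le> 2 * tail q N f x"
    using trunc_tail[of N n q f x] trunc_tail[of N k q f x] by linarith
  then have "(trunc q n f x - trunc q k f x)\<^sup>2 \<le> (2 * tail q N f x)\<^sup>2"
    using tail_bounds(1)[of q N f x] by (intro abs_le_square_iff[THEN iffD1]) auto
  then show ?thesis by (simp add: power_mult_distrib)
qed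

text \<open>Guarantees that the choice in \<open>wiener_ito\<close> picks a genuine limit. The
  truncations themselves are the witnesses: by the L^2 bound their integrals are Cauchy as soon as
  the tails of \<open>f\<close> vanish in L^2.\<close>

lemma is_wiener_ito_ex:
  assumes f: "f \<in> Lsym 2 \<mu> q"
  shows "\<exists>Y. is_wiener_ito M \<mu> \<eta> q f Y"
proof -
  have fm[measurable]: "f \<in> borel_measurable (pow_measure \<mu> q)" and sym: "symmetric_on \<mu> q f"
    and f2: "(\<integral>\<^sup>+x. ennreal ((f x)\<^sup>2) \<partial>pow_measure \<mu> q) < \<infinity>" using f by (auto simp: Lsym_def)
  define X where "X n = WI q (trunc q n f)" for n
  note ts = trunc_simple[OF fm] and tb = trunc_box_supp[OF fm]
  have tm: "trunc q n f \<in> borel_measurable (pow_measure \<mu> q)" for n using tb[of n] by (simp add: box_supp_def)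
  have Xm[measurable]: "X n \<in> borel_measurable M" for n unfolding X_def by (rule WI_meas[OF tm])
  have Xi: "integrable M (X n)" for n
    using box_supp_prod_integrable(1)[of "{1::nat}" n "\<lambda>_. q" "\<lambda>_. trunc q n f"] tb by (simp add: X_def)
  have X2: "(\<integral>\<^sup>+\<omega>. ennreal ((X n \<omega>)\<^sup>2) \<partial>M) < \<infinity>" for n
  proof -
    have "integrable M (\<lambda>\<omega>. (X n \<omega>)\<^sup>2)"
      using box_supp_prod_integrable(1)[of "{1, 2::nat}" n "\<lambda>_. q" "\<lambda>_. trunc q n f"] tb by (simp add: X_def power2_eq_square)
    then show ?thesis by (simp add: integrable_iff_bounded)
  qed
  have diff: "(\<integral>\<^sup>+\<omega>. ennreal ((X n \<omega> - X k \<omega>)\<^sup>2) \<partial>M) \<le> of_nat (L2const q) * (4 * (\<integral>\<^sup>+x. ennreal ((tail q N f x)\<^sup>2) \<partial>pow_measure \<mu> q))"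
    if "N \<le> n" "N \<le> k" for n k N
  proof -
    have "(\<integral>\<^sup>+\<omega>. ennreal ((X n \<omega> - X k \<omega>)\<^sup>2) \<partial>M) \<le> of_nat (L2const q) * (\<integral>\<^sup>+x. ennreal ((trunc q n f x - trunc q k f x)\<^sup>2) \<partial>pow_measure \<mu> q)"
      unfolding X_def by (intro WI_L2_diff ts box_supp_L1[OF tb])
    also have "\<dots> \<le> of_nat (L2const q) * (\<integral>\<^sup>+x. 4 * ennreal ((tail q N f x)\<^sup>2) \<partial>pow_measure \<mu> q)"
    proof (intro mult_left_mono nn_integral_mono)
      fix x
      have "ennreal ((trunc q n f x - trunc q k f x)\<^sup>2) \<le> ennreal (4 * (tail q N f x)\<^sup>2)"
        using trunc_diff_sq[OF that] by (rule ennreal_leI)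
      then show "ennreal ((trunc q n f x - trunc q k f x)\<^sup>2) \<le> 4 * ennreal ((tail q N f x)\<^sup>2)" by (simp add: ennreal_mult)
    qed simp
    also have "\<dots> = of_nat (L2const q) * (4 * (\<integral>\<^sup>+x. ennreal ((tail q N f x)\<^sup>2) \<partial>pow_measure \<mu> q))"
      using tail_meas[OF fm, of N] by (subst nn_integral_cmult) auto
    finally show ?thesis .
  qed
  have a0: "(\<lambda>N. of_nat (L2const q) * (4 * (\<integral>\<^sup>+x. ennreal ((tail q N f x)\<^sup>2) \<partial>pow_measure \<mu> q))) \<longlonglongrightarrow> of_nat (L2const q) * (4 * 0)"
    by (intro ennreal_tendsto_cmult tail_L2[OF fm f2]) (auto simp: of_nat_less_top)
  have cauchy: "\<exists>N. \<forall>n\<ge>N. \<forall>k\<ge>N. (\<integral>\<^sup>+\<omega>. ennreal (\<bar>X n \<omega> - X k \<omega>\<bar> ^ 2) \<partial>M) \<le> ennreal \<epsilon>" if "0 < \<epsilon>" for \<epsilon>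
  proof -
    have "0 < ennreal \<epsilon>" using that by simp
    then obtain N where N: "of_nat (L2const q) * (4 * (\<integral>\<^sup>+x. ennreal ((tail q N f x)\<^sup>2) \<partial>pow_measure \<mu> q)) < ennreal \<epsilon>"
      using order_tendstoD(2)[OF a0, of "ennreal \<epsilon>"] by (auto simp: eventually_sequentially)
    have "(\<integral>\<^sup>+\<omega>. ennreal (\<bar>X n \<omega> - X k \<omega>\<bar> ^ 2) \<partial>M) \<le> ennreal \<epsilon>" if "N \<le> n" "N \<le> k" for n k
      using order_trans[OF diff[OF that] less_imp_le[OF N]] by simp
    then show ?thesis by blast
  qed
  obtain Y where Ym[measurable]: "Y \<in> borel_measurable M" and lim: "(\<lambda>n. \<integral>\<^sup>+\<omega>. ennreal (\<bar>X n \<omega> - Y \<omega>\<bar> ^ 2) \<partial>M) \<longlonglongrightarrow> 0"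
    using Lp_complete[OF Xi _ cauchy] by auto
  have Y2: "(\<integral>\<^sup>+\<omega>. ennreal ((Y \<omega>)\<^sup>2) \<partial>M) < \<infinity>"
  proof -
    obtain n where n: "(\<integral>\<^sup>+\<omega>. ennreal (\<bar>X n \<omega> - Y \<omega>\<bar> ^ 2) \<partial>M) < 1"
      using order_tendstoD(2)[OF lim, of 1] by (auto simp: eventually_sequentially)
    have "(\<integral>\<^sup>+\<omega>. ennreal ((Y \<omega>)\<^sup>2) \<partial>M) \<le> (\<integral>\<^sup>+\<omega>. 2 * ennreal ((X n \<omega>)\<^sup>2) + 2 * ennreal (\<bar>X n \<omega> - Y \<omega>\<bar> ^ 2) \<partial>M)"
    proof (rule nn_integral_mono)
      fix \<omega>
      have "(Y \<omega>)\<^sup>2 \<le> 2 * (X n \<omega>)\<^sup>2 + 2 * \<bar>X n \<omega> - Y \<omega>\<bar> ^ 2"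
        using sq_sum_le[of "X n \<omega>" "Y \<omega> - X n \<omega>"] by (simp add: power2_commute)
      then have "ennreal ((Y \<omega>)\<^sup>2) \<le> ennreal (2 * (X n \<omega>)\<^sup>2 + 2 * \<bar>X n \<omega> - Y \<omega>\<bar> ^ 2)" by (rule ennreal_leI)
      then show "ennreal ((Y \<omega>)\<^sup>2) \<le> 2 * ennreal ((X n \<omega>)\<^sup>2) + 2 * ennreal (\<bar>X n \<omega> - Y \<omega>\<bar> ^ 2)"
        by (simp add: ennreal_mult)
    qed
    also have "\<dots> = 2 * (\<integral>\<^sup>+\<omega>. ennreal ((X n \<omega>)\<^sup>2) \<partial>M) + 2 * (\<integral>\<^sup>+\<omega>. ennreal (\<bar>X n \<omega> - Y \<omega>\<bar> ^ 2) \<partial>M)"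
      by (simp add: nn_integral_add nn_integral_cmult)
    also have "\<dots> < \<infinity>" using X2[of n] less_trans[OF n, of \<infinity>] by (simp add: ennreal_mult_less_top)
    finally show ?thesis .
  qed
  have "is_wiener_ito M \<mu> \<eta> q f Y"
    unfolding is_wiener_ito_def
  proof (intro conjI exI[of _ "\<lambda>n. trunc q n f"] allI)
    show "simple_function (pow_measure \<mu> q) (trunc q j f)" for j by (rule ts)
    show "trunc q j f \<in> Lsym 1 \<mu> q" for j
      using tm[of j] trunc_sym[OF sym, of j] box_supp_L1[OF tb[of j]] by (simp add: Lsym_def)
    show "(\<lambda>j. \<integral>\<^sup>+x. ennreal ((trunc q j f x - f x)\<^sup>2) \<partial>pow_measure \<mu> q) \<longlonglongrightarrow> 0"
    proof (rule tendsto_sandwich[where f="\<lambda>_. 0" and h="\<lambda>N. \<integral>\<^sup>+x. ennreal ((tail q N f x)\<^sup>2) \<partial>pow_measure \<mu> q"])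
      show "eventually (\<lambda>j. (\<integral>\<^sup>+x. ennreal ((trunc q j f x - f x)\<^sup>2) \<partial>pow_measure \<mu> q) \<le> (\<integral>\<^sup>+x. ennreal ((tail q j f x)\<^sup>2) \<partial>pow_measure \<mu> q)) sequentially"
      proof (intro always_eventually allI nn_integral_mono ennreal_leI)
        fix j x show "(trunc q j f x - f x)\<^sup>2 \<le> (tail q j f x)\<^sup>2"
          using trunc_tail[OF order_refl, of q j f x] tail_bounds(1)[of q j f x] by (intro abs_le_square_iff[THEN iffD1]) auto
      qed
    qed (use tail_L2[OF fm f2] in auto)
    have "(\<integral>\<^sup>+\<omega>. ennreal ((wiener_ito_L1 \<mu> \<eta> q (trunc q j f) \<omega> - Y \<omega>)\<^sup>2) \<partial>M) = (\<integral>\<^sup>+\<omega>. ennreal (\<bar>X j \<omega> - Y \<omega>\<bar> ^ 2) \<partial>M)" for j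
      using box_supp_integrable[OF tb] by (intro nn_integral_cong) (simp add: WI_eq X_def)
    then show "(\<lambda>j. \<integral>\<^sup>+\<omega>. ennreal ((wiener_ito_L1 \<mu> \<eta> q (trunc q j f) \<omega> - Y \<omega>)\<^sup>2) \<partial>M) \<longlonglongrightarrow> 0"
      using lim by simp
  qed (use Y2 in auto)
  then show ?thesis by (rule exI[of _ Y])
qed

text \<open>The chosen version comes with some unknown approximating sequence \<open>g\<close>. Both
  \<open>g\<close> and the truncations approach \<open>f\<close>, so the L^2 bound forces their
  integrals to have the same limit.\<close>

lemma wiener_ito_L2_limit:
  assumes f: "f \<in> Lsym 2 \<mu> q"
  shows "wiener_ito M \<mu> \<eta> q f \<in> borel_measurable M"
    and "(\<lambda>n. \<integral>\<^sup>+\<omega>. ennreal (\<bar>WI q (trunc q n f) \<omega> - wiener_ito M \<mu> \<eta> q f \<omega>\<bar> ^ 2) \<partial>M) \<longlonglongrightarrow> 0"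
proof -
  define W where "W = wiener_ito M \<mu> \<eta> q f"
  have fm[measurable]: "f \<in> borel_measurable (pow_measure \<mu> q)"
    and f2: "(\<integral>\<^sup>+x. ennreal ((f x)\<^sup>2) \<partial>pow_measure \<mu> q) < \<infinity>" using f by (auto simp: Lsym_def)
  have isW: "is_wiener_ito M \<mu> \<eta> q f W"
    unfolding W_def wiener_ito_def by (rule someI_ex[OF is_wiener_ito_ex[OF f]])
  then have Wm[measurable]: "W \<in> borel_measurable M" by (simp add: is_wiener_ito_def)
  then show "wiener_ito M \<mu> \<eta> q f \<in> borel_measurable M" by (simp add: W_def)
  from isW obtain g where gs: "\<And>j. simple_function (pow_measure \<mu> q) (g j)" and gL: "\<And>j. g j \<in> Lsym 1 \<mu> q"
    and gf: "(\<lambda>j. \<integral>\<^sup>+ x. ennreal ((g j x - f x)\<^sup>2) \<partial>pow_measure \<mu> q) \<longlonglongrightarrow> 0"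
    and gW: "(\<lambda>j. \<integral>\<^sup>+ \<omega>. ennreal ((wiener_ito_L1 \<mu> \<eta> q (g j) \<omega> - W \<omega>)\<^sup>2) \<partial>M) \<longlonglongrightarrow> 0"
    unfolding is_wiener_ito_def by blast
  have gm[measurable]: "g j \<in> borel_measurable (pow_measure \<mu> q)" for j using gs by (rule borel_measurable_simple_function)
  have g1: "(\<integral>\<^sup>+x. ennreal \<bar>g j x\<bar> \<partial>pow_measure \<mu> q) < \<infinity>" for j using gL[of j] by (simp add: Lsym_def)
  have gW': "(\<integral>\<^sup>+ \<omega>. ennreal ((wiener_ito_L1 \<mu> \<eta> q (g j) \<omega> - W \<omega>)\<^sup>2) \<partial>M) = (\<integral>\<^sup>+ \<omega>. ennreal ((WI q (g j) \<omega> - W \<omega>)\<^sup>2) \<partial>M)" for j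
    using AE_WI_eq[OF gm g1, of j] by (intro nn_integral_cong_AE) auto
  have WIm[measurable]: "WI q (g j) \<in> borel_measurable M" for j by (rule WI_meas[OF gm])
  let ?K = "of_nat (L2const q) :: ennreal"
  let ?t = "\<lambda>n. \<integral>\<^sup>+x. ennreal ((trunc q n f x - f x)\<^sup>2) \<partial>pow_measure \<mu> q"
  note ts = trunc_simple[OF fm] and tb = trunc_box_supp[OF fm]
  have tm[measurable]: "trunc q n f \<in> borel_measurable (pow_measure \<mu> q)" for n using tb[of n] by (simp add: box_supp_def)
  have Xm[measurable]: "WI q (trunc q n f) \<in> borel_measurable M" for n by (rule WI_meas[OF tm])
  \<comment> \<open>The two terms with factor 0 are the limits in \<open>j\<close> of the distances
    involving \<open>g j\<close>; they are kept so that the limit can be taken term by term.\<close>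
  have bound: "(\<integral>\<^sup>+\<omega>. ennreal (\<bar>WI q (trunc q n f) \<omega> - W \<omega>\<bar> ^ 2) \<partial>M) \<le> 2 * (?K * (2 * ?t n + 2 * 0)) + 2 * 0" for n
  proof (rule tendsto_lowerbound)
    show "(\<lambda>j. 2 * (?K * (2 * ?t n + 2 * (\<integral>\<^sup>+ x. ennreal ((g j x - f x)\<^sup>2) \<partial>pow_measure \<mu> q))) +
       2 * (\<integral>\<^sup>+ \<omega>. ennreal ((wiener_ito_L1 \<mu> \<eta> q (g j) \<omega> - W \<omega>)\<^sup>2) \<partial>M)) \<longlonglongrightarrow> 2 * (?K * (2 * ?t n + 2 * 0)) + 2 * 0"
      by (intro tendsto_add ennreal_tendsto_cmult tendsto_const gf gW) (auto simp: of_nat_less_top)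
    show "eventually (\<lambda>j. (\<integral>\<^sup>+\<omega>. ennreal (\<bar>WI q (trunc q n f) \<omega> - W \<omega>\<bar> ^ 2) \<partial>M) \<le>
       2 * (?K * (2 * ?t n + 2 * (\<integral>\<^sup>+ x. ennreal ((g j x - f x)\<^sup>2) \<partial>pow_measure \<mu> q))) +
       2 * (\<integral>\<^sup>+ \<omega>. ennreal ((wiener_ito_L1 \<mu> \<eta> q (g j) \<omega> - W \<omega>)\<^sup>2) \<partial>M)) sequentially"
    proof (intro always_eventually allI)
      fix j
      have "(\<integral>\<^sup>+\<omega>. ennreal (\<bar>WI q (trunc q n f) \<omega> - W \<omega>\<bar> ^ 2) \<partial>M) \<le>
        (\<integral>\<^sup>+\<omega>. 2 * ennreal ((WI q (trunc q n f) \<omega> - WI q (g j) \<omega>)\<^sup>2) + 2 * ennreal ((WI q (g j) \<omega> - W \<omega>)\<^sup>2) \<partial>M)"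
      proof (rule nn_integral_mono)
        fix \<omega>
        have "ennreal (\<bar>WI q (trunc q n f) \<omega> - W \<omega>\<bar> ^ 2) \<le>
          ennreal (2 * (WI q (trunc q n f) \<omega> - WI q (g j) \<omega>)\<^sup>2 + 2 * (WI q (g j) \<omega> - W \<omega>)\<^sup>2)"
          using sq_sum_le[of "WI q (trunc q n f) \<omega> - WI q (g j) \<omega>" "WI q (g j) \<omega> - W \<omega>"] by (intro ennreal_leI) simp
        then show "ennreal (\<bar>WI q (trunc q n f) \<omega> - W \<omega>\<bar> ^ 2) \<le>
          2 * ennreal ((WI q (trunc q n f) \<omega> - WI q (g j) \<omega>)\<^sup>2) + 2 * ennreal ((WI q (g j) \<omega> - W \<omega>)\<^sup>2)"
          by (simp add: ennreal_mult)
      qed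
      also have "\<dots> = 2 * (\<integral>\<^sup>+\<omega>. ennreal ((WI q (trunc q n f) \<omega> - WI q (g j) \<omega>)\<^sup>2) \<partial>M) + 2 * (\<integral>\<^sup>+\<omega>. ennreal ((WI q (g j) \<omega> - W \<omega>)\<^sup>2) \<partial>M)"
        by (simp add: nn_integral_add nn_integral_cmult)
      also have "(\<integral>\<^sup>+\<omega>. ennreal ((WI q (trunc q n f) \<omega> - WI q (g j) \<omega>)\<^sup>2) \<partial>M) \<le>
         ?K * (\<integral>\<^sup>+x. ennreal ((trunc q n f x - g j x)\<^sup>2) \<partial>pow_measure \<mu> q)"
        by (intro WI_L2_diff ts box_supp_L1[OF tb] gs g1)
      also have "(\<integral>\<^sup>+x. ennreal ((trunc q n f x - g j x)\<^sup>2) \<partial>pow_measure \<mu> q) \<le>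
         (\<integral>\<^sup>+x. 2 * ennreal ((trunc q n f x - f x)\<^sup>2) + 2 * ennreal ((g j x - f x)\<^sup>2) \<partial>pow_measure \<mu> q)"
      proof (rule nn_integral_mono)
        fix x
        have "ennreal ((trunc q n f x - g j x)\<^sup>2) \<le> ennreal (2 * (trunc q n f x - f x)\<^sup>2 + 2 * (g j x - f x)\<^sup>2)"
          using sq_sum_le[of "trunc q n f x - f x" "f x - g j x"] by (intro ennreal_leI) (simp add: power2_commute)
        then show "ennreal ((trunc q n f x - g j x)\<^sup>2) \<le> 2 * ennreal ((trunc q n f x - f x)\<^sup>2) + 2 * ennreal ((g j x - f x)\<^sup>2)"
          by (simp add: ennreal_mult)
      qed
      also have "\<dots> = 2 * ?t n + 2 * (\<integral>\<^sup>+ x. ennreal ((g j x - f x)\<^sup>2) \<partial>pow_measure \<mu> q)"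
        by (simp add: nn_integral_add nn_integral_cmult)
      finally show "(\<integral>\<^sup>+\<omega>. ennreal (\<bar>WI q (trunc q n f) \<omega> - W \<omega>\<bar> ^ 2) \<partial>M) \<le>
       2 * (?K * (2 * ?t n + 2 * (\<integral>\<^sup>+ x. ennreal ((g j x - f x)\<^sup>2) \<partial>pow_measure \<mu> q))) +
       2 * (\<integral>\<^sup>+ \<omega>. ennreal ((wiener_ito_L1 \<mu> \<eta> q (g j) \<omega> - W \<omega>)\<^sup>2) \<partial>M)"
        unfolding gW' by (simp add: mult_left_mono)
    qed
  qed simp
  have t0: "?t \<longlonglongrightarrow> 0"
  proof (rule tendsto_sandwich[where f="\<lambda>_. 0" and h="\<lambda>N. \<integral>\<^sup>+x. ennreal ((tail q N f x)\<^sup>2) \<partial>pow_measure \<mu> q"])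
    show "eventually (\<lambda>j. ?t j \<le> (\<integral>\<^sup>+x. ennreal ((tail q j f x)\<^sup>2) \<partial>pow_measure \<mu> q)) sequentially"
    proof (intro always_eventually allI nn_integral_mono ennreal_leI)
      fix j x show "(trunc q j f x - f x)\<^sup>2 \<le> (tail q j f x)\<^sup>2"
        using trunc_tail[OF order_refl, of q j f x] tail_bounds(1)[of q j f x] by (intro abs_le_square_iff[THEN iffD1]) auto
    qed
  qed (use tail_L2[OF fm f2] in auto)
  have "(\<lambda>n. 2 * (?K * (2 * ?t n))) \<longlonglongrightarrow> 2 * (?K * (2 * 0))"
    by (intro ennreal_tendsto_cmult t0) (simp_all add: of_nat_less_top)
  then have lim0: "(\<lambda>n. 2 * (?K * (2 * ?t n))) \<longlonglongrightarrow> 0" by (simp only: mult_zero_right)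
  have "(\<lambda>n. \<integral>\<^sup>+\<omega>. ennreal (\<bar>WI q (trunc q n f) \<omega> - W \<omega>\<bar> ^ 2) \<partial>M) \<longlonglongrightarrow> 0"
  proof (rule tendsto_sandwich[OF _ _ tendsto_const lim0])
    show "eventually (\<lambda>n. (\<integral>\<^sup>+\<omega>. ennreal (\<bar>WI q (trunc q n f) \<omega> - W \<omega>\<bar> ^ 2) \<partial>M) \<le> 2 * (?K * (2 * ?t n))) sequentially"
      using bound unfolding mult_zero_right add_0_right by (intro always_eventually allI)
  qed (intro always_eventually allI zero_le)
  then show "(\<lambda>n. \<integral>\<^sup>+\<omega>. ennreal (\<bar>WI q (trunc q n f) \<omega> - wiener_ito M \<mu> \<eta> q f \<omega>\<bar> ^ 2) \<partial>M) \<longlonglongrightarrow> 0"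
    unfolding W_def .
qed

end

section \<open>Moments of Wiener-Ito integrals\<close>

text \<open>If some factor exceeds \<open>1\<close> in absolute value, the product is at most the \<open>p\<close>-th power of the
  largest factor.\<close>

lemma abs_prod_le_sum_power:
  fixes a :: "'l \<Rightarrow> real"
  assumes S: "finite S" "card S \<le> p"
  shows "\<bar>\<Prod>l\<in>S. a l\<bar> \<le> 1 + (\<Sum>l\<in>S. \<bar>a l\<bar> ^ p)"
proof (cases "\<forall>l\<in>S. \<bar>a l\<bar> \<le> 1")
  case True
  then have "(\<Prod>l\<in>S. \<bar>a l\<bar>) \<le> 1" by (intro prod_le_1) auto
  moreover have "0 \<le> (\<Sum>l\<in>S. \<bar>a l\<bar> ^ p)" by (intro sum_nonneg) auto
  ultimately show ?thesis by (simp add: abs_prod)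
next
  case False
  then have ne: "S \<noteq> {}" by auto
  define c where "c = Max ((\<lambda>l. \<bar>a l\<bar>) ` S)"
  have "c \<in> (\<lambda>l. \<bar>a l\<bar>) ` S" unfolding c_def using S(1) ne by (intro Max_in) auto
  then obtain l0 where l0: "l0 \<in> S" "c = \<bar>a l0\<bar>" by auto
  have le: "\<bar>a l\<bar> \<le> c" if "l \<in> S" for l unfolding c_def using S(1) that by (intro Max_ge) auto
  have c1: "1 \<le> c" using False le by force
  have "\<bar>\<Prod>l\<in>S. a l\<bar> = (\<Prod>l\<in>S. \<bar>a l\<bar>)" by (rule abs_prod)
  also have "\<dots> \<le> (\<Prod>l\<in>S. c)" using le by (intro prod_mono) auto
  also have "\<dots> = c ^ card S" by simp
  also have "\<dots> \<le> c ^ p" using c1 S(2) by (intro power_increasing) auto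
  also have "\<dots> \<le> (\<Sum>l\<in>S. \<bar>a l\<bar> ^ p)"
    unfolding l0(2) using l0(1) S(1) by (intro member_le_sum) auto
  finally show ?thesis by simp
qed

text \<open>Expand the product over the nonempty set \<open>T\<close> of factors taken from
  \<open>d\<close>, and divide those factors by \<epsilon>. This extracts \<epsilon>^card T, which
  is at most \<epsilon>, and leaves a product to which the bound by powers applies. The error is
  then small with \<epsilon> although the powers of \<open>b\<close> are only bounded.\<close>

lemma abs_prod_diff_le:
  fixes b d :: "'l \<Rightarrow> real"
  assumes S: "finite S" "card S \<le> p" and \<epsilon>: "0 < \<epsilon>" "\<epsilon> \<le> 1"
  shows "\<bar>(\<Prod>l\<in>S. d l + b l) - (\<Prod>l\<in>S. b l)\<bar> \<le>
    2 ^ card S * (\<epsilon> * (1 + (\<Sum>l\<in>S. \<bar>d l\<bar> ^ p / \<epsilon> ^ p + \<bar>b l\<bar> ^ p)))"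
proof -
  let ?R = "\<epsilon> * (1 + (\<Sum>l\<in>S. \<bar>d l\<bar> ^ p / \<epsilon> ^ p + \<bar>b l\<bar> ^ p))"
  have R0: "0 \<le> ?R" using \<epsilon> by (intro mult_nonneg_nonneg add_nonneg_nonneg sum_nonneg) auto
  have "(\<Prod>l\<in>S. d l + b l) = (\<Sum>T\<in>Pow S. (\<Prod>l\<in>T. d l) * (\<Prod>l\<in>S - T. b l))" by (rule prod_add[OF S(1)])
  also have "\<dots> = (\<Prod>l\<in>S. b l) + (\<Sum>T\<in>Pow S - {{}}. (\<Prod>l\<in>T. d l) * (\<Prod>l\<in>S - T. b l))"
    using S(1) by (subst sum.remove[of _ "{}"]) auto
  finally have "\<bar>(\<Prod>l\<in>S. d l + b l) - (\<Prod>l\<in>S. b l)\<bar> = \<bar>\<Sum>T\<in>Pow S - {{}}. (\<Prod>l\<in>T. d l) * (\<Prod>l\<in>S - T. b l)\<bar>" by simp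
  also have "\<dots> \<le> (\<Sum>T\<in>Pow S - {{}}. \<bar>(\<Prod>l\<in>T. d l) * (\<Prod>l\<in>S - T. b l)\<bar>)" by (rule sum_abs)
  also have "\<dots> \<le> (\<Sum>T\<in>Pow S - {{}}. ?R)"
  proof (rule sum_mono)
    fix T assume "T \<in> Pow S - {{}}"
    then have T: "T \<subseteq> S" "T \<noteq> {}" "finite T" using S(1) finite_subset by auto
    define u where "u l = (if l \<in> T then d l / \<epsilon> else b l)" for l
    have "(\<Prod>l\<in>S. u l) = (\<Prod>l\<in>S - T. u l) * (\<Prod>l\<in>T. u l)" by (rule prod.subset_diff[OF T(1) S(1)])
    also have "(\<Prod>l\<in>S - T. u l) = (\<Prod>l\<in>S - T. b l)" by (intro prod.cong) (auto simp: u_def)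
    also have "(\<Prod>l\<in>T. u l) = (\<Prod>l\<in>T. d l) / \<epsilon> ^ card T" by (simp add: u_def prod_dividef)
    finally have "(\<Prod>l\<in>T. d l) * (\<Prod>l\<in>S - T. b l) = \<epsilon> ^ card T * (\<Prod>l\<in>S. u l)" using \<epsilon> by simp
    then have "\<bar>(\<Prod>l\<in>T. d l) * (\<Prod>l\<in>S - T. b l)\<bar> = \<epsilon> ^ card T * \<bar>\<Prod>l\<in>S. u l\<bar>" using \<epsilon> by (simp add: abs_mult)
    also have "\<dots> \<le> \<epsilon> * (1 + (\<Sum>l\<in>S. \<bar>u l\<bar> ^ p))"
    proof (intro mult_mono abs_prod_le_sum_power S)
      have "card T \<noteq> 0" using T by auto
      then show "\<epsilon> ^ card T \<le> \<epsilon>" using \<epsilon> power_decreasing[of 1 "card T" \<epsilon>] by simp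
    qed (use \<epsilon> in auto)
    also have "\<dots> \<le> ?R"
      using \<epsilon> by (intro mult_left_mono add_left_mono sum_mono) (auto simp: u_def power_divide abs_divide)
    finally show "\<bar>(\<Prod>l\<in>T. d l) * (\<Prod>l\<in>S - T. b l)\<bar> \<le> ?R" .
  qed
  also have "\<dots> \<le> (\<Sum>T\<in>Pow S. ?R)" using S(1) R0 by (intro sum_mono2) auto
  also have "\<dots> = 2 ^ card S * ?R" using S(1) by (simp add: card_Pow)
  finally show ?thesis .
qed

lemma abs_add_power_le: "\<bar>a + b\<bar> ^ p \<le> 2 ^ p * (\<bar>a\<bar> ^ p + \<bar>b :: real\<bar> ^ p)"
proof -
  have "\<bar>a + b\<bar> \<le> 2 * max \<bar>a\<bar> \<bar>b\<bar>" by (auto simp: max_def)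
  then have "\<bar>a + b\<bar> ^ p \<le> (2 * max \<bar>a\<bar> \<bar>b\<bar>) ^ p" by (intro power_mono) auto
  also have "\<dots> = 2 ^ p * (max \<bar>a\<bar> \<bar>b\<bar>) ^ p" by (rule power_mult_distrib)
  also have "\<dots> \<le> 2 ^ p * (\<bar>a\<bar> ^ p + \<bar>b\<bar> ^ p)" by (intro mult_left_mono) (auto simp: max_def)
  finally show ?thesis .
qed

context prob_space begin

lemma prod_integrable_Lp:
  fixes W :: "'l \<Rightarrow> 'a \<Rightarrow> real"
  assumes S: "finite S" "card S \<le> p" and W[measurable]: "\<And>l. l \<in> S \<Longrightarrow> W l \<in> borel_measurable M"
    and Wp: "\<And>l. l \<in> S \<Longrightarrow> (\<integral>\<^sup>+\<omega>. ennreal (\<bar>W l \<omega>\<bar> ^ p) \<partial>M) < \<infinity>"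
  shows "integrable M (\<lambda>\<omega>. \<Prod>l\<in>S. W l \<omega>)"
proof (rule Bochner_Integration.integrable_bound)
  have "integrable M (\<lambda>\<omega>. \<bar>W l \<omega>\<bar> ^ p)" if "l \<in> S" for l
    using Wp[OF that] W[OF that] by (intro integrableI_bounded) auto
  then show "integrable M (\<lambda>\<omega>. 1 + (\<Sum>l\<in>S. \<bar>W l \<omega>\<bar> ^ p))" by (intro Bochner_Integration.integrable_add Bochner_Integration.integrable_sum) auto
  show "(\<lambda>\<omega>. \<Prod>l\<in>S. W l \<omega>) \<in> borel_measurable M" using W by (intro borel_measurable_prod) auto
  show "AE \<omega> in M. norm (\<Prod>l\<in>S. W l \<omega>) \<le> norm (1 + (\<Sum>l\<in>S. \<bar>W l \<omega>\<bar> ^ p))"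
  proof (rule AE_I2)
    fix \<omega>
    show "norm (\<Prod>l\<in>S. W l \<omega>) \<le> norm (1 + (\<Sum>l\<in>S. \<bar>W l \<omega>\<bar> ^ p))"
      using abs_prod_le_sum_power[OF S, of "\<lambda>l. W l \<omega>"] by simp
  qed
qed

text \<open>The order of choices matters: first \<epsilon> is taken small relative to the moments of
  the limits, and then \<open>n\<close> so large that the differences, after division by
  \<epsilon>^p, contribute at most 1.\<close>

lemma prod_limit_Lp:
  fixes W :: "'l \<Rightarrow> 'a \<Rightarrow> real" and X :: "'l \<Rightarrow> nat \<Rightarrow> 'a \<Rightarrow> real"
  assumes S: "finite S" "card S \<le> p" and W[measurable]: "\<And>l. l \<in> S \<Longrightarrow> W l \<in> borel_measurable M"
    and X[measurable]: "\<And>l n. l \<in> S \<Longrightarrow> X l n \<in> borel_measurable M"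
    and Wp: "\<And>l. l \<in> S \<Longrightarrow> (\<integral>\<^sup>+\<omega>. ennreal (\<bar>W l \<omega>\<bar> ^ p) \<partial>M) < \<infinity>"
    and Xi: "\<And>n. integrable M (\<lambda>\<omega>. \<Prod>l\<in>S. X l n \<omega>)"
    and lim: "\<And>l. l \<in> S \<Longrightarrow> (\<lambda>n. \<integral>\<^sup>+\<omega>. ennreal (\<bar>X l n \<omega> - W l \<omega>\<bar> ^ p) \<partial>M) \<longlonglongrightarrow> 0"
  shows "(\<lambda>n. \<integral>\<omega>. (\<Prod>l\<in>S. X l n \<omega>) \<partial>M) \<longlonglongrightarrow> (\<integral>\<omega>. (\<Prod>l\<in>S. W l \<omega>) \<partial>M)"
proof (rule tendsto_L1_int[OF Xi prod_integrable_Lp[OF S W Wp]])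
  define I where "I n l = (\<integral>\<^sup>+\<omega>. ennreal (\<bar>X l n \<omega> - W l \<omega>\<bar> ^ p) \<partial>M)" for n l
  define w where "w l = enn2real (\<integral>\<^sup>+\<omega>. ennreal (\<bar>W l \<omega>\<bar> ^ p) \<partial>M)" for l
  have w: "(\<integral>\<^sup>+\<omega>. ennreal (\<bar>W l \<omega>\<bar> ^ p) \<partial>M) = ennreal (w l)" "0 \<le> w l" if "l \<in> S" for l
    using Wp[OF that] by (auto simp: w_def less_top)
  \<comment> \<open>One unit comes from the bound for the product, one is allowed for the rescaled
    differences, and the sum accounts for the limits.\<close>
  define C where "C = 2 + (\<Sum>l\<in>S. w l)"
  have C: "0 < C" unfolding C_def using w(2) by (intro add_pos_nonneg sum_nonneg) auto
  show "(\<lambda>n. \<integral>\<^sup>+\<omega>. norm ((\<Prod>l\<in>S. X l n \<omega>) - (\<Prod>l\<in>S. W l \<omega>)) \<partial>M) \<longlonglongrightarrow> 0"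
  proof (rule order_tendstoI)
    fix e :: ennreal assume e: "0 < e"
    obtain \<delta> where \<delta>: "0 < \<delta>" "ennreal \<delta> < e"
    proof -
      obtain z where z: "0 < z" "z < e" using dense[OF e] by auto
      then show ?thesis using that[of "enn2real z"] by (cases z) (auto simp: less_top[symmetric])
    qed
    define \<epsilon> where "\<epsilon> = min 1 (\<delta> / (2 ^ card S * C))"
    have \<epsilon>: "0 < \<epsilon>" "\<epsilon> \<le> 1" "2 ^ card S * (\<epsilon> * C) \<le> \<delta>"
    proof -
      show "0 < \<epsilon>" "\<epsilon> \<le> 1" using \<delta> C by (auto simp: \<epsilon>_def)
      have "\<epsilon> \<le> \<delta> / (2 ^ card S * C)" by (simp add: \<epsilon>_def)
      then show "2 ^ card S * (\<epsilon> * C) \<le> \<delta>" using C by (simp add: field_simps)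
    qed
    have "(\<lambda>n. \<Sum>l\<in>S. ennreal (1 / \<epsilon> ^ p) * I n l) \<longlonglongrightarrow> (\<Sum>l\<in>S. ennreal (1 / \<epsilon> ^ p) * 0)"
      unfolding I_def using lim by (intro tendsto_sum ennreal_tendsto_cmult) auto
    then have "(\<lambda>n. \<Sum>l\<in>S. ennreal (1 / \<epsilon> ^ p) * I n l) \<longlonglongrightarrow> 0" by simp
    from order_tendstoD(2)[OF this zero_less_one]
    show "eventually (\<lambda>n. (\<integral>\<^sup>+\<omega>. norm ((\<Prod>l\<in>S. X l n \<omega>) - (\<Prod>l\<in>S. W l \<omega>)) \<partial>M) < e) sequentially"
    proof (eventually_elim)
      case (elim n)
      have "(\<integral>\<^sup>+\<omega>. norm ((\<Prod>l\<in>S. X l n \<omega>) - (\<Prod>l\<in>S. W l \<omega>)) \<partial>M) \<le>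
        (\<integral>\<^sup>+\<omega>. ennreal (2 ^ card S * \<epsilon>) * (1 + (\<Sum>l\<in>S. ennreal (1 / \<epsilon> ^ p) * ennreal (\<bar>X l n \<omega> - W l \<omega>\<bar> ^ p) + ennreal (\<bar>W l \<omega>\<bar> ^ p))) \<partial>M)"
      proof (rule nn_integral_mono)
        fix \<omega>
        let ?s = "\<Sum>l\<in>S. \<bar>X l n \<omega> - W l \<omega>\<bar> ^ p / \<epsilon> ^ p + \<bar>W l \<omega>\<bar> ^ p"
        have s0: "0 \<le> ?s" using \<epsilon> by (intro sum_nonneg) auto
        have "ennreal (norm ((\<Prod>l\<in>S. X l n \<omega>) - (\<Prod>l\<in>S. W l \<omega>))) \<le> ennreal ((2 ^ card S * \<epsilon>) * (1 + ?s))"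
          using abs_prod_diff_le[OF S \<epsilon>(1,2), of "\<lambda>l. X l n \<omega> - W l \<omega>" "\<lambda>l. W l \<omega>"]
          by (intro ennreal_leI) (simp add: mult.assoc)
        also have "\<dots> = ennreal (2 ^ card S * \<epsilon>) * (1 + ennreal ?s)"
        proof -
          have "ennreal (1 + ?s) = 1 + ennreal ?s" using s0 by (subst ennreal_plus) auto
          then show ?thesis using s0 \<epsilon> by (subst ennreal_mult) auto
        qed
        also have "ennreal ?s = (\<Sum>l\<in>S. ennreal (\<bar>X l n \<omega> - W l \<omega>\<bar> ^ p / \<epsilon> ^ p + \<bar>W l \<omega>\<bar> ^ p))"
          using \<epsilon> by (intro sum_ennreal[symmetric]) auto
        also have "\<dots> = (\<Sum>l\<in>S. ennreal (1 / \<epsilon> ^ p) * ennreal (\<bar>X l n \<omega> - W l \<omega>\<bar> ^ p) + ennreal (\<bar>W l \<omega>\<bar> ^ p))"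
          using \<epsilon> by (intro sum.cong refl) (simp add: ennreal_mult[symmetric])
        finally show "ennreal (norm ((\<Prod>l\<in>S. X l n \<omega>) - (\<Prod>l\<in>S. W l \<omega>))) \<le>
          ennreal (2 ^ card S * \<epsilon>) * (1 + (\<Sum>l\<in>S. ennreal (1 / \<epsilon> ^ p) * ennreal (\<bar>X l n \<omega> - W l \<omega>\<bar> ^ p) + ennreal (\<bar>W l \<omega>\<bar> ^ p)))" .
      qed
      also have "\<dots> = ennreal (2 ^ card S * \<epsilon>) * (1 + (\<Sum>l\<in>S. ennreal (1 / \<epsilon> ^ p) * I n l + ennreal (w l)))"
      proof -
        have m1: "(\<lambda>\<omega>. ennreal (1 / \<epsilon> ^ p) * ennreal (\<bar>X l n \<omega> - W l \<omega>\<bar> ^ p) + ennreal (\<bar>W l \<omega>\<bar> ^ p)) \<in> borel_measurable M" if "l \<in> S" for l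
          using X[OF that, of n] W[OF that] by measurable
        have m2: "(\<integral>\<^sup>+\<omega>. ennreal (1 / \<epsilon> ^ p) * ennreal (\<bar>X l n \<omega> - W l \<omega>\<bar> ^ p) + ennreal (\<bar>W l \<omega>\<bar> ^ p) \<partial>M) = ennreal (1 / \<epsilon> ^ p) * I n l + ennreal (w l)"
          if l: "l \<in> S" for l
        proof -
          have [measurable]: "X l n \<in> borel_measurable M" "W l \<in> borel_measurable M" using X W l by auto
          show ?thesis unfolding I_def w(1)[OF l, symmetric] by (simp add: nn_integral_add nn_integral_cmult)
        qed
        have "(\<integral>\<^sup>+\<omega>. ennreal (2 ^ card S * \<epsilon>) * (1 + (\<Sum>l\<in>S. ennreal (1 / \<epsilon> ^ p) * ennreal (\<bar>X l n \<omega> - W l \<omega>\<bar> ^ p) + ennreal (\<bar>W l \<omega>\<bar> ^ p))) \<partial>M)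
          = ennreal (2 ^ card S * \<epsilon>) * (\<integral>\<^sup>+\<omega>. 1 + (\<Sum>l\<in>S. ennreal (1 / \<epsilon> ^ p) * ennreal (\<bar>X l n \<omega> - W l \<omega>\<bar> ^ p) + ennreal (\<bar>W l \<omega>\<bar> ^ p)) \<partial>M)"
          by (rule nn_integral_cmult[OF borel_measurable_add[OF borel_measurable_const borel_measurable_sum[OF m1]]])
        also have "(\<integral>\<^sup>+\<omega>. 1 + (\<Sum>l\<in>S. ennreal (1 / \<epsilon> ^ p) * ennreal (\<bar>X l n \<omega> - W l \<omega>\<bar> ^ p) + ennreal (\<bar>W l \<omega>\<bar> ^ p)) \<partial>M)
          = (\<integral>\<^sup>+\<omega>. 1 \<partial>M) + (\<integral>\<^sup>+\<omega>. (\<Sum>l\<in>S. ennreal (1 / \<epsilon> ^ p) * ennreal (\<bar>X l n \<omega> - W l \<omega>\<bar> ^ p) + ennreal (\<bar>W l \<omega>\<bar> ^ p)) \<partial>M)"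
          by (rule nn_integral_add[OF borel_measurable_const borel_measurable_sum[OF m1]])
        also have "(\<integral>\<^sup>+\<omega>. (\<Sum>l\<in>S. ennreal (1 / \<epsilon> ^ p) * ennreal (\<bar>X l n \<omega> - W l \<omega>\<bar> ^ p) + ennreal (\<bar>W l \<omega>\<bar> ^ p)) \<partial>M)
          = (\<Sum>l\<in>S. ennreal (1 / \<epsilon> ^ p) * I n l + ennreal (w l))"
          by (subst nn_integral_sum[OF m1]) (auto intro!: sum.cong m2)
        finally show ?thesis by (simp add: emeasure_space_1)
      qed
      also have "\<dots> = ennreal (2 ^ card S * \<epsilon>) * (1 + ((\<Sum>l\<in>S. ennreal (1 / \<epsilon> ^ p) * I n l) + ennreal (\<Sum>l\<in>S. w l)))"
        using w(2) by (simp add: sum.distrib)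
      also have "\<dots> \<le> ennreal (2 ^ card S * \<epsilon>) * (1 + (1 + ennreal (\<Sum>l\<in>S. w l)))"
        using elim by (intro mult_left_mono add_left_mono add_right_mono) auto
      also have "\<dots> = ennreal ((2 ^ card S * \<epsilon>) * C)"
      proof -
        have w0: "0 \<le> (\<Sum>l\<in>S. w l)" using w(2) by (rule sum_nonneg)
        then have "1 + (1 + ennreal (\<Sum>l\<in>S. w l)) = ennreal C"
          unfolding C_def by (simp add: ennreal_plus[symmetric] ennreal_1[symmetric] del: ennreal_plus ennreal_1)
        then show ?thesis using \<epsilon> C by (simp add: ennreal_mult)
      qed
      also have "\<dots> \<le> ennreal \<delta>" using \<epsilon>(3) by (intro ennreal_leI) (simp add: mult.assoc)
      finally show ?case using \<delta>(2) by (rule le_less_trans)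
    qed
  qed simp
qed

end

section \<open>Convergence of truncations in L^p and the moment formula in general\<close>

context poisson_sf begin

lemma box_supp_mono: "n \<le> n' \<Longrightarrow> box_supp n q g \<Longrightarrow> box_supp n' q g"
proof -
  assume n: "n \<le> n'" and g: "box_supp n q g"
  then obtain c where c: "\<And>x. x \<in> space (pow_measure \<mu> q) \<Longrightarrow> \<bar>g x\<bar> \<le> c * indicator (Box q n) x" by (auto simp: box_supp_def)
  have "\<bar>g x\<bar> \<le> \<bar>c\<bar> * indicator (Box q n') x" if "x \<in> space (pow_measure \<mu> q)" for x
    using c[OF that] n Box_inc[of q] by (auto simp: incseq_def split: split_indicator_asm split_indicator)
  then show ?thesis using g by (auto simp: box_supp_def)
qed

lemma contr_abs_mono:
  assumes S: "\<And>l. l \<in> S \<Longrightarrow> 1 \<le> l" and \<sigma>: "\<sigma> \<in> gparts q S" and y: "y \<in> space (PiM \<sigma> (\<lambda>_. \<mu>))"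
    and gh: "\<And>l x. l \<in> S \<Longrightarrow> x \<in> space (pow_measure \<mu> (q l)) \<Longrightarrow> \<bar>g l x\<bar> \<le> \<bar>h l x\<bar>"
  shows "\<bar>contr q g S \<sigma> y\<bar> \<le> \<bar>contr q h S \<sigma> y\<bar>"
  unfolding contr_def abs_prod using gh contr_arg_space[OF _ S \<sigma> y] by (intro prod_mono) auto

lemma contr_tendsto:
  assumes S: "\<And>l. l \<in> S \<Longrightarrow> 1 \<le> l" and \<sigma>: "\<sigma> \<in> gparts q S" and y: "y \<in> space (PiM \<sigma> (\<lambda>_. \<mu>))"
    and lim: "\<And>l x. l \<in> S \<Longrightarrow> x \<in> space (pow_measure \<mu> (q l)) \<Longrightarrow> (\<lambda>n. g n l x) \<longlonglongrightarrow> h l x"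
  shows "(\<lambda>n. contr q (g n) S \<sigma> y) \<longlonglongrightarrow> contr q h S \<sigma> y"
  unfolding contr_def using lim contr_arg_space[OF _ S \<sigma> y] by (intro tendsto_prod) auto

lemma WI_power_bound:
  assumes p: "even p" "1 \<le> p" and g: "simple_function (pow_measure \<mu> q) g" "box_supp n q g"
  shows "(\<integral>\<^sup>+\<omega>. ennreal (\<bar>WI q g \<omega>\<bar> ^ p) \<partial>M) \<le>
    (\<Sum>\<sigma>\<in>gparts2 (\<lambda>_. q) {1..p}. \<integral>\<^sup>+y. ennreal \<bar>contr (\<lambda>_. q) (\<lambda>_. g) {1..p} \<sigma> y\<bar> \<partial>PiM \<sigma> (\<lambda>_. \<mu>))"
proof -
  have pr: "(\<Prod>l\<in>{1..p}. WI q g \<omega>) = \<bar>WI q g \<omega>\<bar> ^ p" for \<omega> using p by (simp add: power_even_abs)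
  have "integrable M (\<lambda>\<omega>. \<Prod>l\<in>{1..p}. WI q g \<omega>)"
    using g by (intro box_supp_prod_integrable(1)[of "{1..p}" n "\<lambda>_. q" "\<lambda>_. g"]) auto
  then have "(\<integral>\<^sup>+\<omega>. ennreal (\<bar>WI q g \<omega>\<bar> ^ p) \<partial>M) = ennreal (\<integral>\<omega>. (\<Prod>l\<in>{1..p}. WI q g \<omega>) \<partial>M)"
    unfolding pr by (intro nn_integral_eq_integral) auto
  also have "\<dots> \<le> (\<Sum>\<sigma>\<in>gparts2 (\<lambda>_. q) {1..p}. \<integral>\<^sup>+y. ennreal \<bar>contr (\<lambda>_. q) (\<lambda>_. g) {1..p} \<sigma> y\<bar> \<partial>PiM \<sigma> (\<lambda>_. \<mu>))"
    using g by (intro moment_abs_bound[of "{1..p}" "\<lambda>_. q" "\<lambda>_. g" n]) auto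
  finally show ?thesis .
qed

text \<open>The sum that bounds the \<open>p\<close>-th absolute moment of the integral for even
  \<open>p\<close>. It is monotone in |f| rather than a norm, and its finiteness is what the
  condition on \<open>mt\<close> copies supplies.\<close>

definition contr_norm :: "nat \<Rightarrow> nat \<Rightarrow> ((nat \<Rightarrow> 'x) \<Rightarrow> real) \<Rightarrow> ennreal" where
  "contr_norm p q f = (\<Sum>\<sigma>\<in>gparts2 (\<lambda>_. q) {1..p}. \<integral>\<^sup>+y. ennreal \<bar>contr (\<lambda>_. q) (\<lambda>_. f) {1..p} \<sigma> y\<bar> \<partial>PiM \<sigma> (\<lambda>_. \<mu>))"

lemma contr_norm_mono:
  assumes "\<And>x. x \<in> space (pow_measure \<mu> q) \<Longrightarrow> \<bar>g x\<bar> \<le> \<bar>f x\<bar>"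
  shows "contr_norm p q g \<le> contr_norm p q f"
  unfolding contr_norm_def
  using assms by (intro sum_mono nn_integral_mono ennreal_leI contr_abs_mono) (auto dest: gparts2D)

text \<open>Differences of truncations are controlled by contractions of twice the tail. These tend
  to zero by dominated convergence, with 2^p times the contraction of \<open>f\<close> as majorant.
  The resulting L^p limit agrees almost surely with the L^2 limit chosen in
  \<open>wiener_ito\<close>.\<close>

lemma wiener_ito_Lp:
  assumes f: "f \<in> Lsym 2 \<mu> q" and p: "even p" "1 \<le> p" and fp: "contr_norm p q f < \<infinity>"
  shows "(\<lambda>n. \<integral>\<^sup>+\<omega>. ennreal (\<bar>WI q (trunc q n f) \<omega> - wiener_ito M \<mu> \<eta> q f \<omega>\<bar> ^ p) \<partial>M) \<longlonglongrightarrow> 0"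
    and "(\<integral>\<^sup>+\<omega>. ennreal (\<bar>wiener_ito M \<mu> \<eta> q f \<omega>\<bar> ^ p) \<partial>M) < \<infinity>"
proof -
  have fm[measurable]: "f \<in> borel_measurable (pow_measure \<mu> q)" using f by (auto simp: Lsym_def)
  define X where "X n = WI q (trunc q n f)" for n
  define W where "W = wiener_ito M \<mu> \<eta> q f"
  note ts = trunc_simple[OF fm] and tb = trunc_box_supp[OF fm]
  have tm: "trunc q n f \<in> borel_measurable (pow_measure \<mu> q)" for n using tb[of n] by (simp add: box_supp_def)
  have Xm[measurable]: "X n \<in> borel_measurable M" for n unfolding X_def by (rule WI_meas[OF tm])
  have Wm[measurable]: "W \<in> borel_measurable M" unfolding W_def by (rule wiener_ito_L2_limit(1)[OF f])
  have Xi: "integrable M (X n)" for n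
    using box_supp_prod_integrable(1)[of "{1::nat}" n "\<lambda>_. q" "\<lambda>_. trunc q n f"] tb by (simp add: X_def)
  have diff: "(\<integral>\<^sup>+\<omega>. ennreal (\<bar>X n \<omega> - X k \<omega>\<bar> ^ p) \<partial>M) \<le> contr_norm p q (\<lambda>x. 2 * tail q N f x)"
    if nk: "N \<le> n" "N \<le> k" for n k N
  proof -
    let ?g = "\<lambda>x. 1 * trunc q n f x + (-1) * trunc q k f x"
    have gb: "box_supp (max n k) q ?g"
      using box_supp_mono[OF max.cobounded1 tb[of n], of k] box_supp_mono[OF max.cobounded2 tb[of k], of n] by (rule box_supp_lin)
    have gs: "simple_function (pow_measure \<mu> q) ?g" using ts[of n] ts[of k] by (intro simple_function_add simple_function_mult) auto
    have "(\<integral>\<^sup>+\<omega>. ennreal (\<bar>X n \<omega> - X k \<omega>\<bar> ^ p) \<partial>M) = (\<integral>\<^sup>+\<omega>. ennreal (\<bar>WI q ?g \<omega>\<bar> ^ p) \<partial>M)"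
    proof (rule nn_integral_cong)
      fix \<omega> assume \<omega>: "\<omega> \<in> space M"
      have "WI q ?g \<omega> = 1 * X n \<omega> + (-1) * X k \<omega>"
        unfolding X_def using box_supp_integrable[OF tb _ \<omega>] by (intro WI_lin) auto
      then show "ennreal (\<bar>X n \<omega> - X k \<omega>\<bar> ^ p) = ennreal (\<bar>WI q ?g \<omega>\<bar> ^ p)" by simp
    qed
    also have "\<dots> \<le> contr_norm p q ?g" unfolding contr_norm_def by (rule WI_power_bound[OF p gs gb])
    also have "\<dots> \<le> contr_norm p q (\<lambda>x. 2 * tail q N f x)"
    proof (rule contr_norm_mono)
      fix x
      show "\<bar>?g x\<bar> \<le> \<bar>2 * tail q N f x\<bar>"
        using trunc_tail[OF nk(1), of q f x] trunc_tail[OF nk(2), of q f x] by (simp add: abs_mult)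
    qed
    finally show ?thesis .
  qed
  have a0: "(\<lambda>N. contr_norm p q (\<lambda>x. 2 * tail q N f x)) \<longlonglongrightarrow> 0"
  proof -
    let ?q = "\<lambda>_::nat. q"
    have "(\<lambda>N. contr_norm p q (\<lambda>x. 2 * tail q N f x)) \<longlonglongrightarrow> (\<Sum>\<sigma>\<in>gparts2 ?q {1..p}. \<integral>\<^sup>+y. 0 \<partial>PiM \<sigma> (\<lambda>_. \<mu>))"
      unfolding contr_norm_def
    proof (rule tendsto_sum)
      fix \<sigma> assume \<sigma>2: "\<sigma> \<in> gparts2 ?q {1..p}"
      then have \<sigma>: "\<sigma> \<in> gparts ?q {1..p}" by (rule gparts2D)
      have one: "\<And>l. l \<in> {1..p} \<Longrightarrow> 1 \<le> l" by simp
      show "(\<lambda>N. \<integral>\<^sup>+y. ennreal \<bar>contr ?q (\<lambda>_ x. 2 * tail q N f x) {1..p} \<sigma> y\<bar> \<partial>PiM \<sigma> (\<lambda>_. \<mu>)) \<longlonglongrightarrow> (\<integral>\<^sup>+y. 0 \<partial>PiM \<sigma> (\<lambda>_. \<mu>))"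
      proof (rule nn_integral_dominated_convergence[where w="\<lambda>y. ennreal (2 ^ p) * ennreal \<bar>contr ?q (\<lambda>_. f) {1..p} \<sigma> y\<bar>"])
        have cm: "contr ?q (\<lambda>_. f) {1..p} \<sigma> \<in> borel_measurable (PiM \<sigma> (\<lambda>_. \<mu>))" by (rule contr_meas[OF one \<sigma> fm])
        then show "(\<lambda>y. ennreal (2 ^ p) * ennreal \<bar>contr ?q (\<lambda>_. f) {1..p} \<sigma> y\<bar>) \<in> borel_measurable (PiM \<sigma> (\<lambda>_. \<mu>))" by measurable
        show "(\<lambda>y. ennreal \<bar>contr ?q (\<lambda>_ x. 2 * tail q N f x) {1..p} \<sigma> y\<bar>) \<in> borel_measurable (PiM \<sigma> (\<lambda>_. \<mu>))" for N
        proof -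
          have "contr ?q (\<lambda>_ x. 2 * tail q N f x) {1..p} \<sigma> \<in> borel_measurable (PiM \<sigma> (\<lambda>_. \<mu>))"
            using tail_meas[OF fm, of N] by (intro contr_meas[OF one \<sigma>]) measurable
          then show ?thesis by measurable
        qed
        show "AE y in PiM \<sigma> (\<lambda>_. \<mu>). ennreal \<bar>contr ?q (\<lambda>_ x. 2 * tail q N f x) {1..p} \<sigma> y\<bar> \<le> ennreal (2 ^ p) * ennreal \<bar>contr ?q (\<lambda>_. f) {1..p} \<sigma> y\<bar>" for N
        proof (rule AE_I2)
          fix y assume y: "y \<in> space (PiM \<sigma> (\<lambda>_. \<mu>))"
          have "\<bar>contr ?q (\<lambda>_ x. 2 * tail q N f x) {1..p} \<sigma> y\<bar> \<le> \<bar>contr ?q (\<lambda>_ x. 2 * f x) {1..p} \<sigma> y\<bar>"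
            using tail_bounds by (intro contr_abs_mono[OF one \<sigma> y]) (auto simp: abs_mult)
          also have "\<dots> = 2 ^ p * \<bar>contr ?q (\<lambda>_. f) {1..p} \<sigma> y\<bar>" by (simp add: contr_def prod.distrib abs_mult)
          finally show "ennreal \<bar>contr ?q (\<lambda>_ x. 2 * tail q N f x) {1..p} \<sigma> y\<bar> \<le> ennreal (2 ^ p) * ennreal \<bar>contr ?q (\<lambda>_. f) {1..p} \<sigma> y\<bar>"
            by (simp add: ennreal_mult[symmetric] ennreal_leI)
        qed
        have "(\<integral>\<^sup>+y. ennreal \<bar>contr ?q (\<lambda>_. f) {1..p} \<sigma> y\<bar> \<partial>PiM \<sigma> (\<lambda>_. \<mu>)) \<le> contr_norm p q f"
          unfolding contr_norm_def using \<sigma>2 finite_gparts2[of "{1..p}" ?q] by (intro member_le_sum) auto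
        then have "(\<integral>\<^sup>+y. ennreal \<bar>contr ?q (\<lambda>_. f) {1..p} \<sigma> y\<bar> \<partial>PiM \<sigma> (\<lambda>_. \<mu>)) < \<infinity>" using fp by (rule le_less_trans)
        then show "(\<integral>\<^sup>+y. ennreal (2 ^ p) * ennreal \<bar>contr ?q (\<lambda>_. f) {1..p} \<sigma> y\<bar> \<partial>PiM \<sigma> (\<lambda>_. \<mu>)) < \<infinity>"
          using cm by (subst nn_integral_cmult) (auto simp: ennreal_mult_less_top)
        show "AE y in PiM \<sigma> (\<lambda>_. \<mu>). (\<lambda>N. ennreal \<bar>contr ?q (\<lambda>_ x. 2 * tail q N f x) {1..p} \<sigma> y\<bar>) \<longlonglongrightarrow> 0"
        proof (rule AE_I2)
          fix y assume y: "y \<in> space (PiM \<sigma> (\<lambda>_. \<mu>))"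
          have "(\<lambda>N. contr ?q (\<lambda>_ x. 2 * tail q N f x) {1..p} \<sigma> y) \<longlonglongrightarrow> contr ?q (\<lambda>_ x. 2 * 0) {1..p} \<sigma> y"
            by (intro contr_tendsto[OF one \<sigma> y] tendsto_mult tendsto_const tail_lim)
          \<comment> \<open>At least one factor is present; an empty product would be 1.\<close>
          moreover have "contr ?q (\<lambda>_ x. 2 * 0) {1..p} \<sigma> y = 0" using p(2) by (simp add: contr_def)
          ultimately have "(\<lambda>N. contr ?q (\<lambda>_ x. 2 * tail q N f x) {1..p} \<sigma> y) \<longlonglongrightarrow> 0" by simp
          from tendsto_ennrealI[OF tendsto_rabs_zero[OF this]]
          show "(\<lambda>N. ennreal \<bar>contr ?q (\<lambda>_ x. 2 * tail q N f x) {1..p} \<sigma> y\<bar>) \<longlonglongrightarrow> 0" by simp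
        qed
      qed simp
    qed
    then show ?thesis by simp
  qed
  have cauchy: "\<exists>N. \<forall>n\<ge>N. \<forall>k\<ge>N. (\<integral>\<^sup>+\<omega>. ennreal (\<bar>X n \<omega> - X k \<omega>\<bar> ^ p) \<partial>M) \<le> ennreal \<epsilon>" if \<epsilon>: "0 < \<epsilon>" for \<epsilon>
  proof -
    have "0 < ennreal \<epsilon>" using \<epsilon> by simp
    then obtain N where N: "contr_norm p q (\<lambda>x. 2 * tail q N f x) < ennreal \<epsilon>"
      using order_tendstoD(2)[OF a0, of "ennreal \<epsilon>"] by (auto simp: eventually_sequentially)
    have "(\<integral>\<^sup>+\<omega>. ennreal (\<bar>X n \<omega> - X k \<omega>\<bar> ^ p) \<partial>M) \<le> ennreal \<epsilon>" if "N \<le> n" "N \<le> k" for n k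
      using order_trans[OF diff[OF that] less_imp_le[OF N]] by simp
    then show ?thesis by blast
  qed
  obtain Y where Ym[measurable]: "Y \<in> borel_measurable M" and limY: "(\<lambda>n. \<integral>\<^sup>+\<omega>. ennreal (\<bar>X n \<omega> - Y \<omega>\<bar> ^ p) \<partial>M) \<longlonglongrightarrow> 0"
    using Lp_complete[OF Xi p(2) cauchy] by auto
  have "AE \<omega> in M. Y \<omega> = W \<omega>"
    using wiener_ito_L2_limit(2)[OF f] p(2)
    by (intro Lp_limits_AE_eq[OF Xm Ym Wm _ _ limY, of 2]) (auto simp: X_def W_def)
  then have YW: "(\<integral>\<^sup>+\<omega>. ennreal (\<bar>X n \<omega> - Y \<omega>\<bar> ^ p) \<partial>M) = (\<integral>\<^sup>+\<omega>. ennreal (\<bar>X n \<omega> - W \<omega>\<bar> ^ p) \<partial>M)" for n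
    by (intro nn_integral_cong_AE) auto
  have limW: "(\<lambda>n. \<integral>\<^sup>+\<omega>. ennreal (\<bar>X n \<omega> - W \<omega>\<bar> ^ p) \<partial>M) \<longlonglongrightarrow> 0" using limY unfolding YW .
  then show "(\<lambda>n. \<integral>\<^sup>+\<omega>. ennreal (\<bar>WI q (trunc q n f) \<omega> - wiener_ito M \<mu> \<eta> q f \<omega>\<bar> ^ p) \<partial>M) \<longlonglongrightarrow> 0"
    unfolding X_def W_def .
  obtain n where n: "(\<integral>\<^sup>+\<omega>. ennreal (\<bar>X n \<omega> - W \<omega>\<bar> ^ p) \<partial>M) < 1"
    using order_tendstoD(2)[OF limW, of 1] by (auto simp: eventually_sequentially)
  have Xp: "(\<integral>\<^sup>+\<omega>. ennreal (\<bar>X n \<omega>\<bar> ^ p) \<partial>M) < \<infinity>"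
  proof -
    have "(\<integral>\<^sup>+\<omega>. ennreal (\<bar>X n \<omega>\<bar> ^ p) \<partial>M) \<le> contr_norm p q (trunc q n f)"
      unfolding contr_norm_def X_def by (rule WI_power_bound[OF p ts tb])
    also have "\<dots> \<le> contr_norm p q f" by (intro contr_norm_mono trunc_abs)
    finally show ?thesis using fp by (rule le_less_trans)
  qed
  have "(\<integral>\<^sup>+\<omega>. ennreal (\<bar>W \<omega>\<bar> ^ p) \<partial>M) \<le> (\<integral>\<^sup>+\<omega>. ennreal (2 ^ p) * (ennreal (\<bar>X n \<omega>\<bar> ^ p) + ennreal (\<bar>X n \<omega> - W \<omega>\<bar> ^ p)) \<partial>M)"
  proof (rule nn_integral_mono)
    fix \<omega>
    have "\<bar>W \<omega>\<bar> ^ p \<le> 2 ^ p * (\<bar>X n \<omega>\<bar> ^ p + \<bar>X n \<omega> - W \<omega>\<bar> ^ p)"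
      using abs_add_power_le[of "X n \<omega>" "W \<omega> - X n \<omega>" p] by (simp add: abs_minus_commute)
    then have "ennreal (\<bar>W \<omega>\<bar> ^ p) \<le> ennreal (2 ^ p * (\<bar>X n \<omega>\<bar> ^ p + \<bar>X n \<omega> - W \<omega>\<bar> ^ p))" by (rule ennreal_leI)
    then show "ennreal (\<bar>W \<omega>\<bar> ^ p) \<le> ennreal (2 ^ p) * (ennreal (\<bar>X n \<omega>\<bar> ^ p) + ennreal (\<bar>X n \<omega> - W \<omega>\<bar> ^ p))"
      by (simp add: ennreal_mult)
  qed
  also have "\<dots> = ennreal (2 ^ p) * ((\<integral>\<^sup>+\<omega>. ennreal (\<bar>X n \<omega>\<bar> ^ p) \<partial>M) + (\<integral>\<^sup>+\<omega>. ennreal (\<bar>X n \<omega> - W \<omega>\<bar> ^ p) \<partial>M))"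
    by (subst nn_integral_cmult) (auto simp: nn_integral_add)
  also have "\<dots> < \<infinity>" using Xp less_trans[OF n, of \<infinity>] by (simp add: ennreal_mult_less_top)
  finally show "(\<integral>\<^sup>+\<omega>. ennreal (\<bar>wiener_ito M \<mu> \<eta> q f \<omega>\<bar> ^ p) \<partial>M) < \<infinity>" unfolding W_def .
qed

text \<open>Applied to the absolute values of the truncations, the moment formula has only
  nonnegative summands, so each contraction is at most the moment of the product. That moment is
  bounded by the \<open>p\<close>-th moments of the single factors, uniformly in \<open>n\<close>,
  and Fatou's lemma passes to \<open>f\<close>. This makes the contractions available for every
  subset of the factors.\<close>

lemma contr_finite:
  assumes S: "finite S" "\<And>l. l \<in> S \<Longrightarrow> 1 \<le> l" "card S \<le> p" and p: "even p" "1 \<le> p"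
    and f: "\<And>l. l \<in> S \<Longrightarrow> f l \<in> borel_measurable (pow_measure \<mu> (q l))"
    and fp: "\<And>l. l \<in> S \<Longrightarrow> contr_norm p (q l) (f l) < \<infinity>" and \<sigma>2: "\<sigma> \<in> gparts2 q S"
  shows "(\<integral>\<^sup>+y. ennreal \<bar>contr q f S \<sigma> y\<bar> \<partial>PiM \<sigma> (\<lambda>_. \<mu>)) < \<infinity>"
proof -
  define g where "g n l x = \<bar>trunc (q l) n (f l) x\<bar>" for n l x
  have gs: "simple_function (pow_measure \<mu> (q l)) (g n l)" if "l \<in> S" for n l
    unfolding g_def using trunc_simple[OF f[OF that], of n] by (rule simple_function_compose1)
  have gb: "box_supp n (q l) (g n l)" if "l \<in> S" for n l
    using trunc_box_supp[OF f[OF that], of n] unfolding g_def box_supp_def by auto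
  have gm: "g n l \<in> borel_measurable (pow_measure \<mu> (q l))" if "l \<in> S" for n l
    using gs[OF that] by (rule borel_measurable_simple_function)
  have g0: "0 \<le> contr q (g n) S \<sigma> y" for n \<sigma> y unfolding contr_def g_def by (intro prod_nonneg) auto
  have \<sigma>: "\<sigma> \<in> gparts q S" using \<sigma>2 by (rule gparts2D)
  let ?K = "1 + (\<Sum>l\<in>S. contr_norm p (q l) (f l))"
  have bound: "(\<integral>\<^sup>+y. ennreal (contr q (g n) S \<sigma> y) \<partial>PiM \<sigma> (\<lambda>_. \<mu>)) \<le> ?K" for n
  proof -
    have "(\<integral>\<^sup>+y. ennreal (contr q (g n) S \<sigma> y) \<partial>PiM \<sigma> (\<lambda>_. \<mu>)) = ennreal (\<integral>y. contr q (g n) S \<sigma> y \<partial>PiM \<sigma> (\<lambda>_. \<mu>))"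
      using g0 contr_integrable[OF S(1,2) \<sigma> gb] by (intro nn_integral_eq_integral) auto
    also have "(\<integral>y. contr q (g n) S \<sigma> y \<partial>PiM \<sigma> (\<lambda>_. \<mu>)) \<le> (\<Sum>\<sigma>\<in>gparts2 q S. \<integral>y. contr q (g n) S \<sigma> y \<partial>PiM \<sigma> (\<lambda>_. \<mu>))"
      using \<sigma>2 finite_gparts2[OF S(1), of q] g0 by (intro member_le_sum Bochner_Integration.integral_nonneg) auto
    also have "\<dots> = (\<integral>\<omega>. (\<Prod>l\<in>S. WI (q l) (g n l) \<omega>) \<partial>M)"
      using moment_formula_simple[OF S(1,2) gs gb] by (simp add: moment_formula_def)
    also have "\<dots> \<le> (\<integral>\<omega>. \<bar>\<Prod>l\<in>S. WI (q l) (g n l) \<omega>\<bar> \<partial>M)"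
      using box_supp_prod_integrable(1)[OF S(1) gb] by (intro integral_mono) auto
    finally have "(\<integral>\<^sup>+y. ennreal (contr q (g n) S \<sigma> y) \<partial>PiM \<sigma> (\<lambda>_. \<mu>)) \<le> ennreal (\<integral>\<omega>. \<bar>\<Prod>l\<in>S. WI (q l) (g n l) \<omega>\<bar> \<partial>M)"
      by (simp add: ennreal_leI)
    also have "\<dots> = (\<integral>\<^sup>+\<omega>. ennreal \<bar>\<Prod>l\<in>S. WI (q l) (g n l) \<omega>\<bar> \<partial>M)"
      using box_supp_prod_integrable(1)[OF S(1) gb] by (intro nn_integral_eq_integral[symmetric]) auto
    also have "\<dots> \<le> (\<integral>\<^sup>+\<omega>. 1 + (\<Sum>l\<in>S. ennreal (\<bar>WI (q l) (g n l) \<omega>\<bar> ^ p)) \<partial>M)"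
    proof (rule nn_integral_mono)
      fix \<omega>
      have "ennreal \<bar>\<Prod>l\<in>S. WI (q l) (g n l) \<omega>\<bar> \<le> ennreal (1 + (\<Sum>l\<in>S. \<bar>WI (q l) (g n l) \<omega>\<bar> ^ p))"
        by (intro ennreal_leI abs_prod_le_sum_power S)
      also have "\<dots> = 1 + (\<Sum>l\<in>S. ennreal (\<bar>WI (q l) (g n l) \<omega>\<bar> ^ p))"
        by (subst ennreal_plus) (auto intro!: sum_nonneg)
      finally show "ennreal \<bar>\<Prod>l\<in>S. WI (q l) (g n l) \<omega>\<bar> \<le> 1 + (\<Sum>l\<in>S. ennreal (\<bar>WI (q l) (g n l) \<omega>\<bar> ^ p))" .
    qed
    also have "\<dots> = 1 + (\<Sum>l\<in>S. \<integral>\<^sup>+\<omega>. ennreal (\<bar>WI (q l) (g n l) \<omega>\<bar> ^ p) \<partial>M)"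
    proof -
      have m: "(\<lambda>\<omega>. ennreal (\<bar>WI (q l) (g n l) \<omega>\<bar> ^ p)) \<in> borel_measurable M" if "l \<in> S" for l
        using WI_meas[OF gm[OF that, of n]] by measurable
      have "(\<integral>\<^sup>+\<omega>. 1 + (\<Sum>l\<in>S. ennreal (\<bar>WI (q l) (g n l) \<omega>\<bar> ^ p)) \<partial>M)
        = (\<integral>\<^sup>+\<omega>. 1 \<partial>M) + (\<integral>\<^sup>+\<omega>. (\<Sum>l\<in>S. ennreal (\<bar>WI (q l) (g n l) \<omega>\<bar> ^ p)) \<partial>M)"
        using m by (intro nn_integral_add borel_measurable_const borel_measurable_sum)
      also have "(\<integral>\<^sup>+\<omega>. (\<Sum>l\<in>S. ennreal (\<bar>WI (q l) (g n l) \<omega>\<bar> ^ p)) \<partial>M) = (\<Sum>l\<in>S. \<integral>\<^sup>+\<omega>. ennreal (\<bar>WI (q l) (g n l) \<omega>\<bar> ^ p) \<partial>M)"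
        by (rule nn_integral_sum[OF m])
      finally show ?thesis by (simp add: emeasure_space_1)
    qed
    also have "\<dots> \<le> ?K"
    proof (intro add_left_mono sum_mono)
      fix l assume l: "l \<in> S"
      have "(\<integral>\<^sup>+\<omega>. ennreal (\<bar>WI (q l) (g n l) \<omega>\<bar> ^ p) \<partial>M) \<le> contr_norm p (q l) (g n l)"
        unfolding contr_norm_def by (rule WI_power_bound[OF p gs[OF l] gb[OF l]])
      also have "\<dots> \<le> contr_norm p (q l) (f l)" using trunc_abs by (intro contr_norm_mono) (simp add: g_def)
      finally show "(\<integral>\<^sup>+\<omega>. ennreal (\<bar>WI (q l) (g n l) \<omega>\<bar> ^ p) \<partial>M) \<le> contr_norm p (q l) (f l)" .
    qed
    finally show ?thesis .
  qed
  have "(\<integral>\<^sup>+y. ennreal \<bar>contr q f S \<sigma> y\<bar> \<partial>PiM \<sigma> (\<lambda>_. \<mu>)) = (\<integral>\<^sup>+y. liminf (\<lambda>n. ennreal (contr q (g n) S \<sigma> y)) \<partial>PiM \<sigma> (\<lambda>_. \<mu>))"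
  proof (rule nn_integral_cong)
    fix y assume y: "y \<in> space (PiM \<sigma> (\<lambda>_. \<mu>))"
    have "(\<lambda>n. contr q (g n) S \<sigma> y) \<longlonglongrightarrow> contr q (\<lambda>l x. \<bar>f l x\<bar>) S \<sigma> y"
      unfolding g_def by (intro contr_tendsto[OF S(2) \<sigma> y] tendsto_rabs trunc_lim)
    moreover have "contr q (\<lambda>l x. \<bar>f l x\<bar>) S \<sigma> y = \<bar>contr q f S \<sigma> y\<bar>" by (simp add: contr_def abs_prod)
    ultimately have "(\<lambda>n. ennreal (contr q (g n) S \<sigma> y)) \<longlonglongrightarrow> ennreal \<bar>contr q f S \<sigma> y\<bar>" by (intro tendsto_ennrealI) simp
    then show "ennreal \<bar>contr q f S \<sigma> y\<bar> = liminf (\<lambda>n. ennreal (contr q (g n) S \<sigma> y))"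
      by (intro lim_imp_Liminf[symmetric]) auto
  qed
  also have "\<dots> \<le> liminf (\<lambda>n. \<integral>\<^sup>+y. ennreal (contr q (g n) S \<sigma> y) \<partial>PiM \<sigma> (\<lambda>_. \<mu>))"
    using contr_meas[OF S(2) \<sigma> gm] by (intro nn_integral_liminf) measurable
  also have "\<dots> \<le> liminf (\<lambda>n. ?K)" using bound by (intro Liminf_mono always_eventually allI)
  also have "\<dots> = ?K" by (simp add: Liminf_const)
  also have "\<dots> < \<infinity>" using fp S(1) by simp
  finally show ?thesis .
qed

theorem wiener_ito_moments:
  assumes S: "finite S" "\<And>l. l \<in> S \<Longrightarrow> 1 \<le> l" "card S \<le> p" and p: "even p" "1 \<le> p"
    and f: "\<And>l. l \<in> S \<Longrightarrow> f l \<in> Lsym 2 \<mu> (q l)"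
    and fp: "\<And>l. l \<in> S \<Longrightarrow> contr_norm p (q l) (f l) < \<infinity>"
  shows "integrable M (\<lambda>\<omega>. \<Prod>l\<in>S. wiener_ito M \<mu> \<eta> (q l) (f l) \<omega>)" (is ?th1)
    and "\<And>\<sigma>. \<sigma> \<in> gparts2 q S \<Longrightarrow> integrable (PiM \<sigma> (\<lambda>_. \<mu>)) (contr q f S \<sigma>)"
    and "(\<integral>\<omega>. (\<Prod>l\<in>S. wiener_ito M \<mu> \<eta> (q l) (f l) \<omega>) \<partial>M) = (\<Sum>\<sigma>\<in>gparts2 q S. \<integral>y. contr q f S \<sigma> y \<partial>PiM \<sigma> (\<lambda>_. \<mu>))" (is ?th3)
proof -
  have fm: "f l \<in> borel_measurable (pow_measure \<mu> (q l))" if "l \<in> S" for l using f[OF that] by (simp add: Lsym_def)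
  define t where "t n l = trunc (q l) n (f l)" for n l
  have ts: "simple_function (pow_measure \<mu> (q l)) (t n l)" if "l \<in> S" for n l unfolding t_def by (rule trunc_simple[OF fm[OF that]])
  have tb: "box_supp n (q l) (t n l)" if "l \<in> S" for n l unfolding t_def by (rule trunc_box_supp[OF fm[OF that]])
  have tm: "t n l \<in> borel_measurable (pow_measure \<mu> (q l))" if "l \<in> S" for n l using tb[OF that, of n] by (simp add: box_supp_def)
  have Wm: "wiener_ito M \<mu> \<eta> (q l) (f l) \<in> borel_measurable M" if "l \<in> S" for l by (rule wiener_ito_L2_limit(1)[OF f[OF that]])
  have Wp: "(\<integral>\<^sup>+\<omega>. ennreal (\<bar>wiener_ito M \<mu> \<eta> (q l) (f l) \<omega>\<bar> ^ p) \<partial>M) < \<infinity>" if "l \<in> S" for l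
    by (rule wiener_ito_Lp(2)[OF f[OF that] p fp[OF that]])
  show ?th1 using prod_integrable_Lp[OF S(1,3) Wm Wp] .
  have ci: "integrable (PiM \<sigma> (\<lambda>_. \<mu>)) (contr q f S \<sigma>)" if \<sigma>: "\<sigma> \<in> gparts2 q S" for \<sigma>
    using contr_finite[OF S p fm fp \<sigma>] contr_meas[OF S(2) gparts2D[OF \<sigma>] fm] by (intro integrableI_bounded) auto
  then show "\<And>\<sigma>. \<sigma> \<in> gparts2 q S \<Longrightarrow> integrable (PiM \<sigma> (\<lambda>_. \<mu>)) (contr q f S \<sigma>)" .
  have 1: "(\<lambda>n. \<integral>\<omega>. (\<Prod>l\<in>S. WI (q l) (t n l) \<omega>) \<partial>M) \<longlonglongrightarrow> (\<integral>\<omega>. (\<Prod>l\<in>S. wiener_ito M \<mu> \<eta> (q l) (f l) \<omega>) \<partial>M)"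
  proof (rule prod_limit_Lp[where X="\<lambda>l n. WI (q l) (t n l)" and W="\<lambda>l. wiener_ito M \<mu> \<eta> (q l) (f l)", OF S(1,3) Wm _ Wp])
    show "WI (q l) (t n l) \<in> borel_measurable M" if "l \<in> S" for l n by (rule WI_meas[OF tm[OF that]])
    show "integrable M (\<lambda>\<omega>. \<Prod>l\<in>S. WI (q l) (t n l) \<omega>)" for n by (rule box_supp_prod_integrable(1)[OF S(1) tb])
    show "(\<lambda>n. \<integral>\<^sup>+\<omega>. ennreal (\<bar>WI (q l) (t n l) \<omega> - wiener_ito M \<mu> \<eta> (q l) (f l) \<omega>\<bar> ^ p) \<partial>M) \<longlonglongrightarrow> 0" if "l \<in> S" for l
      unfolding t_def by (rule wiener_ito_Lp(1)[OF f[OF that] p fp[OF that]])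
  qed
  have 2: "(\<lambda>n. \<Sum>\<sigma>\<in>gparts2 q S. \<integral>y. contr q (t n) S \<sigma> y \<partial>PiM \<sigma> (\<lambda>_. \<mu>)) \<longlonglongrightarrow> (\<Sum>\<sigma>\<in>gparts2 q S. \<integral>y. contr q f S \<sigma> y \<partial>PiM \<sigma> (\<lambda>_. \<mu>))"
  proof (rule tendsto_sum)
    fix \<sigma> assume \<sigma>2: "\<sigma> \<in> gparts2 q S"
    then have \<sigma>: "\<sigma> \<in> gparts q S" by (rule gparts2D)
    show "(\<lambda>n. \<integral>y. contr q (t n) S \<sigma> y \<partial>PiM \<sigma> (\<lambda>_. \<mu>)) \<longlonglongrightarrow> (\<integral>y. contr q f S \<sigma> y \<partial>PiM \<sigma> (\<lambda>_. \<mu>))"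
    proof (rule integral_dominated_convergence[where w="\<lambda>y. \<bar>contr q f S \<sigma> y\<bar>"])
      show "contr q f S \<sigma> \<in> borel_measurable (PiM \<sigma> (\<lambda>_. \<mu>))" by (rule contr_meas[OF S(2) \<sigma> fm])
      show "contr q (t n) S \<sigma> \<in> borel_measurable (PiM \<sigma> (\<lambda>_. \<mu>))" for n by (rule contr_meas[OF S(2) \<sigma> tm])
      show "integrable (PiM \<sigma> (\<lambda>_. \<mu>)) (\<lambda>y. \<bar>contr q f S \<sigma> y\<bar>)" using ci[OF \<sigma>2] by (rule integrable_abs)
      show "AE y in PiM \<sigma> (\<lambda>_. \<mu>). (\<lambda>n. contr q (t n) S \<sigma> y) \<longlonglongrightarrow> contr q f S \<sigma> y"
        unfolding t_def by (intro AE_I2 contr_tendsto[OF S(2) \<sigma>] trunc_lim)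
      show "AE y in PiM \<sigma> (\<lambda>_. \<mu>). norm (contr q (t n) S \<sigma> y) \<le> \<bar>contr q f S \<sigma> y\<bar>" for n
        unfolding real_norm_def t_def by (intro AE_I2 contr_abs_mono[OF S(2) \<sigma>] trunc_abs)
    qed
  qed
  have "(\<integral>\<omega>. (\<Prod>l\<in>S. WI (q l) (t n l) \<omega>) \<partial>M) = (\<Sum>\<sigma>\<in>gparts2 q S. \<integral>y. contr q (t n) S \<sigma> y \<partial>PiM \<sigma> (\<lambda>_. \<mu>))" for n
    using moment_formula_simple[OF S(1,2) ts tb] by (simp add: moment_formula_def)
  with 1 2 show ?th3 using LIMSEQ_unique by simp
qed

end

section \<open>Cumulants as derivatives\<close>

text \<open>Differentiating \<open>\<phi> = exp L\<close> in the direction \<open>m\<close> gives \<open>\<partial>\<^sub>m \<phi> = \<phi> \<partial>\<^sub>m L\<close>; the Leibniz rule then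
  expresses every mixed derivative \<open>\<partial>\<^sub>S L\<close> with \<open>m \<in> S\<close> recursively by the derivatives \<open>d A\<close> of \<open>\<phi>\<close>.\<close>

function cumul :: "(nat set \<Rightarrow> complex) \<Rightarrow> nat \<Rightarrow> nat set \<Rightarrow> complex" where
  "cumul d m S = (if finite S \<and> m \<in> S then
     (d S - (\<Sum>A\<in>Pow (S - {m}) - {{}}. d A * cumul d m (S - A))) / d {} else 0)"
  by auto
termination
proof (relation "Wellfounded.measure (\<lambda>(d, m, S). card S)")
  fix d :: "nat set \<Rightarrow> complex" and m S A
  assume "finite S \<and> m \<in> S" "A \<in> Pow (S - {m}) - {{}}"
  then show "((d, m, S - A), d, m, S) \<in> Wellfounded.measure (\<lambda>(d, m, S). card S)"
    by (auto intro!: psubset_card_mono)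
qed simp

declare cumul.simps [simp del]

lemma cumul_eq:
  "finite S \<Longrightarrow> m \<in> S \<Longrightarrow>
    cumul d m S = (d S - (\<Sum>A\<in>Pow (S - {m}) - {{}}. d A * cumul d m (S - A))) / d {}"
  by (simp add: cumul.simps)

lemma sum_Pow_insert_nonempty:
  fixes g :: "'b set \<Rightarrow> complex"
  assumes "finite R" "j \<notin> R"
  shows "(\<Sum>A\<in>Pow (insert j R) - {{}}. g A) = (\<Sum>A\<in>Pow R - {{}}. g A) + (\<Sum>A\<in>Pow R. g (insert j A))"
proof -
  have e: "Pow (insert j R) - {{}} = (Pow R - {{}}) \<union> insert j ` Pow R" by (auto simp: Pow_insert)
  have inj: "inj_on (insert j) (Pow R)" using assms(2) by (auto simp: inj_on_def)
  have "(Pow R - {{}}) \<inter> insert j ` Pow R = {}" using assms(2) by auto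
  then show ?thesis unfolding e using assms(1) inj by (subst sum.union_disjoint) (auto simp: sum.reindex)
qed

text \<open>In the moment recursion the summand with empty \<open>A\<close> is \<kappa> S itself, as
  \<open>Mo {}\<close> is 1; solving for it gives the recursion of \<open>cumul\<close>. The powers
  of the imaginary unit factor out because \<open>A\<close> and \<open>S - A\<close> share the
  elements of \<open>S\<close>.\<close>

lemma cumul_moments:
  fixes Mo :: "nat set \<Rightarrow> real" and \<kappa> :: "nat set \<Rightarrow> real"
  assumes S: "finite S" "m \<in> S" "S \<subseteq> V"
    and d: "\<And>A. A \<subseteq> V \<Longrightarrow> d A = \<i> ^ card A * complex_of_real (Mo A)"
    and M0: "Mo {} = 1"
    and rec: "\<And>S. S \<subseteq> V \<Longrightarrow> m \<in> S \<Longrightarrow> Mo S = (\<Sum>A\<in>Pow (S - {m}). Mo A * \<kappa> (S - A))"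
  shows "cumul d m S = \<i> ^ card S * complex_of_real (\<kappa> S)"
  using S
proof (induction "card S" arbitrary: S rule: less_induct)
  case (less S)
  have t: "d A * cumul d m (S - A) = \<i> ^ card S * complex_of_real (Mo A * \<kappa> (S - A))"
    if A: "A \<in> Pow (S - {m}) - {{}}" for A
  proof -
    have AS: "A \<subseteq> S" "A \<noteq> {}" "m \<notin> A" using A by auto
    have "card (S - A) < card S" using AS less.prems by (intro psubset_card_mono) auto
    then have "cumul d m (S - A) = \<i> ^ card (S - A) * complex_of_real (\<kappa> (S - A))"
      using AS less.prems by (intro less.hyps) auto
    moreover have "\<i> ^ card A * \<i> ^ card (S - A) = \<i> ^ card S"
      using AS less.prems by (simp add: power_add[symmetric] card_Diff_subset finite_subset card_mono)
    moreover have "d A = \<i> ^ card A * complex_of_real (Mo A)" using AS less.prems by (intro d) auto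
    ultimately show ?thesis by (simp add: mult_ac)
  qed
  have "cumul d m S = (d S - (\<Sum>A\<in>Pow (S - {m}) - {{}}. d A * cumul d m (S - A))) / d {}"
    by (rule cumul_eq[OF less.prems(1,2)])
  also have "(\<Sum>A\<in>Pow (S - {m}) - {{}}. d A * cumul d m (S - A)) =
     (\<Sum>A\<in>Pow (S - {m}) - {{}}. \<i> ^ card S * complex_of_real (Mo A * \<kappa> (S - A)))" by (intro sum.cong refl t)
  also have "\<dots> = \<i> ^ card S * complex_of_real (\<Sum>A\<in>Pow (S - {m}) - {{}}. Mo A * \<kappa> (S - A))"
    by (simp add: sum_distrib_left)
  also have "(\<Sum>A\<in>Pow (S - {m}) - {{}}. Mo A * \<kappa> (S - A)) = Mo S - \<kappa> S"
  proof -
    have "Mo S = (\<Sum>A\<in>Pow (S - {m}). Mo A * \<kappa> (S - A))" using less.prems by (intro rec) auto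
    also have "\<dots> = \<kappa> S + (\<Sum>A\<in>Pow (S - {m}) - {{}}. Mo A * \<kappa> (S - A))"
      using less.prems(1) M0 by (subst sum.remove[of _ "{}"]) auto
    finally show ?thesis by simp
  qed
  also have "d S = \<i> ^ card S * complex_of_real (Mo S)" using less.prems by (intro d)
  also have "d {} = 1" using d[of "{}"] M0 by simp
  finally show ?case by (simp add: algebra_simps)
qed

text \<open>Under the product rule the new direction \<open>j\<close> falls either on the factor
  indexed by \<open>A\<close> or on the one indexed by \<open>S - A\<close>. These are the nonempty
  subsets of \<open>insert j S - {m}\<close> without and with \<open>j\<close>; the subset
  \<open>{j}\<close> itself comes from differentiating the denominator \<open>D {}\<close>.\<close>

lemma cumul_deriv:
  fixes D :: "nat set \<Rightarrow> real \<Rightarrow> complex"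
  assumes S: "finite S" "m \<in> S" "S \<subseteq> V" and j: "j \<in> V" "j \<notin> S"
    and D: "\<And>A. A \<subseteq> V \<Longrightarrow> j \<notin> A \<Longrightarrow> (D A has_vector_derivative D (insert j A) s) (at s)"
    and ne: "D {} s \<noteq> 0"
  shows "((\<lambda>r. cumul (\<lambda>A. D A r) m S) has_vector_derivative cumul (\<lambda>A. D A s) m (insert j S)) (at s)"
  using S j(2)
proof (induction "card S" arbitrary: S rule: less_induct)
  case (less S)
  let ?K = "\<lambda>S r. cumul (\<lambda>A. D A r) m S"
  let ?R = "S - {m}"
  define N where "N r = D S r - (\<Sum>A\<in>Pow ?R - {{}}. D A r * ?K (S - A) r)" for r
  define N' where "N' = D (insert j S) s - (\<Sum>A\<in>Pow ?R - {{}}. D A s * ?K (insert j (S - A)) s + D (insert j A) s * ?K (S - A) s)"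
  have dN: "(N has_vector_derivative N') (at s)"
    unfolding N_def N'_def
  proof (intro has_vector_derivative_diff has_vector_derivative_sum has_vector_derivative_mult)
    show "(D S has_vector_derivative D (insert j S) s) (at s)" using less.prems by (intro D) auto
    fix A assume A: "A \<in> Pow ?R - {{}}"
    then have AS: "A \<subseteq> S" "A \<noteq> {}" "m \<notin> A" by auto
    show "(D A has_vector_derivative D (insert j A) s) (at s)" using AS less.prems by (intro D) auto
    have "card (S - A) < card S" using AS less.prems by (intro psubset_card_mono) auto
    then show "((\<lambda>r. ?K (S - A) r) has_vector_derivative ?K (insert j (S - A)) s) (at s)"
      using AS less.prems by (intro less.hyps) auto
  qed
  have d0: "(D {} has_vector_derivative D {j} s) (at s)" using D[of "{}"] by simp
  have "((\<lambda>z. inverse z) has_field_derivative - (inverse (D {} s) * inverse (D {} s))) (at (D {} s))"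
    using DERIV_inverse[OF ne] by (simp add: power2_eq_square eval_nat_numeral)
  from field_vector_diff_chain_at[OF d0 this]
  have di: "((\<lambda>r. inverse (D {} r)) has_vector_derivative D {j} s * - (inverse (D {} s) * inverse (D {} s))) (at s)"
    by (simp add: comp_def)
  have KN: "?K S r = N r * inverse (D {} r)" for r
    unfolding N_def by (subst cumul_eq[OF less.prems(1,2)]) (simp add: divide_inverse)
  have "((\<lambda>r. N r * inverse (D {} r)) has_vector_derivative
     N s * (D {j} s * - (inverse (D {} s) * inverse (D {} s))) + N' * inverse (D {} s)) (at s)"
    by (rule has_vector_derivative_mult[OF dN di])
  also have "N s * (D {j} s * - (inverse (D {} s) * inverse (D {} s))) + N' * inverse (D {} s) = (N' - D {j} s * ?K S s) / D {} s"
    unfolding KN by (simp add: divide_inverse algebra_simps)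
  also have "\<dots> = ?K (insert j S) s"
  proof -
    have fin: "finite (insert j S)" "m \<in> insert j S" using less.prems by auto
    have jm: "j \<noteq> m" using less.prems by auto
    then have e: "insert j S - {m} = insert j ?R" by auto
    have "(\<Sum>A\<in>Pow (insert j S - {m}) - {{}}. D A s * ?K (insert j S - A) s) =
      (\<Sum>A\<in>Pow ?R - {{}}. D A s * ?K (insert j S - A) s) + (\<Sum>A\<in>Pow ?R. D (insert j A) s * ?K (insert j S - insert j A) s)"
      unfolding e using less.prems by (intro sum_Pow_insert_nonempty) auto
    also have "(\<Sum>A\<in>Pow ?R - {{}}. D A s * ?K (insert j S - A) s) = (\<Sum>A\<in>Pow ?R - {{}}. D A s * ?K (insert j (S - A)) s)"
    proof (intro sum.cong refl)
      fix A assume "A \<in> Pow ?R - {{}}"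
      then have "insert j S - A = insert j (S - A)" using less.prems by auto
      then show "D A s * ?K (insert j S - A) s = D A s * ?K (insert j (S - A)) s" by simp
    qed
    also have "(\<Sum>A\<in>Pow ?R. D (insert j A) s * ?K (insert j S - insert j A) s) = (\<Sum>A\<in>Pow ?R. D (insert j A) s * ?K (S - A) s)"
    proof (intro sum.cong refl)
      fix A assume "A \<in> Pow ?R"
      then have "insert j S - insert j A = S - A" using less.prems by auto
      then show "D (insert j A) s * ?K (insert j S - insert j A) s = D (insert j A) s * ?K (S - A) s" by simp
    qed
    also have "(\<Sum>A\<in>Pow ?R. D (insert j A) s * ?K (S - A) s) = D {j} s * ?K S s + (\<Sum>A\<in>Pow ?R - {{}}. D (insert j A) s * ?K (S - A) s)"
      using less.prems(1) by (subst sum.remove[of _ "{}"]) auto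
    finally show ?thesis unfolding cumul_eq[OF fin] N'_def by (simp add: sum.distrib algebra_simps)
  qed
  finally show ?case unfolding KN .
qed

section \<open>Mixed derivatives of the characteristic function and of its logarithm\<close>

context prob_space begin

text \<open>The mixed partial derivative of the characteristic function in the directions \<open>A\<close>.\<close>

definition mchar :: "nat \<Rightarrow> (nat \<Rightarrow> 'a \<Rightarrow> real) \<Rightarrow> nat set \<Rightarrow> (nat \<Rightarrow> real) \<Rightarrow> complex" where
  "mchar m X A t = (\<integral>\<omega>. \<i> ^ card A * complex_of_real (\<Prod>l\<in>A. X l \<omega>) *
     exp (\<i> * complex_of_real (\<Sum>j\<in>{1..m}. t j * X j \<omega>)) \<partial>M)"

lemma mchar_integrable:
  assumes X: "\<And>l. l \<in> {1..m} \<Longrightarrow> X l \<in> borel_measurable M" and A: "integrable M (\<lambda>\<omega>. \<Prod>l\<in>A. X l \<omega>)"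
  shows "integrable M (\<lambda>\<omega>. \<i> ^ card A * complex_of_real (\<Prod>l\<in>A. X l \<omega>) *
     exp (\<i> * complex_of_real (\<Sum>j\<in>{1..m}. t j * X j \<omega>)))"
proof (rule Bochner_Integration.integrable_bound[OF A])
  have m1: "(\<lambda>\<omega>. \<Sum>j\<in>{1..m}. t j * X j \<omega>) \<in> borel_measurable M" using X by (intro borel_measurable_sum borel_measurable_times) auto
  have m2: "(\<lambda>\<omega>. \<Prod>l\<in>A. X l \<omega>) \<in> borel_measurable M" using A by auto
  show "(\<lambda>\<omega>. \<i> ^ card A * complex_of_real (\<Prod>l\<in>A. X l \<omega>) * exp (\<i> * complex_of_real (\<Sum>j\<in>{1..m}. t j * X j \<omega>))) \<in> borel_measurable M"
    by (intro borel_measurable_times borel_measurable_const measurable_compose[OF m2 borel_measurable_of_real]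
        measurable_compose[OF borel_measurable_times[OF borel_measurable_const measurable_compose[OF m1 borel_measurable_of_real]] borel_measurable_exp])
qed (auto simp: norm_mult norm_power simp del: of_real_prod)

text \<open>Differentiation under the integral. The second-order remainder \<open>Q\<close> of the
  exponential is bounded by y^2/2 and also by 2|y|: the first bound makes the difference quotients
  converge pointwise, the second dominates them by the product over \<open>insert j A\<close>, which
  is integrable.\<close>

lemma mchar_deriv:
  assumes X: "\<And>l. l \<in> {1..m} \<Longrightarrow> X l \<in> borel_measurable M"
    and I: "\<And>A. A \<subseteq> {1..m} \<Longrightarrow> integrable M (\<lambda>\<omega>. \<Prod>l\<in>A. X l \<omega>)"
    and A: "A \<subseteq> {1..m}" and j: "j \<in> {1..m}" "j \<notin> A"
  shows "((\<lambda>s. mchar m X A (t(j := s))) has_vector_derivative mchar m X (insert j A) t) (at (t j))"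
proof -
  define E where "E t \<omega> = exp (\<i> * complex_of_real (\<Sum>j\<in>{1..m}. t j * X j \<omega>))" for t \<omega>
  define Z where "Z \<omega> = \<i> ^ card A * complex_of_real (\<Prod>l\<in>A. X l \<omega>)" for \<omega>
  have fA: "finite A" using A finite_subset by blast
  have mA: "mchar m X A u = (\<integral>\<omega>. Z \<omega> * E u \<omega> \<partial>M)" for u by (simp add: mchar_def Z_def E_def)
  have iA: "integrable M (\<lambda>\<omega>. Z \<omega> * E u \<omega>)" for u
    unfolding Z_def E_def by (rule mchar_integrable[OF X I[OF A]])
  have jA: "insert j A \<subseteq> {1..m}" using A j by auto
  have Zj: "\<i> ^ card (insert j A) * complex_of_real (\<Prod>l\<in>insert j A. X l \<omega>) = Z \<omega> * (\<i> * complex_of_real (X j \<omega>))" for \<omega>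
    using fA j by (simp add: Z_def algebra_simps)
  have mjA: "mchar m X (insert j A) u = (\<integral>\<omega>. Z \<omega> * (\<i> * complex_of_real (X j \<omega>)) * E u \<omega> \<partial>M)" for u
    unfolding mchar_def Zj E_def ..
  have ijA: "integrable M (\<lambda>\<omega>. Z \<omega> * (\<i> * complex_of_real (X j \<omega>)) * E u \<omega>)" for u
    using mchar_integrable[OF X I[OF jA], where t=u] unfolding Zj E_def .
  have E_upd: "E (t(j := s)) \<omega> = E t \<omega> * exp (\<i> * complex_of_real ((s - t j) * X j \<omega>))" for s \<omega>
  proof -
    have "(\<Sum>i\<in>{1..m}. (t(j := s)) i * X i \<omega>) = s * X j \<omega> + (\<Sum>i\<in>{1..m} - {j}. t i * X i \<omega>)"
      using j by (subst sum.remove[of _ j]) (auto intro!: sum.cong)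
    moreover have "(\<Sum>i\<in>{1..m}. t i * X i \<omega>) = t j * X j \<omega> + (\<Sum>i\<in>{1..m} - {j}. t i * X i \<omega>)"
      using j by (subst sum.remove[of _ j]) auto
    ultimately have "(\<Sum>i\<in>{1..m}. (t(j := s)) i * X i \<omega>) = (\<Sum>i\<in>{1..m}. t i * X i \<omega>) + (s - t j) * X j \<omega>"
      by (simp add: algebra_simps)
    then show ?thesis unfolding E_def by (simp add: exp_add[symmetric] distrib_left)
  qed
  have nE: "norm (E u \<omega>) = 1" for u \<omega> by (simp add: E_def)
  define Q where "Q y = exp (\<i> * complex_of_real y) - 1 - \<i> * complex_of_real y" for y
  have Q1: "norm (Q y) \<le> \<bar>y\<bar>\<^sup>2 / 2" for y
    using iexp_approx1[of y 1] by (simp add: Q_def One_nat_def eval_nat_numeral algebra_simps)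
  have Q2: "norm (Q y) \<le> 2 * \<bar>y\<bar>" for y
    using iexp_approx2[of y 1] by (simp add: Q_def One_nat_def algebra_simps)
  define G where "G h \<omega> = norm (Z \<omega>) * (norm (Q (h * X j \<omega>)) / \<bar>h\<bar>)" for h \<omega>
  have Zm: "(\<lambda>\<omega>. norm (Z \<omega>)) \<in> borel_measurable M"
    unfolding Z_def using I[OF A] by (auto simp: norm_mult norm_power simp del: of_real_prod)
  have Xj: "X j \<in> borel_measurable M" using X j by simp
  have Gm: "G h \<in> borel_measurable M" for h
    unfolding G_def Q_def
  proof -
    have [measurable]: "X j \<in> borel_measurable M" "(\<lambda>\<omega>. norm (Z \<omega>)) \<in> borel_measurable M" by (fact Xj Zm)+
    show "(\<lambda>\<omega>. norm (Z \<omega>) * (norm (iexp (h * X j \<omega>) - 1 - \<i> * complex_of_real (h * X j \<omega>)) / \<bar>h\<bar>)) \<in> borel_measurable M"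
      by measurable
  qed
  have ZX: "integrable M (\<lambda>\<omega>. norm (Z \<omega>) * (2 * \<bar>X j \<omega>\<bar>))"
  proof -
    have "integrable M (\<lambda>\<omega>. 2 * \<bar>\<Prod>l\<in>insert j A. X l \<omega>\<bar>)" using I[OF jA] by (intro integrable_mult_right integrable_abs)
    moreover have "2 * \<bar>\<Prod>l\<in>insert j A. X l \<omega>\<bar> = norm (Z \<omega>) * (2 * \<bar>X j \<omega>\<bar>)" for \<omega>
      using fA j by (simp add: Z_def norm_mult norm_power abs_mult del: of_real_prod)
    ultimately show ?thesis by simp
  qed
  have Gb: "norm (G h \<omega>) \<le> norm (Z \<omega>) * (2 * \<bar>X j \<omega>\<bar>)" for h \<omega>
  proof -
    have "norm (Q (h * X j \<omega>)) / \<bar>h\<bar> \<le> 2 * \<bar>X j \<omega>\<bar>"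
      using Q2[of "h * X j \<omega>"] by (cases "h = 0") (auto simp: abs_mult divide_le_eq mult_ac)
    then have "norm (Z \<omega>) * (norm (Q (h * X j \<omega>)) / \<bar>h\<bar>) \<le> norm (Z \<omega>) * (2 * \<bar>X j \<omega>\<bar>)" by (rule mult_left_mono) simp
    then show ?thesis by (simp add: G_def abs_mult)
  qed
  have key: "norm (mchar m X A (t(j := s)) - mchar m X A t - (s - t j) *\<^sub>R mchar m X (insert j A) t) / norm (s - t j)
     \<le> (\<integral>\<omega>. G (s - t j) \<omega> \<partial>M)" for s
  proof -
    have "mchar m X A (t(j := s)) - mchar m X A t - (s - t j) *\<^sub>R mchar m X (insert j A) t
      = (\<integral>\<omega>. Z \<omega> * E (t(j := s)) \<omega> - Z \<omega> * E t \<omega> - (s - t j) *\<^sub>R (Z \<omega> * (\<i> * complex_of_real (X j \<omega>)) * E t \<omega>) \<partial>M)"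
      unfolding mA mjA using iA ijA by simp
    also have "\<dots> = (\<integral>\<omega>. Z \<omega> * E t \<omega> * Q ((s - t j) * X j \<omega>) \<partial>M)"
      unfolding E_upd Q_def by (intro Bochner_Integration.integral_cong refl) (simp add: algebra_simps scaleR_conv_of_real)
    finally have "norm (mchar m X A (t(j := s)) - mchar m X A t - (s - t j) *\<^sub>R mchar m X (insert j A) t)
      \<le> (\<integral>\<omega>. norm (Z \<omega> * E t \<omega> * Q ((s - t j) * X j \<omega>)) \<partial>M)" by (simp add: integral_norm_bound)
    then have "norm (mchar m X A (t(j := s)) - mchar m X A t - (s - t j) *\<^sub>R mchar m X (insert j A) t) / norm (s - t j)
      \<le> (\<integral>\<omega>. norm (Z \<omega> * E t \<omega> * Q ((s - t j) * X j \<omega>)) \<partial>M) / norm (s - t j)" by (rule divide_right_mono) simp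
    also have "\<dots> = (\<integral>\<omega>. G (s - t j) \<omega> \<partial>M)"
      unfolding G_def by (simp add: norm_mult nE)
    finally show ?thesis .
  qed
  have lim: "((\<lambda>s. \<integral>\<omega>. G (s - t j) \<omega> \<partial>M) \<longlongrightarrow> 0) (at (t j))"
    unfolding tendsto_at_iff_sequentially
  proof (intro allI impI)
    fix r :: "nat \<Rightarrow> real" assume r: "\<forall>i. r i \<in> UNIV - {t j}" "r \<longlonglongrightarrow> t j"
    have h0: "(\<lambda>i. r i - t j) \<longlonglongrightarrow> 0" using r(2) by (simp add: LIM_zero)
    have "(\<lambda>i. \<integral>\<omega>. G (r i - t j) \<omega> \<partial>M) \<longlonglongrightarrow> (\<integral>\<omega>. 0 \<partial>M)"
    proof (rule integral_dominated_convergence[OF _ Gm ZX])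
      show "AE \<omega> in M. (\<lambda>i. G (r i - t j) \<omega>) \<longlonglongrightarrow> 0"
      proof (rule AE_I2)
        fix \<omega>
        have "(\<lambda>i. norm (Z \<omega>) * (\<bar>r i - t j\<bar> * (X j \<omega>)\<^sup>2 / 2)) \<longlonglongrightarrow> norm (Z \<omega>) * (\<bar>0\<bar> * (X j \<omega>)\<^sup>2 / 2)"
          by (intro tendsto_intros h0) auto
        then have u: "(\<lambda>i. norm (Z \<omega>) * (\<bar>r i - t j\<bar> * (X j \<omega>)\<^sup>2 / 2)) \<longlonglongrightarrow> 0" by simp
        show "(\<lambda>i. G (r i - t j) \<omega>) \<longlonglongrightarrow> 0"
        proof (rule tendsto_sandwich[OF _ _ tendsto_const u])
          show "eventually (\<lambda>i. 0 \<le> G (r i - t j) \<omega>) sequentially" by (intro always_eventually allI) (simp add: G_def)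
          show "eventually (\<lambda>i. G (r i - t j) \<omega> \<le> norm (Z \<omega>) * (\<bar>r i - t j\<bar> * (X j \<omega>)\<^sup>2 / 2)) sequentially"
          proof (intro always_eventually allI)
            fix i
            let ?h = "r i - t j"
            have "?h \<noteq> 0" using r(1) by auto
            then have "norm (Q (?h * X j \<omega>)) / \<bar>?h\<bar> \<le> \<bar>?h\<bar> * (X j \<omega>)\<^sup>2 / 2"
              using Q1[of "?h * X j \<omega>"] by (simp add: divide_le_eq abs_mult power2_eq_square mult_ac)
            then show "G ?h \<omega> \<le> norm (Z \<omega>) * (\<bar>?h\<bar> * (X j \<omega>)\<^sup>2 / 2)"
              unfolding G_def by (rule mult_left_mono) simp
          qed
        qed
      qed
      show "AE \<omega> in M. norm (G (r i - t j) \<omega>) \<le> norm (Z \<omega>) * (2 * \<bar>X j \<omega>\<bar>)" for i using Gb by (intro AE_I2)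
    qed simp
    then show "((\<lambda>s. \<integral>\<omega>. G (s - t j) \<omega> \<partial>M) \<circ> r) \<longlonglongrightarrow> 0" by (simp add: comp_def)
  qed
  show ?thesis
    unfolding has_vector_derivative_def has_derivative_iff_norm fun_upd_triv
  proof
    show "bounded_linear (\<lambda>s. s *\<^sub>R mchar m X (insert j A) t)" by (rule bounded_linear_scaleR_left)
    show "((\<lambda>s. norm (mchar m X A (t(j := s)) - mchar m X A t - (s - t j) *\<^sub>R mchar m X (insert j A) t) / norm (s - t j)) \<longlongrightarrow> 0) (at (t j))"
    proof (rule tendsto_sandwich[OF _ _ tendsto_const lim])
      show "eventually (\<lambda>s. 0 \<le> norm (mchar m X A (t(j := s)) - mchar m X A t - (s - t j) *\<^sub>R mchar m X (insert j A) t) / norm (s - t j)) (at (t j))"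
        by (intro always_eventually allI divide_nonneg_nonneg norm_ge_zero)
      show "eventually (\<lambda>s. norm (mchar m X A (t(j := s)) - mchar m X A t - (s - t j) *\<^sub>R mchar m X (insert j A) t) / norm (s - t j)
         \<le> (\<integral>\<omega>. G (s - t j) \<omega> \<partial>M)) (at (t j))"
        using key by (intro always_eventually allI)
    qed
  qed
qed

text \<open>\<open>mixed_deriv\<close> differentiates in direction \<open>m\<close> first and in
  direction 1 last, so with \<open>k\<close> directions left the derivative is indexed by
  \<open>{Suc k..m}\<close>. This always contains \<open>m\<close>, the base element of
  \<open>cumul\<close>. Each identity is needed near the point along the next coordinate and not
  only at the origin.\<close>

theorem cum_eq_cumul:
  assumes X: "\<And>l. l \<in> {1..m} \<Longrightarrow> X l \<in> borel_measurable M"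
    and I: "\<And>A. A \<subseteq> {1..m} \<Longrightarrow> integrable M (\<lambda>\<omega>. \<Prod>l\<in>A. X l \<omega>)" and m: "1 \<le> m"
  shows "cum M m X = (- \<i>) ^ m * cumul (\<lambda>A. mchar m X A (\<lambda>_. 0)) m {1..m}"
proof -
  define D where "D = mchar m X"
  \<comment> \<open>Here the principal logarithm is differentiable and the denominator
    \<open>D {}\<close> does not vanish. \<open>U\<close> contains the origin, where
    \<open>D {}\<close> is 1, and is stable under small changes of a single coordinate, which is all
    that a partial derivative sees.\<close>
  define U where "U = {t. D {} t \<notin> \<real>\<^sub>\<le>\<^sub>0}"
  have Dder: "((\<lambda>s. D A (t(j := s))) has_vector_derivative D (insert j A) t) (at (t j))"
    if "A \<subseteq> {1..m}" "j \<in> {1..m}" "j \<notin> A" for A j t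
    unfolding D_def by (rule mchar_deriv[OF X I that])
  have ev: "eventually (\<lambda>s. t(j := s) \<in> U) (nhds (t j))" if j: "j \<in> {1..m}" and t: "t \<in> U" for j t
  proof -
    have "continuous (at (t j)) (\<lambda>s. D {} (t(j := s)))"
      using Dder[of "{}" j t] j by (intro has_vector_derivative_continuous) auto
    then have c: "((\<lambda>s. D {} (t(j := s))) \<longlongrightarrow> D {} t) (nhds (t j))"
      by (simp add: continuous_at tendsto_nhds_iff)
    have o: "open (- \<real>\<^sub>\<le>\<^sub>0 :: complex set)" using closed_nonpos_Reals_complex by (simp add: open_closed)
    have "D {} t \<in> - \<real>\<^sub>\<le>\<^sub>0" using t by (simp add: U_def)
    from topological_tendstoD[OF c o this] show ?thesis by eventually_elim (simp add: U_def)
  qed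
  have ne: "D {} t \<noteq> 0" if "t \<in> U" for t using that by (auto simp: U_def)
  let ?F = "\<lambda>t. Ln (\<integral>\<omega>. exp (\<i> * complex_of_real (\<Sum>j\<in>{1..m}. t j * X j \<omega>)) \<partial>M)"
  have F: "?F t = Ln (D {} t)" for t by (simp add: D_def mchar_def)
  have first: "partial_deriv m ?F t = cumul (\<lambda>A. D A t) m {m}" if t: "t \<in> U" for t
  proof -
    have mm: "m \<in> {1..m}" using m by simp
    have d: "((\<lambda>s. D {} (t(m := s))) has_vector_derivative D {m} t) (at (t m))" using Dder[of "{}" m t] mm by simp
    have tm: "D {} (t(m := t m)) = D {} t" by simp
    have "(Ln has_field_derivative inverse (D {} (t(m := t m)))) (at (D {} (t(m := t m))))"
      unfolding tm using t by (intro has_field_derivative_Ln) (simp add: U_def)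
    from field_vector_diff_chain_at[OF d this]
    have "((\<lambda>s. ?F (t(m := s))) has_vector_derivative D {m} t * inverse (D {} t)) (at (t m))"
      unfolding F by (simp add: comp_def)
    then have "partial_deriv m ?F t = D {m} t * inverse (D {} t)"
      unfolding partial_deriv_def by (rule vector_derivative_at)
    also have "\<dots> = cumul (\<lambda>A. D A t) m {m}" by (subst cumul_eq) (auto simp: divide_inverse)
    finally show ?thesis .
  qed
  have step: "mixed_deriv k G t = cumul (\<lambda>A. D A t) m {1..m}"
    if "k < m" "\<And>t. t \<in> U \<Longrightarrow> G t = cumul (\<lambda>A. D A t) m {Suc k..m}" "t \<in> U" for k G t
    using that
  proof (induction k arbitrary: G t)
    case 0
    then show ?case by (simp add: One_nat_def)
  next
    case (Suc k)
    have "partial_deriv (Suc k) G u = cumul (\<lambda>A. D A u) m {Suc k..m}" if u: "u \<in> U" for u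
    proof -
      let ?j = "Suc k"
      have j: "?j \<in> {1..m}" using Suc.prems(1) by simp
      have "((\<lambda>s. cumul (\<lambda>A. D A (u(?j := s))) m {Suc (Suc k)..m}) has_vector_derivative
          cumul (\<lambda>A. D A (u(?j := u ?j))) m (insert ?j {Suc (Suc k)..m})) (at (u ?j))"
      proof (rule cumul_deriv[where V="{1..m}" and D="\<lambda>A s. D A (u(?j := s))"])
        show "((\<lambda>s. D A (u(?j := s))) has_vector_derivative D (insert ?j A) (u(?j := u ?j))) (at (u ?j))"
          if "A \<subseteq> {1..m}" "?j \<notin> A" for A using Dder[OF that(1) j that(2), of u] by simp
      qed (use Suc.prems(1) ne[OF u] in auto)
      moreover have "insert ?j {Suc (Suc k)..m} = {Suc k..m}" using Suc.prems(1) by auto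
      ultimately have d: "((\<lambda>s. cumul (\<lambda>A. D A (u(?j := s))) m {Suc (Suc k)..m}) has_vector_derivative
          cumul (\<lambda>A. D A u) m {Suc k..m}) (at (u ?j))" by simp
      have "((\<lambda>s. G (u(?j := s))) has_vector_derivative cumul (\<lambda>A. D A u) m {Suc k..m}) (at (u ?j))"
      proof -
        have e: "eventually (\<lambda>s. cumul (\<lambda>A. D A (u(?j := s))) m {Suc (Suc k)..m} = G (u(?j := s))) (nhds (u ?j))"
          using ev[OF j u]
        proof eventually_elim
          case (elim s)
          show ?case by (rule Suc.prems(2)[OF elim, symmetric])
        qed
        show ?thesis
          using d unfolding has_vector_derivative_def
        proof (rule has_derivative_transform_eventually)
          show "eventually (\<lambda>s. cumul (\<lambda>A. D A (u(?j := s))) m {Suc (Suc k)..m} = G (u(?j := s))) (at (u ?j))"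
            using e by (auto simp: eventually_at_filter elim: eventually_mono)
          show "cumul (\<lambda>A. D A (u(?j := u ?j))) m {Suc (Suc k)..m} = G (u(?j := u ?j))"
            by (rule eventually_nhds_x_imp_x[OF e])
        qed simp
      qed
      then show ?thesis unfolding partial_deriv_def by (rule vector_derivative_at)
    qed
    then show ?case using Suc.IH[of "partial_deriv (Suc k) G" t] Suc.prems by simp
  qed
  have z: "(\<lambda>_. 0) \<in> U" by (simp add: U_def D_def mchar_def prob_space)
  obtain k where k: "m = Suc k" using m by (cases m) auto
  have "mixed_deriv m ?F (\<lambda>_. 0) = mixed_deriv k (partial_deriv m ?F) (\<lambda>_. 0)" unfolding k by simp
  also have "\<dots> = cumul (\<lambda>A. D A (\<lambda>_. 0)) m {1..m}"
    using first z by (intro step) (auto simp: k)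
  finally show ?thesis unfolding cum_def D_def by simp
qed

lemma mchar_0: "mchar m X A (\<lambda>_. 0) = \<i> ^ card A * complex_of_real (\<integral>\<omega>. (\<Prod>l\<in>A. X l \<omega>) \<partial>M)"
  by (simp add: mchar_def del: of_real_prod)

end

section \<open>Connected components of partitions\<close>

text \<open>The relation whose closure appears in \<open>row_partition\<close>, for an arbitrary set
  of rows.\<close>

definition row_link :: "(nat \<Rightarrow> nat) \<Rightarrow> nat set \<Rightarrow> nat set set \<Rightarrow> (nat \<times> nat) set" where
  "row_link q S \<sigma> = {(i, j). i \<in> S \<and> j \<in> S \<and> (\<exists>b\<in>\<sigma>. b \<inter> row q i \<noteq> {} \<and> b \<inter> row q j \<noteq> {})}"

text \<open>Connectedness expressed as reachability of every row from the base row \<open>m\<close>.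
  For \<open>m\<close> in \<open>S\<close> this means that there is a single component, since links
  are symmetric.\<close>

definition conn_gparts2 :: "nat \<Rightarrow> (nat \<Rightarrow> nat) \<Rightarrow> nat set \<Rightarrow> nat set set set" where
  "conn_gparts2 m q S = {\<sigma> \<in> gparts2 q S. \<forall>j\<in>S. (m, j) \<in> (row_link q S \<sigma>)\<^sup>*}"

lemma gparts2_iff:
  "\<sigma> \<in> gparts2 q S \<longleftrightarrow> partition_on (rows q S) \<sigma> \<and> (\<forall>b\<in>\<sigma>. inj_on (row_index q) b \<and> 2 \<le> card b)"
  by (auto simp: gparts2_def gparts_def row_parts_def)

lemma rows_Int_empty:
  assumes "\<And>l. l \<in> A \<union> T \<Longrightarrow> 1 \<le> l" "A \<inter> T = {}" shows "rows q A \<inter> rows q T = {}"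
proof -
  have "p \<notin> row q l'" if "l \<in> A" "l' \<in> T" "p \<in> row q l" for l l' p
    using disjoint_rows[of l l' q] that assms by auto
  then show ?thesis by (auto simp: rows_def)
qed

lemma gparts2_Un:
  assumes l: "\<And>l. l \<in> A \<union> T \<Longrightarrow> 1 \<le> l" "A \<inter> T = {}" and \<tau>: "\<tau> \<in> gparts2 q A" and \<rho>: "\<rho> \<in> gparts2 q T"
  shows "\<tau> \<union> \<rho> \<in> gparts2 q (A \<union> T)" "\<tau> \<inter> \<rho> = {}"
    "{b\<in>\<tau> \<union> \<rho>. b \<subseteq> rows q A} = \<tau>" "{b\<in>\<tau> \<union> \<rho>. b \<subseteq> rows q T} = \<rho>"
proof -
  have d: "rows q A \<inter> rows q T = {}" by (rule rows_Int_empty[OF l])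
  have p1: "partition_on (rows q A) \<tau>" and p2: "partition_on (rows q T) \<rho>"
    using \<tau> \<rho> by (auto simp: gparts2_iff)
  have s1: "b \<subseteq> rows q A" "b \<noteq> {}" if "b \<in> \<tau>" for b using p1 that by (auto simp: partition_on_def)
  have s2: "b \<subseteq> rows q T" "b \<noteq> {}" if "b \<in> \<rho>" for b using p2 that by (auto simp: partition_on_def)
  have n1: "\<not> b \<subseteq> rows q T" if "b \<in> \<tau>" for b using s1[OF that] d by auto
  have n2: "\<not> b \<subseteq> rows q A" if "b \<in> \<rho>" for b using s2[OF that] d by auto
  have "rows q (A \<union> T) = rows q A \<union> rows q T" by (simp add: rows_def)
  then have "partition_on (rows q (A \<union> T)) (\<tau> \<union> \<rho>)" using p1 p2 d disjoint_union[of \<tau> \<rho>] by (simp add: partition_on_def)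
  then show "\<tau> \<union> \<rho> \<in> gparts2 q (A \<union> T)" using \<tau> \<rho> by (auto simp: gparts2_iff)
  show "\<tau> \<inter> \<rho> = {}" using n1 s2(1) by auto
  show "{b\<in>\<tau> \<union> \<rho>. b \<subseteq> rows q A} = \<tau>" using s1(1) n2 by auto
  show "{b\<in>\<tau> \<union> \<rho>. b \<subseteq> rows q T} = \<rho>" using s2(1) n1 by auto
qed

text \<open>The last premise says that no block straddles the boundary of \<open>U\<close>, so the
  blocks inside still cover all of its rows.\<close>

lemma gparts2_restrict:
  assumes \<sigma>: "\<sigma> \<in> gparts2 q S" and U: "U \<subseteq> S" and b: "\<And>b. b \<in> \<sigma> \<Longrightarrow> b \<inter> rows q U \<noteq> {} \<Longrightarrow> b \<subseteq> rows q U"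
  shows "{b\<in>\<sigma>. b \<subseteq> rows q U} \<in> gparts2 q U"
proof -
  have p: "partition_on (rows q S) \<sigma>" using \<sigma> by (simp add: gparts2_iff)
  have "rows q U \<subseteq> rows q S" using U by (auto simp: rows_def)
  have "\<Union>{b\<in>\<sigma>. b \<subseteq> rows q U} = rows q U"
  proof
    show "rows q U \<subseteq> \<Union>{b\<in>\<sigma>. b \<subseteq> rows q U}"
    proof
      fix x assume x: "x \<in> rows q U"
      then have "x \<in> \<Union>\<sigma>" using \<open>rows q U \<subseteq> rows q S\<close> partition_onD1[OF p] by auto
      then obtain b0 where "b0 \<in> \<sigma>" "x \<in> b0" by auto
      then show "x \<in> \<Union>{b\<in>\<sigma>. b \<subseteq> rows q U}" using b[of b0] x by auto
    qed
  qed auto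
  then have "partition_on (rows q U) {b\<in>\<sigma>. b \<subseteq> rows q U}"
    using p by (auto simp: partition_on_def disjoint_def)
  then show ?thesis using \<sigma> by (auto simp: gparts2_iff)
qed

lemma row_subset_rows: "l \<in> S \<Longrightarrow> row q l \<subseteq> rows q S" by (auto simp: rows_def)

text \<open>A partition splits uniquely into its part on the component of the row \<open>m\<close> and an arbitrary
  partition of the remaining rows.\<close>

lemma sum_gparts2_component:
  fixes c :: "nat set \<Rightarrow> nat set set \<Rightarrow> real"
  assumes S: "finite S" "\<And>l. l \<in> S \<Longrightarrow> 1 \<le> l" and m: "m \<in> S"
    and c: "\<And>A \<tau> \<rho>. A \<subseteq> S \<Longrightarrow> \<tau> \<in> gparts2 q A \<Longrightarrow> \<rho> \<in> gparts2 q (S - A) \<Longrightarrow> c S (\<tau> \<union> \<rho>) = c A \<tau> * c (S - A) \<rho>"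
  shows "(\<Sum>\<sigma>\<in>gparts2 q S. c S \<sigma>) =
    (\<Sum>A\<in>Pow (S - {m}). (\<Sum>\<tau>\<in>gparts2 q A. c A \<tau>) * (\<Sum>\<rho>\<in>conn_gparts2 m q (S - A). c (S - A) \<rho>))"
proof -
  define W where "W = Sigma (Pow (S - {m})) (\<lambda>A. gparts2 q A \<times> conn_gparts2 m q (S - A))"
  define T where "T \<sigma> = {j\<in>S. (m, j) \<in> (row_link q S \<sigma>)\<^sup>*}" for \<sigma>
  define split where "split \<sigma> = (S - T \<sigma>, {b\<in>\<sigma>. b \<subseteq> rows q (S - T \<sigma>)}, {b\<in>\<sigma>. b \<subseteq> rows q (T \<sigma>)})" for \<sigma>
  have fA: "finite A" if "A \<subseteq> S" for A using that S(1) finite_subset by auto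
  have fin: "finite (gparts2 q A)" "finite (conn_gparts2 m q A)" if "A \<subseteq> S" for A
    using finite_gparts2[OF fA[OF that]] by (auto simp: conn_gparts2_def)
  have TS: "T \<sigma> \<subseteq> S" "m \<in> T \<sigma>" for \<sigma> using m by (auto simp: T_def)
  \<comment> \<open>A block that touches the component links every row it meets to that
    component.\<close>
  have closed: "b \<subseteq> rows q (T \<sigma>)" if \<sigma>: "\<sigma> \<in> gparts2 q S" and b: "b \<in> \<sigma>" "b \<inter> rows q (T \<sigma>) \<noteq> {}" for b \<sigma>
  proof
    fix x assume x: "x \<in> b"
    obtain i where i: "i \<in> T \<sigma>" "b \<inter> row q i \<noteq> {}" using b(2) by (auto simp: rows_def)
    have "x \<in> rows q S" using \<sigma> b(1) x by (auto simp: gparts2_iff partition_on_def)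
    then obtain j where j: "j \<in> S" "x \<in> row q j" by (auto simp: rows_def)
    have "(i, j) \<in> row_link q S \<sigma>" using i j x b(1) TS by (auto simp: row_link_def)
    then have "j \<in> T \<sigma>" using i(1) j(1) by (auto simp: T_def intro: rtrancl_into_rtrancl)
    then show "x \<in> rows q (T \<sigma>)" using j by (auto simp: rows_def)
  qed
  have dj: "rows q (T \<sigma>) \<inter> rows q (S - T \<sigma>) = {}" for \<sigma>
    using S(2) TS(1) by (intro rows_Int_empty) auto
  have cases: "b \<subseteq> rows q (T \<sigma>) \<or> b \<subseteq> rows q (S - T \<sigma>)" if \<sigma>: "\<sigma> \<in> gparts2 q S" and b: "b \<in> \<sigma>" for b \<sigma>
  proof -
    have "b \<subseteq> rows q S" using \<sigma> b by (auto simp: gparts2_iff partition_on_def)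
    also have "rows q S = rows q (T \<sigma>) \<union> rows q (S - T \<sigma>)" using TS(1)[of \<sigma>] by (auto simp: rows_def)
    finally show ?thesis using closed[OF \<sigma> b] by auto
  qed
  \<comment> \<open>No block of the union joins \<open>A\<close> to \<open>S - A\<close>, so a path
    from \<open>m\<close> never enters \<open>A\<close>, while connectedness of \<rho> reaches all
    of \<open>S - A\<close>. The component, and with it the decomposition, is thus recovered from
    the union.\<close>
  have comp: "T (\<tau> \<union> \<rho>) = S - A" if A: "A \<subseteq> S - {m}" and \<tau>: "\<tau> \<in> gparts2 q A" and \<rho>: "\<rho> \<in> conn_gparts2 m q (S - A)" for A \<tau> \<rho>
  proof
    have dA: "rows q A \<inter> rows q (S - A) = {}" using A S(2) by (intro rows_Int_empty) auto
    show "S - A \<subseteq> T (\<tau> \<union> \<rho>)"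
    proof
      fix j assume j: "j \<in> S - A"
      then have "(m, j) \<in> (row_link q (S - A) \<rho>)\<^sup>*" using \<rho> by (simp add: conn_gparts2_def)
      moreover have "row_link q (S - A) \<rho> \<subseteq> row_link q S (\<tau> \<union> \<rho>)" by (auto simp: row_link_def)
      ultimately have "(m, j) \<in> (row_link q S (\<tau> \<union> \<rho>))\<^sup>*" using rtrancl_mono by auto
      then show "j \<in> T (\<tau> \<union> \<rho>)" using j by (simp add: T_def)
    qed
    have "j \<in> S - A" if "(m, j) \<in> (row_link q S (\<tau> \<union> \<rho>))\<^sup>*" for j
      using that
    proof (induction rule: rtrancl_induct)
      case base
      show ?case using m A by auto
    next
      case (step i j)
      from step.hyps(2) obtain b where b: "b \<in> \<tau> \<union> \<rho>" "b \<inter> row q i \<noteq> {}" "b \<inter> row q j \<noteq> {}" and j: "j \<in> S"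
        by (auto simp: row_link_def)
      have "b \<notin> \<tau>"
      proof
        assume "b \<in> \<tau>"
        then have "b \<subseteq> rows q A" using \<tau> by (auto simp: gparts2_iff partition_on_def)
        then show False using b(2) row_subset_rows[OF step.IH] dA by blast
      qed
      then have "b \<in> \<rho>" using b(1) by simp
      then have bS: "b \<subseteq> rows q (S - A)" using \<rho> by (auto simp: conn_gparts2_def gparts2_iff partition_on_def)
      have "j \<notin> A"
      proof
        assume "j \<in> A"
        from row_subset_rows[OF this, of q] show False using b(3) bS dA by blast
      qed
      then show ?case using j by simp
    qed
    then show "T (\<tau> \<union> \<rho>) \<subseteq> S - A" by (auto simp: T_def)
  qed
  have r1: "{b\<in>\<sigma>. b \<subseteq> rows q (T \<sigma>)} \<in> gparts2 q (T \<sigma>)" if \<sigma>: "\<sigma> \<in> gparts2 q S" for \<sigma>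
    by (rule gparts2_restrict[OF \<sigma> TS(1) closed[OF \<sigma>]])
  have r2: "{b\<in>\<sigma>. b \<subseteq> rows q (S - T \<sigma>)} \<in> gparts2 q (S - T \<sigma>)" if \<sigma>: "\<sigma> \<in> gparts2 q S" for \<sigma>
  proof (rule gparts2_restrict[OF \<sigma>])
    fix b assume "b \<in> \<sigma>" "b \<inter> rows q (S - T \<sigma>) \<noteq> {}"
    then show "b \<subseteq> rows q (S - T \<sigma>)" using cases[OF \<sigma>] dj[of \<sigma>] by blast
  qed auto
  have SA: "A \<union> (S - A) = S" "\<And>l. l \<in> A \<union> (S - A) \<Longrightarrow> 1 \<le> l" "A \<inter> (S - A) = {}" if "A \<subseteq> S - {m}" for A
    using that S(2) by auto
  have con: "\<rho> \<in> gparts2 q U" if "\<rho> \<in> conn_gparts2 m q U" for \<rho> U using that by (simp add: conn_gparts2_def)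
  have "(\<Sum>\<sigma>\<in>gparts2 q S. c S \<sigma>) = (\<Sum>(A, \<tau>, \<rho>)\<in>W. c A \<tau> * c (S - A) \<rho>)"
  proof (rule sum.reindex_bij_witness[of _ "\<lambda>(A, \<tau>, \<rho>). \<tau> \<union> \<rho>" split], goal_cases)
    case (1 \<sigma>)
    then show ?case using cases[OF 1] by (auto simp: split_def)
  next
    case (2 \<sigma>)
    \<comment> \<open>A path from \<open>m\<close> stays inside the component, and the blocks it
      uses lie there too, so it survives the restriction.\<close>
    have "(m, j) \<in> (row_link q (T \<sigma>) {b\<in>\<sigma>. b \<subseteq> rows q (T \<sigma>)})\<^sup>*" if "(m, j) \<in> (row_link q S \<sigma>)\<^sup>*" for j
      using that
    proof (induction rule: rtrancl_induct)
      case (step i j)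
      from step.hyps(2) obtain b where b: "b \<in> \<sigma>" "b \<inter> row q i \<noteq> {}" "b \<inter> row q j \<noteq> {}" and ij: "i \<in> S" "j \<in> S"
        by (auto simp: row_link_def)
      have iT: "i \<in> T \<sigma>" using step.hyps(1) ij by (simp add: T_def)
      have jT: "j \<in> T \<sigma>" using step.hyps ij by (auto simp: T_def intro: rtrancl_into_rtrancl)
      have "b \<subseteq> rows q (T \<sigma>)" using closed[OF 2 b(1)] b(2) row_subset_rows[OF iT, of q] by blast
      then have "(i, j) \<in> row_link q (T \<sigma>) {b\<in>\<sigma>. b \<subseteq> rows q (T \<sigma>)}" using b iT jT by (auto simp: row_link_def)
      with step.IH show ?case by (rule rtrancl_into_rtrancl)
    qed simp
    then have "{b\<in>\<sigma>. b \<subseteq> rows q (T \<sigma>)} \<in> conn_gparts2 m q (T \<sigma>)" using r1[OF 2] by (auto simp: conn_gparts2_def T_def)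
    moreover have "S - (S - T \<sigma>) = T \<sigma>" using TS(1)[of \<sigma>] by auto
    ultimately show ?case using r2[OF 2] TS(2)[of \<sigma>] by (auto simp: split_def W_def)
  next
    case (3 w)
    then obtain A \<tau> \<rho> where w: "w = (A, \<tau>, \<rho>)" "A \<subseteq> S - {m}" "\<tau> \<in> gparts2 q A" "\<rho> \<in> conn_gparts2 m q (S - A)"
      by (auto simp: W_def)
    have "S - (S - A) = A" using w(2) by auto
    then show ?case
      using comp[OF w(2-4)] gparts2_Un(3,4)[OF SA(2,3)[OF w(2)] w(3) con[OF w(4)]]
      by (simp add: w(1) split_def)
  next
    case (4 w)
    then obtain A \<tau> \<rho> where w: "w = (A, \<tau>, \<rho>)" "A \<subseteq> S - {m}" "\<tau> \<in> gparts2 q A" "\<rho> \<in> conn_gparts2 m q (S - A)"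
      by (auto simp: W_def)
    show ?case using gparts2_Un(1)[OF SA(2,3)[OF w(2)] w(3) con[OF w(4)]] unfolding SA(1)[OF w(2)] by (simp add: w(1))
  next
    case (5 \<sigma>)
    have STT: "S - (S - T \<sigma>) = T \<sigma>" using TS(1)[of \<sigma>] by auto
    have "{b\<in>\<sigma>. b \<subseteq> rows q (S - T \<sigma>)} \<union> {b\<in>\<sigma>. b \<subseteq> rows q (T \<sigma>)} = \<sigma>" using cases[OF 5] by auto
    then show ?case using c[of "S - T \<sigma>", OF _ r2[OF 5], of "{b\<in>\<sigma>. b \<subseteq> rows q (T \<sigma>)}"] r1[OF 5]
      by (simp add: split_def STT)
  qed
  also have "\<dots> = (\<Sum>A\<in>Pow (S - {m}). \<Sum>(\<tau>, \<rho>)\<in>gparts2 q A \<times> conn_gparts2 m q (S - A). c A \<tau> * c (S - A) \<rho>)"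
    unfolding W_def using S(1) fin by (intro sum.Sigma[symmetric] ballI finite_cartesian_product) auto
  also have "\<dots> = (\<Sum>A\<in>Pow (S - {m}). (\<Sum>\<tau>\<in>gparts2 q A. c A \<tau>) * (\<Sum>\<rho>\<in>conn_gparts2 m q (S - A). c (S - A) \<rho>))"
    by (simp add: sum_product sum.cartesian_product)
  finally show ?thesis .
qed

text \<open>Links are symmetric, so their reflexive transitive closure is an equivalence relation;
  it has a single class if and only if the class of \<open>m\<close> contains all rows.\<close>

lemma conn_Parts_ge2_eq:
  assumes "1 \<le> m"
  shows "conn_Parts_ge2 m q = conn_gparts2 m q {1..m}"
proof -
  have "card (row_partition m q \<sigma>) = 1 \<longleftrightarrow> (\<forall>j\<in>{1..m}. (m, j) \<in> (row_link q {1..m} \<sigma>)\<^sup>*)" for \<sigma>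
  proof -
    let ?R = "(row_link q {1..m} \<sigma>)\<^sup>*"
    have rp: "row_partition m q \<sigma> = (\<lambda>x. ?R `` {x}) ` {1..m}"
      by (auto simp: row_partition_def row_link_def quotient_def)
    have mm: "m \<in> {1..m}" using assms by simp
    have sym: "sym ?R" by (rule sym_rtrancl) (auto simp: sym_def row_link_def)
    show ?thesis
    proof
      assume "card (row_partition m q \<sigma>) = 1"
      then obtain C where C: "(\<lambda>x. ?R `` {x}) ` {1..m} = {C}" unfolding rp by (rule card_1_singletonE)
      have e: "?R `` {j} = C" if "j \<in> {1..m}" for j
        using imageI[OF that, of "\<lambda>x. ?R `` {x}"] unfolding C by simp
      show "\<forall>j\<in>{1..m}. (m, j) \<in> ?R"
      proof
        fix j assume j: "j \<in> {1..m}"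
        have "j \<in> ?R `` {j}" by simp
        then show "(m, j) \<in> ?R" unfolding e[OF j] e[OF mm, symmetric] by simp
      qed
    next
      assume h: "\<forall>j\<in>{1..m}. (m, j) \<in> ?R"
      have "?R `` {j} = ?R `` {m}" if "j \<in> {1..m}" for j
      proof -
        have j: "(m, j) \<in> ?R" by (rule bspec[OF h that])
        show ?thesis using j symD[OF sym j] by (auto intro: rtrancl_trans)
      qed
      then have "(\<lambda>x. ?R `` {x}) ` {1..m} = (\<lambda>x. ?R `` {m}) ` {1..m}" by (intro image_cong refl)
      also have "\<dots> = {?R `` {m}}" using mm by (simp add: image_constant_conv)
      finally have "(\<lambda>x. ?R `` {x}) ` {1..m} = {?R `` {m}}" .
      then show "card (row_partition m q \<sigma>) = 1" unfolding rp by simp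
    qed
  qed
  then show ?thesis
    unfolding conn_Parts_ge2_def conn_Parts_def conn_gparts2_def gparts2_def Parts_eq_gparts by auto
qed

section \<open>Factorization over components and the cumulant formula\<close>

context poisson_sf begin

text \<open>Factors with index in \<open>A\<close> depend only on variables of \<tau>, the others
  only on variables of \<rho>. The integrand splits into a product, and Fubini's theorem separates
  the two groups of variables.\<close>

lemma integral_contr_Un:
  assumes S: "finite S" "\<And>l. l \<in> S \<Longrightarrow> 1 \<le> l" and A: "A \<subseteq> S"
    and \<tau>: "\<tau> \<in> gparts2 q A" and \<rho>: "\<rho> \<in> gparts2 q (S - A)"
    and int: "integrable (PiM (\<tau> \<union> \<rho>) (\<lambda>_. \<mu>)) (contr q f S (\<tau> \<union> \<rho>))"
  shows "(\<integral>y. contr q f S (\<tau> \<union> \<rho>) y \<partial>PiM (\<tau> \<union> \<rho>) (\<lambda>_. \<mu>)) =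
    (\<integral>y. contr q f A \<tau> y \<partial>PiM \<tau> (\<lambda>_. \<mu>)) * (\<integral>y. contr q f (S - A) \<rho> y \<partial>PiM \<rho> (\<lambda>_. \<mu>))"
proof -
  let ?T = "S - A"
  have fin: "finite A" "finite ?T" using A S(1) finite_subset by auto
  have l: "\<And>l. l \<in> A \<union> ?T \<Longrightarrow> 1 \<le> l" "A \<inter> ?T = {}" using A S(2) by auto
  have AT: "A \<union> ?T = S" using A by auto
  have U: "\<tau> \<union> \<rho> \<in> gparts2 q S" "\<tau> \<inter> \<rho> = {}" using gparts2_Un(1,2)[OF l \<tau> \<rho>] unfolding AT by auto
  have f: "finite \<tau>" "finite \<rho>" using finite_gpart[OF fin(1) gparts2D[OF \<tau>]] finite_gpart[OF fin(2) gparts2D[OF \<rho>]] by auto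
  have p: "partition_on (rows q S) (\<tau> \<union> \<rho>)" using U(1) by (simp add: gparts2_iff)
  have p1: "partition_on (rows q A) \<tau>" and p2: "partition_on (rows q ?T) \<rho>" using \<tau> \<rho> by (auto simp: gparts2_iff)
  have b1: "block_of (\<tau> \<union> \<rho>) (pos q l k) = block_of \<tau> (pos q l k)" "block_of \<tau> (pos q l k) \<in> \<tau>" if "l \<in> A" "k \<in> {1..q l}" for l k
  proof -
    have "pos q l k \<in> rows q A" using pos_in_row[of l k q] that l(1) by (auto simp: rows_def)
    from block_of_in[OF p1 this] show "block_of (\<tau> \<union> \<rho>) (pos q l k) = block_of \<tau> (pos q l k)" "block_of \<tau> (pos q l k) \<in> \<tau>"
      using block_of_eq[OF p] by auto
  qed
  have b2: "block_of (\<tau> \<union> \<rho>) (pos q l k) = block_of \<rho> (pos q l k)" "block_of \<rho> (pos q l k) \<in> \<rho>" if "l \<in> ?T" "k \<in> {1..q l}" for l k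
  proof -
    have "pos q l k \<in> rows q ?T" using pos_in_row[of l k q] that l(1) by (auto simp: rows_def)
    from block_of_in[OF p2 this] show "block_of (\<tau> \<union> \<rho>) (pos q l k) = block_of \<rho> (pos q l k)" "block_of \<rho> (pos q l k) \<in> \<rho>"
      using block_of_eq[OF p] by auto
  qed
  have split: "contr q f S (\<tau> \<union> \<rho>) (merge \<tau> \<rho> (x, y)) = contr q f A \<tau> x * contr q f ?T \<rho> y" for x y
  proof -
    have m2: "merge \<tau> \<rho> (x, y) b = y b" if "b \<in> \<rho>" for b using U(2) that by (auto simp: merge_def)
    have "contr q f S (\<tau> \<union> \<rho>) (merge \<tau> \<rho> (x, y)) =
      (\<Prod>l\<in>A. f l (\<lambda>k\<in>{1..q l}. merge \<tau> \<rho> (x, y) (block_of (\<tau> \<union> \<rho>) (pos q l k)))) *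
      (\<Prod>l\<in>?T. f l (\<lambda>k\<in>{1..q l}. merge \<tau> \<rho> (x, y) (block_of (\<tau> \<union> \<rho>) (pos q l k))))"
      unfolding contr_def using prod.union_disjoint[OF fin l(2)] unfolding AT .
    also have "(\<Prod>l\<in>A. f l (\<lambda>k\<in>{1..q l}. merge \<tau> \<rho> (x, y) (block_of (\<tau> \<union> \<rho>) (pos q l k)))) = contr q f A \<tau> x"
      unfolding contr_def by (intro prod.cong refl arg_cong[where f="f _"] restrict_ext) (use b1 in \<open>simp add: merge_def\<close>)
    also have "(\<Prod>l\<in>?T. f l (\<lambda>k\<in>{1..q l}. merge \<tau> \<rho> (x, y) (block_of (\<tau> \<union> \<rho>) (pos q l k)))) = contr q f ?T \<rho> y"
      unfolding contr_def by (intro prod.cong refl arg_cong[where f="f _"] restrict_ext) (use b2 m2 in simp)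
    finally show ?thesis .
  qed
  show ?thesis
    unfolding PS.product_integral_fold[OF U(2) f int] split by simp
qed

lemma moments_component:
  assumes S: "finite S" "\<And>l. l \<in> S \<Longrightarrow> 1 \<le> l" and m: "m \<in> S"
    and int: "\<And>\<sigma>. \<sigma> \<in> gparts2 q S \<Longrightarrow> integrable (PiM \<sigma> (\<lambda>_. \<mu>)) (contr q f S \<sigma>)"
  shows "(\<Sum>\<sigma>\<in>gparts2 q S. \<integral>y. contr q f S \<sigma> y \<partial>PiM \<sigma> (\<lambda>_. \<mu>)) =
    (\<Sum>A\<in>Pow (S - {m}). (\<Sum>\<tau>\<in>gparts2 q A. \<integral>y. contr q f A \<tau> y \<partial>PiM \<tau> (\<lambda>_. \<mu>)) *
       (\<Sum>\<rho>\<in>conn_gparts2 m q (S - A). \<integral>y. contr q f (S - A) \<rho> y \<partial>PiM \<rho> (\<lambda>_. \<mu>)))"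
proof (rule sum_gparts2_component[OF S m])
  fix A \<tau> \<rho> assume h: "A \<subseteq> S" "\<tau> \<in> gparts2 q A" "\<rho> \<in> gparts2 q (S - A)"
  have "A \<union> (S - A) = S" "\<And>l. l \<in> A \<union> (S - A) \<Longrightarrow> 1 \<le> l" using h S(2) by auto
  then have "\<tau> \<union> \<rho> \<in> gparts2 q S" using gparts2_Un(1)[OF _ _ h(2,3)] by simp
  from integral_contr_Un[OF S h int[OF this]]
  show "(\<integral>y. contr q f S (\<tau> \<union> \<rho>) y \<partial>PiM (\<tau> \<union> \<rho>) (\<lambda>_. \<mu>)) =
    (\<integral>y. contr q f A \<tau> y \<partial>PiM \<tau> (\<lambda>_. \<mu>)) * (\<integral>y. contr q f (S - A) \<rho> y \<partial>PiM \<rho> (\<lambda>_. \<mu>))" .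
qed


text \<open>Splitting off the component of row \<open>m\<close> gives the moment recursion of
  \<open>cumul_moments\<close>, with the connected sums as \<kappa>. The powers of the imaginary
  unit from the derivatives cancel against the prefactor of \<open>cum\<close>.\<close>

lemma wiener_ito_cum:
  assumes m: "1 \<le> m" "m \<le> p" "even p"
    and f: "\<And>l. l \<in> {1..m} \<Longrightarrow> f l \<in> Lsym 2 \<mu> (q l)"
    and fp: "\<And>l. l \<in> {1..m} \<Longrightarrow> contr_norm p (q l) (f l) < \<infinity>"
  shows "cum M m (\<lambda>l. wiener_ito M \<mu> \<eta> (q l) (f l)) =
    complex_of_real (\<Sum>\<sigma>\<in>conn_gparts2 m q {1..m}. \<integral>y. contr q f {1..m} \<sigma> y \<partial>PiM \<sigma> (\<lambda>_. \<mu>))"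
proof -
  define X where "X l = wiener_ito M \<mu> \<eta> (q l) (f l)" for l
  define Mo where "Mo S = (\<integral>\<omega>. (\<Prod>l\<in>S. X l \<omega>) \<partial>M)" for S
  define \<kappa> where "\<kappa> S = (\<Sum>\<sigma>\<in>conn_gparts2 m q S. \<integral>y. contr q f S \<sigma> y \<partial>PiM \<sigma> (\<lambda>_. \<mu>))" for S
  have p: "1 \<le> p" using m by simp
  have S: "finite S" "\<And>l. l \<in> S \<Longrightarrow> 1 \<le> l" "card S \<le> p" "\<And>l. l \<in> S \<Longrightarrow> f l \<in> Lsym 2 \<mu> (q l)"
    "\<And>l. l \<in> S \<Longrightarrow> contr_norm p (q l) (f l) < \<infinity>" if "S \<subseteq> {1..m}" for S
  proof -
    show "finite S" using that finite_subset by auto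
    have "card S \<le> card {1..m}" using that by (intro card_mono) auto
    then show "card S \<le> p" using m by simp
  qed (use that f fp in auto)
  have mom: "integrable M (\<lambda>\<omega>. \<Prod>l\<in>S. X l \<omega>)"
    "\<And>\<sigma>. \<sigma> \<in> gparts2 q S \<Longrightarrow> integrable (PiM \<sigma> (\<lambda>_. \<mu>)) (contr q f S \<sigma>)"
    "Mo S = (\<Sum>\<sigma>\<in>gparts2 q S. \<integral>y. contr q f S \<sigma> y \<partial>PiM \<sigma> (\<lambda>_. \<mu>))" if SV: "S \<subseteq> {1..m}" for S
    unfolding X_def Mo_def
    using wiener_ito_moments[of S p f q, OF S(1,2,3)[OF SV] m(3) p S(4,5)[OF SV]] by simp_all
  have Xm: "X l \<in> borel_measurable M" if "l \<in> {1..m}" for l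
    unfolding X_def by (rule wiener_ito_L2_limit(1)[OF f[OF that]])
  have "cumul (\<lambda>A. mchar m X A (\<lambda>_. 0)) m {1..m} = \<i> ^ card {1..m} * complex_of_real (\<kappa> {1..m})"
  proof (rule cumul_moments[where V="{1..m}" and Mo=Mo])
    show "mchar m X A (\<lambda>_. 0) = \<i> ^ card A * complex_of_real (Mo A)" for A unfolding Mo_def by (rule mchar_0)
    show "Mo {} = 1" by (simp add: Mo_def prob_space)
    fix S assume SV: "S \<subseteq> {1..m}" "m \<in> S"
    have "Mo S = (\<Sum>A\<in>Pow (S - {m}). (\<Sum>\<tau>\<in>gparts2 q A. \<integral>y. contr q f A \<tau> y \<partial>PiM \<tau> (\<lambda>_. \<mu>)) * \<kappa> (S - A))"
      unfolding mom(3)[OF SV(1)] \<kappa>_def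
      by (rule moments_component[OF S(1)[OF SV(1)] S(2)[OF SV(1)] SV(2) mom(2)[OF SV(1)]])
    also have "\<dots> = (\<Sum>A\<in>Pow (S - {m}). Mo A * \<kappa> (S - A))"
    proof (intro sum.cong refl)
      fix A assume "A \<in> Pow (S - {m})"
      then have "A \<subseteq> {1..m}" using SV by auto
      then show "(\<Sum>\<tau>\<in>gparts2 q A. \<integral>y. contr q f A \<tau> y \<partial>PiM \<tau> (\<lambda>_. \<mu>)) * \<kappa> (S - A) = Mo A * \<kappa> (S - A)"
        by (simp add: mom(3))
    qed
    finally show "Mo S = (\<Sum>A\<in>Pow (S - {m}). Mo A * \<kappa> (S - A))" .
  qed (use m in auto)
  then have "cum M m X = ((- \<i>) ^ m * \<i> ^ m) * complex_of_real (\<kappa> {1..m})"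
    using cum_eq_cumul[of m X, OF Xm mom(1) m(1)] by simp
  also have "(- \<i>) ^ m * \<i> ^ m = 1" by (simp add: power_mult_distrib[symmetric])
  finally show ?thesis unfolding X_def[abs_def] \<kappa>_def by simp
qed

end

section \<open>Locally finite versions\<close>

text \<open>The Poisson weights of the natural numbers already sum to one, which leaves no
  probability for other values.\<close>

lemma (in prob_space) AE_poisson_finite:
  assumes Z: "Z \<in> borel_measurable M" and P: "poisson_distributed M Z c" and c: "c < \<infinity>"
  shows "AE \<omega> in M. Z \<omega> < \<infinity>"
proof -
  define E where "E k = {\<omega>\<in>space M. Z \<omega> = of_nat k}" for k :: nat
  have Em: "range E \<subseteq> events" unfolding E_def using Z by auto
  have "disjoint_family E" by (auto simp: disjoint_family_on_def E_def)
  then have "(\<lambda>k. prob (E k)) sums prob (\<Union>k. E k)" by (rule finite_measure_UNION[OF Em])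
  moreover have "prob (E k) = enn2real c ^ k / fact k * exp (- enn2real c)" for k
    using P c unfolding poisson_distributed_def E_def by simp
  moreover have "(\<lambda>k. enn2real c ^ k / fact k * exp (- enn2real c)) sums (exp (enn2real c) * exp (- enn2real c))"
    using exp_converges[of "enn2real c"] by (intro sums_mult2) (simp add: divide_inverse mult.commute)
  ultimately have "prob (\<Union>k. E k) = 1" using sums_unique2 by (fastforce simp: exp_minus)
  then have "AE \<omega> in M. \<omega> \<in> (\<Union>k. E k)" using Em by (subst prob_eq_1[symmetric]) auto
  then show ?thesis by eventually_elim (auto simp: E_def of_nat_less_top)
qed

text \<open>Independence is a property of the joint and marginal distributions, which do not change
  on null sets. The empty index set is treated apart, as the characterization by product measures
  assumes a nonempty one.\<close>

lemma (in prob_space) indep_vars_AE_cong: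
  assumes I: "indep_vars N X I" and Y: "\<And>i. i \<in> I \<Longrightarrow> Y i \<in> measurable M (N i)"
    and eq: "AE \<omega> in M. \<forall>i\<in>I. X i \<omega> = Y i \<omega>"
  shows "indep_vars N Y I"
proof (cases "I = {}")
  case True
  then show ?thesis by (simp add: indep_vars_def indep_sets_def)
next
  case False
  have X: "X i \<in> measurable M (N i)" if "i \<in> I" for i using I that by (simp add: indep_vars_def)
  have "distr M (PiM I N) (\<lambda>x. \<lambda>i\<in>I. Y i x) = distr M (PiM I N) (\<lambda>x. \<lambda>i\<in>I. X i x)"
  proof (rule distr_cong_AE[OF refl refl])
    show "AE x in M. (\<lambda>i\<in>I. Y i x) = (\<lambda>i\<in>I. X i x)" using eq by eventually_elim (auto simp: restrict_def)
  qed (auto intro!: measurable_restrict X Y)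
  also have "\<dots> = PiM I (\<lambda>i. distr M (N i) (X i))" using indep_vars_iff_distr_eq_PiM'[OF False X] I by simp
  also have "\<dots> = PiM I (\<lambda>i. distr M (N i) (Y i))"
  proof (intro PiM_cong refl distr_cong_AE X Y)
    fix i assume "i \<in> I"
    then show "AE x in M. X i x = Y i x" using eq by auto
  qed auto
  finally show ?thesis using indep_vars_iff_distr_eq_PiM'[OF False Y] by simp
qed

text \<open>On a null set \<open>\<eta> \<omega>\<close> may fail to be locally finite; there it is replaced by the zero measure.\<close>

lemma poisson_sf_version:
  assumes M: "prob_space M" and \<mu>: "sigma_finite_measure \<mu>" and \<eta>: "poisson_process M \<mu> \<eta>"
  obtains \<eta>' B where "poisson_sf M \<mu> \<eta>' B" "\<And>q f. wiener_ito M \<mu> \<eta> q f = wiener_ito M \<mu> \<eta>' q f"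
proof -
  interpret prob_space M by (rule M)
  obtain B :: "nat \<Rightarrow> 'b set" where B: "range B \<subseteq> sets \<mu>" "(\<Union>i. B i) = space \<mu>" "\<And>i. emeasure \<mu> (B i) \<noteq> \<infinity>" "incseq B"
    using sigma_finite_measure.sigma_finite_incseq[OF \<mu>] by metis
  have Bs: "B n \<in> sets \<mu>" for n using B(1) by auto
  have sets: "sets (\<eta> \<omega>) = sets \<mu>" and cnt: "counting_measure (\<eta> \<omega>)" if "\<omega> \<in> space M" for \<omega>
    using \<eta> that by (auto simp: poisson_process_def random_counting_measure_def)
  have meas: "(\<lambda>\<omega>. emeasure (\<eta> \<omega>) A) \<in> borel_measurable M" if "A \<in> sets \<mu>" for A
    using \<eta> that by (auto simp: poisson_process_def random_counting_measure_def)
  have pois: "poisson_distributed M (\<lambda>\<omega>. emeasure (\<eta> \<omega>) A) (emeasure \<mu> A)" if "A \<in> sets \<mu>" for A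
    using \<eta> that by (auto simp: poisson_process_def)
  have indep: "indep_vars (\<lambda>_. borel) (\<lambda>i \<omega>. emeasure (\<eta> \<omega>) (D i)) {1..n}"
    if "\<And>i. i \<in> {1..n} \<Longrightarrow> D i \<in> sets \<mu>" "disjoint_family_on D {1..n}" for D and n :: nat
    using \<eta> that unfolding poisson_process_def by blast
  \<comment> \<open>An intersection of countably many almost sure events, so \<eta>' agrees with
    \<eta> almost surely as a measure, that is on all sets simultaneously.\<close>
  define G where "G = {\<omega>\<in>space M. \<forall>n. emeasure (\<eta> \<omega>) (B n) < \<infinity>}"
  define \<eta>' where "\<eta>' \<omega> = (if \<omega> \<in> G then \<eta> \<omega> else null_measure \<mu>)" for \<omega>
  have Gm: "G \<in> sets M"
    unfolding G_def using meas[OF Bs] by measurable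
  have "AE \<omega> in M. \<forall>n. emeasure (\<eta> \<omega>) (B n) < \<infinity>"
    unfolding AE_all_countable
    using AE_poisson_finite[OF meas[OF Bs] pois[OF Bs]] B(3) by (auto simp: less_top)
  then have G: "AE \<omega> in M. \<omega> \<in> G" using AE_space by eventually_elim (auto simp: G_def)
  then have eq: "AE \<omega> in M. \<eta>' \<omega> = \<eta> \<omega>" by eventually_elim (simp add: \<eta>'_def)
  have em: "emeasure (\<eta>' \<omega>) A = (if \<omega> \<in> G then emeasure (\<eta> \<omega>) A else 0)" for \<omega> A by (simp add: \<eta>'_def)
  have meas': "(\<lambda>\<omega>. emeasure (\<eta>' \<omega>) A) \<in> borel_measurable M" if "A \<in> sets \<mu>" for A
    unfolding em using Gm meas[OF that] by (intro measurable_If_set) (auto simp: sets.Int_space_eq2)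
  have "poisson_sf M \<mu> \<eta>' B"
  proof (rule poisson_sf.intro[OF M poisson_sf_axioms.intro])
    show "sigma_finite_measure \<mu>" by (rule \<mu>)
    show "B n \<in> sets \<mu>" for n by (rule Bs)
    show "incseq B" "(\<Union>n. B n) = space \<mu>" by (fact B)+
    show "emeasure \<mu> (B n) < \<infinity>" for n using B(3)[of n] by (simp add: less_top)
    show "sets (\<eta>' \<omega>) = sets \<mu>" if "\<omega> \<in> space M" for \<omega> using sets[OF that] by (simp add: \<eta>'_def)
    show "counting_measure (\<eta>' \<omega>)" if "\<omega> \<in> space M" for \<omega>
      using cnt[OF that] by (auto simp: \<eta>'_def counting_measure_def intro!: exI[of _ "0::nat"])
    show "emeasure (\<eta>' \<omega>) (B n) < \<infinity>" for \<omega> n by (simp add: em) (simp add: G_def)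
    show "(\<lambda>\<omega>. emeasure (\<eta>' \<omega>) A) \<in> borel_measurable M" if "A \<in> sets \<mu>" for A by (rule meas'[OF that])
    show "poisson_distributed M (\<lambda>\<omega>. emeasure (\<eta>' \<omega>) A) (emeasure \<mu> A)" if A: "A \<in> sets \<mu>" for A
    proof (cases "emeasure \<mu> A = \<infinity>")
      case True
      then have "AE \<omega> in M. emeasure (\<eta> \<omega>) A = \<infinity>" using pois[OF A] by (simp add: poisson_distributed_def)
      then have "AE \<omega> in M. emeasure (\<eta>' \<omega>) A = \<infinity>" using eq by eventually_elim simp
      then show ?thesis using True by (simp add: poisson_distributed_def)
    next
      case False
      have "prob {\<omega>\<in>space M. emeasure (\<eta>' \<omega>) A = of_nat k} = prob {\<omega>\<in>space M. emeasure (\<eta> \<omega>) A = of_nat k}" for k :: nat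
      proof (rule finite_measure_eq_AE)
        show "AE \<omega> in M. (\<omega> \<in> {\<omega>\<in>space M. emeasure (\<eta>' \<omega>) A = of_nat k}) = (\<omega> \<in> {\<omega>\<in>space M. emeasure (\<eta> \<omega>) A = of_nat k})"
          using eq by eventually_elim simp
      qed (use meas[OF A] meas'[OF A] in measurable)
      then show ?thesis using False pois[OF A] by (simp add: poisson_distributed_def)
    qed
    show "indep_vars (\<lambda>_. borel) (\<lambda>i \<omega>. emeasure (\<eta>' \<omega>) (D i)) {1..n}"
      if "\<And>i. i \<in> {1..n} \<Longrightarrow> D i \<in> sets \<mu>" "disjoint_family_on D {1..n}" for D and n :: nat
    proof (rule indep_vars_AE_cong[OF indep[OF that]])
      show "(\<lambda>\<omega>. emeasure (\<eta>' \<omega>) (D i)) \<in> borel_measurable M" if "i \<in> {1..n}" for i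
        by (rule meas'[OF \<open>\<And>i. i \<in> {1..n} \<Longrightarrow> D i \<in> sets \<mu>\<close>[OF that]])
      show "AE \<omega> in M. \<forall>i\<in>{1..n}. emeasure (\<eta> \<omega>) (D i) = emeasure (\<eta>' \<omega>) (D i)"
        using eq by eventually_elim simp
    qed
  qed
  \<comment> \<open>\<open>is_wiener_ito\<close> sees the process only through integrals over
    \<open>M\<close>, so the two predicates are equal and the choice operator returns the same
    version. The equality is therefore exact and not merely almost sure.\<close>
  moreover have "wiener_ito M \<mu> \<eta> q f = wiener_ito M \<mu> \<eta>' q f" for q f
  proof -
    have "(\<integral>\<^sup>+ \<omega>. ennreal ((wiener_ito_L1 \<mu> \<eta> q g \<omega> - Y \<omega>)\<^sup>2) \<partial>M) = (\<integral>\<^sup>+ \<omega>. ennreal ((wiener_ito_L1 \<mu> \<eta>' q g \<omega> - Y \<omega>)\<^sup>2) \<partial>M)" for g Y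
    proof (rule nn_integral_cong_AE)
      show "AE \<omega> in M. ennreal ((wiener_ito_L1 \<mu> \<eta> q g \<omega> - Y \<omega>)\<^sup>2) = ennreal ((wiener_ito_L1 \<mu> \<eta>' q g \<omega> - Y \<omega>)\<^sup>2)"
        using eq by eventually_elim (simp add: wiener_ito_L1_def)
    qed
    then show ?thesis unfolding wiener_ito_def is_wiener_ito_def by simp
  qed
  ultimately show ?thesis by (rule that)
qed

theorem theorem3p6:
  fixes M :: "'w measure" and \<mu> :: "'x measure" and \<eta> :: "'w \<Rightarrow> 'x measure"
    and m mt :: nat and q :: "nat \<Rightarrow> nat" and f :: "nat \<Rightarrow> (nat \<Rightarrow> 'x) \<Rightarrow> real"
  assumes "prob_space M" and "sigma_finite_measure \<mu>" and "poisson_process M \<mu> \<eta>"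
    and "1 \<le> m" and "m \<le> mt" and "even mt"
    and "\<And>l. l \<in> {1..m} \<Longrightarrow> 1 \<le> q l"
    and "\<And>l. l \<in> {1..m} \<Longrightarrow> f l \<in> Lsym 2 \<mu> (q l)"
    and "\<And>i \<sigma>. i \<in> {1..m} \<Longrightarrow> \<sigma> \<in> Parts_ge2 mt (\<lambda>_. q i) \<Longrightarrow>
           (\<integral>\<^sup>+ y. ennreal \<bar>tensor_contr mt (\<lambda>_. q i) (\<lambda>_. f i) \<sigma> y\<bar> \<partial>PiM \<sigma> (\<lambda>_. \<mu>)) < \<infinity>"
    and "\<And>\<sigma>. \<sigma> \<in> Parts_ge2 m q \<Longrightarrow>
           (\<integral>\<^sup>+ y. ennreal \<bar>tensor_contr m q f \<sigma> y\<bar> \<partial>PiM \<sigma> (\<lambda>_. \<mu>)) < \<infinity>"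
  shows "integrable M (\<lambda>\<omega>. \<Prod>l\<in>{1..m}. wiener_ito M \<mu> \<eta> (q l) (f l) \<omega>)
    \<and> (\<integral>\<omega>. (\<Prod>l\<in>{1..m}. wiener_ito M \<mu> \<eta> (q l) (f l) \<omega>) \<partial>M)
        = (\<Sum>\<sigma>\<in>Parts_ge2 m q. \<integral>y. tensor_contr m q f \<sigma> y \<partial>PiM \<sigma> (\<lambda>_. \<mu>))
    \<and> cum M m (\<lambda>l. wiener_ito M \<mu> \<eta> (q l) (f l))
        = complex_of_real
            (\<Sum>\<sigma>\<in>conn_Parts_ge2 m q. \<integral>y. tensor_contr m q f \<sigma> y \<partial>PiM \<sigma> (\<lambda>_. \<mu>))"
proof -
  obtain \<eta>' B where loc: "poisson_sf M \<mu> \<eta>' B"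
    and eq: "\<And>q f. wiener_ito M \<mu> \<eta> q f = wiener_ito M \<mu> \<eta>' q f"
    using poisson_sf_version[OF assms(1-3)] by metis
  interpret poisson_sf M \<mu> \<eta>' B by (rule loc)
  \<comment> \<open>Each summand of this finite sum is one of the contractions of \<open>mt\<close>
    copies assumed finite.\<close>
  have fp: "contr_norm mt (q l) (f l) < \<infinity>" if "l \<in> {1..m}" for l
    unfolding contr_norm_def
    using assms(9)[OF that] finite_gparts2[of "{1..mt}" "\<lambda>_. q l"]
    unfolding Parts_ge2_eq_gparts2 tensor_contr_eq by (auto simp: less_top)
  have mt: "1 \<le> mt" using assms(4,5) by simp
  have S: "finite {1..m}" "\<And>l. l \<in> {1..m} \<Longrightarrow> 1 \<le> l" "card {1..m} \<le> mt" using assms(5) by auto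
  show ?thesis
    unfolding eq Parts_ge2_eq_gparts2 tensor_contr_eq conn_Parts_ge2_eq[OF assms(4)]
    using wiener_ito_moments(1,3)[OF S assms(6) mt assms(8) fp] wiener_ito_cum[OF assms(4-6,8) fp]
    by simp
qed

end
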